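(* Assume the setting below, with $r\ge2$, $\chi\ge1$ and $0<s\le3/2$, and assume $h=\max_ih_i\le\min(\hat h_0,\hat h_1,0.2)$. Then, with $u=M\eta(r)h$, $$\psi(r)ue^u<1\quad\text{and}\quad\frac{\kappa_1e^u}{1-\psi(r)ue^u}<\kappa_2-\frac{sM_0(\nu)}{M},$$ and $M>M_2$. Furthermore $\mathbf{L}_{s,\nu}(K_M(T))\subset K_{M'}(T)$ with $M'=\kappa_2M<M$, and with $H=H_{r+1}$, $$\lambda_s^\nu(1-Hh^r)\le R(\mathbf{L}_{s,\nu})\le\lambda_s^\nu(1+Hh^r),$$ where $R(\mathbf{L}_{s,\nu})$ is the spectral radius of $\mathbf{L}_{s,\nu}$.
   Context: Setting. $\mathcal{B}$ is a finite set of distinct reals, $\gamma=\min\mathcal{B}\ge1$, $\Gamma=\max\mathcal{B}>\gamma$, $\theta_\beta(x)=1/(x+\beta)$. $\mathfrak{a}_0=0$, $\mathfrak{b}_0=1/\gamma$, $\mathfrak{a}_{k+1}=\theta_\Gamma(\mathfrak{b}_k)$, $\mathfrak{b}_{k+1}=\theta_\gamma(\mathfrak{a}_k)$; their limits are $\mathfrak{a}_\infty=-\gamma/2+\sqrt{(\gamma/2)^2+\gamma/\Gamma}$, $\mathfrak{b}_\infty=-\Gamma/2+\sqrt{(\Gamma/2)^2+\Gamma/\gamma}$. $S=[\mathfrak{a}_\infty,\mathfrak{b}_\infty]$ (invariant under all $\theta_\beta$), $\chi=2\mathfrak{a}_\infty+\gamma$. For $s>0$, $(L_sf)(x)=\sum_{\beta\in\mathcal{B}}|\theta_\beta'(x)|^sf(\theta_\beta(x))$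 on $C(S)$, $\lambda_s$ its spectral radius. For $\nu\ge1$, $\Omega_\nu=\mathcal{B}^\nu$, $\theta_\omega=\theta_{\beta_1}\circ\cdots\circ\theta_{\beta_\nu}$, $g_\omega=|\theta_\omega'|$. Parameters. $\eta(r)=\tfrac12$ ($r$ even), $\tfrac12[1+\tan(\pi/(2r+2))]$ ($r$ odd); $\psi(r)=\tfrac2\pi\ln(r+1)+\tfrac34$. $\tilde B_0=1$, $\tilde B_1=\gamma$, $\tilde B_{j+1}=\tilde B_{j-1}+\gamma\tilde B_j$; $c(\nu)=(\tilde B_{\nu-1}\mathfrak{a}_\infty+\tilde B_\nu)^{-2}$. The positive integer $\nu$ satisfies $\kappa_1:=c(\nu)[2\eta(r)r^2\psi(r)]<1$; $\kappa_2$ is any number with $\kappa_1<\kappa_2<1$. $M_0(\nu)=2/(\mathfrak{a}_\infty+\mathfrak{a}_{\nu-1}+\gamma)$, $M=\frac{4s}{\mathfrak{a}_\infty+\mathfrak{a}_{\nu-1}+\gamma}\cdot\frac{1}{\kappa_2-\kappa_1}$. Mesh. Pairwise disjoint nonempty compact intervals $[a_i,b_i]\subset S$, $1\le i\le I$, $b_i<a_{i+1}$, such that each $\theta_\omega(S)$, $\omega\in\Omega_\nu$, lies in some $[a_i,b_i]$; positive integers $N_i$, $h_i=(b_i-a_i)/N_i$, $h=\max_ih_i$, $\mu=h/\min_ih_i$, $t^i_j=a_i+jh_i$; and $2[\sin(\pi/(2r+2))]^2h_i\le a_{i+1}-b_i$ for $1\le i<I$. $\hat c_k=-\cos(\tfrac{2k+1}{2r+2}\pi)/\cos(\tfrac\pi{2r+2})$,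 $c^i_{j,k}=t^i_{j-1}+h_i(1+\hat c_k)/2$; $T$ = set of all $c^i_{j,k}$. For $F:T\to\mathbb{R}$, $\mathcal{F}$ is the continuous function on $\bigcup_i[a_i,b_i]$ equal on each $[t^i_{j-1},t^i_j]$ to the polynomial of degree $\le r$ interpolating $F$ at $c^i_{j,0},\dots,c^i_{j,r}$. $K_M(T)=\{F:T\to\mathbb{R}:F(\xi)\le e^{M|\xi-\eta|}F(\eta)\ \forall\xi,\eta\in T\}$. $(\mathbf{L}_{s,\nu}F)(\xi)=\sum_{\omega\in\Omega_\nu}g_\omega(\xi)^s\mathcal{F}(\theta_\omega(\xi))$, $\xi\in T$. Constants. $G_{r+1}=2e^{2sh/\chi}\big[\frac{(2s)(2s+1)\cdots(2s+r)}{(2)(4)\cdots(2r+2)}\big]\chi^{-(r+1)}\big[\frac{1}{2\cos(\pi/(2r+2))}\big]^{r+1}$; $H_{r+1}=\mu\big[\frac{1}{\sin(\pi/(2r+2))}\big]^2G_{r+1}\frac{\chi}{2s}$; $M_2=\frac{2s}{\chi}\Big[1+\frac{H_{r+1}h^r}{1-G_{r+1}^2h^{2r+2}}+\Big(1-h^2\frac{2s}{\mu\chi}\sin^2(\pi/(2r+2))\Big)^{-1}\Big]$. $\hat h_0>0$ is such that for all $0<h\le\hat h_0$, with $u=M\eta(r)h$: $\psi(r)ue^u<1$ and $\kappa_1e^u/(1-\psi(r)ue^u)<\kappa_2-sM_0(\nu)/M$. $\hat h_1>0$ is such that for all $0<h\le\hat h_1$: $2+H_{r+1}h^r(1+h^{2r+2})+h^2\le2/(\kappa_2-\kappa_1)$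 (with $H_{r+1}$ evaluated at that $h$). *)

theory Defs
  imports "HOL-Analysis.Analysis" "HOL-Computational_Algebra.Polynomial"
begin

section \<open>Spectral radius of operators on real function spaces\<close>

text \<open>
  A real Banach space of functions on a set \<open>D\<close>, under the supremum norm, is represented by a
  set \<open>V\<close> of total functions vanishing outside \<open>D\<close>, so that \<open>V\<close> is a linear subspace of the
  function type.  The spectrum of a real operator is that of its complexification: the \<open>z\<close> for
  which \<open>z I - A\<close> has no bounded everywhere defined inverse.
\<close>

definition sup_norm_on :: "'a set \<Rightarrow> ('a \<Rightarrow> complex) \<Rightarrow> real" where
  "sup_norm_on D f = (SUP x\<in>D. cmod (f x))"

definition complexified_space :: "('a \<Rightarrow> real) set \<Rightarrow> ('a \<Rightarrow> complex) set" where
  "complexified_space V = {f. (\<lambda>x. Re (f x)) \<in> V \<and> (\<lambda>x. Im (f x)) \<in> V}"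

definition complexified_op ::
    "(('a \<Rightarrow> real) \<Rightarrow> 'a \<Rightarrow> real) \<Rightarrow> ('a \<Rightarrow> complex) \<Rightarrow> 'a \<Rightarrow> complex" where
  "complexified_op A f = (\<lambda>x. Complex (A (\<lambda>y. Re (f y)) x) (A (\<lambda>y. Im (f y)) x))"

definition spectrum_on ::
    "'a set \<Rightarrow> ('a \<Rightarrow> real) set \<Rightarrow> (('a \<Rightarrow> real) \<Rightarrow> 'a \<Rightarrow> real) \<Rightarrow> complex set" where
  "spectrum_on D V A =
     (let W = complexified_space V;
          P = (\<lambda>z f x. z * f x - complexified_op A f x)
      in {z. \<not> (bij_betw (P z) W W \<and>
                (\<exists>C. \<forall>f\<in>W. sup_norm_on D f \<le> C * sup_norm_on D (P z f)))})"

definition spectral_radius_on ::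
    "'a set \<Rightarrow> ('a \<Rightarrow> real) set \<Rightarrow> (('a \<Rightarrow> real) \<Rightarrow> 'a \<Rightarrow> real) \<Rightarrow> real" where
  "spectral_radius_on D V A = Sup (cmod ` spectrum_on D V A)"

definition continuous_functions :: "real set \<Rightarrow> (real \<Rightarrow> real) set" where
  "continuous_functions S = {f. continuous_on S f \<and> (\<forall>x. x \<notin> S \<longrightarrow> f x = 0)}"

definition functions_on :: "'a set \<Rightarrow> ('a \<Rightarrow> real) set" where
  "functions_on T = {F. \<forall>x. x \<notin> T \<longrightarrow> F x = 0}"


section \<open>The iterated function system and its transfer operator\<close>

definition cf_map :: "real \<Rightarrow> real \<Rightarrow> real" where
  "cf_map \<beta> x = 1 / (x + \<beta>)"

fun frak_a :: "real \<Rightarrow> real \<Rightarrow> nat \<Rightarrow> real"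
  and frak_b :: "real \<Rightarrow> real \<Rightarrow> nat \<Rightarrow> real" where
  "frak_a \<gamma> \<Gamma> 0 = 0"
| "frak_a \<gamma> \<Gamma> (Suc k) = cf_map \<Gamma> (frak_b \<gamma> \<Gamma> k)"
| "frak_b \<gamma> \<Gamma> 0 = 1 / \<gamma>"
| "frak_b \<gamma> \<Gamma> (Suc k) = cf_map \<gamma> (frak_a \<gamma> \<Gamma> k)"

definition a_inf :: "real \<Rightarrow> real \<Rightarrow> real" where
  "a_inf \<gamma> \<Gamma> = - \<gamma> / 2 + sqrt ((\<gamma> / 2)\<^sup>2 + \<gamma> / \<Gamma>)"

definition b_inf :: "real \<Rightarrow> real \<Rightarrow> real" where
  "b_inf \<gamma> \<Gamma> = - \<Gamma> / 2 + sqrt ((\<Gamma> / 2)\<^sup>2 + \<Gamma> / \<gamma>)"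

lemma frak_limits:
  assumes "1 \<le> \<gamma>" "\<gamma> < \<Gamma>"
  shows "frak_a \<gamma> \<Gamma> \<longlonglongrightarrow> a_inf \<gamma> \<Gamma>" and "frak_b \<gamma> \<Gamma> \<longlonglongrightarrow> b_inf \<gamma> \<Gamma>"
proof -
  define A where "A = a_inf \<gamma> \<Gamma>"
  define B where "B = b_inf \<gamma> \<Gamma>"
  have sq: "(A + \<gamma>/2)\<^sup>2 = (\<gamma>/2)\<^sup>2 + \<gamma>/\<Gamma>" "(B + \<Gamma>/2)\<^sup>2 = (\<Gamma>/2)\<^sup>2 + \<Gamma>/\<gamma>"
    using assms unfolding A_def B_def a_inf_def b_inf_def by simp_all
  have A0: "0 < A"
    unfolding A_def a_inf_def using assms real_less_rsqrt[of "\<gamma>/2" "(\<gamma>/2)\<^sup>2 + \<gamma>/\<Gamma>"] by simp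
  have B0: "0 < B"
    unfolding B_def b_inf_def using assms real_less_rsqrt[of "\<Gamma>/2" "(\<Gamma>/2)\<^sup>2 + \<Gamma>/\<gamma>"] by simp
  have qA: "A * (A + \<gamma>) = \<gamma>/\<Gamma>" and qB: "B * (B + \<Gamma>) = \<Gamma>/\<gamma>"
    using sq by (simp_all add: power2_eq_square algebra_simps)
  have pA: "0 < A * \<Gamma> / \<gamma>" using A0 assms by simp
  have "(A * \<Gamma> / \<gamma>) * (A * \<Gamma> / \<gamma> + \<Gamma>) = (\<Gamma>/\<gamma>)\<^sup>2 * (A * (A + \<gamma>))"
    using assms by (simp add: field_simps power2_eq_square)
  also have "\<dots> = \<Gamma>/\<gamma>" unfolding qA using assms by (simp add: field_simps power2_eq_square)
  finally have e: "(A * \<Gamma> / \<gamma>) * (A * \<Gamma> / \<gamma> + \<Gamma>) = B * (B + \<Gamma>)" using qB by simp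
  have "(A * \<Gamma> / \<gamma> - B) * (A * \<Gamma> / \<gamma> + B + \<Gamma>) = 0"
    using e by (simp add: algebra_simps)
  moreover have "A * \<Gamma> / \<gamma> + B + \<Gamma> \<noteq> 0" using pA B0 assms by linarith
  ultimately have BA: "B = A * \<Gamma> / \<gamma>" by simp
  have fB: "B = 1 / (A + \<gamma>)" using qA A0 assms unfolding BA by (simp add: field_simps)
  have "A * (B + \<Gamma>) = B * (A + \<gamma>)" using BA assms by (simp add: field_simps)
  also have "\<dots> = 1" using fB A0 assms by simp
  finally have fA: "A = 1 / (B + \<Gamma>)" using B0 assms by (simp add: eq_divide_eq)
  define q where "q = max (1 / (B + \<Gamma>)) (1 / (A + \<gamma>))"
  have q1: "q < 1" "0 \<le> q" unfolding q_def using A0 B0 assms by (auto simp: le_max_iff_disj)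
  have main: "0 \<le> frak_a \<gamma> \<Gamma> k \<and> 0 \<le> frak_b \<gamma> \<Gamma> k \<and> \<bar>frak_a \<gamma> \<Gamma> k - A\<bar> \<le> q ^ k \<and> \<bar>frak_b \<gamma> \<Gamma> k - B\<bar> \<le> q ^ k" for k
  proof (induction k)
    case 0
    have "A \<le> 1" unfolding fA using B0 assms by simp
    moreover have "B \<le> 1" unfolding fB using A0 assms by simp
    moreover have "1 / \<gamma> \<le> 1" "0 \<le> 1 / \<gamma>" using assms by auto
    ultimately have "\<bar>1 / \<gamma> - B\<bar> \<le> 1" "\<bar>0 - A\<bar> \<le> 1" "0 \<le> 1 / \<gamma>" using A0 B0 by linarith+
    thus ?case by simp
  next
    case (Suc k)
    have step: "\<bar>1 / (x + g) - 1 / (y + g)\<bar> \<le> q * q ^ k"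
      if "0 \<le> x" "0 < y" "1 \<le> g" "\<bar>x - y\<bar> \<le> q ^ k" "1 / (y + g) \<le> q" for x y g
    proof -
      have "\<bar>1 / (x + g) - 1 / (y + g)\<bar> = 1 / (y + g) * (\<bar>x - y\<bar> / (x + g))"
        using that by (simp add: field_simps abs_minus_commute abs_divide)
      also have "\<dots> \<le> q * q ^ k"
      proof (rule mult_mono)
        have "\<bar>x - y\<bar> / (x + g) \<le> \<bar>x - y\<bar> / 1" using that by (intro divide_left_mono) auto
        thus "\<bar>x - y\<bar> / (x + g) \<le> q ^ k" using that by simp
      qed (use that q1 in auto)
      finally show ?thesis .
    qed
    have "\<bar>1 / (frak_b \<gamma> \<Gamma> k + \<Gamma>) - 1 / (B + \<Gamma>)\<bar> \<le> q * q ^ k"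
      by (rule step) (use Suc B0 assms in \<open>auto simp: q_def\<close>)
    moreover have "\<bar>1 / (frak_a \<gamma> \<Gamma> k + \<gamma>) - 1 / (A + \<gamma>)\<bar> \<le> q * q ^ k"
      by (rule step) (use Suc A0 assms in \<open>auto simp: q_def\<close>)
    ultimately show ?case
      using Suc assms unfolding fA[symmetric] fB[symmetric] by (simp add: cf_map_def)
  qed
  have l: "(\<lambda>k. q ^ k) \<longlonglongrightarrow> 0" using q1 by (intro LIMSEQ_power_zero) auto
  have "(\<lambda>k. frak_a \<gamma> \<Gamma> k - A) \<longlonglongrightarrow> 0" "(\<lambda>k. frak_b \<gamma> \<Gamma> k - B) \<longlonglongrightarrow> 0"
    by (rule Lim_null_comparison[OF _ l], use main in simp)+
  thus "frak_a \<gamma> \<Gamma> \<longlonglongrightarrow> a_inf \<gamma> \<Gamma>" "frak_b \<gamma> \<Gamma> \<longlonglongrightarrow> b_inf \<gamma> \<Gamma>"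
    unfolding A_def B_def by (auto simp: LIM_zero_iff)
qed

definition S_int :: "real \<Rightarrow> real \<Rightarrow> real set" where
  "S_int \<gamma> \<Gamma> = {a_inf \<gamma> \<Gamma>..b_inf \<gamma> \<Gamma>}"

definition transfer_op :: "real set \<Rightarrow> real set \<Rightarrow> real \<Rightarrow> (real \<Rightarrow> real) \<Rightarrow> real \<Rightarrow> real" where
  "transfer_op B S s f =
     (\<lambda>x. if x \<in> S then \<Sum>\<beta>\<in>B. \<bar>deriv (cf_map \<beta>) x\<bar> powr s * f (cf_map \<beta> x) else 0)"

definition words :: "real set \<Rightarrow> nat \<Rightarrow> real list set" where
  "words B \<nu> = {\<omega>. length \<omega> = \<nu> \<and> set \<omega> \<subseteq> B}"

fun word_map :: "real list \<Rightarrow> real \<Rightarrow> real" where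
  "word_map [] = id"
| "word_map (\<beta> # \<omega>) = cf_map \<beta> \<circ> word_map \<omega>"

definition word_weight :: "real list \<Rightarrow> real \<Rightarrow> real" where
  "word_weight \<omega> x = \<bar>deriv (word_map \<omega>) x\<bar>"


section \<open>Parameters\<close>

definition eta :: "nat \<Rightarrow> real" where
  "eta r = (if even r then 1 / 2 else 1 / 2 * (1 + tan (pi / (2 * real r + 2))))"

definition psi :: "nat \<Rightarrow> real" where
  "psi r = 2 / pi * ln (real r + 1) + 3 / 4"

fun B_tilde :: "real \<Rightarrow> nat \<Rightarrow> real" where
  "B_tilde \<gamma> 0 = 1"
| "B_tilde \<gamma> (Suc 0) = \<gamma>"
| "B_tilde \<gamma> (Suc (Suc j)) = B_tilde \<gamma> j + \<gamma> * B_tilde \<gamma> (Suc j)"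

definition c_contr :: "real \<Rightarrow> real \<Rightarrow> nat \<Rightarrow> real" where
  "c_contr \<gamma> \<Gamma> \<nu> = 1 / (B_tilde \<gamma> (\<nu> - 1) * a_inf \<gamma> \<Gamma> + B_tilde \<gamma> \<nu>)\<^sup>2"

definition M_zero :: "real \<Rightarrow> real \<Rightarrow> nat \<Rightarrow> real" where
  "M_zero \<gamma> \<Gamma> \<nu> = 2 / (a_inf \<gamma> \<Gamma> + frak_a \<gamma> \<Gamma> (\<nu> - 1) + \<gamma>)"

text \<open>
  \<open>G_const r s chi h\<close> and \<open>H_const r s chi \<mu> h\<close> are the constants with subscript \<open>r + 1\<close>.
\<close>

definition G_const :: "nat \<Rightarrow> real \<Rightarrow> real \<Rightarrow> real \<Rightarrow> real" where
  "G_const r s chi h =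
     2 * exp (2 * s * h / chi)
       * ((\<Prod>k=0..r. 2 * s + real k) / (\<Prod>k=1..r+1. 2 * real k))
       * (1 / chi ^ (r + 1))
       * (1 / (2 * cos (pi / (2 * real r + 2)))) ^ (r + 1)"

definition H_const :: "nat \<Rightarrow> real \<Rightarrow> real \<Rightarrow> real \<Rightarrow> real \<Rightarrow> real" where
  "H_const r s chi \<mu> h =
     \<mu> * (1 / sin (pi / (2 * real r + 2)))\<^sup>2 * G_const r s chi h * (chi / (2 * s))"

definition M_two :: "nat \<Rightarrow> real \<Rightarrow> real \<Rightarrow> real \<Rightarrow> real \<Rightarrow> real" where
  "M_two r s chi \<mu> h =
     2 * s / chi *
       (1 + H_const r s chi \<mu> h * h ^ r / (1 - (G_const r s chi h)\<^sup>2 * h ^ (2 * r + 2))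
          + 1 / (1 - h\<^sup>2 * (2 * s / (\<mu> * chi)) * (sin (pi / (2 * real r + 2)))\<^sup>2))"


section \<open>Mesh, interpolation and the discretized operator\<close>

text \<open>
  The \<open>i\<close>-th mesh interval is \<open>[a i, b i]\<close> for \<open>1 \<le> i \<le> I\<close>, divided into \<open>N i\<close> equal parts.
\<close>

definition sub_width :: "(nat \<Rightarrow> real) \<Rightarrow> (nat \<Rightarrow> real) \<Rightarrow> (nat \<Rightarrow> nat) \<Rightarrow> nat \<Rightarrow> real" where
  "sub_width a b N i = (b i - a i) / real (N i)"

definition mesh_width ::
    "nat \<Rightarrow> (nat \<Rightarrow> real) \<Rightarrow> (nat \<Rightarrow> real) \<Rightarrow> (nat \<Rightarrow> nat) \<Rightarrow> real" where
  "mesh_width I a b N = Max (sub_width a b N ` {1..I})"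

definition mesh_ratio ::
    "nat \<Rightarrow> (nat \<Rightarrow> real) \<Rightarrow> (nat \<Rightarrow> real) \<Rightarrow> (nat \<Rightarrow> nat) \<Rightarrow> real" where
  "mesh_ratio I a b N = mesh_width I a b N / Min (sub_width a b N ` {1..I})"

definition mesh_point ::
    "(nat \<Rightarrow> real) \<Rightarrow> (nat \<Rightarrow> real) \<Rightarrow> (nat \<Rightarrow> nat) \<Rightarrow> nat \<Rightarrow> nat \<Rightarrow> real" where
  "mesh_point a b N i j = a i + real j * sub_width a b N i"

definition ref_node :: "nat \<Rightarrow> nat \<Rightarrow> real" where
  "ref_node r k =
     - cos ((2 * real k + 1) / (2 * real r + 2) * pi) / cos (pi / (2 * real r + 2))"

definition node ::
    "nat \<Rightarrow> (nat \<Rightarrow> real) \<Rightarrow> (nat \<Rightarrow> real) \<Rightarrow> (nat \<Rightarrow> nat) \<Rightarrow> nat \<Rightarrow> nat \<Rightarrow> nat \<Rightarrow> real" where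
  "node r a b N i j k =
     mesh_point a b N i (j - 1) + sub_width a b N i * (1 + ref_node r k) / 2"

definition node_set ::
    "nat \<Rightarrow> nat \<Rightarrow> (nat \<Rightarrow> real) \<Rightarrow> (nat \<Rightarrow> real) \<Rightarrow> (nat \<Rightarrow> nat) \<Rightarrow> real set" where
  "node_set r I a b N =
     {node r a b N i j k | i j k. i \<in> {1..I} \<and> j \<in> {1..N i} \<and> k \<in> {0..r}}"

text \<open>
  Strict inequality \<open>a i < b i\<close>: the mesh ratio \<open>\<mu>\<close> only makes sense if every \<open>h\<^sub>i\<close> is positive.
\<close>

definition admissible_mesh ::
    "real set \<Rightarrow> real set \<Rightarrow> nat \<Rightarrow> nat \<Rightarrow> nat \<Rightarrow>
       (nat \<Rightarrow> real) \<Rightarrow> (nat \<Rightarrow> real) \<Rightarrow> (nat \<Rightarrow> nat) \<Rightarrow> bool" where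
  "admissible_mesh B S \<nu> r I a b N \<longleftrightarrow>
     (\<forall>i\<in>{1..I}. a i < b i \<and> {a i..b i} \<subseteq> S \<and> 0 < N i) \<and>
     (\<forall>i\<in>{1..<I}. b i < a (i + 1) \<and>
        2 * (sin (pi / (2 * real r + 2)))\<^sup>2 * sub_width a b N i \<le> a (i + 1) - b i) \<and>
     (\<forall>\<omega>\<in>words B \<nu>. \<exists>i\<in>{1..I}. word_map \<omega> ` S \<subseteq> {a i..b i})"

definition piecewise_interpolant ::
    "nat \<Rightarrow> nat \<Rightarrow> (nat \<Rightarrow> real) \<Rightarrow> (nat \<Rightarrow> real) \<Rightarrow> (nat \<Rightarrow> nat) \<Rightarrow>
       (real \<Rightarrow> real) \<Rightarrow> real \<Rightarrow> real" where
  "piecewise_interpolant r I a b N F =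
     (THE f.
        continuous_on (\<Union>i\<in>{1..I}. {a i..b i}) f \<and>
        (\<forall>x. x \<notin> (\<Union>i\<in>{1..I}. {a i..b i}) \<longrightarrow> f x = 0) \<and>
        (\<forall>i\<in>{1..I}. \<forall>j\<in>{1..N i}. \<exists>p :: real poly.
           degree p \<le> r \<and>
           (\<forall>k\<in>{0..r}. poly p (node r a b N i j k) = F (node r a b N i j k)) \<and>
           (\<forall>x\<in>{mesh_point a b N i (j - 1)..mesh_point a b N i j}. f x = poly p x)))"

definition cone_K :: "real \<Rightarrow> real set \<Rightarrow> (real \<Rightarrow> real) set" where
  "cone_K M T =
     {F \<in> functions_on T. \<forall>\<xi>\<in>T. \<forall>\<zeta>\<in>T. F \<xi> \<le> exp (M * \<bar>\<xi> - \<zeta>\<bar>) * F \<zeta>}"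

definition discrete_op ::
    "real set \<Rightarrow> nat \<Rightarrow> real \<Rightarrow> nat \<Rightarrow> nat \<Rightarrow>
       (nat \<Rightarrow> real) \<Rightarrow> (nat \<Rightarrow> real) \<Rightarrow> (nat \<Rightarrow> nat) \<Rightarrow> (real \<Rightarrow> real) \<Rightarrow> real \<Rightarrow> real" where
  "discrete_op B \<nu> s r I a b N F =
     (\<lambda>\<xi>. if \<xi> \<in> node_set r I a b N
           then \<Sum>\<omega>\<in>words B \<nu>. word_weight \<omega> \<xi> powr s
                  * piecewise_interpolant r I a b N F (word_map \<omega> \<xi>)
           else 0)"

end

theory Submission
  imports Defs "HOL-Complex_Analysis.Great_Picard"
begin

text \<open>
  The discretized operator is not order preserving, but it maps the cone \<open>K\<^sub>M\<close> of functions that are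
  log-Lipschitz on the nodes into \<open>K\<^sub>M\<^sub>'\<close> with \<open>M' = \<kappa>2 M < M\<close>: by the Lebesgue constant and Markov's
  inequality the interpolant of an element of \<open>K\<^sub>M\<close> is positive with logarithmic derivative at most
  \<open>(\<kappa>1 / c(\<nu>)) M exp u / (1 - psi u exp u)\<close>, and the branches contract by \<open>c(\<nu>)\<close>.  As \<open>K\<^sub>M\<^sub>'\<close> consists
  of order units for \<open>K\<^sub>M\<close>, a Collatz-Wielandt argument gives an eigenvector in \<open>K\<^sub>M\<^sub>'\<close>, whose eigenvalue
  is the spectral radius.  The same argument on \<open>S\<close> gives a positive eigenfunction \<open>v\<close> of the transfer
  operator; it is a limit of positive combinations of functions \<open>(x + q) powr (- 2 s)\<close> with
  \<open>x + q \<ge> chi\<close>, so it inherits their interpolation error \<open>G h\<^bsup>r+1\<^esup>\<close> and their logarithmic Lipschitz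
  constant \<open>2 s / chi\<close>.  Since distinct nodes are at distance at least \<open>2 sin\<^sup>2(\<pi> / (2 r + 2)) h / \<mu>\<close>,
  the error of the discretized operator at \<open>v\<close> is dominated in the order of \<open>K\<^sub>M\<close> by
  \<open>H h\<^sup>r \<lambda>\<^sup>\<nu> v\<close>, and comparison of eigenvalues in that order gives the two bounds.
\<close>

section \<open>Chebyshev polynomials and Lagrange interpolation\<close>

text \<open>The shape of \<open>H_const\<close> comes from writing the relative interpolation error
  \<open>G_const * h ^ (r + 1)\<close> as k x, where k is \<open>H_const * h ^ r\<close> and x is s
  / chi times the guaranteed distance between nodes. If l is the eigenvalue of v, the discretized
  operator at v minus (1 - k) l^\<nu> v lies between k l^\<nu> (1 - x) v and k l^\<nu> (1 + x) v. On
  the nodes such a function has logarithmic Lipschitz constant at most 2 s / chi, from v, plus (2 s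
  / chi) / (1 - x^2), because ln ((1 + x) / (1 - x)) is at most 2 x / (1 - x^2) and distinct nodes
  are at least x chi / s apart. \<open>M_two\<close> pays for both. Spectral radii are found without
  duality or the theory of compact operators: a growth bound on the powers gives the resolvent by a
  Neumann series, and an eigenfunction shows that the bound is sharp. The laborious estimate is the
  constant 3 / 4 in \<open>psi\<close>. The Lebesgue constant must be bounded for all r at once with
  little numerical room, so signs and cancellations of cotangents have to be kept.\<close>

fun cheb_poly :: "nat \<Rightarrow> real poly" where
  "cheb_poly 0 = 1"
| "cheb_poly (Suc 0) = [:0, 1:]"
| "cheb_poly (Suc (Suc n)) = [:0, 2:] * cheb_poly (Suc n) - cheb_poly n"

lemma poly_cheb_poly_cos: "poly (cheb_poly n) (cos t) = cos (real n * t)"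
proof (induction n rule: cheb_poly.induct)
  case (3 n)
  have "cos (real (Suc n) * t + t) + cos (real (Suc n) * t - t) = 2 * cos t * cos (real (Suc n) * t)"
    by (simp add: cos_add cos_diff)
  moreover have "real (Suc n) * t + t = real (Suc (Suc n)) * t" "real (Suc n) * t - t = real n * t"
    by (simp_all add: algebra_simps)
  ultimately show ?case using 3 by (simp add: algebra_simps)
qed auto

lemma cheb_poly_degree_coeff:
  "degree (cheb_poly n) \<le> n \<and> coeff (cheb_poly (Suc n)) (Suc n) = 2 ^ n"
proof -
  have d: "degree (cheb_poly n) \<le> n" for n
  proof (induction n rule: cheb_poly.induct)
    case (3 n)
    have "degree ([:0, 2:] * cheb_poly (Suc n)) \<le> Suc (Suc n)"
      using degree_mult_le[of "[:0, 2:]" "cheb_poly (Suc n)"] 3 by simp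
    then show ?case using 3 by (auto intro!: degree_diff_le)
  qed auto
  have "coeff (cheb_poly (Suc n)) (Suc n) = 2 ^ n" for n
  proof (induction n)
    case (Suc n)
    have "coeff (cheb_poly n) (Suc (Suc n)) = 0"
      using d[of n] by (intro coeff_eq_0) auto
    then show ?case using Suc by simp
  qed auto
  with d show ?thesis by blast
qed

lemma degree_cheb_poly: "degree (cheb_poly n) = n"
proof (cases n)
  case (Suc m)
  then show ?thesis using cheb_poly_degree_coeff[of "Suc m"] cheb_poly_degree_coeff[of m]
    by (metis le_antisym le_degree power_not_zero zero_neq_numeral)
qed auto

lemma pderiv_cheb_poly_cos:
  "sin t * poly (pderiv (cheb_poly n)) (cos t) = real n * sin (real n * t)"
proof -
  have "((\<lambda>t. poly (cheb_poly n) (cos t)) has_real_derivative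
          poly (pderiv (cheb_poly n)) (cos t) * (- sin t)) (at t)"
    by (rule DERIV_chain2[OF poly_DERIV]) (auto intro!: derivative_eq_intros)
  moreover have "((\<lambda>t. cos (real n * t)) has_real_derivative - sin (real n * t) * real n) (at t)"
    by (auto intro!: derivative_eq_intros)
  ultimately show ?thesis
    using DERIV_unique unfolding poly_cheb_poly_cos by (force simp: algebra_simps)
qed

text \<open>In the variable cos t this makes a polynomial a cosine sum, the form on which Riesz's
  formula acts in \<open>bernstein_inequality\<close>. The leading coefficient 2^n of
  \<open>cheb_poly (Suc n)\<close> allows the top term to be split off.\<close>

lemma poly_eq_sum_cheb_poly:
  fixes p :: "real poly"
  assumes "degree p \<le> n"
  shows "\<exists>c. p = (\<Sum>j\<le>n. smult (c j) (cheb_poly j))"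
  using assms
proof (induction n arbitrary: p)
  case 0
  then show ?case by (intro exI[of _ "\<lambda>_. coeff p 0"]) (auto elim!: degree_eq_zeroE)
next
  case (Suc n)
  define a where "a = coeff p (Suc n) / 2 ^ n"
  have "degree (p - smult a (cheb_poly (Suc n))) \<le> n"
  proof (rule degree_le, safe)
    fix i assume i: "n < i"
    show "coeff (p - smult a (cheb_poly (Suc n))) i = 0"
    proof (cases "i = Suc n")
      case True
      then show ?thesis using cheb_poly_degree_coeff[of n] by (simp add: a_def)
    next
      case False
      with i Suc.prems show ?thesis
        by (simp add: coeff_eq_0 degree_cheb_poly)
    qed
  qed
  from Suc.IH[OF this] obtain c where
    c: "p - smult a (cheb_poly (Suc n)) = (\<Sum>j\<le>n. smult (c j) (cheb_poly j))" by blast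
  have "p = (\<Sum>j\<le>Suc n. smult ((c(Suc n := a)) j) (cheb_poly j))"
    using c by (auto simp: algebra_simps)
  then show ?case by blast
qed

text \<open>For k < n these are the angles of the roots of the n-th Chebyshev polynomial, in
  decreasing order of cosine. The indices n to 2 n - 1 continue them through the second half of the
  period, as the sums with \<open>riesz_weight\<close> require.\<close>

definition cheb_angle :: "nat \<Rightarrow> nat \<Rightarrow> real" where
  "cheb_angle n k = (2 * real k + 1) * pi / (2 * real n)"

lemma cheb_angle_bounds:
  assumes "k < n" shows "0 < cheb_angle n k" "cheb_angle n k < pi"
proof -
  have "2 * real k + 1 < 2 * real n" using assms by linarith
  then show "0 < cheb_angle n k" "cheb_angle n k < pi"
    using assms by (simp_all add: cheb_angle_def divide_simps)
qed

lemma cheb_angle_trig: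
  assumes "0 < n"
  shows "cos (real n * cheb_angle n k) = 0" "sin (real n * cheb_angle n k) = (- 1) ^ k"
proof -
  have e: "real n * cheb_angle n k = real k * pi + pi / 2"
    using assms by (simp add: cheb_angle_def field_simps)
  show "cos (real n * cheb_angle n k) = 0" "sin (real n * cheb_angle n k) = (- 1) ^ k"
    unfolding e by (simp_all add: cos_add sin_add cos_npi)
qed

lemma inj_on_cos_cheb_angle: "inj_on (\<lambda>k. cos (cheb_angle n k)) {..<n}"
proof (rule inj_onI)
  fix j k assume jk: "j \<in> {..<n}" "k \<in> {..<n}" and c: "cos (cheb_angle n j) = cos (cheb_angle n k)"
  have "0 < cheb_angle n j" "cheb_angle n j < pi" "0 < cheb_angle n k" "cheb_angle n k < pi"
    using jk cheb_angle_bounds by blast+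
  then have "cheb_angle n j = cheb_angle n k"
    using c by (simp add: cos_inj_pi)
  then show "j = k" using jk by (simp add: cheb_angle_def)
qed

lemma poly_eqI_on_nodes:
  fixes p q :: "real poly"
  assumes "degree p < n" "degree q < n" "inj_on x {..<n}"
    and "\<And>k. k < n \<Longrightarrow> poly p (x k) = poly q (x k)"
  shows "p = q"
proof (rule poly_eqI_degree[of "x ` {..<n}"])
  show "card (x ` {..<n}) > degree p" "card (x ` {..<n}) > degree q"
    using assms by (simp_all add: card_image)
qed (use assms in auto)

text \<open>With T = \<open>cheb_poly n\<close>, the k-th Lagrange basis polynomial at the roots is
  T / (T'(x_k) (y - x_k)), and T'(x_k) is n (-1)^k divided by the sine of the angle. The hypothesis
  on t keeps cos t off the nodes, where the quotient would be 0 / 0.\<close>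

lemma poly_cheb_lagrange:
  fixes p :: "real poly"
  assumes n: "0 < n" and d: "degree p < n" and t: "cos (real n * t) \<noteq> 0"
  shows "poly p (cos t) =
    (\<Sum>k<n. poly p (cos (cheb_angle n k)) *
       ((- 1) ^ k * cos (real n * t) * sin (cheb_angle n k)
         / (real n * (cos t - cos (cheb_angle n k)))))"
proof -
  define x where "x k = cos (cheb_angle n k)" for k
  define \<omega> where "\<omega> = cheb_poly n"
  have root: "poly \<omega> (x k) = 0" for k
    using n by (simp add: \<omega>_def x_def poly_cheb_poly_cos cheb_angle_trig)
  have inj: "inj_on x {..<n}" unfolding x_def by (rule inj_on_cos_cheb_angle)
  define q where "q k = \<omega> div [:- x k, 1:]" for k
  have q: "\<omega> = [:- x k, 1:] * q k" for k
    unfolding q_def using root[of k] by (simp only: poly_eq_0_iff_dvd dvd_mult_div_cancel)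
  have \<omega>0: "\<omega> \<noteq> 0" using degree_cheb_poly[of n] n by (auto simp: \<omega>_def)
  have q0: "q k \<noteq> 0" for k using q[of k] \<omega>0 by (metis mult_zero_right)
  have dq: "degree (q k) = n - 1" for k
  proof -
    have "degree \<omega> = degree [:- x k, 1:] + degree (q k)"
      by (subst q[of k], rule degree_mult_eq) (use q0 in auto)
    then show ?thesis using degree_cheb_poly[of n] by (simp add: \<omega>_def)
  qed
  have q_off: "poly (q k) (x j) = 0" if "j < n" "k < n" "j \<noteq> k" for j k
  proof -
    have "x j \<noteq> x k" using that inj by (auto simp: inj_on_def)
    moreover have "(x j - x k) * poly (q k) (x j) = 0"
      using root[of j] by (subst (asm) q[of k]) (simp add: algebra_simps)
    ultimately show ?thesis by simp
  qed
  have q_on: "poly (q k) (x k) = real n * (- 1) ^ k / sin (cheb_angle n k)" if "k < n" for k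
  proof -
    have "poly (pderiv \<omega>) (x k) = poly (q k) (x k)"
      by (subst q[of k], subst pderiv_mult) (simp add: pderiv_pCons)
    moreover have "sin (cheb_angle n k) > 0"
      using cheb_angle_bounds[OF that] by (intro sin_gt_zero)
    ultimately show ?thesis
      using pderiv_cheb_poly_cos[of "cheb_angle n k" n] cheb_angle_trig[OF n, of k]
      by (simp add: \<omega>_def x_def field_simps)
  qed
  define P where "P = (\<Sum>k<n. smult (poly p (x k) * ((- 1) ^ k * sin (cheb_angle n k) / real n)) (q k))"
  have "p = P"
  proof (rule poly_eqI_on_nodes[OF d _ inj])
    have "degree P \<le> n - 1"
      unfolding P_def by (intro degree_sum_le) (auto simp: dq intro: order_trans[OF degree_smult_le])
    then show "degree P < n" using n by linarith
    fix j assume j: "j < n"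
    have "poly P (x j) = (\<Sum>k<n. if k = j then poly p (x j) else 0)"
      unfolding P_def poly_sum poly_smult
    proof (rule sum.cong)
      fix k assume "k \<in> {..<n}"
      then show "poly p (x k) * ((- 1) ^ k * sin (cheb_angle n k) / real n) * poly (q k) (x j) =
          (if k = j then poly p (x j) else 0)"
        using q_off[OF j, of k] q_on[OF j] n sin_gt_zero[OF cheb_angle_bounds[OF j]]
        by (cases "k = j") (auto simp flip: power_add)
    qed simp
    then show "poly p (x j) = poly P (x j)" using j by simp
  qed
  moreover have "poly P (cos t) =
     (\<Sum>k<n. poly p (x k) * ((- 1) ^ k * cos (real n * t) * sin (cheb_angle n k)
         / (real n * (cos t - x k))))"
    unfolding P_def poly_sum poly_smult
  proof (rule sum.cong)
    fix k assume "k \<in> {..<n}"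
    have "cos (real n * t) = (cos t - x k) * poly (q k) (cos t)"
      using poly_cheb_poly_cos[of n t] unfolding \<omega>_def[symmetric]
      by (subst (asm) q[of k]) (simp add: algebra_simps)
    moreover from this have "cos t - x k \<noteq> 0" using t by auto
    ultimately have "poly (q k) (cos t) = cos (real n * t) / (cos t - x k)"
      by (metis nonzero_mult_div_cancel_left)
    then show "poly p (x k) * ((- 1) ^ k * sin (cheb_angle n k) / real n) * poly (q k) (cos t) =
        poly p (x k) * ((- 1) ^ k * cos (real n * t) * sin (cheb_angle n k) / (real n * (cos t - x k)))"
      by simp
  qed simp
  ultimately show ?thesis by (simp add: x_def)
qed

text \<open>Both sides have degree n and the same leading coefficient, so their difference has
  degree below n but n zeros. The product is the node polynomial of the interpolation error, and its
  vanishing detects the nodes.\<close>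

lemma prod_cheb_nodes:
  assumes n: "0 < n"
  shows "(\<Prod>k<n. y - cos (cheb_angle n k)) = poly (cheb_poly n) y / 2 ^ (n - 1)"
proof -
  define x where "x k = cos (cheb_angle n k)" for k
  define Q where "Q = (\<Prod>k<n. [:- x k, 1:])"
  have dQ: "degree Q = n" unfolding Q_def by (subst degree_prod_eq_sum_degree) auto
  have lQ: "coeff Q n = 1"
    using lead_coeff_prod[of "\<lambda>k. [:- x k, 1:]" "{..<n}"] dQ by (simp add: Q_def)
  have cn: "coeff (cheb_poly n) n = 2 ^ (n - 1)"
    using cheb_poly_degree_coeff[of "n - 1"] n by simp
  define R where "R = cheb_poly n - smult (2 ^ (n - 1)) Q"
  have "degree R \<le> n" unfolding R_def
    by (intro degree_diff_le) (auto simp: degree_cheb_poly dQ)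
  moreover have "coeff R n = 0" by (simp add: R_def cn lQ)
  ultimately have "degree R < n"
    using n by (metis degree_0 le_neq_implies_less leading_coeff_0_iff)
  then have "R = 0"
  proof (rule poly_eqI_on_nodes)
    show "inj_on x {..<n}" unfolding x_def by (rule inj_on_cos_cheb_angle)
    fix k assume "k < n"
    then show "poly R (x k) = poly 0 (x k)"
      using n by (auto simp: R_def Q_def x_def poly_prod poly_cheb_poly_cos cheb_angle_trig
        intro!: prod_zero)
  qed (use n in auto)
  then have "poly (cheb_poly n) y = 2 ^ (n - 1) * poly Q y"
    by (simp add: R_def)
  then show ?thesis by (simp add: Q_def poly_prod x_def)
qed

section \<open>The inequalities of Bernstein and Markov\<close>

text \<open>A chord from 0 lies below the concave sine. Applied with x equal to \<pi> / 6, \<pi> /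
  4, \<pi> / 3 or \<pi> / 2 it gives lower bounds linear in t with exact constants.\<close>

lemma sin_mult_ge:
  fixes t x :: real
  assumes "0 \<le> t" "t \<le> 1" "0 \<le> x" "x \<le> pi"
  shows "t * sin x \<le> sin (t * x)"
proof -
  have "concave_on {0..pi} sin"
  proof (rule f''_le0_imp_concave)
    show "(sin has_real_derivative cos x) (at x)" for x :: real by (rule DERIV_sin)
    show "(cos has_real_derivative - sin x) (at x)" for x :: real by (rule DERIV_cos)
  qed (auto intro: sin_ge_zero)
  from concave_onD[OF this, of t 0 x] assms show ?thesis by simp
qed

text \<open>Multiplication by 2 cos \<phi> turns the sum into a telescoping one; 0 < j < n puts
  \<phi> strictly between 0 and \<pi> / 2, so the factor can be cancelled.\<close>

lemma sum_alternating_sin: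
  assumes "0 < j" "j < n"
  shows "(\<Sum>k<2 * n. (- 1) ^ k * sin (real j * cheb_angle n k)) = 0"
proof -
  define \<phi> where "\<phi> = real j * pi / (2 * real n)"
  have "real j * pi < real n * pi" using assms by simp
  then have \<phi>: "0 < \<phi>" "\<phi> < pi / 2" using assms by (auto simp: \<phi>_def field_simps)
  have tele: "(\<Sum>k<N. (- 1) ^ k * (sin (2 * real (Suc k) * \<phi>) + sin (2 * real k * \<phi>)))
      = - ((- 1) ^ N * sin (2 * real N * \<phi>))" for N
    by (induction N) (auto simp: algebra_simps)
  have "2 * cos \<phi> * (\<Sum>k<2 * n. (- 1) ^ k * sin (real j * cheb_angle n k))
      = (\<Sum>k<2 * n. (- 1) ^ k * (sin (2 * real (Suc k) * \<phi>) + sin (2 * real k * \<phi>)))"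
    unfolding sum_distrib_left
  proof (rule sum.cong)
    fix k
    have a: "real j * cheb_angle n k = (2 * real k + 1) * \<phi>"
      by (simp add: cheb_angle_def \<phi>_def)
    have "2 * real (Suc k) * \<phi> = (2 * real k + 1) * \<phi> + \<phi>" "2 * real k * \<phi> = (2 * real k + 1) * \<phi> - \<phi>"
      by (simp_all add: algebra_simps)
    then have "sin (2 * real (Suc k) * \<phi>) + sin (2 * real k * \<phi>) = 2 * cos \<phi> * sin ((2 * real k + 1) * \<phi>)"
      by (simp only: sin_add sin_diff) simp
    then show "2 * cos \<phi> * ((- 1) ^ k * sin (real j * cheb_angle n k)) =
        (- 1) ^ k * (sin (2 * real (Suc k) * \<phi>) + sin (2 * real k * \<phi>))"
      by (simp add: a)
  qed simp
  also have "\<dots> = 0"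
  proof -
    have "2 * real (2 * n) * \<phi> = 2 * real j * pi" using assms by (simp add: \<phi>_def)
    moreover have "sin (2 * real j * pi) = 0" using sin_2npi[of j] by (simp add: mult.assoc)
    ultimately have "sin (2 * real (2 * n) * \<phi>) = 0" by (simp only:)
    then show ?thesis unfolding tele by (simp only: mult_zero_right minus_zero)
  qed
  finally show ?thesis using \<phi> cos_gt_zero[of \<phi>] by simp
qed

text \<open>Coefficients of M. Riesz's interpolation formula: up to the sign (-1)^k they express the
  derivative at t of a cosine polynomial of degree at most n by its values at the points
  \<open>t + cheb_angle n k\<close>.\<close>

definition riesz_weight :: "nat \<Rightarrow> nat \<Rightarrow> real" where
  "riesz_weight n k = 1 / (4 * real n * (sin (cheb_angle n k / 2))\<^sup>2)"

lemma riesz_weight_mult: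
  assumes "k < 2 * n"
  shows "riesz_weight n k * (2 * cos (cheb_angle n k) - 2) = - 1 / real n"
proof -
  have "0 < cheb_angle n k / 2 \<and> cheb_angle n k / 2 < pi"
    using assms by (auto simp: cheb_angle_def divide_simps)
  then have "sin (cheb_angle n k / 2) > 0" by (simp add: sin_gt_zero)
  moreover have "2 * cos (cheb_angle n k) - 2 = - 4 * (sin (cheb_angle n k / 2))\<^sup>2"
    using cos_double_sin[of "cheb_angle n k / 2"] by simp
  ultimately show ?thesis using assms by (simp add: riesz_weight_def)
qed

text \<open>The second difference in \<open>j\<close> of the left-hand side vanishes for \<open>0 < j < n\<close> by
  orthogonality, and the reflection \<open>n + 1 \<leftrightarrow> n - 1\<close> determines the slope.\<close>

lemma sum_riesz_weight_sin:
  assumes n: "0 < n" and "j \<le> n"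
  shows "(\<Sum>k<2 * n. (- 1) ^ k * riesz_weight n k * sin (real j * cheb_angle n k)) = real j"
proof -
  define f where "f j = (\<Sum>k<2 * n. (- 1) ^ k * riesz_weight n k * sin (real j * cheb_angle n k))" for j
  have trig: "sin (a + c) - 2 * sin a + sin (a - c) = sin a * (2 * cos c - 2)" for a c :: real
    by (simp add: sin_add sin_diff algebra_simps)
  have diff2: "f (Suc (Suc j)) - 2 * f (Suc j) + f j
      = - (\<Sum>k<2 * n. (- 1) ^ k * sin (real (Suc j) * cheb_angle n k)) / real n" for j
  proof -
    have "f (Suc (Suc j)) - 2 * f (Suc j) + f j = (\<Sum>k<2 * n. (- 1) ^ k * riesz_weight n k *
        (sin (real (Suc (Suc j)) * cheb_angle n k) - 2 * sin (real (Suc j) * cheb_angle n k)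
          + sin (real j * cheb_angle n k)))"
      unfolding f_def sum_distrib_left sum.distrib[symmetric] sum_subtractf[symmetric]
      by (intro sum.cong) (auto simp: algebra_simps)
    also have "\<dots> = (\<Sum>k<2 * n. - ((- 1) ^ k * sin (real (Suc j) * cheb_angle n k)) / real n)"
    proof (rule sum.cong)
      fix k assume k: "k \<in> {..<2 * n}"
      have "real (Suc (Suc j)) * cheb_angle n k = real (Suc j) * cheb_angle n k + cheb_angle n k"
        "real j * cheb_angle n k = real (Suc j) * cheb_angle n k - cheb_angle n k"
        by (simp_all add: algebra_simps)
      then have "sin (real (Suc (Suc j)) * cheb_angle n k) - 2 * sin (real (Suc j) * cheb_angle n k)
          + sin (real j * cheb_angle n k) = sin (real (Suc j) * cheb_angle n k) * (2 * cos (cheb_angle n k) - 2)"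
        by (simp only: trig)
      then have "(- 1) ^ k * riesz_weight n k *
        (sin (real (Suc (Suc j)) * cheb_angle n k) - 2 * sin (real (Suc j) * cheb_angle n k)
          + sin (real j * cheb_angle n k)) = (- 1) ^ k * sin (real (Suc j) * cheb_angle n k)
            * (riesz_weight n k * (2 * cos (cheb_angle n k) - 2))"
        by simp
      then show "(- 1) ^ k * riesz_weight n k *
        (sin (real (Suc (Suc j)) * cheb_angle n k) - 2 * sin (real (Suc j) * cheb_angle n k)
          + sin (real j * cheb_angle n k)) = - ((- 1) ^ k * sin (real (Suc j) * cheb_angle n k)) / real n"
        using riesz_weight_mult[of k n] k by (simp only: lessThan_iff) simp
    qed simp
    also have "\<dots> = - (\<Sum>k<2 * n. (- 1) ^ k * sin (real (Suc j) * cheb_angle n k)) / real n"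
      by (simp add: sum_negf sum_divide_distrib)
    finally show ?thesis .
  qed
  have lin: "f j = real j * f 1 \<and> (Suc j \<le> n \<longrightarrow> f (Suc j) = real (Suc j) * f 1)" if "j \<le> n" for j
    using that
  proof (induction j)
    case 0
    show ?case by (simp add: f_def)
  next
    case (Suc j)
    from Suc.prems Suc.IH have e: "f j = real j * f 1" "f (Suc j) = real (Suc j) * f 1" by simp_all
    have "f (Suc (Suc j)) = real (Suc (Suc j)) * f 1" if "Suc (Suc j) \<le> n"
    proof -
      have "f (Suc (Suc j)) - 2 * f (Suc j) + f j = 0"
        unfolding diff2 sum_alternating_sin[OF zero_less_Suc Suc_le_lessD[OF that]] by simp
      then have "f (Suc (Suc j)) = 2 * (real (Suc j) * f 1) - real j * f 1"
        unfolding e by linarith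
      also have "\<dots> = real (Suc (Suc j)) * f 1" by (simp only: of_nat_Suc) algebra
      finally show ?thesis .
    qed
    with e show ?case by blast
  qed
  obtain m where m: "n = Suc m" using n by (cases n) auto
  have "f (Suc (Suc m)) = f m"
    unfolding f_def
  proof (rule sum.cong)
    fix k
    have "real (Suc (Suc m)) * cheb_angle n k = real n * cheb_angle n k + cheb_angle n k"
        "real m * cheb_angle n k = real n * cheb_angle n k - cheb_angle n k"
      by (simp_all add: algebra_simps m)
    then have "sin (real (Suc (Suc m)) * cheb_angle n k) = sin (real m * cheb_angle n k)"
      using cheb_angle_trig(1)[OF n, of k]
      by (simp only: sin_add sin_diff mult_zero_left add_0_right diff_0_right)
    then show "(- 1) ^ k * riesz_weight n k * sin (real (Suc (Suc m)) * cheb_angle n k) =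
        (- 1) ^ k * riesz_weight n k * sin (real m * cheb_angle n k)" by simp
  qed simp
  \<comment> \<open>At frequency n orthogonality fails: sin (n * angle) is (-1)^k, so each of the 2
    n terms is 1. The second difference centred at n is therefore -2, and by the reflection it
    equals 2 (f m - f (Suc m)).\<close>
  moreover have "(\<Sum>k<2 * n. (- 1) ^ k * sin (real (Suc m) * cheb_angle n k)) = 2 * real n"
  proof -
    have "(- 1 :: real) ^ k * (- 1) ^ k = 1" for k by (simp flip: power_add)
    then have "(\<Sum>k<2 * n. (- 1) ^ k * sin (real n * cheb_angle n k)) = (\<Sum>k<2 * n. 1)"
      by (simp only: cheb_angle_trig(2)[OF n])
    then show ?thesis using m by simp
  qed
  ultimately have "f m - f (Suc m) = - 1"
    using diff2[of m] n by simp
  then have "f 1 = 1"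
    using lin[of m] m by (simp add: algebra_simps)
  then show ?thesis using lin[OF assms(2)] by (simp add: f_def)
qed

text \<open>The map from k to 2 n - 1 - k sends the angle to 2 \<pi> minus itself: weight and cosine
  are unchanged while (-1)^k changes sign, so the terms cancel in pairs.\<close>

lemma sum_riesz_weight_cos:
  assumes n: "0 < n"
  shows "(\<Sum>k<2 * n. (- 1) ^ k * riesz_weight n k * cos (real j * cheb_angle n k)) = 0"
proof -
  define g where "g k = (- 1) ^ k * riesz_weight n k * cos (real j * cheb_angle n k)" for k
  have refl: "g (2 * n - Suc k) = - g k" if "k < 2 * n" for k
  proof -
    have r: "real (2 * n - Suc k) = 2 * real n - real k - 1" using that by (simp add: of_nat_diff)
    have a: "cheb_angle n (2 * n - Suc k) = 2 * pi - cheb_angle n k"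
      unfolding cheb_angle_def r using n by (simp add: field_simps)
    have "cos (real j * (2 * pi - cheb_angle n k)) = cos (real j * cheb_angle n k)"
    proof -
      have "real j * (2 * pi - cheb_angle n k) = real j * 2 * pi - real j * cheb_angle n k"
        by (simp add: algebra_simps)
      moreover have "cos (real j * 2 * pi) = 1" "sin (real j * 2 * pi) = 0"
        using cos_2npi[of j] sin_2npi[of j] by (simp_all add: mult.commute)
      ultimately show ?thesis by (simp add: cos_diff)
    qed
    moreover have "riesz_weight n (2 * n - Suc k) = riesz_weight n k"
      unfolding riesz_weight_def a by (simp add: diff_divide_distrib)
    moreover have "(- 1 :: real) ^ (2 * n - Suc k) = - ((- 1) ^ k)"
    proof -
      have "(- 1 :: real) ^ (2 * n - Suc k) * (- 1) ^ Suc k = 1"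
        using that by (simp flip: power_add power_Suc)
      then show ?thesis by (cases "even k") auto
    qed
    ultimately show ?thesis by (simp add: g_def a)
  qed
  have "sum g {..<2 * n} = (\<Sum>k<2 * n. g (2 * n - Suc k))"
    by (rule sum.nat_diff_reindex[symmetric])
  also have "\<dots> = - sum g {..<2 * n}" using refl by (simp add: sum_negf)
  finally show ?thesis by (simp add: g_def)
qed

text \<open>Riesz's formula bounds the derivative of p(cos t) by B times the sum of the weights.
  That sum is n by \<open>sum_riesz_weight_sin\<close> at j = n, where the sines supply exactly the
  signs (-1)^k.\<close>

lemma bernstein_inequality:
  fixes p :: "real poly"
  assumes d: "degree p \<le> n" and B: "\<And>x. \<bar>x\<bar> \<le> 1 \<Longrightarrow> \<bar>poly p x\<bar> \<le> B"
  shows "\<bar>sin t * poly (pderiv p) (cos t)\<bar> \<le> real n * B"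
proof (cases "n = 0")
  case True
  then show ?thesis using d by (auto elim!: degree_eq_zeroE)
next
  case False
  then have n: "0 < n" by simp
  obtain c where c: "p = (\<Sum>j\<le>n. smult (c j) (cheb_poly j))"
    using poly_eq_sum_cheb_poly[OF d] by blast
  have pc: "poly p (cos x) = (\<Sum>j\<le>n. c j * cos (real j * x))" for x
    by (simp add: c poly_sum poly_cheb_poly_cos)
  have "sin t * poly (pderiv p) (cos t) = (\<Sum>j\<le>n. c j * (sin t * poly (pderiv (cheb_poly j)) (cos t)))"
  proof -
    have "pderiv p = (\<Sum>j\<le>n. smult (c j) (pderiv (cheb_poly j)))"
      unfolding c by (induction n) (simp_all add: pderiv_add pderiv_smult)
    then show ?thesis by (simp add: poly_sum sum_distrib_left algebra_simps)
  qed
  also have "\<dots> = (\<Sum>j\<le>n. c j * (real j * sin (real j * t)))"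
    by (simp add: pderiv_cheb_poly_cos)
  also have "\<dots> = (\<Sum>j\<le>n. c j * (- (\<Sum>k<2 * n. (- 1) ^ k * riesz_weight n k * cos (real j * (t + cheb_angle n k)))))"
  proof (rule sum.cong)
    fix j assume j: "j \<in> {..n}"
    have "(\<Sum>k<2 * n. (- 1) ^ k * riesz_weight n k * cos (real j * (t + cheb_angle n k)))
      = cos (real j * t) * (\<Sum>k<2 * n. (- 1) ^ k * riesz_weight n k * cos (real j * cheb_angle n k))
      - sin (real j * t) * (\<Sum>k<2 * n. (- 1) ^ k * riesz_weight n k * sin (real j * cheb_angle n k))"
      by (simp add: cos_add distrib_left sum_distrib_left sum_subtractf[symmetric] algebra_simps)
    also have "\<dots> = - (real j * sin (real j * t))"
      using sum_riesz_weight_sin[OF n, of j] j sum_riesz_weight_cos[OF n, of j] by simp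
    finally show "c j * (real j * sin (real j * t)) = c j * (- (\<Sum>k<2 * n. (- 1) ^ k * riesz_weight n k * cos (real j * (t + cheb_angle n k))))"
      by simp
  qed simp
  also have "\<dots> = - (\<Sum>j\<le>n. \<Sum>k<2 * n. (- 1) ^ k * riesz_weight n k * (c j * cos (real j * (t + cheb_angle n k))))"
    by (simp add: sum_distrib_left sum_negf algebra_simps)
  also have "\<dots> = - (\<Sum>k<2 * n. (- 1) ^ k * riesz_weight n k * poly p (cos (t + cheb_angle n k)))"
    by (subst sum.swap) (simp add: pc sum_distrib_left)
  finally have "\<bar>sin t * poly (pderiv p) (cos t)\<bar> \<le> (\<Sum>k<2 * n. \<bar>(- 1) ^ k * riesz_weight n k * poly p (cos (t + cheb_angle n k))\<bar>)"
    by simp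
  also have "\<dots> \<le> (\<Sum>k<2 * n. riesz_weight n k * B)"
  proof (rule sum_mono)
    fix k
    have "0 \<le> riesz_weight n k" by (simp add: riesz_weight_def)
    then show "\<bar>(- 1) ^ k * riesz_weight n k * poly p (cos (t + cheb_angle n k))\<bar> \<le> riesz_weight n k * B"
      using B[of "cos (t + cheb_angle n k)"] by (simp add: abs_mult power_abs mult_left_mono)
  qed
  also have "\<dots> = (\<Sum>k<2 * n. (- 1) ^ k * riesz_weight n k * sin (real n * cheb_angle n k)) * B"
    unfolding sum_distrib_right cheb_angle_trig(2)[OF n]
  proof (rule sum.cong)
    fix k
    have "(- 1 :: real) ^ k * (- 1) ^ k = 1" by (simp flip: power_add)
    then show "riesz_weight n k * B = (- 1) ^ k * riesz_weight n k * (- 1) ^ k * B"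
      by (metis (no_types, opaque_lifting) mult.assoc mult.commute mult.left_neutral)
  qed simp
  also have "\<dots> = real n * B" using sum_riesz_weight_sin[OF n, of n] by simp
  finally show ?thesis .
qed

lemma abs_sin_mult_le: "\<bar>sin (real n * t)\<bar> \<le> real n * \<bar>sin t\<bar>"
proof (induction n)
  case (Suc n)
  have "\<bar>sin (real (Suc n) * t)\<bar> = \<bar>sin t * cos (real n * t) + cos t * sin (real n * t)\<bar>"
    by (simp add: distrib_right sin_add)
  also have "\<dots> \<le> \<bar>sin t\<bar> * \<bar>cos (real n * t)\<bar> + \<bar>cos t\<bar> * \<bar>sin (real n * t)\<bar>"
    by (metis abs_mult abs_triangle_ineq)
  also have "\<dots> \<le> \<bar>sin t\<bar> * 1 + 1 * \<bar>sin (real n * t)\<bar>"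
    by (intro add_mono mult_mono) auto
  finally show ?case using Suc by (simp add: algebra_simps)
qed auto

text \<open>Away from the endpoints this is Bernstein's inequality; near them all the terms of the
  Lagrange formula for the derivative have one sign, so that the Chebyshev polynomial is extremal.\<close>

lemma markov_inequality:
  fixes p :: "real poly"
  assumes d: "degree p \<le> n" and n: "0 < n" and B: "\<And>x. \<bar>x\<bar> \<le> 1 \<Longrightarrow> \<bar>poly p x\<bar> \<le> B"
    and y: "\<bar>y\<bar> \<le> 1"
  shows "\<bar>poly (pderiv p) y\<bar> \<le> (real n)\<^sup>2 * B"
proof -
  have B0: "0 \<le> B" using B[of 0] by simp
  have inner: "\<bar>poly (pderiv p) (cos t)\<bar> \<le> (real n)\<^sup>2 * B" if t: "0 < t" "t < pi" for t
  \<comment> \<open>The two thresholds are the angles of the outermost Chebyshev roots. Between them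
    sin t is at least 1 / n, so dividing Bernstein's bound n B by sin t costs at most a factor
    n.\<close>
  proof (cases "pi / (2 * real n) \<le> t \<and> t \<le> pi - pi / (2 * real n)")
    case True
    define e where "e = pi / (2 * real n)"
    have e: "0 < e" "e \<le> pi / 2" using n by (simp_all add: e_def divide_simps)
    have "1 / real n * sin (pi / 2) \<le> sin (1 / real n * (pi / 2))"
      using n by (intro sin_mult_ge) auto
    then have "1 / real n \<le> sin e" by (simp add: e_def mult.commute)
    also have "sin e \<le> sin t"
    proof (cases "t \<le> pi / 2")
      case True
      then show ?thesis using \<open>pi / (2 * real n) \<le> t \<and> _\<close> e by (intro sin_monotone_2pi_le) (auto simp: e_def)
    next
      case False
      have "sin e \<le> sin (pi - t)"
        using \<open>pi / (2 * real n) \<le> t \<and> _\<close> e False by (intro sin_monotone_2pi_le) (auto simp: e_def)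
      then show ?thesis by simp
    qed
    finally have s: "1 \<le> real n * sin t" using n by (simp add: field_simps)
    have "\<bar>poly (pderiv p) (cos t)\<bar> \<le> (real n * sin t) * \<bar>poly (pderiv p) (cos t)\<bar>"
      using s by (simp add: mult_le_cancel_right1)
    also have "\<dots> = real n * \<bar>sin t * poly (pderiv p) (cos t)\<bar>"
      using sin_gt_zero[OF t] by (simp add: abs_mult)
    also have "\<dots> \<le> real n * (real n * B)"
      using bernstein_inequality[OF d B, of t] n by (intro mult_left_mono) auto
    finally show ?thesis by (simp add: power2_eq_square)
  next
    case False
    define x where "x k = cos (cheb_angle n k)" for k
    have lo: "pi / (2 * real n) \<le> cheb_angle n k" for k
      using n by (simp add: cheb_angle_def divide_simps)
    have hi: "cheb_angle n k \<le> pi - pi / (2 * real n)" if "k < n" for k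
    proof -
      have "2 * real k + 1 \<le> 2 * real n - 1" using that by linarith
      then have "(2 * real k + 1) * pi \<le> (2 * real n - 1) * pi" by (intro mult_right_mono) auto
      then have "(2 * real k + 1) * pi / (2 * real n) \<le> (2 * real n - 1) * pi / (2 * real n)"
        by (intro divide_right_mono) auto
      also have "\<dots> = pi - pi / (2 * real n)" using n by (simp add: field_simps)
      finally show ?thesis by (simp add: cheb_angle_def)
    qed
    have sgn: "(\<forall>k<n. 0 < cos t - x k) \<or> (\<forall>k<n. cos t - x k < 0)"
    proof (cases "t < pi / (2 * real n)")
      case True
      then have "cos (cheb_angle n k) < cos t" if "k < n" for k
        using lo[of k] t cheb_angle_bounds[OF that] by (intro cos_monotone_0_pi) auto
      then show ?thesis by (auto simp: x_def)
    next
      case F: False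
      then have "pi - pi / (2 * real n) < t" using False by auto
      then have "cos t < cos (cheb_angle n k)" if "k < n" for k
        using hi[OF that] t cheb_angle_bounds[OF that] by (intro cos_monotone_0_pi) auto
      then show ?thesis by (auto simp: x_def)
    qed
    have "poly (cheb_poly n) (cos t) \<noteq> 0"
    proof
      assume "poly (cheb_poly n) (cos t) = 0"
      then obtain k where "k < n" "cos t - x k = 0"
        using prod_cheb_nodes[OF n, of "cos t"] by (auto simp: x_def)
      then show False using sgn by auto
    qed
    then have cn: "cos (real n * t) \<noteq> 0" by (simp add: poly_cheb_poly_cos)
    have ddn: "degree (pderiv q) < n" if "degree q \<le> n" for q :: "real poly"
      using that n by (simp add: degree_pderiv)
    have bern: "sin (cheb_angle n k) * \<bar>poly (pderiv p) (x k)\<bar> \<le> real n * B" if "k < n" for k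
      using bernstein_inequality[OF d B, of "cheb_angle n k"] sin_gt_zero[OF cheb_angle_bounds[OF that]]
      by (simp add: x_def abs_mult)
    \<comment> \<open>For the Chebyshev polynomial itself Bernstein's bound is an equality at the
      roots, with the signs of the Lagrange coefficients. The modulus of this sum is thus the
      majorant obtained for p when B = 1.\<close>
    have cheb: "poly (pderiv (cheb_poly n)) (cos t) = (\<Sum>k<n. cos (real n * t) / (cos t - x k))"
      unfolding poly_cheb_lagrange[OF n ddn[of "cheb_poly n", unfolded degree_cheb_poly, OF order_refl] cn]
    proof (rule sum.cong)
      fix k assume "k \<in> {..<n}"
      then have s: "sin (cheb_angle n k) > 0" using sin_gt_zero[OF cheb_angle_bounds] by auto
      have "poly (pderiv (cheb_poly n)) (cos (cheb_angle n k)) = real n * (- 1) ^ k / sin (cheb_angle n k)"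
        using pderiv_cheb_poly_cos[of "cheb_angle n k" n] cheb_angle_trig(2)[OF n, of k] s
        by (simp add: field_simps)
      moreover have "(- 1 :: real) ^ k * (- 1) ^ k = 1" by (simp flip: power_add)
      ultimately show "poly (pderiv (cheb_poly n)) (cos (cheb_angle n k)) *
         ((- 1) ^ k * cos (real n * t) * sin (cheb_angle n k) / (real n * (cos t - cos (cheb_angle n k)))) =
         cos (real n * t) / (cos t - x k)"
        using s n by (simp add: x_def)
    qed simp
    have "\<bar>poly (pderiv p) (cos t)\<bar> \<le> (\<Sum>k<n. \<bar>poly (pderiv p) (x k) *
       ((- 1) ^ k * cos (real n * t) * sin (cheb_angle n k) / (real n * (cos t - x k)))\<bar>)"
      unfolding poly_cheb_lagrange[OF n ddn[OF d] cn] x_def by (rule sum_abs)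
    also have "\<dots> \<le> (\<Sum>k<n. B * \<bar>cos (real n * t) / (cos t - x k)\<bar>)"
    proof (rule sum_mono)
      fix k assume "k \<in> {..<n}"
      then have k: "k < n" by simp
      have "\<bar>poly (pderiv p) (x k) * ((- 1) ^ k * cos (real n * t) * sin (cheb_angle n k) / (real n * (cos t - x k)))\<bar>
        = (sin (cheb_angle n k) * \<bar>poly (pderiv p) (x k)\<bar>) / real n * \<bar>cos (real n * t) / (cos t - x k)\<bar>"
        using sin_gt_zero[OF cheb_angle_bounds[OF k]] by (simp add: abs_mult power_abs abs_divide)
      also have "\<dots> \<le> B * \<bar>cos (real n * t) / (cos t - x k)\<bar>"
        using bern[OF k] n by (intro mult_right_mono) (auto simp: field_simps)
      finally show "\<bar>poly (pderiv p) (x k) * ((- 1) ^ k * cos (real n * t) * sin (cheb_angle n k) / (real n * (cos t - x k)))\<bar>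
        \<le> B * \<bar>cos (real n * t) / (cos t - x k)\<bar>" .
    qed
    also have "\<dots> = B * \<bar>\<Sum>k<n. cos (real n * t) / (cos t - x k)\<bar>"
    proof -
      have "(\<Sum>k<n. \<bar>cos (real n * t) / (cos t - x k)\<bar>) = \<bar>cos (real n * t)\<bar> * (\<Sum>k<n. \<bar>1 / (cos t - x k)\<bar>)"
        by (simp add: sum_distrib_left abs_divide)
      also have "(\<Sum>k<n. \<bar>1 / (cos t - x k)\<bar>) = \<bar>\<Sum>k<n. 1 / (cos t - x k)\<bar>"
        using sgn
      proof
        assume "\<forall>k<n. 0 < cos t - x k"
        then show ?thesis by (subst abs_of_nonneg[OF sum_nonneg]) (auto intro!: sum.cong)
      next
        assume "\<forall>k<n. cos t - x k < 0"
        then show ?thesis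
          by (subst abs_of_nonpos[OF sum_nonpos])
             (auto simp: sum_negf[symmetric] abs_of_neg field_simps intro!: sum.cong)
      qed
      also have "\<bar>cos (real n * t)\<bar> * \<bar>\<Sum>k<n. 1 / (cos t - x k)\<bar> = \<bar>\<Sum>k<n. cos (real n * t) / (cos t - x k)\<bar>"
        unfolding abs_mult[symmetric] sum_distrib_left by simp
      finally show ?thesis unfolding sum_distrib_left[symmetric] by simp
    qed
    also have "\<dots> = B * \<bar>poly (pderiv (cheb_poly n)) (cos t)\<bar>" by (simp add: cheb)
    also have "\<dots> \<le> B * (real n)\<^sup>2"
    proof (intro mult_left_mono B0)
      have "sin t * \<bar>poly (pderiv (cheb_poly n)) (cos t)\<bar> = real n * \<bar>sin (real n * t)\<bar>"
        using pderiv_cheb_poly_cos[of t n] sin_gt_zero[OF t]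
        by (metis abs_mult abs_of_nat abs_of_pos)
      also have "\<dots> \<le> real n * (real n * sin t)"
        using abs_sin_mult_le[of n t] sin_gt_zero[OF t] by (intro mult_left_mono) auto
      finally show "\<bar>poly (pderiv (cheb_poly n)) (cos t)\<bar> \<le> (real n)\<^sup>2"
        using sin_gt_zero[OF t] by (simp add: power2_eq_square algebra_simps)
    qed
    finally show ?thesis by (simp add: mult.commute)
  qed
  \<comment> \<open>\<open>inner\<close> requires sin t > 0 and so omits y = 1 and y = -1, which
    follow by continuity.\<close>
  have "\<bar>poly (pderiv p) y\<bar> \<le> (real n)\<^sup>2 * B"
  proof (rule continuous_le_on_closure[where S = "{- 1<..<1}" and f = "\<lambda>y. \<bar>poly (pderiv p) y\<bar>"])
    show "y \<in> closure {- 1<..<1}" using y by (simp add: abs_le_iff)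
    show "\<bar>poly (pderiv p) x\<bar> \<le> (real n)\<^sup>2 * B" if "x \<in> {- 1<..<1}" for x
      using inner[of "arccos x"] that arccos_lt_bounded[of x] cos_arccos[of x] by auto
  qed (intro continuous_intros)
  then show ?thesis .
qed

section \<open>The Lebesgue constant of the extended Chebyshev nodes\<close>

lemma nonneg_from_deriv:
  fixes f f' :: "real \<Rightarrow> real"
  assumes "\<And>x. 0 \<le> x \<Longrightarrow> x \<le> b \<Longrightarrow> (f has_real_derivative f' x) (at x)"
    and "\<And>x. 0 \<le> x \<Longrightarrow> x \<le> b \<Longrightarrow> 0 \<le> f' x" and "0 \<le> f 0" and "0 \<le> x" "x \<le> b"
  shows "0 \<le> f x"
proof -
  have "f 0 \<le> f x"
    by (rule DERIV_nonneg_imp_nondecreasing) (use assms in force)+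
  with assms show ?thesis by linarith
qed

text \<open>1 / x - x / 3 is the start of the Laurent series, whose later terms are negative. After
  multiplication by x sin x the difference of the two sides has derivative (x / 3) (sin x - x cos
  x).\<close>

lemma cot_le:
  fixes x :: real
  assumes "0 < x" "x < pi / 2"
  shows "cot x \<le> 1 / x - x / 3"
proof -
  have 1: "0 \<le> sin y - y * cos y" if "0 \<le> y" "y \<le> pi / 2" for y :: real
    by (rule nonneg_from_deriv[where f = "\<lambda>y. sin y - y * cos y" and b = "pi / 2" and f' = "\<lambda>y. y * sin y"])
       (use that in \<open>auto intro!: derivative_eq_intros mult_nonneg_nonneg sin_ge_zero simp: algebra_simps\<close>)
  have "0 \<le> (1 - x\<^sup>2 / 3) * sin x - x * cos x"
  proof (rule nonneg_from_deriv[where f = "\<lambda>x. (1 - x\<^sup>2 / 3) * sin x - x * cos x" and b = "pi / 2" and f' = "\<lambda>y. y / 3 * (sin y - y * cos y)"])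
    show "((\<lambda>x. (1 - x\<^sup>2 / 3) * sin x - x * cos x) has_real_derivative y / 3 * (sin y - y * cos y)) (at y)" for y
      by (auto intro!: derivative_eq_intros simp: algebra_simps power2_eq_square)
    show "0 \<le> y / 3 * (sin y - y * cos y)" if "0 \<le> y" "y \<le> pi / 2" for y
      using that 1[OF that] by simp
  qed (use assms in auto)
  moreover have "0 < sin x" using assms by (intro sin_gt_zero) auto
  ultimately show ?thesis using assms by (simp add: cot_def field_simps power2_eq_square)
qed

lemma sin_cos_taylor_bounds:
  fixes x :: real
  assumes "0 \<le> x"
  shows "sin x \<le> x - x ^ 3 / 6 + x ^ 5 / 120"
    and "1 - x ^ 2 / 2 + x ^ 4 / 24 - x ^ 6 / 720 \<le> cos x"
proof -
  have c2: "0 \<le> cos y - (1 - y ^ 2 / 2)" if "0 \<le> y" for y :: real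
    by (rule nonneg_from_deriv[where f = "\<lambda>y. cos y - (1 - y ^ 2 / 2)" and b = y and f' = "\<lambda>y. y - sin y"])
       (use that in \<open>auto intro!: derivative_eq_intros simp: sin_x_le_x\<close>)
  have s3: "0 \<le> sin y - (y - y ^ 3 / 6)" if "0 \<le> y" for y :: real
    by (rule nonneg_from_deriv[where f = "\<lambda>y. sin y - (y - y ^ 3 / 6)" and b = y and f' = "\<lambda>y. cos y - (1 - y ^ 2 / 2)"])
       (use that in \<open>auto intro!: derivative_eq_intros c2[simplified]\<close>)
  have c4: "0 \<le> (1 - y ^ 2 / 2 + y ^ 4 / 24) - cos y" if "0 \<le> y" for y :: real
    by (rule nonneg_from_deriv[where f = "\<lambda>y. (1 - y ^ 2 / 2 + y ^ 4 / 24) - cos y" and b = y and f' = "\<lambda>y. sin y - (y - y ^ 3 / 6)"])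
       (use that in \<open>auto intro!: derivative_eq_intros s3[simplified]\<close>)
  have s5: "0 \<le> (y - y ^ 3 / 6 + y ^ 5 / 120) - sin y" if "0 \<le> y" for y :: real
    by (rule nonneg_from_deriv[where f = "\<lambda>y. (y - y ^ 3 / 6 + y ^ 5 / 120) - sin y" and b = y and f' = "\<lambda>y. (1 - y ^ 2 / 2 + y ^ 4 / 24) - cos y"])
       (use that in \<open>auto intro!: derivative_eq_intros c4[simplified]\<close>)
  have c6: "0 \<le> cos y - (1 - y ^ 2 / 2 + y ^ 4 / 24 - y ^ 6 / 720)" if "0 \<le> y" for y :: real
    by (rule nonneg_from_deriv[where f = "\<lambda>y. cos y - (1 - y ^ 2 / 2 + y ^ 4 / 24 - y ^ 6 / 720)" and b = y and f' = "\<lambda>y. (y - y ^ 3 / 6 + y ^ 5 / 120) - sin y"])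
       (use that in \<open>auto intro!: derivative_eq_intros s5[simplified]\<close>)
  show "sin x \<le> x - x ^ 3 / 6 + x ^ 5 / 120" "1 - x ^ 2 / 2 + x ^ 4 / 24 - x ^ 6 / 720 \<le> cos x"
    using s5[OF assms] c6[OF assms] by simp_all
qed

text \<open>With 37 / 100 in place of 1 / 3 the truncation becomes a lower bound on this range: (1 /
  x - cot x) / x grows with x and is about 0.361 at \<pi> / 3. The Taylor bounds reduce the claim to
  a polynomial inequality.\<close>

lemma cot_ge:
  fixes x :: real
  assumes "0 < x" "x \<le> pi / 3"
  shows "1 / x - 37 / 100 * x \<le> cot x"
proof -
  have "x \<le> 1.0472" using assms pi_approx by simp
  then have "x * x \<le> 1.0472 * 1.0472" using assms by (intro mult_mono) auto
  then have x2: "x ^ 2 \<le> 1.097" by (simp add: power2_eq_square)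
  have "x * (1 - x ^ 2 / 2 + x ^ 4 / 24 - x ^ 6 / 720) \<le> x * cos x"
    using assms sin_cos_taylor_bounds(2)[of x] by (intro mult_left_mono) auto
  moreover have "(1 - 37 / 100 * x ^ 2) * sin x \<le> (1 - 37 / 100 * x ^ 2) * (x - x ^ 3 / 6 + x ^ 5 / 120)"
    using assms x2 sin_cos_taylor_bounds(1)[of x] by (intro mult_left_mono) auto
  moreover have "(1 - 37 / 100 * x ^ 2) * (x - x ^ 3 / 6 + x ^ 5 / 120)
      \<le> x * (1 - x ^ 2 / 2 + x ^ 4 / 24 - x ^ 6 / 720)"
  proof -
    have "0 \<le> x ^ 3 * ((37/100 - 1/3) - x ^ 2 * (37/600 - 1/30) + x ^ 4 * (37 / 12000 - 1/720))"
      using assms x2 by (intro mult_nonneg_nonneg add_nonneg_nonneg) auto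
    also have "\<dots> = x * (1 - x ^ 2 / 2 + x ^ 4 / 24 - x ^ 6 / 720) - (1 - 37 / 100 * x ^ 2) * (x - x ^ 3 / 6 + x ^ 5 / 120)"
      by (simp add: field_simps flip: power_add power_Suc) (simp add: algebra_simps power_numeral_reduce)
    finally show ?thesis by simp
  qed
  ultimately have "(1 - 37 / 100 * x ^ 2) * sin x \<le> x * cos x" by linarith
  moreover have "0 < sin x" using assms pi_gt_zero by (intro sin_gt_zero) linarith+
  ultimately show ?thesis using assms by (simp add: cot_def field_simps power2_eq_square)
qed

text \<open>This says that sin (n x) / sin x decreases, with denominators cleared. In
  \<open>half_angle_cot_bounds\<close> it compares two small angles through their n-fold multiples,
  which no longer depend on n.\<close>

lemma sin_mult_ratio_antimono:
  fixes a d :: real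
  assumes "0 \<le> d" "d \<le> a" "real n * a \<le> pi / 2" "a \<le> pi / 2"
  shows "sin (real n * a) * sin d \<le> sin (real n * d) * sin a"
  using assms(3)
proof (induction n)
  case (Suc n)
  have na: "0 \<le> real n * a" "real n * a \<le> pi / 2"
    using Suc.prems assms by (auto simp: algebra_simps)
  have nd: "0 \<le> real n * d" "real n * d \<le> real n * a"
    using assms by (auto intro: mult_left_mono)
  have IH: "sin (real n * a) * sin d \<le> sin (real n * d) * sin a" using Suc.IH na by simp
  have c: "0 \<le> cos a" "cos a \<le> cos d" "cos (real n * a) \<le> cos (real n * d)"
    using assms na nd by (auto intro!: cos_ge_zero cos_monotone_0_pi_le)
  have s: "0 \<le> sin a" "0 \<le> sin d" "0 \<le> sin (real n * d)" "0 \<le> sin (real n * a)"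
    using assms na nd by (auto intro!: sin_ge_zero)
  have "sin (real (Suc n) * a) * sin d = (sin (real n * a) * sin d) * cos a + cos (real n * a) * (sin a * sin d)"
    by (simp add: distrib_right sin_add algebra_simps)
  also have "\<dots> \<le> (sin (real n * d) * sin a) * cos d + cos (real n * d) * (sin a * sin d)"
    using IH c s by (intro add_mono mult_mono[OF IH] mult_right_mono) auto
  also have "\<dots> = sin (real (Suc n) * d) * sin a"
    by (simp add: distrib_right sin_add algebra_simps)
  finally show ?case .
qed auto

lemma sin_add_mult_sin_diff:
  fixes a d :: real
  shows "sin (a - d) * sin (a + d) = (sin a)\<^sup>2 - (sin d)\<^sup>2"
proof -
  have "sin (a - d) * sin (a + d) = (sin a * cos d)\<^sup>2 - (cos a * sin d)\<^sup>2"
    by (simp add: sin_add sin_diff algebra_simps power2_eq_square)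
  also have "\<dots> = (sin a)\<^sup>2 * (1 - (sin d)\<^sup>2) - (1 - (sin a)\<^sup>2) * (sin d)\<^sup>2"
    by (simp add: power_mult_distrib cos_squared_eq)
  finally show ?thesis by (simp add: algebra_simps)
qed

lemma cot_diff_add_cot_add:
  fixes a d :: real
  assumes "0 < sin (a - d)" "0 < sin (a + d)"
  shows "cot (a - d) + cot (a + d) = sin (2 * a) / ((sin a)\<^sup>2 - (sin d)\<^sup>2)"
    and "cot (a - d) - cot (a + d) = sin (2 * d) / ((sin a)\<^sup>2 - (sin d)\<^sup>2)"
proof -
  have "sin (2 * a) = sin ((a + d) + (a - d))" "sin (2 * d) = sin ((a + d) - (a - d))" by simp_all
  then have e: "sin (2 * a) = cos (a - d) * sin (a + d) + cos (a + d) * sin (a - d)"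
    "sin (2 * d) = cos (a - d) * sin (a + d) - cos (a + d) * sin (a - d)"
    unfolding sin_add[of "a + d" "a - d"] sin_diff[of "a + d" "a - d"] by (simp_all only: mult.commute)
  show "cot (a - d) + cot (a + d) = sin (2 * a) / ((sin a)\<^sup>2 - (sin d)\<^sup>2)"
    "cot (a - d) - cot (a + d) = sin (2 * d) / ((sin a)\<^sup>2 - (sin d)\<^sup>2)"
    unfolding e sin_add_mult_sin_diff[symmetric] cot_def using assms by (simp_all add: field_simps)
qed

lemma cos_le_quadratic:
  fixes \<sigma> :: real
  assumes "\<bar>\<sigma>\<bar> \<le> pi / 2"
  shows "cos \<sigma> \<le> 1 - (\<sigma> / (pi / 2))\<^sup>2"
proof -
  define t where "t = \<bar>\<sigma>\<bar> / (pi / 2)"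
  have t: "0 \<le> t" "t \<le> 1" using assms by (simp_all add: t_def field_simps)
  have "t * sin (pi / 4) \<le> sin (t * (pi / 4))" using t by (intro sin_mult_ge) auto
  moreover have "t * (pi / 4) = \<bar>\<sigma>\<bar> / 2" by (simp add: t_def)
  ultimately have "(t * sin (pi / 4))\<^sup>2 \<le> (sin (\<bar>\<sigma>\<bar> / 2))\<^sup>2"
    using t by (intro power_mono) (simp_all only: zero_le_mult_iff, simp add: sin_45)
  moreover have "(t * sin (pi / 4))\<^sup>2 = t\<^sup>2 / 2" by (simp add: power_mult_distrib sin_45 power_divide)
  moreover have "cos \<sigma> = 1 - 2 * (sin (\<bar>\<sigma>\<bar> / 2))\<^sup>2"
    using cos_double_sin[of "\<bar>\<sigma>\<bar> / 2"] by (cases "\<sigma> < 0") simp_all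
  moreover have "t\<^sup>2 = (\<sigma> / (pi / 2))\<^sup>2" by (simp add: t_def power_divide)
  ultimately show ?thesis by simp
qed

lemma abs_mult_cos_le:
  fixes \<sigma> :: real
  assumes "\<bar>\<sigma>\<bar> \<le> pi / 2"
  shows "\<bar>\<sigma>\<bar> * cos \<sigma> \<le> 605 / 1000"
proof -
  define t where "t = \<bar>\<sigma>\<bar> / (pi / 2)"
  have t: "0 \<le> t" by (simp add: t_def)
  \<comment> \<open>Factorisation of t^3 minus its tangent line at a. The value 0.5774 taken for a
    lies just above 1 / sqrt 3, the maximiser of t - t^3, where the maximum is about 0.3849.\<close>
  have cube: "(t - a)\<^sup>2 * (t + 2 * a) = t ^ 3 - 3 * a\<^sup>2 * t + 2 * a ^ 3" for a by algebra
  have "0 \<le> (t - 5774 / 10000)\<^sup>2 * (t + 2 * (5774 / 10000))"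
    using t by (intro mult_nonneg_nonneg) auto
  then have "0 \<le> t ^ 3 - 3 * (5774 / 10000)\<^sup>2 * t + 2 * (5774 / 10000) ^ 3" by (simp only: cube)
  moreover have "(1 :: real) \<le> 3 * (5774 / 10000)\<^sup>2" "2 * (5774 / 10000) ^ 3 \<le> (0.385 :: real)"
    by (simp_all add: power2_eq_square power3_eq_cube)
  moreover have "1 * t \<le> 3 * (5774 / 10000)\<^sup>2 * t" using t by (intro mult_right_mono calculation)
  ultimately have "t - t ^ 3 \<le> 0.385" by linarith
  then have p: "t * (1 - t\<^sup>2) \<le> 0.385" by (simp add: power2_eq_square power3_eq_cube algebra_simps)
  have "\<bar>\<sigma>\<bar> * cos \<sigma> \<le> \<bar>\<sigma>\<bar> * (1 - t\<^sup>2)"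
    using cos_le_quadratic[OF assms] by (intro mult_left_mono) (simp_all add: t_def power_divide)
  also have "\<dots> = (pi / 2) * (t * (1 - t\<^sup>2))" by (simp add: t_def)
  also have "\<dots> \<le> (pi / 2) * 0.385" using p by (intro mult_left_mono) auto
  also have "\<dots> \<le> 605 / 1000" using pi_approx by simp
  finally show ?thesis .
qed

definition odd_harmonic :: "nat \<Rightarrow> real" where
  "odd_harmonic n = (\<Sum>i=1..n. 1 / (2 * real i - 1))"

text \<open>The excess of \<open>odd_harmonic n\<close> over ln n / 2 decreases in n: the increment
  y = 1 / (2 n + 1) is below artanh y = ln ((n + 1) / n) / 2. A larger k gives a sharper constant; k
  = 2 and k = 3 are enough below.\<close>

lemma odd_harmonic_le:
  assumes "1 \<le> k" "k \<le> n"
  shows "odd_harmonic n \<le> ln (real n) / 2 + (odd_harmonic k - ln (real k) / 2)"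
  using assms(2)
proof (induction n rule: dec_induct)
  case (step n)
  have n: "1 \<le> n" using step assms by simp
  define y where "y = 1 / (2 * real n + 1)"
  have y: "0 \<le> y" "y < 1" using n by (simp_all add: y_def)
  have "2 * y \<le> ln ((1 + y) / (1 - y))"
  proof -
    have "0 \<le> ln (1 + y) - ln (1 - y) - 2 * y"
    proof (rule nonneg_from_deriv[where f = "\<lambda>y. ln (1 + y) - ln (1 - y) - 2 * y" and b = y and f' = "\<lambda>y. 1 / (1 + y) + 1 / (1 - y) - 2"])
      show "((\<lambda>y. ln (1 + y) - ln (1 - y) - 2 * y) has_real_derivative 1 / (1 + x) + 1 / (1 - x) - 2) (at x)"
        if "0 \<le> x" "x \<le> y" for x
        using that y by (auto intro!: derivative_eq_intros simp: divide_inverse)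
      show "0 \<le> 1 / (1 + x) + 1 / (1 - x) - 2" if "0 \<le> x" "x \<le> y" for x
      proof -
        have "x * x < 1" using that y by (metis le_less_trans mult_less_cancel_left2 mult_nonneg_nonneg mult_right_less_imp_less not_less order_le_less)
        moreover have "1 / (1 + x) + 1 / (1 - x) = 2 / (1 - x * x)"
          using that y by (simp add: field_simps)
        moreover have "2 / 1 \<le> 2 / (1 - x * x)" using calculation by (intro divide_left_mono) auto
        ultimately show ?thesis by simp
      qed
    qed (use y in auto)
    then show ?thesis using y by (simp add: ln_div)
  qed
  also have "(1 + y) / (1 - y) = real (Suc n) / real n"
  proof -
    have "1 + y = 2 * real (Suc n) / (2 * real n + 1)" "1 - y = 2 * real n / (2 * real n + 1)"
      by (simp_all add: y_def divide_simps)
    then have "(1 + y) / (1 - y) = 2 * real (Suc n) / (2 * real n)" by simp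
    then show ?thesis by (simp only: mult_divide_mult_cancel_left_if) simp
  qed
  finally have "y \<le> (ln (real (Suc n)) - ln (real n)) / 2" using n by (simp add: ln_div)
  moreover have "odd_harmonic (Suc n) = odd_harmonic n + y" by (simp add: odd_harmonic_def y_def)
  ultimately show ?case using step by simp
qed simp

text \<open>The block sum is 1 / 3 for m = 1 and increases with m: one step adds 1 / (2 x - 1) + 1 /
  (2 x + 1) - 1 / x with x = 2 m + 1, which is positive by convexity of the reciprocal.\<close>

lemma odd_harmonic_block_ge:
  assumes "1 \<le> m"
  shows "1 / 3 \<le> (\<Sum>i=m+1..2*m. 1 / (2 * real i - 1))"
proof -
  have split: "(\<Sum>i=m+1..2*m. 1 / (2 * real i - 1)) = odd_harmonic (2 * m) - odd_harmonic m" for m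
    unfolding odd_harmonic_def mult_2 by (subst sum.ub_add_nat) simp_all
  show ?thesis
    unfolding split using assms
  proof (induction m rule: dec_induct)
    case base
    show ?case by (simp add: odd_harmonic_def numeral_2_eq_2)
  next
    case (step m)
    define x where "x = 2 * real m + 1"
    have x: "1 < x" using step by (simp add: x_def)
    have "odd_harmonic (2 * Suc m) - odd_harmonic (Suc m)
      = odd_harmonic (2 * m) - odd_harmonic m + (1 / (2 * x - 1) + 1 / (2 * x + 1) - 1 / x)"
      by (simp add: odd_harmonic_def x_def algebra_simps)
    moreover have "1 / (2 * x - 1) + 1 / (2 * x + 1) - 1 / x = 1 / (x * (2 * x - 1) * (2 * x + 1))"
    proof -
      have "x \<noteq> 0" "2 * x - 1 \<noteq> 0" "2 * x + 1 \<noteq> 0" using x by auto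
      then show ?thesis by (simp add: divide_simps) (simp add: algebra_simps)
    qed
    moreover have "0 \<le> 1 / (x * (2 * x - 1) * (2 * x + 1))" using x by simp
    ultimately show ?case using step by linarith
  qed
qed

lemma cos_diff_half_angles:
  fixes a b :: real
  shows "cos a - cos b = 2 * sin ((b - a) / 2) * sin ((b + a) / 2)"
proof -
  define x where "x = (b - a) / 2"
  define y where "y = (b + a) / 2"
  have a: "a = y - x" and b: "b = y + x" by (simp_all add: x_def y_def field_simps)
  show ?thesis unfolding x_def[symmetric] y_def[symmetric] unfolding a b
    by (simp add: cos_add cos_diff)
qed

lemma sin_div_cos_diff:
  fixes a b :: real
  assumes "0 < a" "a < b" "b < pi"
  shows "sin b / \<bar>cos a - cos b\<bar> = (cot ((b - a) / 2) + cot ((b + a) / 2)) / 2"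
    and "sin a / \<bar>cos b - cos a\<bar> = (cot ((b - a) / 2) - cot ((b + a) / 2)) / 2"
proof -
  define x where "x = (b - a) / 2"
  define y where "y = (b + a) / 2"
  have a: "a = y - x" and b: "b = y + x" by (simp_all add: x_def y_def field_simps)
  have s: "0 < sin x" "0 < sin y" using assms by (auto intro!: sin_gt_zero simp: x_def y_def)
  have c: "cos a - cos b = 2 * sin x * sin y"
    using cos_diff_half_angles[of a b] by (simp add: x_def y_def)
  then have "\<bar>cos a - cos b\<bar> = 2 * sin x * sin y" "\<bar>cos b - cos a\<bar> = 2 * sin x * sin y"
    using s by (auto simp: abs_mult abs_minus_commute)
  then show "sin b / \<bar>cos a - cos b\<bar> = (cot ((b - a) / 2) + cot ((b + a) / 2)) / 2"
    "sin a / \<bar>cos b - cos a\<bar> = (cot ((b - a) / 2) - cot ((b + a) / 2)) / 2"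
    unfolding x_def[symmetric] y_def[symmetric] using s
    by (simp_all add: b a cot_def sin_add sin_diff field_simps)
qed

text \<open>Half of \<open>cheb_angle n (i - 1)\<close>. Writing differences of cosines as products
  halves the angles, and counting from 1 makes these the odd multiples of \<pi> / (4 n).\<close>

definition half_angle :: "nat \<Rightarrow> nat \<Rightarrow> real" where
  "half_angle n i = (2 * real i - 1) * pi / (4 * real n)"

text \<open>\<theta> lies between the node angles with indices m - 1 and m, and \<sigma> / n is its
  signed distance from their midpoint m \<pi> / n. Half sums and half differences of \<theta> and
  the node angles are then half angles shifted by d, and a node contributes a sum or a difference of
  two cotangents according to its side of \<theta>.\<close>

lemma cheb_lebesgue_cot:
  fixes n m :: nat and \<sigma> \<theta> :: real
  defines "d \<equiv> \<sigma> / (2 * real n)"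
  assumes m: "1 \<le> m" "2 * m \<le> n" and \<sigma>: "\<bar>\<sigma>\<bar> < pi / 2" and \<theta>: "\<theta> = (real m * pi + \<sigma>) / real n"
  shows "(\<Sum>k<n. sin (cheb_angle n k) / \<bar>cos \<theta> - cos (cheb_angle n k)\<bar>) =
    (\<Sum>i=1..n. (if i \<le> n - m then cot (half_angle n i - d) else - cot (half_angle n i - d)) +
       (if m < i \<and> i \<le> 2 * m then - cot (half_angle n i + d) else cot (half_angle n i + d))) / 2"
proof -
  define cm where "cm i = cot (half_angle n i - d)" for i
  define cp where "cp i = cot (half_angle n i + d)" for i
  have n: "0 < real n" using m by simp
  have \<theta>_pos: "0 < \<theta>"
  proof -
    have "1 * pi \<le> real m * pi" using m by (intro mult_right_mono) auto
    then show ?thesis using \<sigma> n pi_gt_zero unfolding \<theta> by (intro divide_pos_pos) linarith+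
  qed
  have \<theta>_less: "\<theta> < pi"
  proof -
    have "real m * pi \<le> (real n / 2) * pi" using m by (intro mult_right_mono) auto
    moreover have "1 * pi \<le> (real n / 2) * pi" using m by (intro mult_right_mono) auto
    moreover have "real n * pi = (real n / 2) * pi + (real n / 2) * pi" by simp
    moreover have "\<sigma> < pi" using \<sigma> pi_gt_zero by linarith
    ultimately have "real m * pi + \<sigma> < real n * pi" by linarith
    then show ?thesis using n by (simp add: \<theta> field_simps)
  qed
  have ca: "cheb_angle n k = ((2 * real k + 1) * pi / 2) / real n" for k by (simp add: cheb_angle_def)
  have low: "sin (cheb_angle n k) / \<bar>cos \<theta> - cos (cheb_angle n k)\<bar> = (cp (m - k) - cp (m + k + 1)) / 2"
    if k: "k < m" for k
  proof -
    have h1: "cheb_angle n k < \<theta>"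
    proof -
      have "(real k + 1) * pi \<le> real m * pi" using k by (intro mult_right_mono) auto
      then have "(2 * real k + 1) * pi / 2 < real m * pi + \<sigma>" using \<sigma> by (simp add: algebra_simps)
      then show ?thesis unfolding ca \<theta> using n by (rule divide_strict_right_mono)
    qed
    have h2: "0 < cheb_angle n k" using cheb_angle_bounds[of k n] k m by simp
    have h3: "(\<theta> - cheb_angle n k) / 2 = half_angle n (m - k) + d"
      using n k by (simp add: \<theta> cheb_angle_def half_angle_def d_def of_nat_diff field_simps)
    have h4: "(\<theta> + cheb_angle n k) / 2 = half_angle n (m + k + 1) + d"
      using n k by (simp add: \<theta> cheb_angle_def half_angle_def d_def field_simps)
    show ?thesis using sin_div_cos_diff(2)[OF h2 h1 \<theta>_less] unfolding h3 h4 cp_def .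
  qed
  have high: "sin (cheb_angle n k) / \<bar>cos \<theta> - cos (cheb_angle n k)\<bar> = (cm (k + 1 - m) + cp (m + k + 1)) / 2"
    if k: "m \<le> k" "k < n" for k
  proof -
    have h1: "\<theta> < cheb_angle n k"
    proof -
      have "real m * pi \<le> real k * pi" using k by (intro mult_right_mono) auto
      then have "real m * pi + \<sigma> < real k * pi + pi / 2" using \<sigma> by linarith
      also have "\<dots> = (2 * real k + 1) * pi / 2" by (simp add: algebra_simps)
      finally have "real m * pi + \<sigma> < (2 * real k + 1) * pi / 2" .
      then show ?thesis unfolding ca \<theta> using n by (rule divide_strict_right_mono)
    qed
    have h2: "cheb_angle n k < pi" using cheb_angle_bounds[of k n] k by simp
    have h3: "(cheb_angle n k - \<theta>) / 2 = half_angle n (k + 1 - m) - d"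
      using n k by (simp add: \<theta> cheb_angle_def half_angle_def d_def of_nat_diff field_simps)
    have h4: "(cheb_angle n k + \<theta>) / 2 = half_angle n (m + k + 1) + d"
      using n k by (simp add: \<theta> cheb_angle_def half_angle_def d_def field_simps)
    show ?thesis using sin_div_cos_diff(1)[OF \<theta>_pos h1 h2] unfolding h3 h4 cp_def cm_def .
  qed
  \<comment> \<open>Indices beyond n are half angles past \<pi> / 2. The reflection of x to \<pi> -
    x brings them back to the range 1 to n, with the sign of the cotangent and of the shift
    reversed.\<close>
  have refl: "cp (2 * n + 1 - i) = - cm i" if "1 \<le> i" "i \<le> n" for i
  proof -
    have r: "half_angle n (2 * n + 1 - i) + d = pi - (half_angle n i - d)"
      using n that by (simp add: half_angle_def of_nat_diff field_simps)
    show ?thesis unfolding cp_def cm_def cot_def r by simp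
  qed
  have split: "sum f {1..n} = sum f {1..k} + sum f {k + 1..n}" if "k \<le> n" for f :: "nat \<Rightarrow> real" and k
    using sum.ub_add_nat[of 1 k f "n - k"] that by simp
  have "(\<Sum>k<n. sin (cheb_angle n k) / \<bar>cos \<theta> - cos (cheb_angle n k)\<bar>) =
      (\<Sum>k<m. (cp (m - k) - cp (m + k + 1)) / 2) + (\<Sum>k=m..<n. (cm (k + 1 - m) + cp (m + k + 1)) / 2)"
  proof -
    have cat: "sum g {..<n} = sum g {..<m} + sum g {m..<n}" for g :: "nat \<Rightarrow> real"
      using sum.atLeastLessThan_concat[of 0 m n g] m by (simp add: lessThan_atLeast0)
    show ?thesis unfolding cat
      by (intro arg_cong2[where f = "(+)"] sum.cong) (simp_all only: low high atLeastLessThan_iff lessThan_iff)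
  qed
  also have "\<dots> = (((\<Sum>k<m. cp (m - k)) - (\<Sum>k<m. cp (m + k + 1))) +
      ((\<Sum>k=m..<n. cm (k + 1 - m)) + (\<Sum>k=m..<n. cp (m + k + 1)))) / 2"
    by (simp add: sum.distrib sum_subtractf flip: sum_divide_distrib add_divide_distrib)
  also have "(\<Sum>k<m. cp (m - k)) = sum cp {1..m}"
    by (rule sum.reindex_bij_witness[of _ "\<lambda>i. m - i" "\<lambda>k. m - k"]) auto
  also have "(\<Sum>k<m. cp (m + k + 1)) = sum cp {m + 1..2 * m}"
    by (rule sum.reindex_bij_witness[of _ "\<lambda>i. i - (m + 1)" "\<lambda>k. m + k + 1"]) auto
  also have "(\<Sum>k=m..<n. cm (k + 1 - m)) = sum cm {1..n - m}"
    by (rule sum.reindex_bij_witness[of _ "\<lambda>i. i + m - 1" "\<lambda>k. k + 1 - m"]) auto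
  also have "(\<Sum>k=m..<n. cp (m + k + 1)) = sum cp {2 * m + 1..n + m}"
    by (rule sum.reindex_bij_witness[of _ "\<lambda>i. i - (m + 1)" "\<lambda>k. m + k + 1"]) auto
  also have "sum cp {2 * m + 1..n + m} = sum cp {2 * m + 1..n} + sum cp {n + 1..n + m}"
    using m by (intro sum.ub_add_nat) auto
  also have "sum cp {n + 1..n + m} = (\<Sum>i=n - m + 1..n. - cm i)"
  proof (rule sum.reindex_bij_witness[of _ "\<lambda>i. 2 * n + 1 - i" "\<lambda>i. 2 * n + 1 - i"])
    fix j assume "j \<in> {n + 1..n + m}"
    then have j: "1 \<le> 2 * n + 1 - j" "2 * n + 1 - j \<le> n" "2 * n + 1 - (2 * n + 1 - j) = j"
      using m by auto
    show "- cm (2 * n + 1 - j) = cp j" using refl[OF j(1,2)] unfolding j(3) by simp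
  qed (use m in auto)
  also have "(sum cp {1..m} - sum cp {m + 1..2 * m}) +
      (sum cm {1..n - m} + (sum cp {2 * m + 1..n} + (\<Sum>i=n - m + 1..n. - cm i))) =
      (\<Sum>i=1..n. (if i \<le> n - m then cm i else - cm i)) +
      (\<Sum>i=1..n. (if m < i \<and> i \<le> 2 * m then - cp i else cp i))"
  proof -
    have "(\<Sum>i=1..n. (if i \<le> n - m then cm i else - cm i)) = sum cm {1..n - m} + (\<Sum>i=n - m + 1..n. - cm i)"
      by (subst split[of "n - m"]) auto
    moreover have "(\<Sum>i=1..n. (if m < i \<and> i \<le> 2 * m then - cp i else cp i)) =
        sum cp {1..m} + ((\<Sum>i=m + 1..2 * m. - cp i) + sum cp {2 * m + 1..n})"
    proof -
      have "sum f {1..n} = sum f {1..m} + (sum f {m + 1..2 * m} + sum f {2 * m + 1..n})"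
        for f :: "nat \<Rightarrow> real"
        using sum.ub_add_nat[of "m + 1" "2 * m" f "n - 2 * m"] m by (subst split[of m]) auto
      note this[of "\<lambda>i. if m < i \<and> i \<le> 2 * m then - cp i else cp i"]
      then show ?thesis by simp
    qed
    ultimately show ?thesis by (simp add: sum_negf)
  qed
  finally show ?thesis unfolding cm_def cp_def by (simp add: sum.distrib)
qed

text \<open>cot (a - d) + cot (a + d) is sin (2 a) / (sin^2 a - sin^2 d), and the factor cos
  \<sigma> compensates for the smaller denominator. The difference of the two is compared with the
  drop of cot over the whole cell from a - e to a + e, so that these terms telescope. The constant
  605 / 1500 is the 0.605 of \<open>abs_mult_cos_le\<close> divided by 3 / 2, a lower bound for n
  sin (2 e).\<close>

lemma half_angle_cot_bounds:
  fixes n i :: nat and \<sigma> :: real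
  defines "d \<equiv> \<sigma> / (2 * real n)" and "e \<equiv> pi / (4 * real n)" and "a \<equiv> half_angle n i"
  assumes n: "3 \<le> n" and i: "1 \<le> i" "i \<le> n" and \<sigma>: "\<bar>\<sigma>\<bar> < pi / 2"
  shows "0 < cot a" "0 < cot (a - d)" "0 < cot (a + d)"
    and "cos \<sigma> * (cot (a - d) + cot (a + d)) \<le> 2 * cot a"
    and "2 \<le> i \<Longrightarrow> cos \<sigma> * \<bar>cot (a - d) - cot (a + d)\<bar> \<le> 605 / 1500 *
      (cot (real (i - 1) * pi / (2 * real n)) - cot (real i * pi / (2 * real n)))"
proof -
  have e0: "0 < e" using n by (simp add: e_def)
  have de: "\<bar>d\<bar> < e" using n \<sigma> by (simp add: d_def e_def abs_divide field_simps)
  have a: "e \<le> a" "a \<le> pi / 2 - e"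
  proof -
    have "1 * pi \<le> (2 * real i - 1) * pi" using i by (intro mult_right_mono) auto
    then show "e \<le> a" using n by (simp add: a_def e_def half_angle_def divide_right_mono)
    have "(2 * real i - 1) * pi \<le> (2 * real n - 1) * pi" using i by (intro mult_right_mono) auto
    then have "a \<le> (2 * real n - 1) * pi / (4 * real n)"
      by (simp add: a_def half_angle_def divide_right_mono)
    also have "\<dots> = pi / 2 - e" using n by (simp add: e_def field_simps)
    finally show "a \<le> pi / 2 - e" .
  qed
  have pos: "0 < cot x" if "0 < x" "x < pi / 2" for x :: real
    using that by (simp add: cot_def sin_gt_zero cos_gt_zero)
  show "0 < cot a" "0 < cot (a - d)" "0 < cot (a + d)" using a de e0 by (auto intro!: pos)
  have sad: "0 < sin (a - d)" "0 < sin (a + d)" using a de e0 by (auto intro!: sin_gt_zero)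
  have sa: "0 < sin a" using a e0 by (auto intro!: sin_gt_zero)
  have den: "0 < (sin a)\<^sup>2 - (sin d)\<^sup>2" unfolding sin_add_mult_sin_diff[symmetric] using sad by simp
  have c\<sigma>: "0 < cos \<sigma>" using \<sigma> by (intro cos_gt_zero_pi) auto
  have s2a: "0 < sin (2 * a)" using a e0 by (intro sin_gt_zero) auto
  \<comment> \<open>Since n e = \<pi> / 4 and n |d| = |\<sigma>| / 2, the decreasing quotient of
    sines gives sin^2 d <= (1 - cos \<sigma>) sin^2 e, and e <= a.\<close>
  have key: "cos \<sigma> * (sin a)\<^sup>2 \<le> (sin a)\<^sup>2 - (sin d)\<^sup>2"
  proof -
    have ne: "real n * e = pi / 4" using n by (simp add: e_def)
    have "sin (real n * e) * sin \<bar>d\<bar> \<le> sin (real n * \<bar>d\<bar>) * sin e"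
      using de ne a e0 by (intro sin_mult_ratio_antimono) auto
    moreover have "real n * \<bar>d\<bar> = \<bar>\<sigma>\<bar> / 2" using n by (simp add: d_def abs_divide)
    ultimately have "sin (pi / 4) * sin \<bar>d\<bar> \<le> sin (\<bar>\<sigma>\<bar> / 2) * sin e" by (simp only: ne)
    moreover have "0 \<le> sin \<bar>d\<bar>" using de a e0 by (intro sin_ge_zero) auto
    ultimately have "(sin (pi / 4) * sin \<bar>d\<bar>)\<^sup>2 \<le> (sin (\<bar>\<sigma>\<bar> / 2) * sin e)\<^sup>2"
      by (intro power_mono) (auto simp: sin_45)
    moreover have "(sin \<bar>d\<bar>)\<^sup>2 = (sin d)\<^sup>2" by (cases "d < 0") simp_all
    moreover have "(sin (\<bar>\<sigma>\<bar> / 2))\<^sup>2 = (1 - cos \<sigma>) / 2"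
      using cos_double_sin[of "\<bar>\<sigma>\<bar> / 2"] by (cases "\<sigma> < 0") simp_all
    ultimately have "(sin d)\<^sup>2 \<le> (1 - cos \<sigma>) * (sin e)\<^sup>2"
      by (simp add: power_mult_distrib sin_45 power_divide)
    also have "\<dots> \<le> (1 - cos \<sigma>) * (sin a)\<^sup>2"
    proof -
      have "sin e \<le> sin a" using a e0 by (intro sin_monotone_2pi_le) auto
      moreover have "0 \<le> sin e" using a e0 by (intro sin_ge_zero) auto
      ultimately show ?thesis by (intro mult_left_mono power_mono) auto
    qed
    finally show ?thesis by (simp add: algebra_simps)
  qed
  show "cos \<sigma> * (cot (a - d) + cot (a + d)) \<le> 2 * cot a"
  proof -
    have "cos \<sigma> * (cot (a - d) + cot (a + d)) = sin (2 * a) * (cos \<sigma> / ((sin a)\<^sup>2 - (sin d)\<^sup>2))"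
      unfolding cot_diff_add_cot_add(1)[OF sad] by simp
    also have "\<dots> \<le> sin (2 * a) * (1 / (sin a)\<^sup>2)"
      using key den s2a sa by (intro mult_left_mono) (auto simp: field_simps)
    also have "\<dots> = 2 * cot a" using sa by (simp add: sin_double cot_def power2_eq_square)
    finally show ?thesis .
  qed
  assume i2: "2 \<le> i"
  have ae: "3 * e \<le> a"
  proof -
    have "3 * pi \<le> (2 * real i - 1) * pi" using i2 by (intro mult_right_mono) auto
    then have "3 * pi / (4 * real n) \<le> (2 * real i - 1) * pi / (4 * real n)" by (intro divide_right_mono) auto
    then show ?thesis by (simp add: a_def e_def half_angle_def)
  qed
  have sae: "0 < sin (a - e)" "0 < sin (a + e)" using a ae e0 by (auto intro!: sin_gt_zero)
  have dene: "0 < (sin a)\<^sup>2 - (sin e)\<^sup>2" unfolding sin_add_mult_sin_diff[symmetric] using sae by simp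
  have ends: "a - e = real (i - 1) * pi / (2 * real n)" "a + e = real i * pi / (2 * real n)"
    using n i by (simp_all add: a_def e_def half_angle_def of_nat_diff field_simps)
  have s2e: "3 / (2 * real n) \<le> sin (2 * e)"
  proof -
    have "3 / real n * sin (pi / 6) \<le> sin (3 / real n * (pi / 6))" using n by (intro sin_mult_ge) auto
    moreover have "3 / real n * (pi / 6) = 2 * e" by (simp add: e_def)
    ultimately show ?thesis by (simp add: sin_30)
  qed
  have "cos \<sigma> * \<bar>cot (a - d) - cot (a + d)\<bar> = cos \<sigma> * \<bar>sin (2 * d)\<bar> / ((sin a)\<^sup>2 - (sin d)\<^sup>2)"
    unfolding cot_diff_add_cot_add(2)[OF sad] using den by (simp add: abs_divide)
  also have "\<dots> \<le> (605 / 1500 * sin (2 * e)) / ((sin a)\<^sup>2 - (sin e)\<^sup>2)"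
  proof (rule frac_le)
    have "cos \<sigma> * \<bar>sin (2 * d)\<bar> \<le> cos \<sigma> * \<bar>2 * d\<bar>"
      using c\<sigma> abs_sin_x_le_abs_x[of "2 * d"] by (intro mult_left_mono) auto
    also have "\<dots> = \<bar>\<sigma>\<bar> * cos \<sigma> / real n" using n by (simp add: d_def abs_divide)
    also have "\<dots> \<le> (605 / 1000) / real n"
      using abs_mult_cos_le[of \<sigma>] \<sigma> by (intro divide_right_mono) auto
    also have "\<dots> = 605 / 1500 * (3 / (2 * real n))" by simp
    also have "\<dots> \<le> 605 / 1500 * sin (2 * e)" using s2e by (intro mult_left_mono) auto
    finally show "cos \<sigma> * \<bar>sin (2 * d)\<bar> \<le> 605 / 1500 * sin (2 * e)" .
    show "0 \<le> 605 / 1500 * sin (2 * e)" using s2e n by (smt (verit) divide_nonneg_nonneg mult_nonneg_nonneg of_nat_0_le_iff)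
    show "0 < (sin a)\<^sup>2 - (sin e)\<^sup>2" by (rule dene)
    have "\<bar>sin d\<bar> \<le> \<bar>sin e\<bar>"
    proof -
      have "sin \<bar>d\<bar> \<le> sin e" using de a e0 by (intro sin_monotone_2pi_le) auto
      moreover have "0 \<le> sin \<bar>d\<bar>" using de a e0 by (intro sin_ge_zero) auto
      ultimately show ?thesis by (cases "d < 0") auto
    qed
    then show "(sin a)\<^sup>2 - (sin e)\<^sup>2 \<le> (sin a)\<^sup>2 - (sin d)\<^sup>2" by (simp add: abs_le_square_iff)
  qed
  also have "\<dots> = 605 / 1500 * (cot (a - e) - cot (a + e))"
    unfolding cot_diff_add_cot_add(2)[OF sae] by simp
  finally show "cos \<sigma> * \<bar>cot (a - d) - cot (a + d)\<bar> \<le> 605 / 1500 *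
      (cot (real (i - 1) * pi / (2 * real n)) - cot (real i * pi / (2 * real n)))"
    by (simp add: ends)
qed

text \<open>\<open>cot_le\<close> is summed over the half angles: the reciprocals give an odd
  harmonic sum, and the linear terms give k^2, the sum of the first k odd numbers.\<close>

lemma sum_cot_half_angle_le:
  assumes "0 < n" and k: "k \<le> n"
  shows "(\<Sum>i=1..k. cot (half_angle n i)) / real n \<le> 4 / pi * odd_harmonic k - pi / 12 * (real k / real n)\<^sup>2"
proof -
  define C where "C = (\<lambda>i. cot (half_angle n i))"
  have n0: "0 < real n" using assms by simp
  have lin: "(\<Sum>i\<in>A. u * f i - v * g i) = u * sum f A - v * sum g A"
    for A :: "nat set" and f g :: "nat \<Rightarrow> real" and u v
    by (simp add: sum_subtractf sum_distrib_left)
  have "sum C {1..k} \<le> (\<Sum>i=1..k. 4 * real n / pi * (1 / (2 * real i - 1)) - pi / (12 * real n) * (2 * real i - 1))"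
  proof (rule sum_mono)
    fix i assume i: "i \<in> {1..k}"
    define a where "a = half_angle n i"
    have a0: "0 < a" using i n0 by (simp add: a_def half_angle_def)
    have "(2 * real i - 1) * pi < (2 * real n) * pi" using i k by (intro mult_strict_right_mono) auto
    then have "a < pi / 2" using n0 by (simp add: a_def half_angle_def field_simps)
    from cot_le[OF a0 this] have "C i \<le> 1 / a - a / 3" by (simp add: C_def a_def)
    also have "1 / a = 4 * real n / pi * (1 / (2 * real i - 1))" by (simp add: a_def half_angle_def)
    also have "a / 3 = pi / (12 * real n) * (2 * real i - 1)" by (simp add: a_def half_angle_def)
    finally show "C i \<le> 4 * real n / pi * (1 / (2 * real i - 1)) - pi / (12 * real n) * (2 * real i - 1)" .
  qed
  also have "\<dots> = 4 * real n / pi * odd_harmonic k - pi / (12 * real n) * (\<Sum>i=1..k. 2 * real i - 1)"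
    unfolding odd_harmonic_def by (rule lin)
  also have "(\<Sum>i=1..k. 2 * real i - 1) = (real k)\<^sup>2"
    by (induction k) (simp_all add: power2_eq_square algebra_simps)
  finally have "sum C {1..k} / real n \<le> (4 * real n / pi * odd_harmonic k - pi / (12 * real n) * (real k)\<^sup>2) / real n"
    by (intro divide_right_mono) auto
  also have "\<dots> = 4 / pi * odd_harmonic k - pi / 12 * (real k / real n)\<^sup>2"
    using n0 by (simp add: field_simps power2_eq_square)
  finally show ?thesis by (simp only: C_def)
qed

text \<open>The condition 3 m <= n keeps the half angles up to index 2 m at most \<pi> / 3, the
  range of \<open>cot_ge\<close>. The bound is independent of m because the block of odd reciprocals
  is at least 1 / 3 and m / n is at most 1 / 3.\<close>

lemma sum_cot_half_angle_block_ge: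
  assumes m: "1 \<le> m" and True: "3 * m \<le> n"
  shows "4 / pi * (1 / 3) - 37 / 100 * (pi / 4) * (1 / 3) \<le> (\<Sum>i=m + 1..2 * m. cot (half_angle n i)) / real n"
proof -
  define C where "C = (\<lambda>i. cot (half_angle n i))"
  have n0: "0 < real n" using assms by simp
  have x: "real m / real n \<le> 1 / 3" using True n0 by (simp add: field_simps)
  have lin: "(\<Sum>i\<in>A. u * f i - v * g i) = u * sum f A - v * sum g A"
    for A :: "nat set" and f g :: "nat \<Rightarrow> real" and u v
    by (simp add: sum_subtractf sum_distrib_left)
  have s1: "(\<Sum>i=m + 1..2 * m. 4 * real n / pi * (1 / (2 * real i - 1)) - 37 * pi / (400 * real n) * (2 * real i - 1))
      \<le> sum C {m + 1..2 * m}"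
  proof (rule sum_mono)
    fix i assume i: "i \<in> {m + 1..2 * m}"
    define a where "a = half_angle n i"
    have a0: "0 < a" using i n0 by (simp add: a_def half_angle_def)
    have "(2 * real i - 1) * pi \<le> (4 * real n / 3) * pi" using i True by (intro mult_right_mono) auto
    then have "a \<le> pi / 3" using n0 by (simp add: a_def half_angle_def field_simps)
    from cot_ge[OF a0 this] have "1 / a - 37 / 100 * a \<le> C i" by (simp add: C_def a_def)
    moreover have "1 / a = 4 * real n / pi * (1 / (2 * real i - 1))" by (simp add: a_def half_angle_def)
    moreover have "37 / 100 * a = 37 * pi / (400 * real n) * (2 * real i - 1)"
      by (simp add: a_def half_angle_def)
    ultimately show "4 * real n / pi * (1 / (2 * real i - 1)) - 37 * pi / (400 * real n) * (2 * real i - 1) \<le> C i"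
      by simp
  qed
  have s2: "(\<Sum>i=m + 1..2 * m. 4 * real n / pi * (1 / (2 * real i - 1)) - 37 * pi / (400 * real n) * (2 * real i - 1))
    = 4 * real n / pi * (\<Sum>i=m + 1..2 * m. 1 / (2 * real i - 1)) - 37 * pi / (400 * real n) * (\<Sum>i=m + 1..2 * m. 2 * real i - 1)"
    by (rule lin)
  have s3: "(\<Sum>i=m + 1..2 * m. 2 * real i - 1) = 3 * (real m)\<^sup>2"
  proof -
    have sq: "(\<Sum>i=1..k. 2 * real i - 1) = (real k)\<^sup>2" for k
      by (induction k) (simp_all add: power2_eq_square algebra_simps)
    have "(\<Sum>i=1..2 * m. 2 * real i - 1) = (\<Sum>i=1..m. 2 * real i - 1) + (\<Sum>i=m + 1..2 * m. 2 * real i - 1)"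
      unfolding mult_2[of m] by (rule sum.ub_add_nat) simp
    then show ?thesis unfolding sq by (simp add: power2_eq_square)
  qed
  have s4: "4 * real n / pi * (1 / 3) \<le> 4 * real n / pi * (\<Sum>i=m + 1..2 * m. 1 / (2 * real i - 1))"
    using odd_harmonic_block_ge[OF m] n0 by (intro mult_left_mono) auto
  have "4 * real n / pi * (1 / 3) - 37 * pi / (400 * real n) * (3 * (real m)\<^sup>2) \<le> sum C {m + 1..2 * m}"
    using s1 s4 unfolding s2 s3 by linarith
  then have "(4 * real n / pi * (1 / 3) - 37 * pi / (400 * real n) * (3 * (real m)\<^sup>2)) / real n \<le> sum C {m + 1..2 * m} / real n"
    by (intro divide_right_mono) auto
  moreover have "(4 * real n / pi * (1 / 3) - 37 * pi / (400 * real n) * (3 * (real m)\<^sup>2)) / real n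
     = 4 / pi * (1 / 3) - 37 / 100 * (pi / 4) * (3 * (real m / real n)\<^sup>2)"
    using n0 by (simp add: field_simps power2_eq_square)
  moreover have "37 / 100 * (pi / 4) * (3 * (real m / real n)\<^sup>2) \<le> 37 / 100 * (pi / 4) * (1 / 3)"
  proof -
    have "(real m / real n)\<^sup>2 \<le> (1 / 3)\<^sup>2" using x by (intro power_mono) auto
    moreover have "(1 / 3 :: real)\<^sup>2 = 1 / 9" by (simp add: power2_eq_square)
    ultimately have "3 * (real m / real n)\<^sup>2 \<le> 1 / 3" by linarith
    then show ?thesis by (intro mult_left_mono) auto
  qed
  ultimately show ?thesis unfolding C_def by linarith
qed

text \<open>The difference is cot x - cot (2 x) = 1 / sin (2 x). As 2 x <= \<pi> / 3, concavity
  gives n sin (2 x) >= 3 m sqrt 3 / 2 >= 2.598, whose reciprocal is below 0.385.\<close>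

lemma cot_half_diff_le:
  assumes m: "1 \<le> m" and True: "3 * m \<le> n"
  shows "(cot (real m * pi / (2 * real n)) - cot (real (2 * m) * pi / (2 * real n))) / real n \<le> 3850 / 10000"
proof -
  define D where "D i = cot (real i * pi / (2 * real n))" for i
  have n0: "0 < real n" using assms by simp
  define x where "x = real m * pi / (2 * real n)"
  have x2: "real (2 * m) * pi / (2 * real n) = 2 * x" "2 * x = real m * pi / real n" by (simp_all add: x_def)
  have "real m * pi \<le> (real n / 3) * pi" using True by (intro mult_right_mono) auto
  then have x3: "0 < x" "2 * x \<le> pi / 3" using m n0 by (simp_all add: x_def field_simps)
  then have sx: "0 < sin x" "0 < sin (2 * x)" using pi_gt_zero by (auto intro!: sin_gt_zero)
  have "D m - D (2 * m) = cot x - cot (2 * x)" unfolding D_def x2(1) by (simp add: x_def)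
  also have "\<dots> = 1 / sin (2 * x)"
  proof -
    have "0 < cos x" using x3 pi_gt_zero by (intro cos_gt_zero) auto
    then show ?thesis using sx unfolding cot_def sin_double cos_double_cos
      by (simp add: field_simps power2_eq_square)
  qed
  finally have e: "(D m - D (2 * m)) / real n = 1 / (real n * sin (2 * x))" by simp
  have "3 * real m / real n * sin (pi / 3) \<le> sin (3 * real m / real n * (pi / 3))"
    using True n0 by (intro sin_mult_ge) (auto simp: field_simps)
  moreover have "3 * real m / real n * (pi / 3) = 2 * x" by (simp add: x_def)
  ultimately have "3 * real m / real n * sin (pi / 3) \<le> sin (2 * x)" by (simp only:)
  then have "3 * real m * (sqrt 3 / 2) \<le> real n * sin (2 * x)"
    using n0 by (simp add: sin_60 field_simps)
  moreover have "1.7320508 \<le> sqrt 3" by (rule real_le_rsqrt) (simp add: power2_eq_square)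
  moreover have "3 * 1 * (1.7320508 / 2) \<le> 3 * real m * (sqrt 3 / 2)"
    using m calculation by (intro mult_mono) auto
  ultimately have "2.5980 \<le> real n * sin (2 * x)" by simp
  then have "1 / (real n * sin (2 * x)) \<le> 1 / 2.5980" by (intro divide_left_mono) auto
  then have "(D m - D (2 * m)) / real n \<le> 3850 / 10000" unfolding e by simp
  then show ?thesis unfolding D_def .
qed

text \<open>This is cot x - tan x = 2 cot (2 x) at x = m \<pi> / (2 n); the index n contributes cot
  (\<pi> / 2) = 0.\<close>

lemma cot_half_telescope:
  assumes "1 \<le> m" "2 * m \<le> n"
  defines "D \<equiv> \<lambda>i. cot (real i * pi / (2 * real n))"
  shows "D m - D (n - m) + (D (2 * m) - D n) = 3 * cot (real m * pi / real n)"
proof -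
  note m = assms(1,2)
  have n0: "0 < real n" using m by simp
  define x where "x = real m * pi / (2 * real n)"
  have "real m * pi \<le> (real n / 2) * pi" using m by (intro mult_right_mono) auto
  then have x: "0 < x" "x < pi / 2" using m n0 pi_gt_zero by (simp_all add: x_def field_simps)
  then have sx: "0 < sin x" "0 < cos x" by (auto intro!: sin_gt_zero cos_gt_zero)
  have "real (n - m) * pi / (2 * real n) = pi / 2 - x" "real (2 * m) * pi / (2 * real n) = 2 * x"
    "real n * pi / (2 * real n) = pi / 2" "real m * pi / real n = 2 * x"
    using m n0 by (simp_all add: x_def of_nat_diff field_simps)
  moreover have "cot (pi / 2 - x) = sin x / cos x" by (simp add: cot_def cos_diff sin_diff)
  moreover have "cot x - sin x / cos x = 2 * cot (2 * x)"
    using sx unfolding cot_def sin_double cos_double by (simp add: field_simps power2_eq_square)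
  ultimately show ?thesis by (simp add: D_def x_def[symmetric] cot_def)
qed

text \<open>Near \<pi> / 2 the cotangent is the tangent of the small complementary angle. The bound
  y <= 1 / 6 keeps its cosine above sqrt 3 / 2, and 3.628 rounds up 2 \<pi> / sqrt 3.\<close>

lemma cot_near_half_pi_le:
  fixes y :: real
  assumes y: "0 \<le> y" "y \<le> 1 / 6"
  shows "cot (pi / 2 - pi * y) \<le> 3.628 * y"
proof -
  have "cot (pi / 2 - pi * y) = sin (pi * y) / cos (pi * y)"
    by (simp add: cot_def cos_diff sin_diff)
  also have "\<dots> \<le> (pi * y) / (sqrt 3 / 2)"
  proof (rule frac_le)
    show "0 \<le> pi * y" using y by simp
    show "sin (pi * y) \<le> pi * y" using y by (intro sin_x_le_x) auto
    show "0 < sqrt 3 / 2" by simp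
    have "cos (pi / 6) \<le> cos (pi * y)" using y by (intro cos_monotone_0_pi_le) auto
    then show "sqrt 3 / 2 \<le> cos (pi * y)" by (simp add: cos_30)
  qed
  also have "\<dots> \<le> 3.628 * y"
  proof -
    have "1.73205 \<le> sqrt 3" by (rule real_le_rsqrt) (simp add: power2_eq_square)
    then have "pi / (sqrt 3 / 2) \<le> 3.14160 / (1.73205 / 2)" using pi_approx by (intro frac_le) auto
    then have "pi / (sqrt 3 / 2) \<le> 3.628" by simp
    from mult_right_mono[OF this y(1)] show ?thesis by simp
  qed
  finally show ?thesis .
qed

text \<open>These margins yield the constant 3 / 4 of \<open>psi\<close>: the first in the case 3 m
  <= n, the other two for n / 3 < m <= n / 2. Here 6 / 5 is \<open>odd_harmonic 3\<close> minus the
  1 / 3 of the removed block, 4 / 3 is \<open>odd_harmonic 2\<close>, and 0.54875 rounds up 0.605 *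
  3.628 / 4.\<close>

lemma lebesgue_numeric_bounds:
  shows "4 / pi * (6 / 5 - ln 3 / 2) - pi / 12 * (1 - 37 / 100) + 605 / 3000 * (3850 / 10000) \<le> 3 / 4"
    and "4 / pi * (4 / 3 - ln 2) - pi / 48 \<le> 3 / 4"
    and "0.54875 + pi / 12 - 4 / pi \<le> 0"
proof -
  have p: "314159 / 100000 \<le> pi" using pi_approx by simp
  have l3: "1.0985 \<le> ln (3 :: real)"
    using ln_approx_bounds[of 3 6] by (simp add: eval_nat_numeral)
  have "4 / pi * (6 / 5 - ln 3 / 2) \<le> 4 / 3.14159 * (6 / 5 - 1.0985 / 2)"
    using pi_approx l3 ln_le_minus_one[of "3 :: real"] by (intro mult_mono divide_left_mono) auto
  also have "\<dots> \<le> 8287 / 10000" by simp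
  finally have *: "4 / pi * (6 / 5 - ln 3 / 2) \<le> 8287 / 10000" .
  have "X - pi / 12 * (1 - 37 / 100) + 605 / 3000 * (3850 / 10000) \<le> 3 / 4"
    if "X \<le> 8287 / 10000" for X :: real using that p by simp
  from this[OF *] show "4 / pi * (6 / 5 - ln 3 / 2) - pi / 12 * (1 - 37 / 100) + 605 / 3000 * (3850 / 10000) \<le> 3 / 4"
    .
  have l2: "0.6931 \<le> ln (2 :: real)"
    using ln_approx_bounds[of 2 5] by (simp add: eval_nat_numeral)
  have "4 / pi * (4 / 3 - ln 2) \<le> 4 / 3.14159 * (4 / 3 - 0.6931)"
    using pi_approx l2 ln_le_minus_one[of "2 :: real"] by (intro mult_mono divide_left_mono) auto
  also have "\<dots> \<le> 81518 / 100000" by simp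
  finally have *: "4 / pi * (4 / 3 - ln 2) \<le> 81518 / 100000" .
  have "X - pi / 48 \<le> 3 / 4" if "X \<le> 81518 / 100000" for X :: real using that p by simp
  from this[OF *] show "4 / pi * (4 / 3 - ln 2) - pi / 48 \<le> 3 / 4"
    .
  have "4 / 3.1416 \<le> 4 / pi" using pi_approx by (intro divide_left_mono) auto
  moreover have "pi / 12 \<le> 3.1416 / 12" using pi_approx by simp
  ultimately show "0.54875 + pi / 12 - 4 / pi \<le> 0" by simp
qed

text \<open>The absolute values turn the Lebesgue function into a signed sum of cotangents. Pairing the terms
  symmetric about \<open>\<theta>\<close> uses \<open>cos \<sigma> (cot (a - d) + cot (a + d)) \<le> 2 cot a\<close>; the rest telescopes.\<close>

lemma cheb_lebesgue_le:
  fixes n m :: nat and \<sigma> \<theta> :: real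
  assumes n: "3 \<le> n" and m: "1 \<le> m" "2 * m \<le> n" and \<sigma>: "\<bar>\<sigma>\<bar> < pi / 2"
    and \<theta>: "\<theta> = (real m * pi + \<sigma>) / real n"
  shows "cos \<sigma> * (\<Sum>k<n. sin (cheb_angle n k) / \<bar>cos \<theta> - cos (cheb_angle n k)\<bar>) / real n
    \<le> 2 / pi * ln (real n) + 3 / 4"
proof -
  define d where "d = \<sigma> / (2 * real n)"
  define C where "C = (\<lambda>i. cot (half_angle n i))"
  define D where "D i = cot (real i * pi / (2 * real n))" for i
  define E where "E i = (if i \<le> n - m then cot (half_angle n i - d) else - cot (half_angle n i - d)) +
       (if m < i \<and> i \<le> 2 * m then - cot (half_angle n i + d) else cot (half_angle n i + d))" for i
  have n0: "0 < real n" using n by simp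
  have c\<sigma>: "0 < cos \<sigma>" using \<sigma> by (intro cos_gt_zero_pi) auto
  have bnd: "0 < C i" "0 < cot (half_angle n i - d)" "0 < cot (half_angle n i + d)"
     "cos \<sigma> * (cot (half_angle n i - d) + cot (half_angle n i + d)) \<le> 2 * C i"
    if "1 \<le> i" "i \<le> n" for i
    using half_angle_cot_bounds(1-4)[OF n that \<sigma>] by (simp_all add: C_def d_def)
  have bnd2: "cos \<sigma> * \<bar>cot (half_angle n i - d) - cot (half_angle n i + d)\<bar> \<le> 605 / 1500 * (D (i - 1) - D i)"
    if "2 \<le> i" "i \<le> n" for i
    using half_angle_cot_bounds(5)[OF n _ _ \<sigma>, of i] that by (simp add: D_def d_def)
  have tele: "(\<Sum>i=k+1..l. D (i - 1) - D i) = D k - D l" if "k \<le> l" for k l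
    using that by (induction l rule: dec_induct) auto
  have C_sum_le: "sum C {1..k} / real n \<le> 4 / pi * odd_harmonic k - pi / 12 * (real k / real n)\<^sup>2"
    if "k \<le> n" for k
    using sum_cot_half_angle_le[of n k] n that by (simp add: C_def)
  have E: "(\<Sum>k<n. sin (cheb_angle n k) / \<bar>cos \<theta> - cos (cheb_angle n k)\<bar>) = (\<Sum>i=1..n. E i) / 2"
    unfolding E_def d_def by (rule cheb_lebesgue_cot[OF m \<sigma> \<theta>])
  have split3: "sum f {1..n} = sum f {1..k} + sum f {k + 1..l} + sum f {l + 1..n}"
    if "k \<le> l" "l \<le> n" for f :: "nat \<Rightarrow> real" and k l
    using sum.ub_add_nat[of 1 k f "n - k"] sum.ub_add_nat[of "k + 1" l f "n - l"] that by simp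
  show ?thesis
  \<comment> \<open>For 3 m <= n the block m < i <= 2 m avoids the indices above n - m: its
    cotangents drop out of the main sum and the differences left in their place telescope. For
    larger m the two ranges overlap; on the overlap both cotangents carry a minus sign and can be
    discarded.\<close>
  proof (cases "3 * m \<le> n")
    case True
    have x: "real m / real n \<le> 1 / 3" using True n0 by (simp add: field_simps)
    have lowE: "cos \<sigma> * E i \<le> 2 * C i" if "i \<in> {1..n}" "\<not> (m < i \<and> i \<le> 2 * m)" for i
    proof -
      have "E i \<le> cot (half_angle n i - d) + cot (half_angle n i + d)"
        using that bnd[of i] unfolding E_def by simp
      then have "cos \<sigma> * E i \<le> cos \<sigma> * (cot (half_angle n i - d) + cot (half_angle n i + d))"
        using c\<sigma> by (intro mult_left_mono) auto
      with bnd(4)[of i] that show ?thesis by simp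
    qed
    have midE: "cos \<sigma> * E i \<le> 605 / 1500 * (D (i - 1) - D i)" if "i \<in> {m + 1..2 * m}" for i
    proof -
      have "E i = cot (half_angle n i - d) - cot (half_angle n i + d)"
        using that True unfolding E_def by auto
      then have "cos \<sigma> * E i \<le> cos \<sigma> * \<bar>cot (half_angle n i - d) - cot (half_angle n i + d)\<bar>"
        using c\<sigma> by (intro mult_left_mono) auto
      also have "\<dots> \<le> 605 / 1500 * (D (i - 1) - D i)" using that m by (intro bnd2) auto
      finally show ?thesis .
    qed
    have "cos \<sigma> * (\<Sum>i=1..n. E i) = (\<Sum>i=1..n. cos \<sigma> * E i)" by (rule sum_distrib_left)
    also have "\<dots> \<le> sum (\<lambda>i. 2 * C i) {1..m} + (\<Sum>i=m + 1..2 * m. 605 / 1500 * (D (i - 1) - D i))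
        + sum (\<lambda>i. 2 * C i) {2 * m + 1..n}"
    proof -
      have "(\<Sum>i=1..n. cos \<sigma> * E i) = (\<Sum>i=1..m. cos \<sigma> * E i) + (\<Sum>i=m + 1..2 * m. cos \<sigma> * E i)
          + (\<Sum>i=2 * m + 1..n. cos \<sigma> * E i)" by (rule split3) (use m in auto)
      also have "\<dots> \<le> sum (\<lambda>i. 2 * C i) {1..m} + (\<Sum>i=m + 1..2 * m. 605 / 1500 * (D (i - 1) - D i))
        + sum (\<lambda>i. 2 * C i) {2 * m + 1..n}"
        by (intro add_mono sum_mono midE lowE) (use m in auto)
      finally show ?thesis .
    qed
    also have "\<dots> = 2 * sum C {1..n} - 2 * sum C {m + 1..2 * m} + 605 / 1500 * (D m - D (2 * m))"
    proof -
      have t: "(\<Sum>i=m + 1..2 * m. D (i - 1) - D i) = D m - D (2 * m)" by (rule tele) simp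
      show ?thesis using m split3[of m "2 * m" C]
        unfolding sum_distrib_left[symmetric] t by linarith
    qed
    finally have main: "cos \<sigma> * (\<Sum>i=1..n. E i)
      \<le> 2 * sum C {1..n} - 2 * sum C {m + 1..2 * m} + 605 / 1500 * (D m - D (2 * m))" .
    have D_le: "(D m - D (2 * m)) / real n \<le> 3850 / 10000"
      using cot_half_diff_le[OF m(1) True] by (simp only: D_def)
    have X: "4 / pi * (1 / 3) - 37 / 100 * (pi / 4) * (1 / 3) \<le> sum C {m + 1..2 * m} / real n"
      using sum_cot_half_angle_block_ge[OF m(1) True] by (simp only: C_def)
    have "cos \<sigma> * ((\<Sum>i=1..n. E i) / 2) / real n = cos \<sigma> * (\<Sum>i=1..n. E i) / (2 * real n)" by simp
    also have "\<dots> \<le> (2 * sum C {1..n} - 2 * sum C {m + 1..2 * m} + 605 / 1500 * (D m - D (2 * m))) / (2 * real n)"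
      using main by (intro divide_right_mono) auto
    also have "\<dots> = sum C {1..n} / real n - sum C {m + 1..2 * m} / real n + 605 / 3000 * ((D m - D (2 * m)) / real n)"
      using n0 by (simp add: field_simps)
    also have "\<dots> \<le> (4 / pi * odd_harmonic n - pi / 12) - (4 / pi * (1 / 3) - 37 / 100 * (pi / 4) * (1 / 3)) + 605 / 3000 * (3850 / 10000)"
      using C_sum_le[of n] X D_le n0 by (intro add_mono diff_mono mult_left_mono) auto
    also have "\<dots> \<le> 4 / pi * (ln (real n) / 2 + (23 / 15 - ln 3 / 2)) - pi / 12 - (4 / pi * (1 / 3) - 37 / 100 * (pi / 4) * (1 / 3)) + 605 / 3000 * (3850 / 10000)"
    proof -
      have "odd_harmonic 3 = 23 / 15" by (simp add: odd_harmonic_def numeral_3_eq_3)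
      then have "4 / pi * odd_harmonic n \<le> 4 / pi * (ln (real n) / 2 + (23 / 15 - ln 3 / 2))"
        using odd_harmonic_le[of 3 n] n by (intro mult_left_mono) auto
      then show ?thesis by simp
    qed
    also have "\<dots> = 2 / pi * ln (real n) + (4 / pi * (6 / 5 - ln 3 / 2) - pi / 12 * (1 - 37 / 100) + 605 / 3000 * (3850 / 10000))"
      by (simp add: algebra_simps)
    also have "\<dots> \<le> 2 / pi * ln (real n) + 3 / 4"
    proof -
      show ?thesis using lebesgue_numeric_bounds(1) by linarith
    qed
    finally show ?thesis unfolding E .
  next
    case False
    have m2: "2 \<le> m" using False n m by auto
    have n4: "4 \<le> n" using m2 m by simp
    have E1: "cos \<sigma> * E i \<le> 2 * C i" if "i \<in> {1..m}" for i
      using that m bnd(4)[of i] by (auto simp: E_def)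
    have E2: "cos \<sigma> * E i \<le> 605 / 1500 * (D (i - 1) - D i)" if "i \<in> {m + 1..n - m}" for i
    proof -
      have "E i = cot (half_angle n i - d) - cot (half_angle n i + d)"
        using that False unfolding E_def by auto
      then have "cos \<sigma> * E i \<le> cos \<sigma> * \<bar>cot (half_angle n i - d) - cot (half_angle n i + d)\<bar>"
        using c\<sigma> by (intro mult_left_mono) auto
      also have "\<dots> \<le> 605 / 1500 * (D (i - 1) - D i)" using that m by (intro bnd2) auto
      finally show ?thesis .
    qed
    have E3: "cos \<sigma> * E i \<le> 0" if "i \<in> {n - m + 1..2 * m}" for i
    proof -
      have "E i \<le> 0" using that m bnd(2,3)[of i] unfolding E_def by auto
      then show ?thesis using c\<sigma> by (simp add: mult_nonneg_nonpos)
    qed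
    have E4: "cos \<sigma> * E i \<le> 605 / 1500 * (D (i - 1) - D i)" if "i \<in> {2 * m + 1..n}" for i
    proof -
      have "E i = - (cot (half_angle n i - d) - cot (half_angle n i + d))"
        using that False unfolding E_def by auto
      then have "cos \<sigma> * E i \<le> cos \<sigma> * \<bar>cot (half_angle n i - d) - cot (half_angle n i + d)\<bar>"
        using c\<sigma> by (intro mult_left_mono) auto
      also have "\<dots> \<le> 605 / 1500 * (D (i - 1) - D i)" using that m by (intro bnd2) auto
      finally show ?thesis .
    qed
    have "cos \<sigma> * (\<Sum>i=1..n. E i) = (\<Sum>i=1..n. cos \<sigma> * E i)" by (rule sum_distrib_left)
    also have "\<dots> = (\<Sum>i=1..m. cos \<sigma> * E i) + (\<Sum>i=m + 1..n - m. cos \<sigma> * E i)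
        + (\<Sum>i=n - m + 1..2 * m. cos \<sigma> * E i) + (\<Sum>i=2 * m + 1..n. cos \<sigma> * E i)"
      using sum.ub_add_nat[of "n - m + 1" "2 * m" "\<lambda>i. cos \<sigma> * E i" "n - 2 * m"] m False
      by (subst split3[of m "n - m"]) auto
    also have "\<dots> \<le> (\<Sum>i=1..m. 2 * C i) + (\<Sum>i=m + 1..n - m. 605 / 1500 * (D (i - 1) - D i)) + 0
        + (\<Sum>i=2 * m + 1..n. 605 / 1500 * (D (i - 1) - D i))"
      by (intro add_mono sum_mono sum_nonpos E1 E2 E3 E4)
    also have "\<dots> = 2 * sum C {1..m} + 605 / 1500 * (D m - D (n - m) + (D (2 * m) - D n))"
    proof -
      have t: "(\<Sum>i=m + 1..n - m. D (i - 1) - D i) = D m - D (n - m)"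
        "(\<Sum>i=2 * m + 1..n. D (i - 1) - D i) = D (2 * m) - D n" using m by (intro tele; simp)+
      show ?thesis unfolding sum_distrib_left[symmetric] t by (simp only: distrib_left)
    qed
    also have "D m - D (n - m) + (D (2 * m) - D n) = 3 * cot (real m * pi / real n)"
      using cot_half_telescope[OF m] by (simp only: D_def)
    finally have main: "cos \<sigma> * (\<Sum>i=1..n. E i) \<le> 2 * sum C {1..m} + 605 / 500 * cot (real m * pi / real n)"
      by simp
    \<comment> \<open>y measures how far m / n falls short of 1 / 2. Every remaining term is bounded
      by an affine function of y, and the total slope is nonpositive by the third numerical
      bound.\<close>
    define y where "y = 1 / 2 - real m / real n"
    have mn: "real m / real n = 1 / 2 - y" by (simp add: y_def)
    have y: "0 \<le> y" "y \<le> 1 / 6" using m False n0 by (simp_all add: y_def field_simps)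
    have cot_y: "cot (real m * pi / real n) \<le> 3.628 * y"
    proof -
      have "real m * pi / real n = pi / 2 - pi * y" unfolding y_def by (simp add: algebra_simps)
      then show ?thesis using cot_near_half_pi_le[OF y] by (simp only:)
    qed
    have "cos \<sigma> * ((\<Sum>i=1..n. E i) / 2) / real n = cos \<sigma> * (\<Sum>i=1..n. E i) / (2 * real n)" by simp
    also have "\<dots> \<le> (2 * sum C {1..m} + 605 / 500 * cot (real m * pi / real n)) / (2 * real n)"
      using main by (intro divide_right_mono) auto
    also have "\<dots> = sum C {1..m} / real n + 605 / 1000 * cot (real m * pi / real n) / real n"
      using n0 by (simp add: field_simps)
    also have "\<dots> \<le> (4 / pi * odd_harmonic m - pi / 12 * (real m / real n)\<^sup>2) + 605 / 1000 * (3.628 * y) / 4"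
    proof (rule add_mono)
      show "sum C {1..m} / real n \<le> 4 / pi * odd_harmonic m - pi / 12 * (real m / real n)\<^sup>2"
        using m by (intro C_sum_le) auto
      have "605 / 1000 * cot (real m * pi / real n) / real n \<le> 605 / 1000 * (3.628 * y) / real n"
        using cot_y by (intro divide_right_mono mult_left_mono) auto
      also have "\<dots> \<le> 605 / 1000 * (3.628 * y) / 4"
        using n4 y by (intro divide_left_mono) auto
      finally show "605 / 1000 * cot (real m * pi / real n) / real n \<le> 605 / 1000 * (3.628 * y) / 4" .
    qed
    also have "\<dots> \<le> (4 / pi * (ln (real n) / 2 + 4 / 3 - ln 2 - y) - pi / 12 * (1 / 4 - y)) + 0.54875 * y"
    proof -
      have "odd_harmonic 2 = 4 / 3" by (simp add: odd_harmonic_def numeral_2_eq_2)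
      then have "odd_harmonic m \<le> ln (real m) / 2 + (4 / 3 - ln 2 / 2)"
        using odd_harmonic_le[of 2 m] m2 by simp
      moreover have "ln (real m) \<le> ln (real n) - ln 2 - 2 * y"
      proof -
        have "ln (2 * (real m / real n)) \<le> 2 * (real m / real n) - 1"
          using m n0 by (intro ln_le_minus_one) auto
        moreover have "ln (2 * (real m / real n)) = ln 2 + ln (real m) - ln (real n)"
          using m n0 by (subst ln_mult) (auto simp: ln_div)
        ultimately show ?thesis unfolding mn by (simp add: algebra_simps)
      qed
      ultimately have "odd_harmonic m \<le> ln (real n) / 2 + 4 / 3 - ln 2 - y" by linarith
      then have "4 / pi * odd_harmonic m \<le> 4 / pi * (ln (real n) / 2 + 4 / 3 - ln 2 - y)"
        by (intro mult_left_mono) auto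
      moreover have "pi / 12 * (1 / 4 - y) \<le> pi / 12 * (real m / real n)\<^sup>2"
        unfolding mn by (intro mult_left_mono) (auto simp: power2_eq_square algebra_simps)
      ultimately show ?thesis using y by (intro add_mono diff_mono) auto
    qed
    also have "\<dots> = 2 / pi * ln (real n) + (4 / pi * (4 / 3 - ln 2) - pi / 48) + y * (0.54875 + pi / 12 - 4 / pi)"
      by (simp add: algebra_simps add_divide_distrib)
    also have "\<dots> \<le> 2 / pi * ln (real n) + 3 / 4 + 0"
    proof (intro add_mono order_refl)
      show "4 / pi * (4 / 3 - ln 2) - pi / 48 \<le> 3 / 4" by (rule lebesgue_numeric_bounds)
      show "y * (0.54875 + pi / 12 - 4 / pi) \<le> 0" using y(1) lebesgue_numeric_bounds(3) by (rule mult_nonneg_nonpos)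
    qed
    finally show ?thesis unfolding E by simp
  qed
qed

lemma cheb_interp_bound_nonneg:
  fixes p :: "real poly"
  assumes n: "3 \<le> n" and d: "degree p < n" and \<epsilon>: "\<And>k. k < n \<Longrightarrow> \<bar>poly p (cos (cheb_angle n k))\<bar> \<le> \<epsilon>"
    and y: "0 \<le> y" "y \<le> cos (pi / (2 * real n))"
  shows "\<bar>poly p y\<bar> \<le> (2 / pi * ln (real n) + 3 / 4) * \<epsilon>"
proof -
  define \<theta> where "\<theta> = arccos y"
  have n0: "0 < n" "0 < real n" using n by auto
  have \<epsilon>0: "0 \<le> \<epsilon>" using \<epsilon>[of 0] n by auto
  have y1: "y \<le> 1" using y cos_le_one order_trans by blast
  have cos\<theta>: "cos \<theta> = y" using y y1 by (simp add: \<theta>_def)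
  have e: "0 \<le> pi / (2 * real n)" "pi / (2 * real n) \<le> pi"
    using n0 by (auto simp: field_simps)
  have \<theta>1: "pi / (2 * real n) \<le> \<theta>"
    using arccos_le_arccos[of y "cos (pi / (2 * real n))"] y arccos_cos[OF e] by (simp add: \<theta>_def)
  have \<theta>2: "\<theta> \<le> pi / 2" using arccos_le_arccos[of 0 y] y y1 by (simp add: \<theta>_def)
  show ?thesis
  proof (cases "cos (real n * \<theta>) = 0")
    \<comment> \<open>At a node the value of p is at most \<epsilon>, and the factor in the claim is
      at least 1 because n >= 3.\<close>
    case True
    then have "(\<Prod>k<n. y - cos (cheb_angle n k)) = 0"
      using prod_cheb_nodes[OF n0(1), of y] poly_cheb_poly_cos[of n \<theta>] by (simp add: cos\<theta>)
    then obtain k where "k < n" "y = cos (cheb_angle n k)" by auto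
    then have "\<bar>poly p y\<bar> \<le> 1 * \<epsilon>" using \<epsilon> by simp
    also have "\<dots> \<le> (2 / pi * ln (real n) + 3 / 4) * \<epsilon>"
    proof (rule mult_right_mono[OF _ \<epsilon>0])
      have "1 \<le> ln (3 :: real)" using ln_approx_bounds[of 3 2] by (simp add: eval_nat_numeral)
      also have "\<dots> \<le> ln (real n)" using n by simp
      finally have "2 / 4 * 1 \<le> 2 / pi * ln (real n)" using pi_less_4 by (intro mult_mono divide_left_mono) auto
      then show "1 \<le> 2 / pi * ln (real n) + 3 / 4" by linarith
    qed
    finally show ?thesis .
  next
    case False
    \<comment> \<open>The nearest integer to n \<theta> / \<pi>. The lower bound on \<theta> makes
      it at least 1 and y >= 0 makes 2 m <= n. The value \<sigma> = -\<pi> / 2 is impossible because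
      cos (n \<theta>) is nonzero in this case.\<close>
    define m where "m = nat \<lfloor>real n * \<theta> / pi + 1 / 2\<rfloor>"
    define \<sigma> where "\<sigma> = real n * \<theta> - real m * pi"
    have "pi / 2 \<le> real n * \<theta>" using \<theta>1 n0 by (simp add: field_simps)
    then have f1: "1 \<le> \<lfloor>real n * \<theta> / pi + 1 / 2\<rfloor>" by (simp add: le_floor_iff field_simps)
    then have m1: "1 \<le> m" by (simp add: m_def le_nat_iff)
    have rm: "real m = of_int \<lfloor>real n * \<theta> / pi + 1 / 2\<rfloor>" using f1 by (simp add: m_def)
    have "real m \<le> real n * \<theta> / pi + 1 / 2" "real n * \<theta> / pi + 1 / 2 < real m + 1" unfolding rm by linarith+
    then have \<sigma>': "- (pi / 2) \<le> \<sigma>" "\<sigma> < pi / 2"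
      unfolding \<sigma>_def by (simp_all add: field_simps)
    have cn: "cos (real n * \<theta>) = (- 1) ^ m * cos \<sigma>"
    proof -
      have "real n * \<theta> = real m * pi + \<sigma>" by (simp add: \<sigma>_def)
      then show ?thesis by (simp add: cos_add cos_npi)
    qed
    have "\<sigma> \<noteq> - (pi / 2)" using False cn by auto
    with \<sigma>' have \<sigma>: "\<bar>\<sigma>\<bar> < pi / 2" by auto
    have m2: "2 * m \<le> n"
    proof -
      have "real n * \<theta> \<le> real n * (pi / 2)" using \<theta>2 by (intro mult_left_mono) auto
      then have "real m * pi < real n * (pi / 2) + pi / 2" using \<sigma> unfolding \<sigma>_def by linarith
      then have "(2 * real m) * pi < (real n + 1) * pi" by (simp add: algebra_simps)
      then have "2 * real m < real n + 1" by simp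
      then show ?thesis by linarith
    qed
    have c\<sigma>: "0 < cos \<sigma>" using \<sigma> by (intro cos_gt_zero_pi) auto
    have "\<bar>poly p y\<bar> \<le> (\<Sum>k<n. \<bar>poly p (cos (cheb_angle n k)) *
       ((- 1) ^ k * cos (real n * \<theta>) * sin (cheb_angle n k) / (real n * (cos \<theta> - cos (cheb_angle n k))))\<bar>)"
      unfolding cos\<theta>[symmetric] poly_cheb_lagrange[OF n0(1) d False] by (rule sum_abs)
    also have "\<dots> \<le> (\<Sum>k<n. \<epsilon> * (cos \<sigma> * (sin (cheb_angle n k) / \<bar>cos \<theta> - cos (cheb_angle n k)\<bar>) / real n))"
    proof (rule sum_mono)
      fix k assume "k \<in> {..<n}"
      then have k: "k < n" by simp
      have s: "0 < sin (cheb_angle n k)" using sin_gt_zero[OF cheb_angle_bounds[OF k]] .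
      have "\<bar>poly p (cos (cheb_angle n k)) *
         ((- 1) ^ k * cos (real n * \<theta>) * sin (cheb_angle n k) / (real n * (cos \<theta> - cos (cheb_angle n k))))\<bar>
         = \<bar>poly p (cos (cheb_angle n k))\<bar> * (cos \<sigma> * (sin (cheb_angle n k) / \<bar>cos \<theta> - cos (cheb_angle n k)\<bar>) / real n)"
        using s c\<sigma> n0 by (simp add: cn abs_mult abs_divide power_abs)
      also have "\<dots> \<le> \<epsilon> * (cos \<sigma> * (sin (cheb_angle n k) / \<bar>cos \<theta> - cos (cheb_angle n k)\<bar>) / real n)"
        using \<epsilon>[OF k] s c\<sigma> by (intro mult_right_mono) auto
      finally show "\<bar>poly p (cos (cheb_angle n k)) *
         ((- 1) ^ k * cos (real n * \<theta>) * sin (cheb_angle n k) / (real n * (cos \<theta> - cos (cheb_angle n k))))\<bar>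
         \<le> \<epsilon> * (cos \<sigma> * (sin (cheb_angle n k) / \<bar>cos \<theta> - cos (cheb_angle n k)\<bar>) / real n)" .
    qed
    also have "\<dots> = \<epsilon> * (cos \<sigma> * (\<Sum>k<n. sin (cheb_angle n k) / \<bar>cos \<theta> - cos (cheb_angle n k)\<bar>) / real n)"
      by (simp only: sum_distrib_left sum_divide_distrib)
    also have "\<dots> \<le> \<epsilon> * (2 / pi * ln (real n) + 3 / 4)"
    proof (intro mult_left_mono \<epsilon>0 cheb_lebesgue_le[OF n m1 m2 \<sigma>])
      show "\<theta> = (real m * pi + \<sigma>) / real n" using n0 by (simp add: \<sigma>_def)
    qed
    finally show ?thesis by (simp add: mult.commute)
  qed
qed

lemma cheb_interp_bound:
  fixes p :: "real poly"
  assumes n: "3 \<le> n" and d: "degree p < n" and \<epsilon>: "\<And>k. k < n \<Longrightarrow> \<bar>poly p (cos (cheb_angle n k))\<bar> \<le> \<epsilon>"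
    and y: "\<bar>y\<bar> \<le> cos (pi / (2 * real n))"
  shows "\<bar>poly p y\<bar> \<le> (2 / pi * ln (real n) + 3 / 4) * \<epsilon>"
proof (cases "0 \<le> y")
  case True
  then show ?thesis using y by (intro cheb_interp_bound_nonneg[OF n d \<epsilon>]) auto
next
  case False
  define q where "q = pcompose p [:0, - 1:]"
  have q: "poly q x = poly p (- x)" for x by (simp add: q_def poly_pcompose)
  have "\<bar>poly q (- y)\<bar> \<le> (2 / pi * ln (real n) + 3 / 4) * \<epsilon>"
  proof (rule cheb_interp_bound_nonneg[OF n])
    show "degree q < n" using d by (simp add: q_def degree_pcompose)
    fix k assume k: "k < n"
    have "cheb_angle n (n - Suc k) = pi - cheb_angle n k"
      using k by (simp add: cheb_angle_def of_nat_diff field_simps)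
    then have "- cos (cheb_angle n k) = cos (cheb_angle n (n - Suc k))" by simp
    then show "\<bar>poly q (cos (cheb_angle n k))\<bar> \<le> \<epsilon>" using \<epsilon>[of "n - Suc k"] k by (simp add: q)
  qed (use y False in auto)
  then show ?thesis by (simp add: q)
qed

lemma ref_node_eq: "ref_node r k = - cos (cheb_angle (r + 1) k) / cos (pi / (2 * real (r + 1)))"
  by (simp add: ref_node_def cheb_angle_def algebra_simps)

lemma cos_pi_half_div_pos: "0 < cos (pi / (2 * real r + 2))" if "1 \<le> r"
proof -
  have "pi / (2 * real r + 2) < pi / 2" using that by (intro divide_strict_left_mono) auto
  moreover have "0 < pi / (2 * real r + 2)" by simp
  ultimately show ?thesis by (intro cos_gt_zero)
qed

text \<open>\<open>ref_node\<close> negates the Chebyshev roots and divides them by c, so that the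
  extreme nodes are -1 and 1. The reference interval therefore corresponds to |y| <= c, the range of
  \<open>cheb_interp_bound\<close>. Markov's inequality is applied on the reference interval;
  scaling back produces 2 / w.\<close>

lemma interpolant_bounds:
  fixes p :: "real poly"
  assumes r: "2 \<le> r" and w: "0 < w" and d: "degree p \<le> r"
    and \<epsilon>: "\<And>k. k \<le> r \<Longrightarrow> \<bar>poly p (a + w * (1 + ref_node r k) / 2)\<bar> \<le> \<epsilon>"
    and x: "x \<in> {a..a + w}"
  shows "\<bar>poly p x\<bar> \<le> psi r * \<epsilon>"
    and "\<bar>poly (pderiv p) x\<bar> \<le> 2 / w * (real r)\<^sup>2 * (psi r * \<epsilon>)"
proof -
  define c where "c = cos (pi / (2 * real (r + 1)))"
  have c0: "0 < c" using cos_pi_half_div_pos[of r] r by (simp add: c_def algebra_simps)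
  define q where "q = pcompose p [:a + w / 2, w / 2:]"
  have q: "poly q t = poly p (a + w * (1 + t) / 2)" for t
    by (simp add: q_def poly_pcompose field_simps)
  have dq: "degree q \<le> r" using d by (simp add: q_def degree_pcompose)
  define q2 where "q2 = pcompose q [:0, - 1 / c:]"
  have q2: "poly q2 y = poly q (- y / c)" for y by (simp add: q2_def poly_pcompose)
  have bound: "\<bar>poly q t\<bar> \<le> psi r * \<epsilon>" if t: "\<bar>t\<bar> \<le> 1" for t
  proof -
    have "\<bar>poly q2 (- c * t)\<bar> \<le> (2 / pi * ln (real (r + 1)) + 3 / 4) * \<epsilon>"
    proof (rule cheb_interp_bound)
      show "degree q2 < r + 1" using dq by (simp add: q2_def degree_pcompose)
      show "\<bar>- c * t\<bar> \<le> cos (pi / (2 * real (r + 1)))"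
        unfolding c_def[symmetric] using t c0 by (simp add: abs_mult mult_left_le)
      show "\<bar>poly q2 (cos (cheb_angle (r + 1) k))\<bar> \<le> \<epsilon>" if "k < r + 1" for k
      proof -
        have "- cos (cheb_angle (r + 1) k) / c = ref_node r k" by (simp add: ref_node_eq c_def)
        then show ?thesis using \<epsilon>[of k] that by (simp only: q2 q)
      qed
    qed (use r in simp)
    moreover have "poly q2 (- c * t) = poly q t" using c0 by (simp add: q2)
    ultimately show ?thesis by (simp add: psi_def add.commute)
  qed
  define t where "t = 2 * (x - a) / w - 1"
  have t: "\<bar>t\<bar> \<le> 1" using x w by (auto simp: t_def abs_le_iff field_simps)
  have xt: "x = a + w * (1 + t) / 2" using w by (simp add: t_def field_simps)
  show "\<bar>poly p x\<bar> \<le> psi r * \<epsilon>" using bound[OF t] unfolding q xt .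
  have "\<bar>poly (pderiv q) t\<bar> \<le> (real r)\<^sup>2 * (psi r * \<epsilon>)"
    using r by (intro markov_inequality[OF dq _ bound t]) auto
  moreover have "poly (pderiv q) t = poly (pderiv p) x * (w / 2)"
  proof -
    have "a + w / 2 + t * (w / 2) = x" unfolding xt by (simp add: field_simps)
    then show ?thesis by (simp add: q_def pderiv_pcompose poly_pcompose pderiv_pCons)
  qed
  ultimately show "\<bar>poly (pderiv p) x\<bar> \<le> 2 / w * (real r)\<^sup>2 * (psi r * \<epsilon>)"
    using w by (simp add: abs_mult field_simps)
qed

section \<open>Interpolation error\<close>

definition lagrange_basis :: "(nat \<Rightarrow> real) \<Rightarrow> nat \<Rightarrow> nat \<Rightarrow> real poly" where
  "lagrange_basis X n k = (\<Prod>j\<in>{..<n} - {k}. smult (1 / (X k - X j)) [:- X j, 1:])"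

definition lagrange_poly :: "(nat \<Rightarrow> real) \<Rightarrow> nat \<Rightarrow> (real \<Rightarrow> real) \<Rightarrow> real poly" where
  "lagrange_poly X n F = (\<Sum>k<n. smult (F (X k)) (lagrange_basis X n k))"

lemma poly_lagrange_basis:
  assumes "inj_on X {..<n}" "j < n" "k < n"
  shows "poly (lagrange_basis X n k) (X j) = (if j = k then 1 else 0)"
proof (cases "j = k")
  case True
  have "poly (lagrange_basis X n k) (X k) = (\<Prod>j\<in>{..<n} - {k}. 1)"
    unfolding lagrange_basis_def poly_prod
  proof (rule prod.cong)
    fix i assume "i \<in> {..<n} - {k}"
    then have "X k \<noteq> X i" using assms by (auto simp: inj_on_def)
    then show "poly (smult (1 / (X k - X i)) [:- X i, 1:]) (X k) = 1" by (simp flip: diff_divide_distrib)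
  qed simp
  then show ?thesis using True by simp
next
  case False
  then show ?thesis unfolding lagrange_basis_def poly_prod using assms
    by (auto intro!: prod_zero bexI[of _ j])
qed

lemma degree_lagrange_basis: "k < n \<Longrightarrow> degree (lagrange_basis X n k) < n"
proof -
  assume k: "k < n"
  have "degree (lagrange_basis X n k) \<le> (\<Sum>j\<in>{..<n} - {k}. degree (smult (1 / (X k - X j)) [:- X j, 1:]))"
    unfolding lagrange_basis_def by (rule degree_prod_sum_le[unfolded o_def]) simp
  also have "\<dots> \<le> (\<Sum>j\<in>{..<n} - {k}. 1)"
    by (intro sum_mono order_trans[OF degree_smult_le]) simp
  also have "\<dots> = n - 1" using k by simp
  finally show ?thesis using k by simp
qed

lemma degree_lagrange_poly: "0 < n \<Longrightarrow> degree (lagrange_poly X n F) < n"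
proof -
  assume n: "0 < n"
  have "degree (lagrange_poly X n F) \<le> n - 1"
    unfolding lagrange_poly_def
  proof (rule degree_sum_le)
    fix k assume "k \<in> {..<n}"
    then show "degree (smult (F (X k)) (lagrange_basis X n k)) \<le> n - 1"
      using degree_lagrange_basis[of k n X] degree_smult_le[of "F (X k)" "lagrange_basis X n k"] by simp
  qed simp
  then show ?thesis using n by simp
qed

lemma poly_lagrange_poly:
  "poly (lagrange_poly X n F) x = (\<Sum>k<n. F (X k) * poly (lagrange_basis X n k) x)"
  by (simp add: lagrange_poly_def poly_sum)

lemma poly_lagrange_poly_node:
  assumes "inj_on X {..<n}" "j < n"
  shows "poly (lagrange_poly X n F) (X j) = F (X j)"
  unfolding poly_lagrange_poly using assms by (simp add: poly_lagrange_basis if_distrib cong: if_cong)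

lemma iterated_rolle:
  fixes g :: "nat \<Rightarrow> real \<Rightarrow> real" and z :: "nat \<Rightarrow> real"
  assumes "\<And>i. i < n \<Longrightarrow> z i < z (Suc i)" and "\<And>i. i \<le> n \<Longrightarrow> z i \<in> {a..b}"
    and "\<And>i. i \<le> n \<Longrightarrow> g 0 (z i) = 0"
    and "\<And>k t. k < n \<Longrightarrow> t \<in> {a..b} \<Longrightarrow> (g k has_real_derivative g (Suc k) t) (at t)"
  shows "\<exists>\<xi>\<in>{a..b}. g n \<xi> = 0"
  using assms
proof (induction n arbitrary: g z)
  case 0
  then show ?case by auto
next
  case (Suc n)
  have "\<exists>y. z i < y \<and> y < z (Suc i) \<and> g 1 y = 0" if i: "i < Suc n" for i
  proof -
    have sub: "{z i..z (Suc i)} \<subseteq> {a..b}" using Suc.prems(2)[of i] Suc.prems(2)[of "Suc i"] i by auto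
    have d: "(g 0 has_real_derivative g 1 t) (at t)" if "t \<in> {z i..z (Suc i)}" for t
      using Suc.prems(4)[of 0 t] that sub by auto
    have "\<exists>y. z i < y \<and> y < z (Suc i) \<and> (g 0 has_real_derivative 0) (at y)"
    proof (rule Rolle)
      show "z i < z (Suc i)" by (rule Suc.prems(1)[OF i])
      show "g 0 (z i) = g 0 (z (Suc i))" using Suc.prems(3)[of i] Suc.prems(3)[of "Suc i"] i by simp
      show "continuous_on {z i..z (Suc i)} (g 0)"
        using d by (meson DERIV_atLeastAtMost_imp_continuous_on atLeastAtMost_iff)
      show "g 0 differentiable at t" if "z i < t" "t < z (Suc i)" for t
        using d[of t] that by (auto simp: real_differentiable_def)
    qed
    then obtain y where y: "z i < y" "y < z (Suc i)" "(g 0 has_real_derivative 0) (at y)" by blast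
    then have "g 1 y = 0" using d[of y] DERIV_unique by auto
    then show ?thesis using y by blast
  qed
  then obtain y where y: "\<And>i. i < Suc n \<Longrightarrow> z i < y i \<and> y i < z (Suc i) \<and> g 1 (y i) = 0" by metis
  have "\<exists>\<xi>\<in>{a..b}. (\<lambda>k. g (Suc k)) n \<xi> = 0"
  proof (rule Suc.IH)
    show "y i < y (Suc i)" if "i < n" for i using y[of i] y[of "Suc i"] that by simp
    show "y i \<in> {a..b}" if "i \<le> n" for i
      using y[of i] Suc.prems(2)[of i] Suc.prems(2)[of "Suc i"] that by auto
    show "g (Suc 0) (y i) = 0" if "i \<le> n" for i using y[of i] that by simp
    show "(g (Suc k) has_real_derivative g (Suc (Suc k)) t) (at t)" if "k < n" "t \<in> {a..b}" for k t
      using Suc.prems(4)[of "Suc k" t] that by simp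
  qed
  then show ?case by simp
qed

lemma lagrange_error:
  fixes f :: "nat \<Rightarrow> real \<Rightarrow> real" and X :: "nat \<Rightarrow> real"
  assumes n: "0 < n" and inj: "inj_on X {..<n}" and X: "\<And>k. k < n \<Longrightarrow> X k \<in> {a..b}" and x: "x \<in> {a..b}"
    and f: "\<And>k t. k < n \<Longrightarrow> t \<in> {a..b} \<Longrightarrow> (f k has_real_derivative f (Suc k) t) (at t)"
    and K: "\<And>t. t \<in> {a..b} \<Longrightarrow> \<bar>f n t\<bar> \<le> K"
  shows "\<bar>f 0 x - poly (lagrange_poly X n (f 0)) x\<bar> \<le> K / fact n * \<bar>\<Prod>k<n. x - X k\<bar>"
proof (cases "x \<in> X ` {..<n}")
  case True
  then obtain k where "k < n" "x = X k" by auto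
  then have "f 0 x = poly (lagrange_poly X n (f 0)) x" using poly_lagrange_poly_node[OF inj] by simp
  moreover have "0 \<le> K" using K[OF x] abs_ge_zero order_trans by blast
  ultimately show ?thesis by simp
next
  case False
  define P where "P = lagrange_poly X n (f 0)"
  define \<omega> where "\<omega> = (\<Prod>k<n. [:- X k, 1:])"
  have \<omega>: "poly \<omega> t = (\<Prod>k<n. t - X k)" for t by (simp add: \<omega>_def poly_prod)
  have \<omega>x: "poly \<omega> x \<noteq> 0" using False by (auto simp: \<omega>)
  \<comment> \<open>The multiple of the node polynomial that makes the remainder vanish at x in
    addition to the n nodes; its n-th derivative is the constant n! c.\<close>
  define c where "c = (f 0 x - poly P x) / poly \<omega> x"
  define R where "R = P + smult c \<omega>"
  define g where "g k t = f k t - poly ((pderiv ^^ k) R) t" for k t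
  have d\<omega>: "degree \<omega> = n" unfolding \<omega>_def by (subst degree_prod_eq_sum_degree) auto
  have l\<omega>: "coeff \<omega> n = 1"
    using lead_coeff_prod[of "\<lambda>k. [:- X k, 1:]" "{..<n}"] d\<omega> by (simp add: \<omega>_def)
  have dP: "degree P < n" unfolding P_def by (rule degree_lagrange_poly[OF n])
  have gx: "g 0 x = 0" using \<omega>x by (simp add: g_def R_def c_def)
  have gX: "g 0 (X k) = 0" if "k < n" for k
  proof -
    have "poly \<omega> (X k) = 0" using that by (auto simp: \<omega> intro!: prod_zero)
    then show ?thesis using poly_lagrange_poly_node[OF inj that, of "f 0"] by (simp add: g_def R_def P_def)
  qed
  define Z where "Z = insert x (X ` {..<n})"
  have Z: "finite Z" "card Z = Suc n" using False inj by (simp_all add: Z_def card_image)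
  define z where "z i = sorted_list_of_set Z ! i" for i
  have len: "length (sorted_list_of_set Z) = Suc n" using Z by simp
  have zZ: "z i \<in> Z" if "i \<le> n" for i
    using nth_mem[of i "sorted_list_of_set Z"] that Z len by (simp add: z_def)
  have "\<exists>\<xi>\<in>{a..b}. g n \<xi> = 0"
  proof (rule iterated_rolle)
    show "z i < z (Suc i)" if "i < n" for i
      unfolding z_def by (rule sorted_wrt_nth_less[OF strict_sorted_list_of_set]) (use that len in auto)
    show "z i \<in> {a..b}" if "i \<le> n" for i using zZ[OF that] X x by (auto simp: Z_def)
    show "g 0 (z i) = 0" if "i \<le> n" for i using zZ[OF that] gx gX by (auto simp: Z_def)
    show "(g k has_real_derivative g (Suc k) t) (at t)" if "k < n" "t \<in> {a..b}" for k t
      unfolding g_def[abs_def] using f[OF that] by (auto intro!: derivative_eq_intros poly_DERIV)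
  qed
  then obtain \<xi> where \<xi>: "\<xi> \<in> {a..b}" "g n \<xi> = 0" by blast
  have "(pderiv ^^ n) R = [:fact n * c:]"
  proof (rule poly_eqI)
    fix i
    have "degree R \<le> n" unfolding R_def
      using dP d\<omega> by (intro degree_add_le) (auto intro: order_trans[OF degree_smult_le])
    then have "coeff R (i + n) = (if i = 0 then c else 0)"
      using dP l\<omega> by (auto simp: R_def coeff_eq_0 d\<omega>)
    moreover have "pochhammer (1 :: real) n = fact n" by (simp add: pochhammer_fact)
    ultimately show "coeff ((pderiv ^^ n) R) i = coeff [:fact n * c:] i"
      by (simp add: coeff_higher_pderiv coeff_pCons split: nat.split)
  qed
  then have "f n \<xi> = fact n * c" using \<xi>(2) by (simp add: g_def)
  then have "\<bar>c\<bar> \<le> K / fact n" using K[OF \<xi>(1)] by (simp add: abs_mult field_simps)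
  then have "\<bar>c\<bar> * \<bar>poly \<omega> x\<bar> \<le> K / fact n * \<bar>poly \<omega> x\<bar>" by (rule mult_right_mono) simp
  moreover have "f 0 x - poly P x = c * poly \<omega> x" using \<omega>x by (simp add: c_def)
  ultimately show ?thesis unfolding P_def[symmetric] \<omega>[symmetric] by (simp only: abs_mult)
qed

lemma abs_cheb_poly_le: "\<bar>y\<bar> \<le> 1 \<Longrightarrow> \<bar>poly (cheb_poly n) y\<bar> \<le> 1"
  using poly_cheb_poly_cos[of n "arccos y"] by (simp add: abs_le_iff)

lemma inj_on_ref_node: "1 \<le> r \<Longrightarrow> inj_on (ref_node r) {..<r + 1}"
  using inj_on_cos_cheb_angle[of "r + 1"] cos_pi_half_div_pos[of r]
  by (auto simp: inj_on_def ref_node_eq algebra_simps)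

lemma prod_ref_node_le:
  assumes r: "1 \<le> r" and w: "0 < w" and x: "x \<in> {t0..t0 + w}"
  shows "\<bar>\<Prod>k<r + 1. x - (t0 + w * (1 + ref_node r k) / 2)\<bar> \<le>
    (w / 2) ^ (r + 1) * (1 / cos (pi / (2 * real r + 2))) ^ (r + 1) * (1 / 2 ^ r)"
proof -
  define c where "c = cos (pi / (2 * real r + 2))"
  have c0: "0 < c" using cos_pi_half_div_pos[OF r] by (simp add: c_def)
  have c1: "c \<le> 1" by (simp add: c_def)
  define t where "t = 2 * (x - t0) / w - 1"
  have t: "\<bar>t\<bar> \<le> 1" using x w by (auto simp: t_def abs_le_iff field_simps)
  have xt: "x = t0 + w * (1 + t) / 2" using w by (simp add: t_def field_simps)
  \<comment> \<open>The scaling factor is negative because the reference nodes are negated Chebyshev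
    roots; the sign disappears in the absolute value.\<close>
  define \<kappa> where "\<kappa> = - (w / 2) * (1 / c)"
  have "x - (t0 + w * (1 + ref_node r k) / 2) = \<kappa> * (- (c * t) - cos (cheb_angle (r + 1) k))" for k
  proof -
    have "ref_node r k = - cos (cheb_angle (r + 1) k) / c" by (simp add: ref_node_eq c_def algebra_simps)
    then have e: "cos (cheb_angle (r + 1) k) = - (c * ref_node r k)" using c0 by (simp add: field_simps)
    show ?thesis unfolding e xt \<kappa>_def using c0 by (simp add: field_simps)
  qed
  then have "(\<Prod>k<r + 1. x - (t0 + w * (1 + ref_node r k) / 2)) =
      \<kappa> ^ (r + 1) * (\<Prod>k<r + 1. - (c * t) - cos (cheb_angle (r + 1) k))"
    by (simp only: prod.distrib prod_constant card_lessThan)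
  also have "(\<Prod>k<r + 1. - (c * t) - cos (cheb_angle (r + 1) k)) = poly (cheb_poly (r + 1)) (- (c * t)) / 2 ^ r"
    using prod_cheb_nodes[of "r + 1" "- (c * t)"] by simp
  finally have "\<bar>\<Prod>k<r + 1. x - (t0 + w * (1 + ref_node r k) / 2)\<bar> =
      (w / 2) ^ (r + 1) * (1 / c) ^ (r + 1) * (\<bar>poly (cheb_poly (r + 1)) (- (c * t))\<bar> / 2 ^ r)"
    using w c0 by (simp add: \<kappa>_def abs_mult power_abs power_mult_distrib abs_divide power_divide)
  also have "\<dots> \<le> (w / 2) ^ (r + 1) * (1 / c) ^ (r + 1) * (1 / 2 ^ r)"
  proof (intro mult_left_mono divide_right_mono)
    have "c * \<bar>t\<bar> \<le> 1 * 1" using c0 c1 t by (intro mult_mono) auto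
    then show "\<bar>poly (cheb_poly (r + 1)) (- (c * t))\<bar> \<le> 1"
      using c0 by (intro abs_cheb_poly_le) (simp add: abs_mult)
  qed (use w c0 in auto)
  finally show ?thesis by (simp add: c_def)
qed

text \<open>In the remainder, chi bounds the r + 1 additional powers of t + q, and moving t to x
  costs exp (2 s h / chi) because (x + q) / (t + q) <= 1 + h / chi. The error is thereby relative to
  the value at x, a form that survives positive combinations. The leading 2 of
  \<open>G_const\<close> comes from 2^(-r), since all its other powers have exponent r + 1.\<close>

lemma powr_interpolation_error:
  assumes r: "1 \<le> r" and w: "0 < w" "w \<le> h" and x: "x \<in> {t0..t0 + w}" and s: "0 < s"
    and chi: "0 < chi" "chi \<le> t0 + q"
    and X: "\<And>k. k < r + 1 \<Longrightarrow> X k = t0 + w * (1 + ref_node r k) / 2" "\<And>k. k < r + 1 \<Longrightarrow> X k \<in> {t0..t0 + w}"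
  shows "\<bar>(x + q) powr (- 2 * s) - poly (lagrange_poly X (r + 1) (\<lambda>t. (t + q) powr (- 2 * s))) x\<bar>
    \<le> G_const r s chi h * h ^ (r + 1) * (x + q) powr (- 2 * s)"
proof -
  define n where "n = r + 1"
  define c where "c = cos (pi / (2 * real r + 2))"
  have c0: "0 < c" using cos_pi_half_div_pos[OF r] by (simp add: c_def)
  define f where "f k t = (- 1) ^ k * pochhammer (2 * s) k * (t + q) powr (- 2 * s - real k)" for k t
  have pos: "chi \<le> t + q" if "t \<in> {t0..t0 + w}" for t using that chi by simp
  have ph: "0 < pochhammer (2 * s) k" for k using s by (intro pochhammer_pos) simp
  define E where "E = exp (2 * s * h / chi) * (x + q) powr (- 2 * s)"
  define K where "K = pochhammer (2 * s) n * ((1 / chi ^ n) * E)"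
  have inj: "inj_on X {..<n}"
  proof (rule inj_onI)
    fix j k assume "j \<in> {..<n}" "k \<in> {..<n}" "X j = X k"
    then show "j = k" using X(1) w inj_on_ref_node[OF r] by (auto simp: n_def inj_on_def)
  qed
  have "\<bar>f 0 x - poly (lagrange_poly X n (f 0)) x\<bar> \<le> K / fact n * \<bar>\<Prod>k<n. x - X k\<bar>"
  proof (rule lagrange_error[OF _ inj _ x])
    show "(f k has_real_derivative f (Suc k) t) (at t)" if "k < n" "t \<in> {t0..t0 + w}" for k t
    proof -
      have "0 < t + q" using pos[OF that(2)] chi by linarith
      then have "((\<lambda>t. (t + q) powr (- 2 * s - real k)) has_real_derivative
          (- 2 * s - real k) * (t + q) powr (- 2 * s - real k - 1)) (at t)"
        by (auto intro!: derivative_eq_intros)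
      then have "(f k has_real_derivative (- 1) ^ k * pochhammer (2 * s) k *
          ((- 2 * s - real k) * (t + q) powr (- 2 * s - real k - 1))) (at t)"
        unfolding f_def[abs_def] by (rule DERIV_cmult)
      moreover have "- 2 * s - real k - 1 = - 2 * s - real (Suc k)" by simp
      then have "(- 1) ^ k * pochhammer (2 * s) k * ((- 2 * s - real k) * (t + q) powr (- 2 * s - real k - 1)) = f (Suc k) t"
        unfolding f_def by (simp only: pochhammer_Suc) (simp add: algebra_simps)
      ultimately show ?thesis by simp
    qed
    show "\<bar>f n t\<bar> \<le> K" if t: "t \<in> {t0..t0 + w}" for t
    proof -
      have tq: "0 < t + q" "chi \<le> t + q" "0 < x + q" using pos[OF t] pos[OF x] chi by linarith+
      have "\<bar>f n t\<bar> = pochhammer (2 * s) n * (t + q) powr (- 2 * s - real n)"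
        using ph[of n] by (simp add: f_def abs_mult power_abs)
      also have "(t + q) powr (- 2 * s - real n) = (1 / (t + q) ^ n) * (t + q) powr (- 2 * s)"
        using tq by (simp add: powr_diff powr_realpow)
      also have "\<dots> \<le> (1 / chi ^ n) * E"
      proof (rule mult_mono)
        show "1 / (t + q) ^ n \<le> 1 / chi ^ n"
          using tq chi by (intro divide_left_mono power_mono mult_pos_pos zero_less_power) auto
        have "(x + q) / (t + q) \<le> 1 + h / chi"
        proof -
          have "(x + q) / (t + q) = 1 + (x - t) / (t + q)" using tq by (simp add: field_simps)
          also have "(x - t) / (t + q) \<le> h / chi" using tq chi t x w by (intro frac_le) auto
          finally show ?thesis by simp
        qed
        also have "\<dots> \<le> exp (h / chi)" by (rule exp_ge_add_one_self)
        finally have "((x + q) / (t + q)) powr (2 * s) \<le> exp (h / chi) powr (2 * s)"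
          using tq s by (intro powr_mono2) auto
        moreover have "exp (h / chi) powr (2 * s) = exp (2 * s * h / chi)" by (simp add: powr_def)
        moreover have "(t + q) powr (- 2 * s) = ((x + q) / (t + q)) powr (2 * s) * (x + q) powr (- 2 * s)"
          using tq by (simp add: powr_divide powr_minus_divide)
        ultimately show "(t + q) powr (- 2 * s) \<le> E"
          unfolding E_def by (metis mult_right_mono powr_ge_zero)
      qed (use chi in \<open>auto simp: E_def\<close>)
      finally show ?thesis using ph[of n] by (simp add: K_def)
    qed
  qed (use X in \<open>auto simp: n_def\<close>)
  also have "\<dots> \<le> K / fact n * ((w / 2) ^ n * (1 / c) ^ n * (1 / 2 ^ r))"
  proof (rule mult_left_mono)
    have "(\<Prod>k<n. x - X k) = (\<Prod>k<n. x - (t0 + w * (1 + ref_node r k) / 2))"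
      using X(1) by (intro prod.cong) (auto simp: n_def)
    then show "\<bar>\<Prod>k<n. x - X k\<bar> \<le> (w / 2) ^ n * (1 / c) ^ n * (1 / 2 ^ r)"
      using prod_ref_node_le[OF r w(1) x] by (simp add: n_def c_def)
    show "0 \<le> K / fact n" using ph[of n] chi by (simp add: K_def E_def)
  qed
  also have "\<dots> \<le> K / fact n * ((h / 2) ^ n * (1 / c) ^ n * (1 / 2 ^ r))"
    using ph[of n] chi w c0 by (intro mult_left_mono mult_right_mono power_mono) (auto simp: K_def E_def)
  also have "\<dots> = G_const r s chi h * h ^ (r + 1) * (x + q) powr (- 2 * s)"
  proof -
    have 1: "(\<Prod>k=0..r. 2 * s + real k) = pochhammer (2 * s) n"
      by (simp add: n_def pochhammer_prod atLeast0AtMost lessThan_Suc_atMost atLeast0LessThan)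
    have 2: "(\<Prod>k=1..r + 1. 2 * real k) = 2 ^ n * fact n"
      by (simp add: n_def prod.distrib fact_prod algebra_simps)
    have n2: "(2 :: real) ^ n = 2 * 2 ^ r" by (simp add: n_def)
    show ?thesis unfolding G_const_def 1 2 unfolding c_def[symmetric] K_def E_def n_def[symmetric]
      using c0 chi by (simp add: power_divide power_mult_distrib n2 field_simps)
  qed
  finally have "\<bar>f 0 x - poly (lagrange_poly X n (f 0)) x\<bar> \<le> G_const r s chi h * h ^ (r + 1) * (x + q) powr (- 2 * s)" .
  moreover have "f 0 = (\<lambda>t. (t + q) powr (- 2 * s))" by (simp add: f_def fun_eq_iff)
  ultimately show ?thesis by (simp only: n_def)
qed

section \<open>Piecewise interpolation on the mesh\<close>

lemma exp_minus_one_le: "exp t - 1 \<le> t * exp t" for t :: real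
proof -
  have "1 - t \<le> exp (- t)" using exp_ge_add_one_self[of "- t"] by simp
  then have "(1 - t) * exp t \<le> exp (- t) * exp t" by (intro mult_right_mono) auto
  then show ?thesis by (simp add: algebra_simps flip: exp_add)
qed

lemma ref_node_0: "1 \<le> r \<Longrightarrow> ref_node r 0 = - 1"
  using cos_pi_half_div_pos[of r] by (simp add: ref_node_def)

lemma ref_node_last: "1 \<le> r \<Longrightarrow> ref_node r r = 1"
proof -
  assume r: "1 \<le> r"
  have "(2 * real r + 1) / (2 * real r + 2) * pi = pi - pi / (2 * real r + 2)"
    by (simp add: field_simps)
  then show ?thesis using cos_pi_half_div_pos[OF r] by (simp add: ref_node_def)
qed

lemma sin_sq_node_bounds:
  assumes "2 \<le> r"
  shows "0 < sin (pi / (2 * real r + 2))" "(sin (pi / (2 * real r + 2)))\<^sup>2 \<le> 1 / 4"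
proof -
  define \<theta> where "\<theta> = pi / (2 * real r + 2)"
  have "\<theta> \<le> pi / 6" unfolding \<theta>_def using assms by (intro divide_left_mono) auto
  moreover have "0 < \<theta>" by (simp add: \<theta>_def add_nonneg_pos)
  ultimately have "0 < sin \<theta>" "sin \<theta> \<le> sin (pi / 6)"
    using pi_gt_zero by (auto intro!: sin_gt_zero sin_monotone_2pi_le)
  then show "0 < sin (pi / (2 * real r + 2))" "(sin (pi / (2 * real r + 2)))\<^sup>2 \<le> 1 / 4"
    using power_mono[of "sin \<theta>" "1 / 2" 2] by (simp_all add: \<theta>_def sin_30 power2_eq_square)
qed

text \<open>With \<theta> = \<pi> / (2 r + 2) the difference is 2 sin ((l - k) \<theta>) sin ((l + k
  + 1) \<theta>) / cos \<theta>. The first sine is least at \<theta>, the second at 2 \<theta> or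
  its supplement, and 2 sin \<theta> sin (2 \<theta>) / cos \<theta> is 4 sin^2 \<theta>.\<close>

lemma ref_node_spacing:
  assumes r: "1 \<le> r" and kl: "k < l" "l \<le> r"
  shows "4 * (sin (pi / (2 * real r + 2)))\<^sup>2 \<le> ref_node r l - ref_node r k"
proof -
  define \<theta> where "\<theta> = pi / (2 * real r + 2)"
  have \<theta>0: "0 < \<theta>" by (simp add: \<theta>_def add_nonneg_pos)
  have \<theta>r: "real r * \<theta> = pi / 2 - \<theta>" by (simp add: \<theta>_def field_simps)
  have c0: "0 < cos \<theta>" using cos_pi_half_div_pos[OF r] by (simp add: \<theta>_def)
  have \<theta>1: "1 * \<theta> \<le> real r * \<theta>" using r \<theta>0 by (intro mult_right_mono) auto
  have s0: "0 < sin \<theta>" using \<theta>0 \<theta>1 \<theta>r by (intro sin_gt_zero) auto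
  have "sin \<theta> \<le> sin (real (l - k) * \<theta>)"
  proof (rule sin_monotone_2pi_le)
    have "1 * \<theta> \<le> real (l - k) * \<theta>" using kl \<theta>0 by (intro mult_right_mono) auto
    then show "\<theta> \<le> real (l - k) * \<theta>" by simp
    have "real (l - k) * \<theta> \<le> real r * \<theta>" using kl \<theta>0 by (intro mult_right_mono) auto
    then show "real (l - k) * \<theta> \<le> pi / 2" using \<theta>r \<theta>0 by simp
  qed (use \<theta>0 pi_gt_zero in linarith)
  moreover have "sin (2 * \<theta>) \<le> sin (real (l + k + 1) * \<theta>)"
  proof -
    have lo: "2 * \<theta> \<le> real (l + k + 1) * \<theta>" using kl \<theta>0 by (intro mult_right_mono) auto
    have "real (l + k + 1) * \<theta> \<le> (2 * real r) * \<theta>" using kl \<theta>0 by (intro mult_right_mono) auto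
    then have hi: "real (l + k + 1) * \<theta> \<le> pi - 2 * \<theta>" using \<theta>r by (simp add: algebra_simps)
    show ?thesis
    proof (cases "real (l + k + 1) * \<theta> \<le> pi / 2")
      case True
      then show ?thesis using lo \<theta>0 pi_gt_zero by (intro sin_monotone_2pi_le) linarith+
    next
      case False
      have "sin (2 * \<theta>) \<le> sin (pi - real (l + k + 1) * \<theta>)"
        using hi False \<theta>0 pi_gt_zero by (intro sin_monotone_2pi_le) linarith+
      then show ?thesis by simp
    qed
  qed
  moreover have "0 \<le> sin (2 * \<theta>)" using \<theta>0 \<theta>1 \<theta>r by (intro sin_ge_zero) auto
  ultimately have p1: "sin \<theta> * sin (2 * \<theta>) \<le> sin (real (l - k) * \<theta>) * sin (real (l + k + 1) * \<theta>)"
    using s0 by (intro mult_mono) auto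
  have p2: "cos ((2 * real k + 1) * \<theta>) - cos ((2 * real l + 1) * \<theta>) = 2 * sin (real (l - k) * \<theta>) * sin (real (l + k + 1) * \<theta>)"
  proof -
    have "((2 * real l + 1) * \<theta> - (2 * real k + 1) * \<theta>) / 2 = real (l - k) * \<theta>"
      "((2 * real l + 1) * \<theta> + (2 * real k + 1) * \<theta>) / 2 = real (l + k + 1) * \<theta>"
      using kl by (simp_all add: of_nat_diff field_simps)
    then show ?thesis using cos_diff_half_angles[of "(2 * real k + 1) * \<theta>" "(2 * real l + 1) * \<theta>"] by (simp only:)
  qed
  have "2 * (sin \<theta> * (2 * sin \<theta> * cos \<theta>)) \<le> cos ((2 * real k + 1) * \<theta>) - cos ((2 * real l + 1) * \<theta>)"
    using p1 p2 unfolding sin_double by linarith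
  then have "2 * (sin \<theta> * (2 * sin \<theta> * cos \<theta>)) / cos \<theta> \<le> (cos ((2 * real k + 1) * \<theta>) - cos ((2 * real l + 1) * \<theta>)) / cos \<theta>"
    using c0 by (intro divide_right_mono) auto
  moreover have "ref_node r i = - cos ((2 * real i + 1) * \<theta>) / cos \<theta>" for i
    by (simp add: ref_node_def \<theta>_def)
  ultimately show ?thesis using c0 by (simp add: \<theta>_def[symmetric] power2_eq_square diff_divide_distrib)
qed

lemma ref_node_bounds: "1 \<le> r \<Longrightarrow> k \<le> r \<Longrightarrow> - 1 \<le> ref_node r k \<and> ref_node r k \<le> 1"
proof -
  assume r: "1 \<le> r" and k: "k \<le> r"
  have "0 \<le> ref_node r k - ref_node r 0" if "0 < k"
    by (rule order_trans[OF _ ref_node_spacing[OF r that k]]) simp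
  moreover have "0 \<le> ref_node r r - ref_node r k" if "k < r"
    by (rule order_trans[OF _ ref_node_spacing[OF r that order_refl]]) simp
  ultimately show ?thesis using ref_node_0[OF r] ref_node_last[OF r] k
    by (cases "k = 0"; cases "k = r") auto
qed

text \<open>The origin of \<open>eta\<close>: half the largest distance on [-1, 1] to a middle node.
  For even r that node is 0. For odd r no node is central, and index \<open>r div 2\<close> gives
  minus the tangent of \<pi> / (2 r + 2).\<close>

lemma ref_node_center:
  assumes r: "2 \<le> r" and k: "k \<le> r"
  shows "\<bar>ref_node r k - ref_node r (r div 2)\<bar> \<le> 2 * eta r"
proof (cases "even r")
  case True
  have e: "(2 * real (r div 2) + 1) / (2 * real r + 2) * pi = pi / 2"
    using True by (simp add: real_of_nat_div field_simps)
  have "ref_node r (r div 2) = 0" unfolding ref_node_def e by simp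
  then show ?thesis using ref_node_bounds[of r k] r k True by (simp add: eta_def abs_le_iff)
next
  case False
  define \<theta> where "\<theta> = pi / (2 * real r + 2)"
  have "2 * real (r div 2) + 1 = real r" using False by (metis odd_two_times_div_two_succ of_nat_1 of_nat_add of_nat_mult of_nat_numeral)
  then have e: "(2 * real (r div 2) + 1) / (2 * real r + 2) * pi = pi / 2 - \<theta>"
    by (simp add: \<theta>_def field_simps)
  have c: "ref_node r (r div 2) = - tan \<theta>"
    unfolding ref_node_def e \<theta>_def[symmetric] by (simp add: cos_diff tan_def)
  have "0 \<le> tan \<theta>"
  proof -
    have "0 < cos \<theta>" using cos_pi_half_div_pos[of r] r by (simp add: \<theta>_def)
    then show ?thesis using sin_sq_node_bounds(1)[OF r] by (simp add: tan_def \<theta>_def)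
  qed
  then have "\<bar>ref_node r k - - tan \<theta>\<bar> \<le> 1 + tan \<theta>" using ref_node_bounds[of r k] r k by (simp add: abs_le_iff)
  then show ?thesis unfolding c using False by (simp add: eta_def \<theta>_def)
qed

lemma eta_bounds: "2 \<le> r \<Longrightarrow> 1 / 2 \<le> eta r"
proof -
  assume r: "2 \<le> r"
  have "0 \<le> tan (pi / (2 * real r + 2))"
    using cos_pi_half_div_pos[of r] sin_sq_node_bounds(1)[OF r] r by (simp add: tan_def)
  then show ?thesis by (simp add: eta_def)
qed

lemma psi_pos: "0 < psi r" by (simp add: psi_def add_nonneg_pos)

text \<open>Subtracting the middle value F0 leaves an interpolant whose node values are at most
  \<open>\<epsilon>\<close>. The Lebesgue constant then keeps P above (1 - psi u exp u) F0, Markov's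
  inequality bounds its derivative, and the quotient bounds the logarithmic derivative.\<close>

lemma interpolant_log_lipschitz:
  fixes F :: "real \<Rightarrow> real" and X :: "nat \<Rightarrow> real" and r :: nat
  defines "P \<equiv> lagrange_poly X (r + 1) F"
  assumes r: "2 \<le> r" and w: "0 < w" "w \<le> h" and X: "\<And>k. X k = t0 + w * (1 + ref_node r k) / 2"
    and M: "0 < M" and F: "\<And>k l. k \<le> r \<Longrightarrow> l \<le> r \<Longrightarrow> F (X k) \<le> exp (M * \<bar>X k - X l\<bar>) * F (X l)"
    and Fpos: "\<And>k. k \<le> r \<Longrightarrow> 0 < F (X k)"
    and u: "u = M * eta r * h" "psi r * u * exp u < 1"
    and xy: "x \<in> {t0..t0 + w}" "y \<in> {t0..t0 + w}"
  shows "0 < poly P x"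
    and "poly P x \<le> exp (2 * eta r * (real r)\<^sup>2 * psi r * M * exp u / (1 - psi r * u * exp u) * \<bar>x - y\<bar>) * poly P y"
proof -
  define m where "m = r div 2"
  have m: "m \<le> r" by (simp add: m_def)
  define F0 where "F0 = F (X m)"
  have F0: "0 < F0" using Fpos[OF m] by (simp add: F0_def)
  have \<eta>: "0 < eta r" using eta_bounds[OF r] by simp
  \<comment> \<open>The deviation is measured with the local width w and not with h: the factor w in
    \<open>\<epsilon>\<close> cancels the 2 / w of Markov's inequality, so the ratio of h to w does
    not enter.\<close>
  define uw where "uw = M * eta r * w"
  have uw: "0 \<le> uw" "uw \<le> u" using M \<eta> w by (simp_all add: uw_def u(1) mult_left_mono)
  define \<epsilon> where "\<epsilon> = uw * exp u * F0"
  have inj: "inj_on X {..<r + 1}"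
    using inj_on_ref_node[of r] r w by (auto simp: inj_on_def X)
  define q where "q = P - [:F0:]"
  have dq: "degree q \<le> r"
    unfolding q_def P_def using degree_lagrange_poly[of "r + 1" X F] by (intro degree_diff_le) auto
  have dev: "\<bar>poly q (t0 + w * (1 + ref_node r k) / 2)\<bar> \<le> \<epsilon>" if k: "k \<le> r" for k
  proof -
    have "poly q (t0 + w * (1 + ref_node r k) / 2) = F (X k) - F0"
      unfolding X[symmetric] q_def P_def using poly_lagrange_poly_node[OF inj, of k F] k by simp
    moreover have "\<bar>X k - X m\<bar> \<le> w * eta r"
    proof -
      have e: "X k - X m = w / 2 * (ref_node r k - ref_node r m)" by (simp add: X field_simps)
      have "\<bar>X k - X m\<bar> = w / 2 * \<bar>ref_node r k - ref_node r m\<bar>" unfolding e abs_mult using w by simp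
      also have "\<dots> \<le> w / 2 * (2 * eta r)"
        using ref_node_center[OF r k] w by (intro mult_left_mono) (auto simp: m_def)
      finally show ?thesis by simp
    qed
    then have e: "exp (M * \<bar>X k - X m\<bar>) \<le> exp uw" using M by (simp add: uw_def mult.assoc mult.commute)
    have up: "F (X k) \<le> exp uw * F0"
    proof -
      have "F (X k) \<le> exp (M * \<bar>X k - X m\<bar>) * F0" using F[OF k m] by (simp add: F0_def)
      also have "\<dots> \<le> exp uw * F0" using e F0 by (intro mult_right_mono) auto
      finally show ?thesis .
    qed
    have dn: "F0 \<le> exp uw * F (X k)"
    proof -
      have "F0 \<le> exp (M * \<bar>X k - X m\<bar>) * F (X k)" using F[OF m k] by (simp add: F0_def abs_minus_commute)
      also have "\<dots> \<le> exp uw * F (X k)" using e Fpos[OF k] by (intro mult_right_mono) auto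
      finally show ?thesis .
    qed
    have ex: "exp uw - 1 \<le> uw * exp u"
    proof -
      have "exp uw - 1 \<le> uw * exp uw" by (rule exp_minus_one_le)
      also have "\<dots> \<le> uw * exp u" using uw by (intro mult_left_mono) auto
      finally show ?thesis .
    qed
    have "F (X k) - F0 \<le> (exp uw - 1) * F0" using up by (simp add: algebra_simps)
    moreover have "F0 - F (X k) \<le> (exp uw - 1) * F0"
    proof (cases "F (X k) \<le> F0")
      case True
      have "F0 - F (X k) \<le> (exp uw - 1) * F (X k)" using dn by (simp add: algebra_simps)
      also have "\<dots> \<le> (exp uw - 1) * F0" using True uw by (intro mult_left_mono) auto
      finally show ?thesis .
    next
      case False
      then show ?thesis using uw F0 by (smt (verit) mult_nonneg_nonneg one_le_exp_iff)
    qed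
    moreover have "(exp uw - 1) * F0 \<le> \<epsilon>" unfolding \<epsilon>_def using ex F0 by (intro mult_right_mono) auto
    ultimately show ?thesis by (simp add: abs_le_iff)
  qed
  have q1: "\<bar>poly q z\<bar> \<le> psi r * \<epsilon>" and q2: "\<bar>poly (pderiv q) z\<bar> \<le> 2 / w * (real r)\<^sup>2 * (psi r * \<epsilon>)"
    if "z \<in> {t0..t0 + w}" for z
    using interpolant_bounds[OF r w(1) dq dev that] by auto
  define d where "d = 1 - psi r * u * exp u"
  have d: "0 < d" using u(2) by (simp add: d_def)
  have lo: "d * F0 \<le> poly P z" if "z \<in> {t0..t0 + w}" for z
  proof -
    have "psi r * \<epsilon> \<le> psi r * (u * exp u * F0)"
      unfolding \<epsilon>_def using uw F0 psi_pos[of r] by (intro mult_left_mono mult_right_mono) auto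
    moreover have "poly P z = F0 + poly q z" by (simp add: q_def)
    ultimately show ?thesis using q1[OF that] by (simp add: d_def algebra_simps abs_le_iff)
  qed
  have Ppos: "0 < poly P z" if "z \<in> {t0..t0 + w}" for z
    using lo[OF that] d F0 by (smt (verit) mult_pos_pos)
  define Q where "Q = 2 * eta r * (real r)\<^sup>2 * psi r * M * exp u / (1 - psi r * u * exp u)"
  have Q0: "0 \<le> Q" using \<eta> psi_pos[of r] M d by (simp add: Q_def d_def)
  have dP: "\<bar>poly (pderiv P) z\<bar> \<le> Q * poly P z" if z: "z \<in> {t0..t0 + w}" for z
  proof -
    have "pderiv P = pderiv q" by (simp add: q_def pderiv_diff)
    then have "\<bar>poly (pderiv P) z\<bar> \<le> 2 / w * (real r)\<^sup>2 * (psi r * \<epsilon>)" using q2[OF z] by simp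
    also have "\<dots> = Q * (d * F0)" using w d by (simp add: \<epsilon>_def uw_def Q_def d_def field_simps)
    also have "\<dots> \<le> Q * poly P z" using lo[OF z] Q0 by (intro mult_left_mono) auto
    finally show ?thesis .
  qed
  have "norm (ln (poly P x) - ln (poly P y)) \<le> Q * norm (x - y)"
  proof (rule field_differentiable_bound[where S = "{t0..t0 + w}" and f' = "\<lambda>z. poly (pderiv P) z / poly P z"])
    fix z assume z: "z \<in> {t0..t0 + w}"
    show "((\<lambda>z. ln (poly P z)) has_field_derivative poly (pderiv P) z / poly P z) (at z within {t0..t0 + w})"
      using Ppos[OF z] by (auto intro!: derivative_eq_intros has_field_derivative_at_within[OF poly_DERIV])
    show "norm (poly (pderiv P) z / poly P z) \<le> Q"
      using dP[OF z] Ppos[OF z] by (simp add: abs_divide field_simps)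
  qed (use xy in auto)
  then have "ln (poly P x) \<le> Q * \<bar>x - y\<bar> + ln (poly P y)" by (simp add: abs_le_iff)
  then have "exp (ln (poly P x)) \<le> exp (Q * \<bar>x - y\<bar> + ln (poly P y))" by simp
  then show "poly P x \<le> exp (2 * eta r * (real r)\<^sup>2 * psi r * M * exp u / (1 - psi r * u * exp u) * \<bar>x - y\<bar>) * poly P y"
    using Ppos xy by (simp add: exp_add Q_def)
  show "0 < poly P x" by (rule Ppos[OF xy(1)])
qed

text \<open>A breakpoint between x and y splits their distance exactly, so the exponential factors
  of the two parts multiply to the required one.\<close>

lemma log_lipschitz_chain:
  fixes f :: "real \<Rightarrow> real" and t :: "nat \<Rightarrow> real"
  assumes mono: "\<And>j. t j \<le> t (Suc j)"
    and loc: "\<And>j x y. j < n \<Longrightarrow> x \<in> {t j..t (Suc j)} \<Longrightarrow> y \<in> {t j..t (Suc j)} \<Longrightarrow> f x \<le> exp (Q * \<bar>x - y\<bar>) * f y"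
    and n: "0 < n" and xy: "x \<in> {t 0..t n}" "y \<in> {t 0..t n}"
  shows "f x \<le> exp (Q * \<bar>x - y\<bar>) * f y"
  using n loc xy
proof (induction n arbitrary: x y rule: nat_induct_non_zero)
  case 1
  then show ?case by simp
next
  case (Suc n)
  have t0n: "t 0 \<le> t n" by (rule lift_Suc_mono_le[of t, OF mono]) simp
  have old: "f x \<le> exp (Q * \<bar>x - y\<bar>) * f y" if "x \<in> {t 0..t n}" "y \<in> {t 0..t n}" for x y
  proof (rule Suc.IH[OF _ that])
    show "f x \<le> exp (Q * \<bar>x - y\<bar>) * f y" if "j < n" "x \<in> {t j..t (Suc j)}" "y \<in> {t j..t (Suc j)}" for j x y
      by (rule Suc.prems(1)[OF _ that(2,3)]) (use that(1) in simp)
  qed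
  have new: "f x \<le> exp (Q * \<bar>x - y\<bar>) * f y" if "x \<in> {t n..t (Suc n)}" "y \<in> {t n..t (Suc n)}" for x y
    by (rule Suc.prems(1)[OF _ that]) simp
  have join: "f x \<le> exp (Q * \<bar>x - y\<bar>) * f y"
    if "f x \<le> exp (Q * \<bar>x - t n\<bar>) * f (t n)" "f (t n) \<le> exp (Q * \<bar>t n - y\<bar>) * f y"
      "\<bar>x - y\<bar> = \<bar>x - t n\<bar> + \<bar>t n - y\<bar>" for x y
  proof -
    have "f x \<le> exp (Q * \<bar>x - t n\<bar>) * (exp (Q * \<bar>t n - y\<bar>) * f y)"
      by (rule order_trans[OF that(1) mult_left_mono[OF that(2)]]) simp
    then show ?thesis by (simp add: that(3) distrib_left exp_add)
  qed
  have tn: "t n \<in> {t 0..t n}" "t n \<in> {t n..t (Suc n)}" using t0n mono by auto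
  consider "x \<le> t n" "y \<le> t n" | "x \<le> t n" "t n \<le> y" | "t n \<le> x" "y \<le> t n" | "t n \<le> x" "t n \<le> y" by linarith
  then show ?case
  proof cases
    case 1
    then show ?thesis using Suc.prems by (intro old) auto
  next
    case 2
    show ?thesis
      by (rule join[OF old[OF _ tn(1)] new[OF tn(2)]]) (use 2 Suc.prems in auto)
  next
    case 3
    show ?thesis
      by (rule join[OF new[OF _ tn(2)] old[OF tn(1)]]) (use 3 Suc.prems in auto)
  next
    case 4
    then show ?thesis using Suc.prems by (intro new) auto
  qed
qed

locale mesh =
  fixes r I :: nat and a b :: "nat \<Rightarrow> real" and N :: "nat \<Rightarrow> nat"
  assumes r2: "2 \<le> r" and I1: "1 \<le> I"
    and ab: "i \<in> {1..I} \<Longrightarrow> a i < b i" and N_pos: "i \<in> {1..I} \<Longrightarrow> 0 < N i"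
    and gap: "i \<in> {1..<I} \<Longrightarrow> b i < a (i + 1) \<and>
      2 * (sin (pi / (2 * real r + 2)))\<^sup>2 * sub_width a b N i \<le> a (i + 1) - b i"
begin

abbreviation "w \<equiv> sub_width a b N"
abbreviation "mp \<equiv> mesh_point a b N"
abbreviation "nd \<equiv> node r a b N"
abbreviation "T \<equiv> node_set r I a b N"
abbreviation "mdom \<equiv> (\<Union>i\<in>{1..I}. {a i..b i})"

lemma r1: "1 \<le> r" using r2 by simp

lemma w_pos: "i \<in> {1..I} \<Longrightarrow> 0 < w i" using ab N_pos by (simp add: sub_width_def)

lemma mp_0: "mp i 0 = a i" by (simp add: mesh_point_def)

lemma mp_N: "i \<in> {1..I} \<Longrightarrow> mp i (N i) = b i"
  using N_pos by (simp add: mesh_point_def sub_width_def)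

lemma mp_Suc: "mp i (Suc j) = mp i j + w i" by (simp add: mesh_point_def algebra_simps)

lemma mp_mono: "i \<in> {1..I} \<Longrightarrow> j \<le> k \<Longrightarrow> mp i j \<le> mp i k"
  using w_pos[of i] by (simp add: mesh_point_def mult_right_mono)

lemma nd_eq: "nd i j k = mp i (j - 1) + w i * (1 + ref_node r k) / 2" by (simp add: node_def)

lemma nd_0: "nd i j 0 = mp i (j - 1)" by (simp add: nd_eq ref_node_0[OF r1])

lemma nd_r: "1 \<le> j \<Longrightarrow> nd i j r = mp i j"
  using mp_Suc[of i "j - 1"] by (simp add: nd_eq ref_node_last[OF r1])

lemma nd_mem:
  assumes "i \<in> {1..I}" "1 \<le> j" "k \<le> r"
  shows "nd i j k \<in> {mp i (j - 1)..mp i j}"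
proof -
  have "0 \<le> w i * (1 + ref_node r k)" "w i * (1 + ref_node r k) \<le> w i * 2"
    using ref_node_bounds[OF r1 assms(3)] w_pos[OF assms(1)] by (auto intro!: mult_left_mono)
  then show ?thesis using mp_Suc[of i "j - 1"] assms(2) by (simp add: nd_eq)
qed

lemma nd_spacing:
  assumes "i \<in> {1..I}" "k < l" "l \<le> r"
  shows "2 * (sin (pi / (2 * real r + 2)))\<^sup>2 * w i \<le> nd i j l - nd i j k"
proof -
  have "w i / 2 * (4 * (sin (pi / (2 * real r + 2)))\<^sup>2) \<le> w i / 2 * (ref_node r l - ref_node r k)"
    using ref_node_spacing[OF r1 assms(2,3)] w_pos[OF assms(1)] by (intro mult_left_mono) auto
  then show ?thesis by (simp add: nd_eq field_simps)
qed

lemma nd_inj: "i \<in> {1..I} \<Longrightarrow> inj_on (nd i j) {..<r + 1}"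
  using inj_on_ref_node[OF r1] w_pos[of i] by (auto simp: inj_on_def nd_eq)

lemma a_b_mono: "i \<in> {1..I} \<Longrightarrow> k \<in> {1..I} \<Longrightarrow> i < k \<Longrightarrow> a (i + 1) \<le> a k \<and> b i < a k"
proof (induction k)
  case (Suc k)
  show ?case
  proof (cases "i = k")
    case True
    then show ?thesis using gap[of i] Suc.prems by simp
  next
    case False
    then have "a (i + 1) \<le> a k" "b i < a k" using Suc by auto
    moreover have "a k < b k" "b k < a (k + 1)" using ab[of k] gap[of k] Suc.prems False by auto
    ultimately show ?thesis by simp
  qed
qed simp

lemma mp_in: "i \<in> {1..I} \<Longrightarrow> j \<le> N i \<Longrightarrow> a i \<le> mp i j \<and> mp i j \<le> b i"
  using mp_mono[of i 0 j] mp_mono[of i j "N i"] mp_0[of i] mp_N[of i] by simp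

lemma piece_exists:
  assumes "i \<in> {1..I}" "x \<in> {a i..b i}"
  shows "\<exists>j\<in>{1..N i}. x \<in> {mp i (j - 1)..mp i j}"
proof -
  have "\<exists>j\<in>{1..n}. x \<in> {mp i (j - 1)..mp i j}" if "0 < n" "x \<in> {mp i 0..mp i n}" for n
    using that
  proof (induction n rule: nat_induct_non_zero)
    case (Suc n)
    show ?case
    proof (cases "x \<le> mp i n")
      case True
      then obtain j where "j \<in> {1..n}" "x \<in> {mp i (j - 1)..mp i j}" using Suc by auto
      then show ?thesis by (intro bexI[of _ j]) auto
    next
      case False
      then show ?thesis using Suc by (intro bexI[of _ "Suc n"]) auto
    qed
  qed auto
  from this[OF N_pos[OF assms(1)]] show ?thesis using assms mp_0[of i] mp_N[of i] by simp
qed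

lemma piece_subset:
  assumes "i \<in> {1..I}" "j \<in> {1..N i}" "x \<in> {mp i (j - 1)..mp i j}"
  shows "a i \<le> x \<and> x \<le> b i"
proof -
  have "j - 1 \<le> N i" "j \<le> N i" using assms(2) by auto
  then have "a i \<le> mp i (j - 1)" "mp i j \<le> b i" using mp_in[OF assms(1)] by auto
  then show ?thesis using assms(3) by auto
qed

definition lag :: "(real \<Rightarrow> real) \<Rightarrow> nat \<Rightarrow> nat \<Rightarrow> real poly" where
  "lag F i j = lagrange_poly (nd i j) (r + 1) F"

lemma lag_node: "i \<in> {1..I} \<Longrightarrow> k \<le> r \<Longrightarrow> poly (lag F i j) (nd i j k) = F (nd i j k)"
  unfolding lag_def by (rule poly_lagrange_poly_node[OF nd_inj]) auto

text \<open>Two pieces of one interval meet at most in a common endpoint. It is the last node of one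
  and the first node of the other, so both polynomials take the value of F there.\<close>

lemma lag_agree:
  assumes i: "i \<in> {1..I}" "i' \<in> {1..I}" and j: "j \<in> {1..N i}" "j' \<in> {1..N i'}"
    and x: "x \<in> {mp i (j - 1)..mp i j}" "x \<in> {mp i' (j' - 1)..mp i' j'}"
  shows "poly (lag F i j) x = poly (lag F i' j') x"
proof -
  have "i = i'"
  proof (rule ccontr)
    assume "i \<noteq> i'"
    then consider "i < i'" | "i' < i" by linarith
    then show False
      using a_b_mono[of i i'] a_b_mono[of i' i] piece_subset[OF i(1) j(1) x(1)] piece_subset[OF i(2) j(2) x(2)] i by cases auto
  qed
  have aux: "poly (lag F i j) x = poly (lag F i j') x"
    if jj: "j < j'" "j \<in> {1..N i}" "j' \<in> {1..N i}" "x \<in> {mp i (j - 1)..mp i j}" "x \<in> {mp i (j' - 1)..mp i j'}" for j j'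
  proof -
    have "mp i j \<le> mp i (j' - 1)" using jj by (intro mp_mono[OF i(1)]) auto
    then have "x = mp i j" "x = mp i (j' - 1)" using jj by auto
    then have "x = nd i j r" "x = nd i j' 0" using nd_r[of j i] nd_0[of i j'] jj by auto
    then show ?thesis using lag_node[OF i(1), of r F j] lag_node[OF i(1), of 0 F j'] by simp
  qed
  note j' = j(2)[folded \<open>i = i'\<close>] and x' = x(2)[folded \<open>i = i'\<close>]
  consider "j < j'" | "j = j'" | "j' < j" by linarith
  then have "poly (lag F i j) x = poly (lag F i j') x"
  proof cases
    case 1
    then show ?thesis by (rule aux[OF _ j(1) j' x(1) x'])
  next
    case 3
    then show ?thesis by (rule aux[OF _ j' j(1) x' x(1), symmetric])
  qed simp
  then show ?thesis by (simp only: \<open>i = i'\<close>)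
qed

lemma piecewise_interpolant_unique:
  assumes "\<exists>p :: real poly. degree p \<le> r \<and> (\<forall>k\<in>{0..r}. poly p (nd i j k) = F (nd i j k)) \<and>
      (\<forall>x\<in>{mp i (j - 1)..mp i j}. f x = poly p x)"
    and "i \<in> {1..I}" "x \<in> {mp i (j - 1)..mp i j}"
  shows "f x = poly (lag F i j) x"
proof -
  obtain p :: "real poly" where p: "degree p \<le> r" "\<forall>k\<in>{0..r}. poly p (nd i j k) = F (nd i j k)"
    "\<forall>x\<in>{mp i (j - 1)..mp i j}. f x = poly p x" using assms(1) by blast
  have "p = lag F i j"
  proof (rule poly_eqI_on_nodes[OF _ _ nd_inj[OF assms(2), of j]])
    show "degree (lag F i j) < r + 1" unfolding lag_def by (rule degree_lagrange_poly) simp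
    show "poly p (nd i j k) = poly (lag F i j) (nd i j k)" if "k < r + 1" for k
      using p(2) lag_node[OF assms(2), of k F j] that by simp
  qed (use p in simp)
  then show ?thesis using p(3) assms(3) by simp
qed

lemma piecewise_interpolant_eq:
  assumes i: "i \<in> {1..I}" and j: "j \<in> {1..N i}" and x: "x \<in> {mp i (j - 1)..mp i j}"
  shows "piecewise_interpolant r I a b N F x = poly (lag F i j) x"
proof -
  define Pr where "Pr f \<longleftrightarrow> continuous_on mdom f \<and> (\<forall>x. x \<notin> mdom \<longrightarrow> f x = 0) \<and>
     (\<forall>i\<in>{1..I}. \<forall>j\<in>{1..N i}. \<exists>p :: real poly. degree p \<le> r \<and>
       (\<forall>k\<in>{0..r}. poly p (nd i j k) = F (nd i j k)) \<and>
       (\<forall>x\<in>{mp i (j - 1)..mp i j}. f x = poly p x))" for f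
  define R where "R x ij \<longleftrightarrow> fst ij \<in> {1..I} \<and> snd ij \<in> {1..N (fst ij)} \<and>
     x \<in> {mp (fst ij) (snd ij - 1)..mp (fst ij) (snd ij)}" for x ij
  \<comment> \<open>The witness for the definite description: by \<open>lag_agree\<close> any piece
    containing x may be chosen, and outside \<open>mdom\<close> the value is forced to be 0.\<close>
  define f where "f x = (if x \<in> mdom then (let ij = SOME ij. R x ij in poly (lag F (fst ij) (snd ij)) x) else 0)" for x
  have mem: "x \<in> mdom" if "i \<in> {1..I}" "j \<in> {1..N i}" "x \<in> {mp i (j - 1)..mp i j}" for i j x
    using piece_subset[OF that] that(1) by auto
  have fx: "f x = poly (lag F i j) x" if ij: "i \<in> {1..I}" "j \<in> {1..N i}" "x \<in> {mp i (j - 1)..mp i j}" for i j x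
  proof -
    have "R x (i, j)" using ij by (simp add: R_def)
    then have "R x (SOME ij. R x ij)" by (rule someI)
    then have "poly (lag F (fst (SOME ij. R x ij)) (snd (SOME ij. R x ij))) x = poly (lag F i j) x"
      unfolding R_def using ij by (intro lag_agree) auto
    then show ?thesis using mem[OF ij] by (simp add: f_def Let_def)
  qed
  have mdom_eq: "mdom = (\<Union>ij\<in>Sigma {1..I} (\<lambda>i. {1..N i}). {mp (fst ij) (snd ij - 1)..mp (fst ij) (snd ij)})"
    using mem piece_exists by fastforce
  have "continuous_on mdom f"
    unfolding mdom_eq
  proof (rule continuous_on_closed_Union)
    fix ij assume "ij \<in> Sigma {1..I} (\<lambda>i. {1..N i})"
    then have "continuous_on {mp (fst ij) (snd ij - 1)..mp (fst ij) (snd ij)} f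
      \<longleftrightarrow> continuous_on {mp (fst ij) (snd ij - 1)..mp (fst ij) (snd ij)} (poly (lag F (fst ij) (snd ij)))"
      using fx by (intro continuous_on_cong) auto
    then show "continuous_on {mp (fst ij) (snd ij - 1)..mp (fst ij) (snd ij)} f"
      by (simp add: continuous_on_poly continuous_on_id)
  qed auto
  moreover have "\<exists>p :: real poly. degree p \<le> r \<and> (\<forall>k\<in>{0..r}. poly p (nd i j k) = F (nd i j k)) \<and>
       (\<forall>x\<in>{mp i (j - 1)..mp i j}. f x = poly p x)" if ij: "i \<in> {1..I}" "j \<in> {1..N i}" for i j
  proof (intro exI[of _ "lag F i j"] conjI ballI)
    show "degree (lag F i j) \<le> r"
      using degree_lagrange_poly[of "r + 1" "nd i j" F] by (simp add: lag_def)
  qed (use fx[OF ij] lag_node[OF ij(1)] in auto)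
  ultimately have Pf: "Pr f" unfolding Pr_def by (auto simp: f_def)
  have "g = f" if "Pr g" for g
  proof
    fix x
    show "g x = f x"
    proof (cases "x \<in> mdom")
      case True
      then obtain i j where ij: "i \<in> {1..I}" "j \<in> {1..N i}" "x \<in> {mp i (j - 1)..mp i j}"
        using piece_exists by blast
      then show ?thesis using that piecewise_interpolant_unique[OF _ ij(1,3), of F g] fx[OF ij]
        unfolding Pr_def by auto
    next
      case False
      then have "g x = 0" using that unfolding Pr_def by blast
      moreover have "f x = 0" unfolding f_def using False by (rule if_not_P)
      ultimately show ?thesis by simp
    qed
  qed
  then have "(THE f. Pr f) = f" using Pf by (intro the_equality)
  moreover have "piecewise_interpolant r I a b N F = (THE f. Pr f)"
    unfolding piecewise_interpolant_def Pr_def by (rule refl)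
  ultimately show ?thesis using fx[OF i j x] by simp
qed

lemma node_in_T: "i \<in> {1..I} \<Longrightarrow> j \<in> {1..N i} \<Longrightarrow> k \<le> r \<Longrightarrow> nd i j k \<in> T"
  unfolding node_set_def by force

lemma T_cases:
  assumes "\<xi> \<in> T"
  obtains i j k where "i \<in> {1..I}" "j \<in> {1..N i}" "k \<le> r" "\<xi> = nd i j k"
proof -
  from assms obtain i j k where "\<xi> = nd i j k \<and> i \<in> {1..I} \<and> j \<in> {1..N i} \<and> k \<in> {0..r}"
    unfolding node_set_def by blast
  then show ?thesis using that[of i j k] by simp
qed

lemma finite_T: "finite T"
proof -
  have "T \<subseteq> (\<lambda>(i, j, k). nd i j k) ` (Sigma {1..I} (\<lambda>i. {1..N i} \<times> {0..r}))"
  proof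
    fix \<xi> assume "\<xi> \<in> T"
    then obtain i j k where "i \<in> {1..I}" "j \<in> {1..N i}" "k \<le> r" "\<xi> = nd i j k" by (rule T_cases)
    then show "\<xi> \<in> (\<lambda>(i, j, k). nd i j k) ` (Sigma {1..I} (\<lambda>i. {1..N i} \<times> {0..r}))"
      by (intro image_eqI[of _ _ "(i, j, k)"]) auto
  qed
  then show ?thesis by (rule finite_subset) simp
qed

lemma T_two_points: "\<exists>p\<in>T. \<exists>q\<in>T. p \<noteq> q"
proof -
  have i: "1 \<in> {1..I}" "1 \<in> {1..N 1}" using I1 N_pos[of 1] by auto
  have "nd 1 1 0 \<noteq> nd 1 1 1"
    using inj_onD[OF nd_inj[OF i(1), of 1], of 0 1] r1 by auto
  then show ?thesis using node_in_T[OF i, of 0] node_in_T[OF i, of 1] r1 by blast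
qed

lemma T_subset: "T \<subseteq> mdom"
proof
  fix \<xi> assume "\<xi> \<in> T"
  then obtain i j k where ijk: "i \<in> {1..I}" "j \<in> {1..N i}" "k \<le> r" "\<xi> = nd i j k" by (rule T_cases)
  then have "a i \<le> \<xi> \<and> \<xi> \<le> b i" using nd_mem[OF ijk(1), of j k] by (intro piece_subset) auto
  then show "\<xi> \<in> mdom" using ijk(1) by auto
qed

lemma Min_width: "i \<in> {1..I} \<Longrightarrow> Min (w ` {1..I}) \<le> w i" by simp

lemma Min_width_pos: "0 < Min (w ` {1..I})"
  using I1 w_pos by (subst Min_gr_iff) auto

text \<open>Inside a piece this is the spacing of the reference nodes scaled by w / 2. Between
  different intervals it is the gap condition of the mesh, which carries the same constant. Across a
  whole subinterval it holds because that constant is at most 1.\<close>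

lemma T_separation:
  assumes "\<xi> \<in> T" "\<zeta> \<in> T" "\<xi> \<noteq> \<zeta>"
  shows "2 * (sin (pi / (2 * real r + 2)))\<^sup>2 * Min (w ` {1..I}) \<le> \<bar>\<xi> - \<zeta>\<bar>"
proof -
  define \<delta> where "\<delta> = 2 * (sin (pi / (2 * real r + 2)))\<^sup>2"
  have \<delta>: "0 \<le> \<delta>" "\<delta> \<le> 1" using sin_sq_node_bounds(2)[OF r2] by (simp_all add: \<delta>_def)
  have Min: "\<delta> * Min (w ` {1..I}) \<le> \<delta> * w i" if "i \<in> {1..I}" for i
    using Min_width[OF that] \<delta> by (intro mult_left_mono) auto
  have main: "\<delta> * Min (w ` {1..I}) \<le> \<zeta> - \<xi>" if T: "\<xi> \<in> T" "\<zeta> \<in> T" and less: "\<xi> < \<zeta>" for \<xi> \<zeta>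
  proof -
    obtain i j k where x: "i \<in> {1..I}" "j \<in> {1..N i}" "k \<le> r" "\<xi> = nd i j k" using T(1) by (rule T_cases)
    obtain i' j' k' where z: "i' \<in> {1..I}" "j' \<in> {1..N i'}" "k' \<le> r" "\<zeta> = nd i' j' k'" using T(2) by (rule T_cases)
    have xm: "mp i (j - 1) \<le> \<xi>" "\<xi> \<le> mp i j" using nd_mem[OF x(1) _ x(3), of j] x by auto
    have zm: "mp i' (j' - 1) \<le> \<zeta>" "\<zeta> \<le> mp i' j'" using nd_mem[OF z(1) _ z(3), of j'] z by auto
    have xab: "a i \<le> \<xi>" "\<xi> \<le> b i" using piece_subset[OF x(1,2), of \<xi>] xm by auto
    have zab: "a i' \<le> \<zeta>" "\<zeta> \<le> b i'" using piece_subset[OF z(1,2), of \<zeta>] zm by auto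
    have "\<not> i' < i"
      using a_b_mono[OF z(1) x(1)] xab zab less by auto
    moreover have ?thesis if "i < i'"
    proof -
      have "\<delta> * w i \<le> a (i + 1) - b i" using gap[of i] that z(1) x(1) by (auto simp: \<delta>_def)
      moreover have "a (i + 1) \<le> a i'" using a_b_mono[OF x(1) z(1) that] by simp
      ultimately show ?thesis using Min[OF x(1)] xab zab by linarith
    qed
    moreover have ?thesis if ii: "i = i'"
    proof -
      have sp: "\<delta> * w i \<le> nd i l k2 - nd i l k1" if "k1 < k2" "k2 \<le> r" for l k1 k2
        using nd_spacing[OF x(1) that] by (simp add: \<delta>_def)
      consider "j = j'" | "j < j'" | "j' < j" by linarith
      then have "\<delta> * w i \<le> \<zeta> - \<xi>"
      proof cases
        case 1
        have "k < k'"
        proof (rule ccontr)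
          assume "\<not> k < k'"
          then consider "k = k'" | "k' < k" by linarith
          then have "\<zeta> \<le> \<xi>"
          proof cases
            case 2
            have "0 \<le> \<delta> * w i" using \<delta> w_pos[OF x(1)] by simp
            then show ?thesis using sp[OF 2 x(3), of j] x z 1 ii by simp
          qed (use x z 1 ii in simp)
          then show False using less by simp
        qed
        then show ?thesis using sp[OF _ z(3), of k j] x z 1 ii by simp
      next
        case 2
        have m1: "mp i j \<le> mp i (j' - 1)" using 2 by (intro mp_mono[OF x(1)]) auto
        show ?thesis
        proof (cases "k = r")
          case False
          then have "\<delta> * w i \<le> mp i j - \<xi>" using sp[of k r j] nd_r[of j i] x by simp
          then show ?thesis using m1 zm ii by simp
        next
          case True
          then have xj: "\<xi> = mp i j" using nd_r[of j i] x by simp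
          show ?thesis
          proof (cases "k' = 0")
            case False
            then have "\<delta> * w i \<le> \<zeta> - mp i (j' - 1)" using sp[of 0 k' j'] nd_0[of i j'] z ii by simp
            then show ?thesis using m1 xj by simp
          next
            case True
            then have zj: "\<zeta> = mp i (j' - 1)" using nd_0[of i j'] z ii by simp
            \<comment> \<open>The last node of piece j and the first node of piece j + 1 are the
              same point, so distinct nodes here leave at least one full piece between them.\<close>
            then have "j < j' - 1" using 2 xj less by (metis Suc_diff_1 less_Suc_eq less_irrefl less_nat_zero_code neq0_conv)
            then have "mp i (Suc j) \<le> mp i (j' - 1)" by (intro mp_mono[OF x(1)]) auto
            then have "w i \<le> \<zeta> - \<xi>" unfolding zj xj by (simp add: mp_Suc)
            moreover have "\<delta> * w i \<le> 1 * w i" using \<delta> w_pos[OF x(1)] by (intro mult_right_mono) auto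
            ultimately show ?thesis by simp
          qed
        qed
      next
        case 3
        have "mp i j' \<le> mp i (j - 1)" using 3 by (intro mp_mono[OF x(1)]) auto
        then show ?thesis using xm zm ii less by simp
      qed
      then show ?thesis using Min[OF x(1)] by simp
    qed
    ultimately show ?thesis by linarith
  qed
  show ?thesis
    using main[of \<xi> \<zeta>] main[of \<zeta> \<xi>] assms unfolding \<delta>_def by (cases "\<xi> < \<zeta>") (auto simp: abs_if)
qed

text \<open>The estimate is confined to one mesh interval, whose pieces can be chained. This
  suffices because a branch maps all of S into a single interval.\<close>

lemma interpolant_cone:
  fixes F :: "real \<Rightarrow> real"
  assumes F: "\<And>\<xi> \<zeta>. \<xi> \<in> T \<Longrightarrow> \<zeta> \<in> T \<Longrightarrow> F \<xi> \<le> exp (M * \<bar>\<xi> - \<zeta>\<bar>) * F \<zeta>" and Fpos: "\<And>\<xi>. \<xi> \<in> T \<Longrightarrow> 0 < F \<xi>"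
    and M: "0 < M" and h: "\<And>i. i \<in> {1..I} \<Longrightarrow> w i \<le> h" and u: "u = M * eta r * h" "psi r * u * exp u < 1"
    and i: "i \<in> {1..I}" and xy: "x \<in> {a i..b i}" "y \<in> {a i..b i}"
  shows "0 < piecewise_interpolant r I a b N F x"
    and "piecewise_interpolant r I a b N F x \<le>
      exp (2 * eta r * (real r)\<^sup>2 * psi r * M * exp u / (1 - psi r * u * exp u) * \<bar>x - y\<bar>) *
      piecewise_interpolant r I a b N F y"
proof -
  define f where "f = piecewise_interpolant r I a b N F"
  define Q where "Q = 2 * eta r * (real r)\<^sup>2 * psi r * M * exp u / (1 - psi r * u * exp u)"
  have piece: "0 < f x \<and> f x \<le> exp (Q * \<bar>x - y\<bar>) * f y"
    if j: "j \<in> {1..N i}" and x: "x \<in> {mp i (j - 1)..mp i j}" and y: "y \<in> {mp i (j - 1)..mp i j}" for j x y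
  proof -
    have mpj: "mp i j = mp i (j - 1) + w i" using mp_Suc[of i "j - 1"] j by simp
    note il = interpolant_log_lipschitz[OF r2 w_pos[OF i] h[OF i] nd_eq[of i j] M _ _ u, of F x y, folded lag_def]
    have "0 < poly (lag F i j) x"
      by (rule il(1)) (use F Fpos node_in_T[OF i j] x y mpj in auto)
    moreover have "poly (lag F i j) x \<le> exp (Q * \<bar>x - y\<bar>) * poly (lag F i j) y"
      unfolding Q_def by (rule il(2)) (use F Fpos node_in_T[OF i j] x y mpj in auto)
    ultimately show ?thesis
      using piecewise_interpolant_eq[OF i j x] piecewise_interpolant_eq[OF i j y] by (simp add: f_def)
  qed
  show "0 < piecewise_interpolant r I a b N F x"
    using piece_exists[OF i xy(1)] piece by (auto simp: f_def)
  have "f x \<le> exp (Q * \<bar>x - y\<bar>) * f y"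
  proof (rule log_lipschitz_chain[of "mp i" "N i"])
    show "mp i j \<le> mp i (Suc j)" for j by (rule mp_mono[OF i]) simp
    show "f x \<le> exp (Q * \<bar>x - y\<bar>) * f y" if "j < N i" "x \<in> {mp i j..mp i (Suc j)}" "y \<in> {mp i j..mp i (Suc j)}" for j x y
      using piece[of "Suc j" x y] that by auto
  qed (use N_pos[OF i] xy mp_0[of i] mp_N[OF i] in auto)
  then show "piecewise_interpolant r I a b N F x \<le>
      exp (2 * eta r * (real r)\<^sup>2 * psi r * M * exp u / (1 - psi r * u * exp u) * \<bar>x - y\<bar>) *
      piecewise_interpolant r I a b N F y" by (simp add: f_def Q_def)
qed

lemma interpolant_linear:
  assumes "x \<in> mdom"
  shows "piecewise_interpolant r I a b N (\<lambda>t. F t + c * G t) x =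
    piecewise_interpolant r I a b N F x + c * piecewise_interpolant r I a b N G x"
proof -
  obtain i j where ij: "i \<in> {1..I}" "j \<in> {1..N i}" "x \<in> {mp i (j - 1)..mp i j}"
    using assms piece_exists by blast
  show ?thesis unfolding piecewise_interpolant_eq[OF ij] lag_def poly_lagrange_poly
    by (simp add: sum.distrib sum_distrib_left algebra_simps)
qed

lemma interpolant_bound:
  assumes "\<And>t. t \<in> T \<Longrightarrow> \<bar>F t\<bar> \<le> C" "x \<in> mdom"
  shows "\<bar>piecewise_interpolant r I a b N F x\<bar> \<le> psi r * C"
proof -
  obtain i j where ij: "i \<in> {1..I}" "j \<in> {1..N i}" "x \<in> {mp i (j - 1)..mp i j}"
    using assms piece_exists by blast
  show ?thesis unfolding piecewise_interpolant_eq[OF ij]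
  proof (rule interpolant_bounds(1)[OF r2 w_pos[OF ij(1)]])
    show "degree (lag F i j) \<le> r"
      using degree_lagrange_poly[of "r + 1" "nd i j" F] by (simp add: lag_def)
    show "\<bar>poly (lag F i j) (mp i (j - 1) + w i * (1 + ref_node r k) / 2)\<bar> \<le> C" if "k \<le> r" for k
      unfolding nd_eq[symmetric] lag_node[OF ij(1) that] by (intro assms node_in_T ij that)
    show "x \<in> {mp i (j - 1)..mp i (j - 1) + w i}" using ij mp_Suc[of i "j - 1"] by auto
  qed
qed

end

section \<open>Resolvents and spectral radii in spaces of continuous functions\<close>

lemma complexified_continuous_functions:
  "complexified_space (continuous_functions D) = {f. continuous_on D f \<and> (\<forall>x. x \<notin> D \<longrightarrow> f x = 0)}"
proof (intro set_eqI iffI)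
  fix f assume "f \<in> complexified_space (continuous_functions D)"
  then have c: "continuous_on D (\<lambda>x. Re (f x))" "continuous_on D (\<lambda>x. Im (f x))"
    and z: "x \<notin> D \<Longrightarrow> f x = 0" for x
    by (auto simp: complexified_space_def continuous_functions_def complex_eq_iff)
  have "continuous_on D (\<lambda>x. of_real (Re (f x)) + \<i> * of_real (Im (f x)))"
    by (intro continuous_on_add continuous_on_mult continuous_on_of_real continuous_on_const c)
  then show "f \<in> {f. continuous_on D f \<and> (\<forall>x. x \<notin> D \<longrightarrow> f x = 0)}"
    using z by (simp flip: complex_eq)
qed (auto simp: complexified_space_def continuous_functions_def intro!: continuous_intros)

lemma sup_norm_on_ge:
  assumes "compact D" "continuous_on D f" "x \<in> D"
  shows "cmod (f x) \<le> sup_norm_on D f"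
proof -
  have "compact ((\<lambda>x. cmod (f x)) ` D)"
    using assms by (intro compact_continuous_image continuous_intros)
  then have "bdd_above ((\<lambda>x. cmod (f x)) ` D)" by (simp add: bounded_imp_bdd_above compact_imp_bounded)
  then show ?thesis unfolding sup_norm_on_def using assms by (intro cSUP_upper)
qed

text \<open>The growth bound makes the Neumann series of L / z converge geometrically. Completeness
  of the function space enters through the Weierstrass test and uniform limits. The estimate
  \<open>bound\<close> supplies both injectivity and the bounded inverse demanded in
  \<open>spectrum_on\<close>.\<close>

lemma neumann_resolvent:
  fixes D :: "real set" and L :: "(real \<Rightarrow> complex) \<Rightarrow> real \<Rightarrow> complex"
  defines "W \<equiv> {f. continuous_on D f \<and> (\<forall>x. x \<notin> D \<longrightarrow> f x = 0)}"
  assumes D: "compact D" "D \<noteq> {}"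
    and maps: "\<And>f. f \<in> W \<Longrightarrow> L f \<in> W"
    and lin: "\<And>f g c. f \<in> W \<Longrightarrow> g \<in> W \<Longrightarrow> L (\<lambda>x. f x + c * g x) = (\<lambda>x. L f x + c * L g x)"
    and pow: "\<And>f B x n. f \<in> W \<Longrightarrow> (\<And>y. y \<in> D \<Longrightarrow> cmod (f y) \<le> B) \<Longrightarrow> x \<in> D \<Longrightarrow>
                cmod ((L ^^ n) f x) \<le> K * \<rho> ^ n * B"
    and K: "0 \<le> K" and \<rho>: "0 \<le> \<rho>" "\<rho> < cmod z"
  shows "bij_betw (\<lambda>f x. z * f x - L f x) W W"
    and "\<exists>C. \<forall>f\<in>W. sup_norm_on D f \<le> C * sup_norm_on D (\<lambda>x. z * f x - L f x)"
proof -
  define P where "P f = (\<lambda>x. z * f x - L f x)" for f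
  have z0: "z \<noteq> 0" using \<rho> by auto
  have comb: "(\<lambda>x. f x + c * g x) \<in> W" if "f \<in> W" "g \<in> W" for f g c
    using that unfolding W_def by (auto intro!: continuous_intros)
  have zero: "(\<lambda>x. 0) \<in> W" by (simp add: W_def)
  have scale: "(\<lambda>x. c * g x) \<in> W" if "g \<in> W" for g c using comb[OF zero that, of c] by simp
  have L0: "L (\<lambda>x. 0) = (\<lambda>x. 0)"
    using lin[OF zero zero, of 1] by (auto simp: fun_eq_iff)
  have Ls: "L (\<lambda>x. c * g x) = (\<lambda>x. c * L g x)" if "g \<in> W" for g c
    using lin[OF zero that, of c] L0 by simp
  have Ln: "(L ^^ n) f \<in> W" if "f \<in> W" for f n by (induction n) (use that maps in auto)
  have linn: "(L ^^ n) (\<lambda>x. f x + c * g x) = (\<lambda>x. (L ^^ n) f x + c * (L ^^ n) g x)"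
    if "f \<in> W" "g \<in> W" for f g c n
    by (induction n) (use that lin Ln in auto)
  have linns: "(L ^^ n) (\<lambda>x. c * f x) = (\<lambda>x. c * (L ^^ n) f x)" if "f \<in> W" for f c n
    by (induction n) (use that Ls Ln in auto)
  have PW: "P f \<in> W" if "f \<in> W" for f
    using comb[OF scale[OF that, of z] maps[OF that], of "- 1"] by (simp add: P_def)
  define q where "q = \<rho> / cmod z"
  have q: "0 \<le> q" "q < 1" using \<rho> by (simp_all add: q_def divide_less_eq)
  have term_le: "cmod ((L ^^ n) g x / z ^ (n + 1)) \<le> K * B / cmod z * q ^ n"
    if "g \<in> W" "\<And>y. y \<in> D \<Longrightarrow> cmod (g y) \<le> B" "x \<in> D" for g B x n
    using pow[OF that, of n] z0
    by (simp add: norm_divide norm_power norm_mult q_def power_divide field_simps)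
  \<comment> \<open>A finite telescoping identity with remainder; it yields \<open>bound\<close> for
    every f before any series is summed.\<close>
  have expand: "f x = (\<Sum>n<N. (L ^^ n) (P f) x / z ^ (n + 1)) + (L ^^ N) f x / z ^ N"
    if f: "f \<in> W" for f x N
  proof (induction N)
    case (Suc N)
    have "(L ^^ N) (P f) x = z * (L ^^ N) f x - (L ^^ Suc N) f x"
    proof -
      have "P f = (\<lambda>x. z * f x + (- 1) * L f x)" by (simp add: P_def)
      then have "(L ^^ N) (P f) x = z * (L ^^ N) f x - (L ^^ N) (L f) x"
        using linn[OF scale[OF f, of z] maps[OF f], of N "- 1"] linns[OF f, of N z] by simp
      then show ?thesis by (simp add: funpow_swap1)
    qed
    then have "(L ^^ N) f x / z ^ N = (L ^^ N) (P f) x / z ^ (N + 1) + (L ^^ Suc N) f x / z ^ Suc N"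
      using z0 by (simp add: field_simps)
    then show ?case using Suc by (simp add: add.assoc)
  qed simp
  have bound: "cmod (f x) \<le> K * B / (cmod z * (1 - q))"
    if f: "f \<in> W" and B: "\<And>y. y \<in> D \<Longrightarrow> cmod (P f y) \<le> B" and x: "x \<in> D" for f x B
  proof -
    define Bf where "Bf = sup_norm_on D f"
    have Bf: "cmod (f y) \<le> Bf" if "y \<in> D" for y
      unfolding Bf_def using f D that by (intro sup_norm_on_ge) (auto simp: W_def)
    have B0: "0 \<le> B" using B[OF x] norm_ge_zero order_trans by blast
    have le: "cmod (f x) \<le> K * B / (cmod z * (1 - q)) + K * Bf * q ^ N" for N
    proof -
      have "cmod (f x) \<le> cmod (\<Sum>n<N. (L ^^ n) (P f) x / z ^ (n + 1)) + cmod ((L ^^ N) f x / z ^ N)"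
        by (subst expand[OF f, of x N]) (rule norm_triangle_ineq)
      also have "cmod (\<Sum>n<N. (L ^^ n) (P f) x / z ^ (n + 1)) \<le> (\<Sum>n<N. K * B / cmod z * q ^ n)"
        by (rule sum_norm_le) (use term_le[OF PW[OF f] B x] in auto)
      also have "(\<Sum>n<N. K * B / cmod z * q ^ n) = K * B / cmod z * ((1 - q ^ N) / (1 - q))"
        unfolding sum_distrib_left[symmetric] using q by (simp add: sum_gp_strict)
      also have "\<dots> \<le> K * B / cmod z * (1 / (1 - q))"
        using q K B0 by (intro mult_left_mono divide_right_mono) auto
      also have "cmod ((L ^^ N) f x / z ^ N) \<le> K * Bf * q ^ N"
        using pow[OF f Bf x, of N] z0 by (simp add: norm_divide norm_power q_def power_divide field_simps)
      finally show ?thesis by simp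
    qed
    have "(\<lambda>N. K * B / (cmod z * (1 - q)) + K * Bf * q ^ N) \<longlonglongrightarrow> K * B / (cmod z * (1 - q)) + K * Bf * 0"
      using q by (intro tendsto_intros LIMSEQ_power_zero) auto
    then show ?thesis using le by (intro LIMSEQ_le_const[of _ _ "cmod (f x)"]) auto
  qed
  show "\<exists>C. \<forall>f\<in>W. sup_norm_on D f \<le> C * sup_norm_on D (\<lambda>x. z * f x - L f x)"
  proof (intro exI ballI)
    fix f assume f: "f \<in> W"
    have "cmod (P f y) \<le> sup_norm_on D (P f)" if "y \<in> D" for y
      using PW[OF f] D that by (intro sup_norm_on_ge) (auto simp: W_def)
    from bound[OF f this] have "cmod (f x) \<le> K / (cmod z * (1 - q)) * sup_norm_on D (P f)" if "x \<in> D" for x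
      using that by simp
    then show "sup_norm_on D f \<le> K / (cmod z * (1 - q)) * sup_norm_on D (\<lambda>x. z * f x - L f x)"
      unfolding sup_norm_on_def[of D f] P_def using D by (intro cSUP_least) auto
  qed
  have inj: "inj_on P W"
  proof (rule inj_onI)
    fix f g assume fg: "f \<in> W" "g \<in> W" "P f = P g"
    define e where "e = (\<lambda>x. f x + (- 1) * g x)"
    have e: "e \<in> W" unfolding e_def by (rule comb) (use fg in auto)
    have "P e = (\<lambda>x. P f x - P g x)"
      unfolding e_def P_def lin[OF fg(1,2)] by (simp add: algebra_simps)
    then have "P e y = 0" for y using fg(3) by simp
    then have "cmod (e x) \<le> K * 0 / (cmod z * (1 - q))" if "x \<in> D" for x
      using bound[OF e _ that, of 0] by simp
    then have "e x = 0" for x using e by (cases "x \<in> D") (auto simp: W_def)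
    then show "f = g" by (auto simp: e_def fun_eq_iff)
  qed
  have surj: "\<exists>f\<in>W. P f = g" if g: "g \<in> W" for g
  proof -
    define B where "B = sup_norm_on D g"
    have B: "cmod (g y) \<le> B" if "y \<in> D" for y
      unfolding B_def using g D that by (intro sup_norm_on_ge) (auto simp: W_def)
    define t where "t n = (\<lambda>x. (L ^^ n) g x / z ^ (n + 1))" for n
    define F where "F N = (\<lambda>x. \<Sum>n<N. t n x)" for N
    define f where "f = (\<lambda>x. if x \<in> D then \<Sum>n. t n x else 0)"
    have "t n \<in> W" for n
      using scale[OF Ln[OF g, of n], of "1 / z ^ (n + 1)"] by (simp add: t_def)
    then have FW: "F N \<in> W" for N
    proof (induction N)
      case (Suc N)
      then show ?case using comb[of "F N" "t N" 1] by (simp add: F_def)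
    qed (simp add: F_def zero)
    have u: "uniform_limit D F (\<lambda>x. \<Sum>n. t n x) sequentially"
      unfolding F_def
    proof (rule Weierstrass_m_test)
      show "norm (t n x) \<le> K * B / cmod z * q ^ n" if "x \<in> D" for n x
        using term_le[OF g B that, of n] by (simp add: t_def)
      show "summable (\<lambda>n. K * B / cmod z * q ^ n)" using q by (intro summable_mult summable_geometric) auto
    qed
    have uf: "uniform_limit D F f sequentially"
      using u by (rule uniform_limit_cong'[THEN iffD1, rotated -1]) (auto simp: f_def)
    have fW: "f \<in> W"
    proof -
      have "continuous_on D f"
        by (rule uniform_limit_theorem[OF _ uf]) (use FW in \<open>auto simp: W_def\<close>)
      then show ?thesis by (simp add: W_def f_def)
    qed
    have lim: "(\<lambda>N. F N x) \<longlonglongrightarrow> f x" if "x \<in> D" for x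
      using tendsto_uniform_limitI[OF uf that] .
    have LF: "(\<lambda>N. L (F N) x) \<longlonglongrightarrow> L f x" if x: "x \<in> D" for x
    proof (rule LIMSEQ_I)
      fix e :: real assume e: "0 < e"
      define e' where "e' = e / (K * \<rho> + 1)"
      have Kr: "0 \<le> K * \<rho>" using K \<rho> by simp
      have e': "0 < e'" using e Kr by (simp add: e'_def)
      obtain N0 where N0: "\<And>N y. N0 \<le> N \<Longrightarrow> y \<in> D \<Longrightarrow> cmod (F N y - f y) < e'"
        using uniform_limitD[OF uf e'] by (auto simp: eventually_sequentially dist_norm)
      have "norm (L (F N) x - L f x) < e" if N: "N0 \<le> N" for N
      proof -
        have eW: "(\<lambda>x. F N x + (- 1) * f x) \<in> W" by (rule comb[OF FW fW])
        have "cmod ((L ^^ 1) (\<lambda>x. F N x + (- 1) * f x) x) \<le> K * \<rho> ^ 1 * e'"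
          by (rule pow[OF eW _ x]) (use N0[OF N] in \<open>auto intro: less_imp_le\<close>)
        then have "cmod (L (F N) x - L f x) \<le> K * \<rho> * e'" using lin[OF FW fW, of N "- 1"] by simp
        also have "\<dots> < (K * \<rho> + 1) * e'" using e' by (simp add: algebra_simps)
        also have "\<dots> = e" using Kr by (simp add: e'_def)
        finally show ?thesis by simp
      qed
      then show "\<exists>N0. \<forall>N\<ge>N0. norm (L (F N) x - L f x) < e" by blast
    qed
    have PF: "z * F N x - L (F N) x = g x - (L ^^ N) g x / z ^ N" for N x
    proof (induction N)
      case 0
      show ?case by (simp add: F_def L0)
    next
      case (Suc N)
      have "F (Suc N) = (\<lambda>x. F N x + (1 / z ^ (N + 1)) * (L ^^ N) g x)" by (simp add: F_def t_def)
      then have "L (F (Suc N)) x = L (F N) x + (L ^^ Suc N) g x / z ^ (N + 1)"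
        using lin[OF FW Ln[OF g], of N "1 / z ^ (N + 1)" N] by simp
      moreover have "z * F (Suc N) x = z * F N x + (L ^^ N) g x / z ^ N"
        using z0 by (simp add: F_def t_def algebra_simps)
      ultimately show ?case using Suc by (simp add: algebra_simps)
    qed
    have "P f x = g x" for x
    proof (cases "x \<in> D")
      case True
      have "(\<lambda>N. z * F N x - L (F N) x) \<longlonglongrightarrow> z * f x - L f x"
        by (intro tendsto_intros lim LF True)
      moreover have "(\<lambda>N. g x - (L ^^ N) g x / z ^ N) \<longlonglongrightarrow> g x - 0"
      proof (rule tendsto_diff[OF tendsto_const])
        show "(\<lambda>N. (L ^^ N) g x / z ^ N) \<longlonglongrightarrow> 0"
        proof (rule Lim_null_comparison)
          have "norm ((L ^^ N) g x / z ^ N) \<le> K * B * q ^ N" for N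
            using pow[OF g B True, of N] z0 by (simp add: norm_divide norm_power q_def power_divide field_simps)
          then show "\<forall>\<^sub>F N in sequentially. norm ((L ^^ N) g x / z ^ N) \<le> K * B * q ^ N" by simp
          show "(\<lambda>N. K * B * q ^ N) \<longlonglongrightarrow> 0"
            using tendsto_mult_left[OF LIMSEQ_power_zero[of q], of "K * B"] q by simp
        qed
      qed
      ultimately have "z * f x - L f x = g x - 0" unfolding PF by (rule LIMSEQ_unique)
      then show ?thesis by (simp add: P_def)
    next
      case False
      then show ?thesis using fW maps[OF fW] g by (simp add: P_def W_def)
    qed
    then show ?thesis using fW by blast
  qed
  show "bij_betw (\<lambda>f x. z * f x - L f x) W W"
    unfolding P_def[symmetric] bij_betw_def using inj surj PW by blast
qed

text \<open>The power bound excludes every z of modulus above \<rho>, and the eigenfunction puts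
  \<rho> itself into the spectrum, so the supremum is a maximum.\<close>

lemma spectral_radius_on_eqI:
  fixes D :: "real set" and A :: "(real \<Rightarrow> real) \<Rightarrow> real \<Rightarrow> real"
  defines "V \<equiv> continuous_functions D"
  assumes D: "compact D" "D \<noteq> {}"
    and maps: "\<And>f. f \<in> V \<Longrightarrow> A f \<in> V"
    and lin: "\<And>f g c. f \<in> V \<Longrightarrow> g \<in> V \<Longrightarrow> A (\<lambda>x. f x + c * g x) = (\<lambda>x. A f x + c * A g x)"
    and pow: "\<And>f B x n. f \<in> V \<Longrightarrow> (\<And>y. y \<in> D \<Longrightarrow> \<bar>f y\<bar> \<le> B) \<Longrightarrow> x \<in> D \<Longrightarrow>
                \<bar>(A ^^ n) f x\<bar> \<le> K * \<rho> ^ n * B"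
    and K: "0 \<le> K" and \<rho>: "0 \<le> \<rho>"
    and U: "U \<in> V" "U x0 \<noteq> 0" "A U = (\<lambda>x. \<rho> * U x)"
  shows "spectral_radius_on D V A = \<rho>"
proof -
  define W where "W = {f :: real \<Rightarrow> complex. continuous_on D f \<and> (\<forall>x. x \<notin> D \<longrightarrow> f x = 0)}"
  have W: "complexified_space V = W" unfolding V_def W_def by (rule complexified_continuous_functions)
  define L where "L = complexified_op A"
  have ReIm: "(\<lambda>x. Re (f x)) \<in> V" "(\<lambda>x. Im (f x)) \<in> V" if "f \<in> W" for f
    using that unfolding W[symmetric] complexified_space_def by auto
  have WI: "f \<in> W" if "(\<lambda>x. Re (f x)) \<in> V" "(\<lambda>x. Im (f x)) \<in> V" for f
    using that unfolding W[symmetric] complexified_space_def by auto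
  have ReL: "(\<lambda>x. Re (L f x)) = A (\<lambda>x. Re (f x))" "(\<lambda>x. Im (L f x)) = A (\<lambda>x. Im (f x))" for f
    by (simp_all add: L_def complexified_op_def)
  have mapsL: "L f \<in> W" if "f \<in> W" for f
    by (rule WI) (use maps ReIm[OF that] in \<open>auto simp: ReL\<close>)
  have comb: "(\<lambda>x. f x + c * g x) \<in> V" if "f \<in> V" "g \<in> V" for f g c
    using that unfolding V_def continuous_functions_def by (auto intro!: continuous_intros)
  have linL: "L (\<lambda>x. f x + c * g x) = (\<lambda>x. L f x + c * L g x)" if f: "f \<in> W" and g: "g \<in> W" for f g c
  proof -
    have 1: "A (\<lambda>x. Re (f x) + Re c * Re (g x) + (- Im c) * Im (g x)) =
        (\<lambda>x. A (\<lambda>x. Re (f x)) x + Re c * A (\<lambda>x. Re (g x)) x + (- Im c) * A (\<lambda>x. Im (g x)) x)"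
      by (subst lin[OF comb]) (use ReIm f g lin in auto)
    have 2: "A (\<lambda>x. Im (f x) + Re c * Im (g x) + Im c * Re (g x)) =
        (\<lambda>x. A (\<lambda>x. Im (f x)) x + Re c * A (\<lambda>x. Im (g x)) x + Im c * A (\<lambda>x. Re (g x)) x)"
      by (subst lin[OF comb]) (use ReIm f g lin in auto)
    show ?thesis
      using 1 2 by (simp add: L_def complexified_op_def fun_eq_iff complex_eq_iff algebra_simps)
  qed
  have Lpow: "(\<lambda>x. Re ((L ^^ n) f x)) = (A ^^ n) (\<lambda>x. Re (f x))"
    "(\<lambda>x. Im ((L ^^ n) f x)) = (A ^^ n) (\<lambda>x. Im (f x))" for n f
    by (induction n) (simp_all add: ReL)
  \<comment> \<open>Real and imaginary parts are iterated separately, hence the factor 2 on K; it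
    does not change the geometric rate.\<close>
  have powL: "cmod ((L ^^ n) f x) \<le> (2 * K) * \<rho> ^ n * B"
    if f: "f \<in> W" and B: "\<And>y. y \<in> D \<Longrightarrow> cmod (f y) \<le> B" and x: "x \<in> D" for f B x n
  proof -
    have "\<bar>Re (f y)\<bar> \<le> B" "\<bar>Im (f y)\<bar> \<le> B" if "y \<in> D" for y
      using abs_Re_le_cmod[of "f y"] abs_Im_le_cmod[of "f y"] B[OF that] by linarith+
    then have "\<bar>(A ^^ n) (\<lambda>x. Re (f x)) x\<bar> \<le> K * \<rho> ^ n * B" "\<bar>(A ^^ n) (\<lambda>x. Im (f x)) x\<bar> \<le> K * \<rho> ^ n * B"
      using ReIm[OF f] x by (auto intro!: pow)
    then have "\<bar>Re ((L ^^ n) f x)\<bar> \<le> K * \<rho> ^ n * B" "\<bar>Im ((L ^^ n) f x)\<bar> \<le> K * \<rho> ^ n * B"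
      by (simp_all flip: fun_cong[OF Lpow(1)] fun_cong[OF Lpow(2)])
    then show ?thesis using cmod_le[of "(L ^^ n) f x"] by linarith
  qed
  have out: "z \<notin> spectrum_on D V A" if z: "\<rho> < cmod z" for z
    using neumann_resolvent[OF D, folded W_def, of L "2 * K" \<rho> z] mapsL linL powL K \<rho> z
    unfolding spectrum_on_def Let_def W L_def[symmetric] by auto
  have inn: "complex_of_real \<rho> \<in> spectrum_on D V A"
  proof -
    define P where "P = (\<lambda>f x. complex_of_real \<rho> * f x - L f x)"
    define Uc where "Uc = (\<lambda>x. complex_of_real (U x))"
    have z: "(\<lambda>x. 0) \<in> V" by (simp add: V_def continuous_functions_def)
    have A0: "A (\<lambda>x. 0) = (\<lambda>x. 0)" using lin[OF z z, of 1] by (auto simp: fun_eq_iff)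
    have "Uc \<in> W" "(\<lambda>x. 0) \<in> W" by (rule WI, use U z in \<open>auto simp: Uc_def\<close>)+
    moreover have "P Uc = P (\<lambda>x. 0)"
      by (simp add: P_def Uc_def L_def complexified_op_def U A0 fun_eq_iff complex_eq_iff)
    moreover have "Uc \<noteq> (\<lambda>x. 0)" using U by (auto simp: Uc_def fun_eq_iff)
    ultimately have "\<not> inj_on P W" by (auto simp: inj_on_def)
    then have "\<not> bij_betw P W W" by (auto simp: bij_betw_def)
    then show ?thesis unfolding spectrum_on_def Let_def W L_def[symmetric] P_def by auto
  qed
  show ?thesis unfolding spectral_radius_on_def
  proof (rule cSup_eq_maximum)
    show "\<rho> \<in> cmod ` spectrum_on D V A" using inn \<rho> by (metis image_eqI norm_of_real abs_of_nonneg)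
    show "y \<le> \<rho>" if "y \<in> cmod ` spectrum_on D V A" for y using that out by force
  qed
qed

section \<open>Eigenfunctions in cones of log-Lipschitz functions\<close>

lemma cone_K_D: "F \<in> cone_K M D \<Longrightarrow> x \<in> D \<Longrightarrow> y \<in> D \<Longrightarrow> F x \<le> exp (M * \<bar>x - y\<bar>) * F y"
  by (simp add: cone_K_def)

lemma cone_K_outside: "F \<in> cone_K M D \<Longrightarrow> x \<notin> D \<Longrightarrow> F x = 0"
  by (simp add: cone_K_def functions_on_def)

lemma cone_KI:
  assumes "\<And>x. x \<notin> D \<Longrightarrow> F x = 0"
    and "\<And>x y. x \<in> D \<Longrightarrow> y \<in> D \<Longrightarrow> F x \<le> exp (M * \<bar>x - y\<bar>) * F y"
  shows "F \<in> cone_K M D"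
  using assms by (simp add: cone_K_def functions_on_def)

lemma cone_K_add:
  assumes "F \<in> cone_K M D" "G \<in> cone_K M D" "0 \<le> c"
  shows "(\<lambda>x. F x + c * G x) \<in> cone_K M D"
proof (rule cone_KI)
  fix x y assume xy: "x \<in> D" "y \<in> D"
  have "F x + c * G x \<le> exp (M * \<bar>x - y\<bar>) * F y + c * (exp (M * \<bar>x - y\<bar>) * G y)"
    using assms xy by (intro add_mono mult_left_mono cone_K_D) auto
  then show "F x + c * G x \<le> exp (M * \<bar>x - y\<bar>) * (F y + c * G y)" by (simp add: algebra_simps)
qed (use cone_K_outside[OF assms(1)] cone_K_outside[OF assms(2)] in simp)

lemma cone_K_scale:
  assumes "G \<in> cone_K M D" "0 \<le> c"
  shows "(\<lambda>x. c * G x) \<in> cone_K M D"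
proof -
  have "(\<lambda>x. 0) \<in> cone_K M D" by (rule cone_KI) auto
  from cone_K_add[OF this assms] show ?thesis by simp
qed

lemma cone_K_tendsto:
  assumes "\<And>n. F n \<in> cone_K M D" "\<And>x. x \<in> D \<Longrightarrow> (\<lambda>n. F n x) \<longlonglongrightarrow> G x" "\<And>x. x \<notin> D \<Longrightarrow> G x = 0"
  shows "G \<in> cone_K M D"
proof (rule cone_KI)
  fix x y assume xy: "x \<in> D" "y \<in> D"
  show "G x \<le> exp (M * \<bar>x - y\<bar>) * G y"
    by (rule LIMSEQ_le[OF assms(2)[OF xy(1)] tendsto_mult_left[OF assms(2)[OF xy(2)]]])
       (use cone_K_D[OF assms(1) xy] in auto)
qed (use assms in simp)

lemma cone_K_mono:
  assumes F: "F \<in> cone_K M D" and pos: "\<And>x. x \<in> D \<Longrightarrow> 0 \<le> F x" and "M \<le> M'"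
  shows "F \<in> cone_K M' D"
proof (rule cone_KI)
  fix x y assume xy: "x \<in> D" "y \<in> D"
  have "F x \<le> exp (M * \<bar>x - y\<bar>) * F y" by (rule cone_K_D[OF F xy])
  also have "\<dots> \<le> exp (M' * \<bar>x - y\<bar>) * F y"
    using assms xy by (intro mult_right_mono) (auto intro: mult_right_mono)
  finally show "F x \<le> exp (M' * \<bar>x - y\<bar>) * F y" .
qed (use cone_K_outside[OF F] in simp)

text \<open>Positivity is not part of \<open>cone_K\<close> but follows from the existence of a
  second point: going to y and back gives F x <= e^2 F x with e > 1, which a negative value
  violates.\<close>

lemma cone_K_nonneg:
  assumes F: "F \<in> cone_K M D" and M: "0 < M" and D: "p \<in> D" "q \<in> D" "p \<noteq> q" and x: "x \<in> D"
  shows "0 \<le> F x"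
proof -
  obtain y where y: "y \<in> D" "y \<noteq> x" using D by metis
  define e where "e = exp (M * \<bar>x - y\<bar>)"
  have e: "1 < e" using y M by (simp add: e_def)
  have "F x \<le> e * F y" "F y \<le> e * F x"
    using cone_K_D[OF F x y(1)] cone_K_D[OF F y(1) x] by (simp_all add: e_def abs_minus_commute)
  then have "F x \<le> e * (e * F x)" using e by (meson less_trans mult_left_mono order_trans less_imp_le zero_less_one)
  then have "0 \<le> (e * e - 1) * F x" by (simp add: algebra_simps)
  moreover have "0 < e * e - 1" using e by (simp add: less_1_mult)
  ultimately show ?thesis by (simp add: zero_le_mult_iff)
qed

lemma cone_K_pos:
  assumes F: "F \<in> cone_K M D" and x: "x \<in> D" "0 < F x" and y: "y \<in> D"
  shows "0 < F y"
proof -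
  have "0 < exp (M * \<bar>x - y\<bar>) * F y" using cone_K_D[OF F x(1) y] x(2) by linarith
  then show ?thesis by (simp add: zero_less_mult_iff)
qed

lemma cone_K_bounded:
  assumes F: "F \<in> cone_K M D" and M: "0 \<le> M" and x: "x \<in> D" "y \<in> D" and \<Delta>: "\<bar>x - y\<bar> \<le> \<Delta>" and pos: "0 \<le> F y"
  shows "F x \<le> exp (M * \<Delta>) * F y"
proof -
  have "F x \<le> exp (M * \<bar>x - y\<bar>) * F y" by (rule cone_K_D[OF F x])
  also have "\<dots> \<le> exp (M * \<Delta>) * F y" using M \<Delta> pos by (intro mult_right_mono) (auto intro: mult_left_mono)
  finally show ?thesis .
qed

lemma cone_K_lipschitz:
  assumes F: "F \<in> cone_K M D" and M: "0 \<le> M" and xy: "x \<in> D" "y \<in> D" and \<Delta>: "\<bar>x - y\<bar> \<le> \<Delta>"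
    and C: "\<And>x. x \<in> D \<Longrightarrow> 0 \<le> F x \<and> F x \<le> C"
  shows "\<bar>F x - F y\<bar> \<le> C * M * exp (M * \<Delta>) * \<bar>x - y\<bar>"
proof -
  have one: "F x - F y \<le> C * M * exp (M * \<Delta>) * \<bar>x - y\<bar>"
    if xy: "x \<in> D" "y \<in> D" "\<bar>x - y\<bar> \<le> \<Delta>" for x y
  proof -
    have "F x - F y \<le> (exp (M * \<bar>x - y\<bar>) - 1) * F y"
      using cone_K_D[OF F xy(1,2)] by (simp add: algebra_simps)
    also have "\<dots> \<le> (M * \<bar>x - y\<bar> * exp (M * \<bar>x - y\<bar>)) * C"
      using exp_minus_one_le[of "M * \<bar>x - y\<bar>"] C[OF xy(2)] M by (intro mult_mono) auto
    also have "\<dots> \<le> (M * \<bar>x - y\<bar> * exp (M * \<Delta>)) * C"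
      using M xy C[OF xy(2)] by (intro mult_right_mono mult_left_mono) (auto intro: mult_left_mono)
    finally show ?thesis by (simp add: algebra_simps)
  qed
  show ?thesis using one[OF xy \<Delta>] one[OF xy(2,1)] \<Delta> by (simp add: abs_minus_commute abs_le_iff)
qed

lemma cone_K_continuous:
  assumes F: "F \<in> cone_K M D" and D: "bounded D" and M: "0 < M" and pq: "p \<in> D" "q \<in> D" "p \<noteq> q"
  shows "F \<in> continuous_functions D"
proof -
  have pos: "0 \<le> F x" if "x \<in> D" for x by (rule cone_K_nonneg[OF F M pq that])
  obtain \<Delta> where \<Delta>: "\<And>x y. x \<in> D \<Longrightarrow> y \<in> D \<Longrightarrow> \<bar>x - y\<bar> \<le> \<Delta>"
    using D by (metis bounded_two_points dist_real_def)
  define C where "C = exp (M * \<Delta>) * F p"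
  have C: "0 \<le> F x \<and> F x \<le> C" if "x \<in> D" for x
    using cone_K_bounded[OF F _ that pq(1) \<Delta>[OF that pq(1)] pos[OF pq(1)]] pos[OF that] M by (simp add: C_def)
  have C0: "0 \<le> C * M * exp (M * \<Delta>)" using C[OF pq(1)] M by simp
  have "(C * M * exp (M * \<Delta>))-lipschitz_on D F"
    by (rule lipschitz_onI) (use cone_K_lipschitz[OF F _ _ _ \<Delta> C] M C0 in \<open>auto simp: dist_real_def\<close>)
  then have "continuous_on D F" by (rule lipschitz_on_continuous_on)
  then show ?thesis using cone_K_outside[OF F] by (simp add: continuous_functions_def)
qed

text \<open>Elements of the narrower cone are order units of the wider one: the slack
  \<open>exp (M d) - exp (M' d)\<close> and the perturbation are both of first order in the distance \<open>d\<close>.\<close>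

lemma cone_K_dominates:
  assumes U: "U \<in> cone_K M' D" and Upos: "\<And>x. x \<in> D \<Longrightarrow> 0 < U x"
    and F: "F \<in> cone_K M D" and M: "0 \<le> M'" "M' < M" and D: "bounded D" and pq: "p \<in> D" "q \<in> D" "p \<noteq> q"
  obtains \<epsilon> where "0 < \<epsilon>" "(\<lambda>x. U x - \<epsilon> * F x) \<in> cone_K M D"
proof -
  have M0: "0 < M" using M by simp
  have pos: "0 \<le> F x" if "x \<in> D" for x by (rule cone_K_nonneg[OF F M0 pq that])
  obtain \<Delta> where \<Delta>: "\<And>x y. x \<in> D \<Longrightarrow> y \<in> D \<Longrightarrow> \<bar>x - y\<bar> \<le> \<Delta>"
    using D by (metis bounded_two_points dist_real_def)
  define C where "C = exp (M * \<Delta>) * F p + 1"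
  have C: "F x \<le> C" if "x \<in> D" for x
    using cone_K_bounded[OF F _ that pq(1) \<Delta>[OF that pq(1)] pos[OF pq(1)]] M by (simp add: C_def)
  have C0: "0 < C" using pos[OF pq(1)] by (simp add: C_def add_nonneg_pos)
  define c where "c = exp (- (M' * \<Delta>)) * U p"
  have c0: "0 < c" using Upos[OF pq(1)] by (simp add: c_def)
  have c: "c \<le> U x" if "x \<in> D" for x
  proof -
    have "U p \<le> exp (M' * \<Delta>) * U x"
      using cone_K_bounded[OF U M(1) pq(1) that \<Delta>[OF pq(1) that]] Upos[OF that] by simp
    then have "exp (- (M' * \<Delta>)) * U p \<le> exp (- (M' * \<Delta>)) * (exp (M' * \<Delta>) * U x)"
      by (intro mult_left_mono) auto
    then show ?thesis by (simp add: c_def mult.assoc[symmetric] exp_add[symmetric])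
  qed
  \<comment> \<open>Chosen so that \<epsilon> times the first-order bound 2 M d exp (M \<Delta>) C
    for the perturbation equals (M - M') d c, a lower bound for the slack.\<close>
  define \<epsilon> where "\<epsilon> = (M - M') * c / (2 * M * exp (M * \<Delta>) * C)"
  have \<epsilon>: "0 < \<epsilon>" using M M0 c0 C0 by (simp add: \<epsilon>_def)
  have "(\<lambda>x. U x - \<epsilon> * F x) \<in> cone_K M D"
  proof (rule cone_KI)
    fix x y assume xy: "x \<in> D" "y \<in> D"
    define d where "d = \<bar>x - y\<bar>"
    have d: "0 \<le> d" "d \<le> \<Delta>" using \<Delta>[OF xy] by (simp_all add: d_def)
    have "exp (M * d) * F y - F x \<le> (exp (M * d) - exp (- (M * d))) * F y"
    proof -
      have "F y \<le> exp (M * d) * F x" using cone_K_D[OF F xy(2,1)] by (simp add: d_def abs_minus_commute)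
      then have "exp (- (M * d)) * F y \<le> exp (- (M * d)) * (exp (M * d) * F x)" by (intro mult_left_mono) auto
      then show ?thesis by (simp add: algebra_simps mult.assoc[symmetric] exp_add[symmetric])
    qed
    also have "\<dots> \<le> (2 * M * d * exp (M * \<Delta>)) * C"
    proof (rule mult_mono)
      have "exp (M * d) - exp (- (M * d)) = exp (- (M * d)) * (exp (2 * (M * d)) - 1)"
        by (simp add: algebra_simps exp_add[symmetric])
      also have "\<dots> \<le> exp (- (M * d)) * (2 * (M * d) * exp (2 * (M * d)))"
        by (intro mult_left_mono exp_minus_one_le) auto
      also have "\<dots> = 2 * M * d * exp (M * d)" by (simp add: algebra_simps exp_add[symmetric])
      also have "\<dots> \<le> 2 * M * d * exp (M * \<Delta>)" using M0 d by (intro mult_left_mono) auto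
      finally show "exp (M * d) - exp (- (M * d)) \<le> 2 * M * d * exp (M * \<Delta>)" .
    qed (use C[OF xy(2)] pos[OF xy(2)] M0 d in auto)
    finally have "\<epsilon> * (exp (M * d) * F y - F x) \<le> \<epsilon> * ((2 * M * d * exp (M * \<Delta>)) * C)"
      using \<epsilon> by (intro mult_left_mono) auto
    also have "\<dots> = (M - M') * d * c"
      using M0 C0 by (simp add: \<epsilon>_def)
    also have "\<dots> \<le> (exp (M * d) - exp (M' * d)) * U y"
    proof (rule mult_mono)
      have "(M - M') * d \<le> exp ((M - M') * d) - 1" using exp_ge_add_one_self[of "(M - M') * d"]
        by (simp only: le_diff_eq add.commute)
      also have "\<dots> = 1 * (exp ((M - M') * d) - 1)" by simp
      also have "\<dots> \<le> exp (M' * d) * (exp ((M - M') * d) - 1)"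
        using M d by (intro mult_right_mono) auto
      also have "\<dots> = exp (M * d) - exp (M' * d)" by (simp add: algebra_simps exp_add[symmetric])
      finally show "(M - M') * d \<le> exp (M * d) - exp (M' * d)" .
      then show "0 \<le> exp (M * d) - exp (M' * d)" using M d by (smt (verit) mult_nonneg_nonneg)
    qed (use c[OF xy(2)] c0 in auto)
    also have "\<dots> \<le> exp (M * d) * U y - U x"
      using cone_K_D[OF U xy] by (simp add: d_def algebra_simps)
    finally show "U x - \<epsilon> * F x \<le> exp (M * \<bar>x - y\<bar>) * (U y - \<epsilon> * F y)"
      by (simp add: d_def algebra_simps)
  qed (use cone_K_outside[OF U] cone_K_outside[OF F] in simp)
  with \<epsilon> show ?thesis by (rule that)
qed

text \<open>Collatz--Wielandt: the supremum of the \<open>c\<close> with \<open>c F \<le> A F\<close> in the cone order is attained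
  by compactness, and a maximiser that is not an eigenfunction could be improved by applying \<open>A\<close>.\<close>

lemma cone_K_eigenfunction:
  fixes D :: "real set" and A :: "(real \<Rightarrow> real) \<Rightarrow> real \<Rightarrow> real"
  defines "V \<equiv> continuous_functions D"
  assumes D: "compact D" and pq: "p \<in> D" "q \<in> D" "p \<noteq> q" and M: "0 < M" and \<kappa>: "0 \<le> \<kappa>" "\<kappa> < 1"
    and lin: "\<And>f g c. f \<in> V \<Longrightarrow> g \<in> V \<Longrightarrow> A (\<lambda>x. f x + c * g x) = (\<lambda>x. A f x + c * A g x)"
    and bd: "\<And>f B x. f \<in> V \<Longrightarrow> (\<And>y. y \<in> D \<Longrightarrow> \<bar>f y\<bar> \<le> B) \<Longrightarrow> x \<in> D \<Longrightarrow> \<bar>A f x\<bar> \<le> N * B"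
    and cone: "\<And>F. F \<in> cone_K M D \<Longrightarrow> A F \<in> cone_K (\<kappa> * M) D"
    and nz: "\<And>F. F \<in> cone_K M D \<Longrightarrow> (\<And>x. x \<in> D \<Longrightarrow> 0 < F x) \<Longrightarrow> 0 < A F p"
  obtains \<rho> U where "0 < \<rho>" "U \<in> cone_K (\<kappa> * M) D" "\<And>x. x \<in> D \<Longrightarrow> 0 < U x" "A U = (\<lambda>x. \<rho> * U x)"
proof -
  have bnd: "bounded D" using D compact_imp_bounded by blast
  obtain \<Delta> where \<Delta>: "\<And>x y. x \<in> D \<Longrightarrow> y \<in> D \<Longrightarrow> \<bar>x - y\<bar> \<le> \<Delta>"
    using bnd by (metis bounded_two_points dist_real_def)
  have \<kappa>M: "\<kappa> * M < M" "0 \<le> \<kappa> * M" using \<kappa> M by auto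
  have pos: "0 \<le> F x" if "F \<in> cone_K M D" "x \<in> D" for F x by (rule cone_K_nonneg[OF that(1) M pq that(2)])
  have inV: "F \<in> V" if "F \<in> cone_K M D" for F unfolding V_def by (rule cone_K_continuous[OF that bnd M pq])
  have spos: "0 < F x" if F: "F \<in> cone_K M D" and ne: "y \<in> D" "F y \<noteq> 0" and x: "x \<in> D" for F x y
    using cone_K_pos[OF F ne(1) _ x] pos[OF F ne(1)] ne by simp
  have Apos: "0 < A F x" if F: "F \<in> cone_K M D" and Fp: "\<And>x. x \<in> D \<Longrightarrow> 0 < F x" and x: "x \<in> D" for F x
    using cone_K_pos[OF cone[OF F] pq(1) nz[OF F Fp] x] .
  have cone': "A F \<in> cone_K M D" if F: "F \<in> cone_K M D" for F
  proof (cases "\<forall>x\<in>D. 0 < F x")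
    case True
    then show ?thesis using cone_K_mono[OF cone[OF F]] Apos[OF F] \<kappa>M by (simp add: less_imp_le)
  next
    case False
    then have "F x = 0" if "x \<in> D" for x using spos[OF F that] by auto
    then have "A F x = 0" if "x \<in> D" for x using bd[OF inV[OF F], of 0 x] that by simp
    then show ?thesis using cone_K_outside[OF cone[OF F]] by (intro cone_KI) auto
  qed
  \<comment> \<open>The Collatz-Wielandt set. The normalisation at p bounds all competitors by exp
    (M \<Delta>), which bounds Q above and prepares the passage to a limit.\<close>
  define Q where "Q = {c. \<exists>F\<in>cone_K M D. F p = 1 \<and> (\<lambda>x. A F x - c * F x) \<in> cone_K M D}"
  have bounds: "F x \<le> exp (M * \<Delta>)" if F: "F \<in> cone_K M D" "F p = 1" "x \<in> D" for F x
    using cone_K_bounded[OF F(1) _ F(3) pq(1) \<Delta>[OF F(3) pq(1)]] F M by simp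
  have Qle: "c \<le> N * exp (M * \<Delta>)" if cQ: "c \<in> Q" for c
  proof -
    obtain F where F: "F \<in> cone_K M D" "F p = 1" "(\<lambda>x. A F x - c * F x) \<in> cone_K M D"
      using cQ unfolding Q_def by blast
    have "c \<le> A F p" using pos[OF F(3) pq(1)] F(2) by simp
    also have "\<dots> \<le> N * exp (M * \<Delta>)"
      using bd[OF inV[OF F(1)] _ pq(1), of "exp (M * \<Delta>)"] bounds[OF F(1,2)] pos[OF F(1)] by force
    finally show ?thesis .
  qed
  define one where "one = (\<lambda>x :: real. if x \<in> D then 1 else 0 :: real)"
  have one: "one \<in> cone_K M D" by (rule cone_KI) (use M in \<open>auto simp: one_def\<close>)
  have "0 \<in> Q" unfolding Q_def using one cone'[OF one] pq by (auto simp: one_def intro!: bexI[of _ one])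
  then have Q: "Q \<noteq> {}" "bdd_above Q" using Qle by (auto simp: bdd_above_def)
  define \<rho> where "\<rho> = Sup Q"
  have Q\<rho>: "c \<le> \<rho>" if "c \<in> Q" for c unfolding \<rho>_def by (rule cSup_upper[OF that Q(2)])
  have "\<exists>c\<in>Q. \<rho> - 1 / real (Suc n) < c" for n
    using less_cSup_iff[OF Q, of "\<rho> - 1 / real (Suc n)"] unfolding \<rho>_def by simp
  then obtain c where c: "\<And>n. c n \<in> Q" "\<And>n. \<rho> - 1 / real (Suc n) < c n" by metis
  then have "\<forall>n. \<exists>F\<in>cone_K M D. F p = 1 \<and> (\<lambda>x. A F x - c n * F x) \<in> cone_K M D" by (simp add: Q_def)
  then obtain F where F: "\<And>n. F n \<in> cone_K M D" "\<And>n. F n p = 1"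
    "\<And>n. (\<lambda>x. A (F n) x - c n * F n x) \<in> cone_K M D" by metis
  have climit: "c \<longlonglongrightarrow> \<rho>"
  proof (rule tendsto_sandwich[OF _ _ _ tendsto_const[of \<rho>]])
    show "\<forall>\<^sub>F n in sequentially. \<rho> - 1 / real (Suc n) \<le> c n" using c(2) by (auto simp: less_imp_le)
    show "\<forall>\<^sub>F n in sequentially. c n \<le> \<rho>" using Q\<rho> c(1) by auto
    have "(\<lambda>n. 1 / real (Suc n)) \<longlonglongrightarrow> 0" using LIMSEQ_inverse_real_of_nat by (simp add: inverse_eq_divide)
    from tendsto_diff[OF tendsto_const[of \<rho>] this] show "(\<lambda>n. \<rho> - 1 / real (Suc n)) \<longlonglongrightarrow> \<rho>" by simp
  qed
  define C where "C = exp (M * \<Delta>)"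
  define Lc where "Lc = C * M * exp (M * \<Delta>) + 1"
  have Lc: "0 < Lc" using M by (simp add: Lc_def C_def add_pos_pos)
  have lip: "\<bar>F n x - F n y\<bar> \<le> Lc * \<bar>x - y\<bar>" if "x \<in> D" "y \<in> D" for n x y
    using cone_K_lipschitz[OF F(1) _ that \<Delta>[OF that], of n C] bounds[OF F(1,2)] pos[OF F(1)] M
    by (fastforce simp: C_def Lc_def algebra_simps intro: order_trans)
  \<comment> \<open>Membership in one cone together with F p = 1 gives a common Lipschitz constant,
    so the maximising sequence has a uniformly convergent subsequence.\<close>
  obtain g k where g: "continuous_on D g" "strict_mono (k :: nat \<Rightarrow> nat)"
    and unif: "\<And>e. 0 < e \<Longrightarrow> \<exists>N. \<forall>n x. n \<ge> N \<and> x \<in> D \<longrightarrow> norm (F (k n) x - g x) < e"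
  proof (rule Arzela_Ascoli[OF D, of F C])
    show "norm (F n x) \<le> C" if "x \<in> D" for n x
      using bounds[OF F(1,2) that] pos[OF F(1) that] by (simp add: C_def)
    show "\<exists>d>0. \<forall>n y. y \<in> D \<and> norm (x - y) < d \<longrightarrow> norm (F n x - F n y) < e" if "x \<in> D" "0 < e" for x e
    proof (intro exI[of _ "e / Lc"] conjI allI impI)
      show "0 < e / Lc" using that Lc by simp
      fix n y assume "y \<in> D \<and> norm (x - y) < e / Lc"
      then have "Lc * \<bar>x - y\<bar> < e" using Lc by (simp add: field_simps)
      then show "norm (F n x - F n y) < e" using lip[of x y n] that \<open>y \<in> D \<and> _\<close> by simp
    qed
  qed blast
  define G where "G = (\<lambda>x. if x \<in> D then g x else 0)"
  have GV: "G \<in> V"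
  proof -
    have "continuous_on D G" using g(1) by (rule continuous_on_eq) (simp add: G_def)
    then show ?thesis by (simp add: V_def continuous_functions_def G_def)
  qed
  have Glim: "(\<lambda>n. F (k n) x) \<longlonglongrightarrow> G x" if "x \<in> D" for x
  proof (rule LIMSEQ_I)
    fix e :: real assume "0 < e"
    from unif[OF this] show "\<exists>N. \<forall>n\<ge>N. norm (F (k n) x - G x) < e" using that by (auto simp: G_def)
  qed
  have AGlim: "(\<lambda>n. A (F (k n)) x) \<longlonglongrightarrow> A G x" if x: "x \<in> D" for x
  proof (rule LIMSEQ_I)
    fix e :: real assume e: "0 < e"
    define e' where "e' = e / (\<bar>N\<bar> + 1)"
    have e': "0 < e'" using e by (simp add: e'_def add_nonneg_pos)
    obtain n0 where n0: "\<And>n x. n \<ge> n0 \<Longrightarrow> x \<in> D \<Longrightarrow> norm (F (k n) x - g x) < e'"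
      using unif[OF e'] by blast
    have "norm (A (F (k n)) x - A G x) < e" if n: "n0 \<le> n" for n
    proof -
      have dV: "(\<lambda>x. F (k n) x + (- 1) * G x) \<in> V"
        using inV[OF F(1), of "k n"] GV unfolding V_def continuous_functions_def
        by (auto intro!: continuous_intros)
      have "\<bar>A (\<lambda>x. F (k n) x + (- 1) * G x) x\<bar> \<le> N * e'"
        by (rule bd[OF dV _ x]) (use n0[OF n] in \<open>auto simp: G_def intro: less_imp_le\<close>)
      then have "\<bar>A (F (k n)) x - A G x\<bar> \<le> N * e'" using lin[OF inV[OF F(1)] GV, of "k n" "- 1"] by simp
      also have "\<dots> < (\<bar>N\<bar> + 1) * e'" using e' by (intro mult_strict_right_mono) auto
      also have "\<dots> = e" by (simp add: e'_def)
      finally show ?thesis by simp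
    qed
    then show "\<exists>n0. \<forall>n\<ge>n0. norm (A (F (k n)) x - A G x) < e" by blast
  qed
  have GK: "G \<in> cone_K M D"
    by (rule cone_K_tendsto[of "\<lambda>n. F (k n)"]) (use F(1) Glim in \<open>auto simp: G_def\<close>)
  have Gp: "G p = 1"
    using LIMSEQ_unique[OF Glim[OF pq(1)]] F(2) by simp
  define H where "H = (\<lambda>x. A G x - \<rho> * G x)"
  have HK: "H \<in> cone_K M D"
  proof (rule cone_K_tendsto)
    show "(\<lambda>x. A (F (k n)) x - c (k n) * F (k n) x) \<in> cone_K M D" for n by (rule F(3))
    show "(\<lambda>n. A (F (k n)) x - c (k n) * F (k n) x) \<longlonglongrightarrow> H x" if "x \<in> D" for x
      unfolding H_def
      by (intro tendsto_intros AGlim[OF that] Glim[OF that] LIMSEQ_subseq_LIMSEQ[OF climit g(2), unfolded comp_def])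
    show "H x = 0" if "x \<notin> D" for x
      using that cone_K_outside[OF cone[OF GK]] by (simp add: H_def G_def)
  qed
  have Gpos: "0 < G x" if "x \<in> D" for x using spos[OF GK pq(1) _ that] Gp by simp
  have H0: "H x = 0" if x: "x \<in> D" for x
  proof (rule ccontr)
    assume ne: "H x \<noteq> 0"
    have Hpos: "0 < H y" if "y \<in> D" for y by (rule spos[OF HK x ne that])
    have AHpos: "0 < A H y" if "y \<in> D" for y by (rule Apos[OF HK Hpos that])
    \<comment> \<open>A H lies in the narrower cone and is positive, so it dominates a multiple of A
      G. Hence A G, normalised at p, is a competitor for \<rho> + \<epsilon>, contradicting the
      supremum.\<close>
    obtain \<epsilon> where \<epsilon>: "0 < \<epsilon>" "(\<lambda>x. A H x - \<epsilon> * A G x) \<in> cone_K M D"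
      using cone_K_dominates[OF cone[OF HK] AHpos cone'[OF GK] \<kappa>M(2,1) bnd pq] by blast
    have AG: "A G \<in> V" by (rule inV[OF cone'[OF GK]])
    have AH: "A H = (\<lambda>x. A (A G) x - \<rho> * A G x)"
      using lin[OF AG GV, of "- \<rho>"] by (simp add: H_def)
    define a where "a = A G p"
    have a: "0 < a" unfolding a_def by (rule Apos[OF GK Gpos pq(1)])
    define F' where "F' = (\<lambda>x. 1 / a * A G x)"
    have F'K: "F' \<in> cone_K M D" unfolding F'_def using a by (intro cone_K_scale[OF cone'[OF GK]]) auto
    have zV: "(\<lambda>x. 0) \<in> V" by (simp add: V_def continuous_functions_def)
    have A0: "A (\<lambda>x. 0) = (\<lambda>x. 0)" using lin[OF zV zV, of 1] by (auto simp: fun_eq_iff)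
    have "A F' = (\<lambda>x. 1 / a * A (A G) x)"
      using lin[OF zV AG, of "1 / a"] A0 by (simp add: F'_def)
    then have "(\<lambda>x. A F' x - (\<rho> + \<epsilon>) * F' x) = (\<lambda>x. 1 / a * (A H x - \<epsilon> * A G x))"
      by (simp add: F'_def AH algebra_simps add_divide_distrib diff_divide_distrib)
    also have "\<dots> \<in> cone_K M D" using a by (intro cone_K_scale[OF \<epsilon>(2)]) auto
    finally have "\<rho> + \<epsilon> \<in> Q" unfolding Q_def using F'K a by (auto simp: F'_def a_def[symmetric] intro!: bexI[of _ F'])
    from Q\<rho>[OF this] \<epsilon>(1) show False by simp
  qed
  have eig: "A G x = \<rho> * G x" for x
    using H0[of x] cone_K_outside[OF cone[OF GK], of x] by (cases "x \<in> D") (auto simp: H_def G_def)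
  have \<rho>0: "0 < \<rho>" using Apos[OF GK Gpos pq(1)] Gp by (simp add: eig)
  have G\<kappa>: "G \<in> cone_K (\<kappa> * M) D"
  proof -
    have "(\<lambda>x. 1 / \<rho> * A G x) \<in> cone_K (\<kappa> * M) D" using \<rho>0 by (intro cone_K_scale[OF cone[OF GK]]) auto
    then show ?thesis using \<rho>0 by (simp add: eig)
  qed
  have "A G = (\<lambda>x. \<rho> * G x)" using eig by blast
  with \<rho>0 G\<kappa> Gpos show ?thesis by (rule that)
qed

section \<open>The iterated function system and its eigenfunction\<close>

locale cf_ifs =
  fixes B :: "real set" and \<gamma> \<Gamma> s :: real
  assumes B_fin: "finite B" and B_ne: "B \<noteq> {}" and \<gamma>_def: "\<gamma> = Min B" and \<gamma>1: "1 \<le> \<gamma>"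
    and \<Gamma>_def: "\<Gamma> = Max B" and \<gamma>\<Gamma>: "\<gamma> < \<Gamma>" and s_pos: "0 < s"
begin

abbreviation "A \<equiv> a_inf \<gamma> \<Gamma>"
abbreviation "A' \<equiv> b_inf \<gamma> \<Gamma>"
abbreviation "S \<equiv> S_int \<gamma> \<Gamma>"
abbreviation "L \<equiv> transfer_op B S s"

lemma B_bounds: "\<beta> \<in> B \<Longrightarrow> \<gamma> \<le> \<beta> \<and> \<beta> \<le> \<Gamma>"
  using B_fin by (simp add: \<gamma>_def \<Gamma>_def)

lemma frak_nonneg: "0 \<le> frak_a \<gamma> \<Gamma> k \<and> 0 \<le> frak_b \<gamma> \<Gamma> k"
  using \<gamma>1 \<gamma>\<Gamma> by (induction k) (auto simp: cf_map_def)

lemma A_nonneg: "0 \<le> A" "0 \<le> A'"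
  by (rule LIMSEQ_le_const[OF frak_limits(1)[OF \<gamma>1 \<gamma>\<Gamma>]], use frak_nonneg in auto)
     (rule LIMSEQ_le_const[OF frak_limits(2)[OF \<gamma>1 \<gamma>\<Gamma>]], use frak_nonneg in auto)

lemma A_fixed: "A = 1 / (A' + \<Gamma>)"
proof (rule LIMSEQ_unique)
  show "(\<lambda>k. frak_a \<gamma> \<Gamma> (Suc k)) \<longlonglongrightarrow> A"
    using frak_limits(1)[OF \<gamma>1 \<gamma>\<Gamma>] by (rule LIMSEQ_Suc)
  have "(\<lambda>k. 1 / (frak_b \<gamma> \<Gamma> k + \<Gamma>)) \<longlonglongrightarrow> 1 / (A' + \<Gamma>)"
    using A_nonneg \<gamma>1 \<gamma>\<Gamma> by (intro tendsto_intros frak_limits) auto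
  then show "(\<lambda>k. frak_a \<gamma> \<Gamma> (Suc k)) \<longlonglongrightarrow> 1 / (A' + \<Gamma>)" by (simp add: cf_map_def)
qed

lemma A'_fixed: "A' = 1 / (A + \<gamma>)"
proof (rule LIMSEQ_unique)
  show "(\<lambda>k. frak_b \<gamma> \<Gamma> (Suc k)) \<longlonglongrightarrow> A'"
    using frak_limits(2)[OF \<gamma>1 \<gamma>\<Gamma>] by (rule LIMSEQ_Suc)
  have "(\<lambda>k. 1 / (frak_a \<gamma> \<Gamma> k + \<gamma>)) \<longlonglongrightarrow> 1 / (A + \<gamma>)"
    using A_nonneg \<gamma>1 \<gamma>\<Gamma> by (intro tendsto_intros frak_limits) auto
  then show "(\<lambda>k. frak_b \<gamma> \<Gamma> (Suc k)) \<longlonglongrightarrow> 1 / (A + \<gamma>)" by (simp add: cf_map_def)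
qed

lemma A_pos: "0 < A" using A_fixed A_nonneg \<gamma>1 \<gamma>\<Gamma> by simp

lemma A_less_A': "A < A'"
proof -
  have "A * (A' + \<Gamma>) = 1" "A' * (A + \<gamma>) = 1"
    by (subst A_fixed, use A_nonneg \<gamma>1 \<gamma>\<Gamma> in simp, subst A'_fixed, use A_nonneg \<gamma>1 \<gamma>\<Gamma> in simp)
  then have "A * \<Gamma> = A' * \<gamma>" by (simp add: algebra_simps)
  moreover have "A * \<gamma> < A * \<Gamma>" using A_pos \<gamma>\<Gamma> by simp
  ultimately have "A * \<gamma> < A' * \<gamma>" by simp
  then show ?thesis using \<gamma>1 by (simp add: mult_less_cancel_right)
qed

lemma frak_bounds: "frak_a \<gamma> \<Gamma> k \<le> A \<and> A' \<le> frak_b \<gamma> \<Gamma> k"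
proof (induction k)
  case 0
  have "A' \<le> 1 / \<gamma>" unfolding A'_fixed using A_pos \<gamma>1 by (intro divide_left_mono) auto
  then show ?case using A_nonneg by simp
next
  case (Suc k)
  have "1 / (frak_b \<gamma> \<Gamma> k + \<Gamma>) \<le> 1 / (A' + \<Gamma>)"
    using Suc A_nonneg \<gamma>1 \<gamma>\<Gamma> by (intro divide_left_mono) auto
  moreover have "1 / (A + \<gamma>) \<le> 1 / (frak_a \<gamma> \<Gamma> k + \<gamma>)"
    using Suc frak_nonneg[of k] A_nonneg \<gamma>1 by (intro divide_left_mono) auto
  ultimately show ?case by (simp add: cf_map_def flip: A_fixed A'_fixed)
qed

lemma S_iff: "x \<in> S \<longleftrightarrow> A \<le> x \<and> x \<le> A'" by (simp add: S_int_def)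

lemma S_pos: "x \<in> S \<Longrightarrow> 0 < x" using A_pos by (simp add: S_iff)

lemma S_compact: "compact S" by (simp add: S_int_def)

lemma cf_map_S: "\<gamma> \<le> \<beta> \<Longrightarrow> \<beta> \<le> \<Gamma> \<Longrightarrow> x \<in> S \<Longrightarrow> cf_map \<beta> x \<in> S"
proof -
  assume b: "\<gamma> \<le> \<beta>" "\<beta> \<le> \<Gamma>" and x: "x \<in> S"
  have "1 / (A' + \<Gamma>) \<le> 1 / (x + \<beta>)" "1 / (x + \<beta>) \<le> 1 / (A + \<gamma>)"
    using b x A_pos \<gamma>1 by (auto simp: S_iff intro!: divide_left_mono)
  then show ?thesis by (simp add: S_iff cf_map_def flip: A_fixed A'_fixed)
qed

end

section \<open>Moebius form, weights and contraction of the word maps\<close>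

lemma cf_map_deriv: "0 < x + \<beta> \<Longrightarrow> (cf_map \<beta> has_real_derivative - (1 / (x + \<beta>)\<^sup>2)) (at x)"
  unfolding cf_map_def[abs_def]
  by (auto intro!: derivative_eq_intros simp: power2_eq_square divide_inverse)

lemma abs_deriv_cf_map: "0 < x + \<beta> \<Longrightarrow> \<bar>deriv (cf_map \<beta>) x\<bar> = 1 / (x + \<beta>)\<^sup>2"
  using DERIV_imp_deriv[OF cf_map_deriv] by simp

lemma word_map_nonneg: "\<forall>\<beta>\<in>set \<omega>. 0 < \<beta> \<Longrightarrow> 0 \<le> x \<Longrightarrow> 0 \<le> word_map \<omega> x"
  by (induction \<omega>) (auto simp: cf_map_def)

lemma word_map_append: "word_map (\<omega> @ \<omega>') = word_map \<omega> \<circ> word_map \<omega>'"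
  by (induction \<omega>) (simp_all add: comp_assoc)

text \<open>The coefficients of the denominator of the Moebius map \<open>word_map \<omega>\<close>.\<close>

definition word_denom :: "real list \<Rightarrow> real \<times> real" where
  "word_denom \<omega> = foldl (\<lambda>(c, d) \<beta>. (d, c + \<beta> * d)) (0, 1) \<omega>"

lemma word_denom_Nil: "word_denom [] = (0, 1)" by (simp add: word_denom_def)

lemma word_denom_snoc:
  "word_denom (\<omega> @ [\<beta>]) = (snd (word_denom \<omega>), fst (word_denom \<omega>) + \<beta> * snd (word_denom \<omega>))"
  by (simp add: word_denom_def case_prod_beta)

lemma word_denom_nonneg:
  assumes "\<forall>\<beta>\<in>set \<omega>. 0 < \<beta>"
  shows "0 \<le> fst (word_denom \<omega>) \<and> 0 < snd (word_denom \<omega>)"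
  using assms
  by (induction \<omega> rule: rev_induct)
     (auto simp: word_denom_Nil word_denom_snoc intro: add_nonneg_pos mult_pos_pos)

text \<open>The Moebius matrix of a word has determinant (-1)^length, so its derivative involves
  only the denominator. The induction is on the last letter because that branch acts first on
  x.\<close>

lemma word_map_deriv:
  assumes "\<forall>\<beta>\<in>set \<omega>. 0 < \<beta>" "0 \<le> x"
  shows "(word_map \<omega> has_real_derivative
    (- 1) ^ length \<omega> / (fst (word_denom \<omega>) * x + snd (word_denom \<omega>))\<^sup>2) (at x)"
  using assms
proof (induction \<omega> arbitrary: x rule: rev_induct)
  case Nil
  show ?case by (simp add: word_denom_Nil id_def)
next
  case (snoc \<beta> \<omega>)
  define C where "C = fst (word_denom \<omega>)"
  define D where "D = snd (word_denom \<omega>)"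
  have xb: "0 < x + \<beta>" using snoc.prems by simp
  have CD: "0 \<le> C" "0 < D" using word_denom_nonneg[of \<omega>] snoc.prems by (auto simp: C_def D_def)
  have "(word_map \<omega> has_real_derivative (- 1) ^ length \<omega> / (C * cf_map \<beta> x + D)\<^sup>2) (at (cf_map \<beta> x))"
    unfolding C_def D_def using snoc.prems xb by (intro snoc.IH) (auto simp: cf_map_def)
  from DERIV_chain[OF this cf_map_deriv[OF xb]]
  have "(word_map (\<omega> @ [\<beta>]) has_real_derivative
     ((- 1) ^ length \<omega> / (C * cf_map \<beta> x + D)\<^sup>2) * (- (1 / (x + \<beta>)\<^sup>2))) (at x)"
    by (simp add: word_map_append)
  moreover have "(C * cf_map \<beta> x + D) * (x + \<beta>) = D * x + (C + \<beta> * D)"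
  proof -
    have "cf_map \<beta> x * (x + \<beta>) = 1" using xb by (simp add: cf_map_def)
    moreover have "(C * cf_map \<beta> x + D) * (x + \<beta>) = C * (cf_map \<beta> x * (x + \<beta>)) + D * (x + \<beta>)"
      by (simp add: algebra_simps)
    ultimately show ?thesis by (simp add: algebra_simps)
  qed
  then have "(C * cf_map \<beta> x + D)\<^sup>2 * (x + \<beta>)\<^sup>2 = (D * x + (C + \<beta> * D))\<^sup>2"
    by (simp flip: power_mult_distrib)
  then have "((- 1) ^ length \<omega> / (C * cf_map \<beta> x + D)\<^sup>2) * (- (1 / (x + \<beta>)\<^sup>2))
      = (- 1) ^ Suc (length \<omega>) / (D * x + (C + \<beta> * D))\<^sup>2"
    by simp
  ultimately show ?case by (simp add: word_denom_snoc C_def D_def)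
qed

lemma word_weight_eq:
  assumes "\<forall>\<beta>\<in>set \<omega>. 0 < \<beta>" "0 \<le> x"
  shows "word_weight \<omega> x = 1 / (fst (word_denom \<omega>) * x + snd (word_denom \<omega>))\<^sup>2"
  using DERIV_imp_deriv[OF word_map_deriv[OF assms]]
  by (simp add: word_weight_def abs_divide power_abs)

lemma word_weight_Cons:
  assumes "\<forall>\<beta>\<in>set \<omega>. 0 < \<beta>" "0 < \<beta>" "0 \<le> x"
  shows "word_weight (\<beta> # \<omega>) x = \<bar>deriv (cf_map \<beta>) (word_map \<omega> x)\<bar> * word_weight \<omega> x"
proof -
  have p: "0 < word_map \<omega> x + \<beta>" using word_map_nonneg[OF assms(1,3)] assms(2) by simp
  have "(word_map (\<beta> # \<omega>) has_real_derivative - (1 / (word_map \<omega> x + \<beta>)\<^sup>2) *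
     ((- 1) ^ length \<omega> / (fst (word_denom \<omega>) * x + snd (word_denom \<omega>))\<^sup>2)) (at x)"
    using DERIV_chain[OF cf_map_deriv[OF p] word_map_deriv[OF assms(1,3)]] by simp
  then show ?thesis
    by (simp add: word_weight_def DERIV_imp_deriv DERIV_imp_deriv[OF word_map_deriv[OF assms(1,3)]]
       DERIV_imp_deriv[OF cf_map_deriv[OF p]] abs_mult)
qed

lemma finite_words: "finite B \<Longrightarrow> finite (words B n)"
  unfolding words_def using finite_lists_length_eq[of B n] by (simp add: conj_commute)

lemma words_Suc: "words B (Suc n) = (\<lambda>(\<beta>, \<omega>). \<beta> # \<omega>) ` (B \<times> words B n)"
  by (force simp: words_def length_Suc_conv image_iff)

lemma sum_words_Suc:
  "(\<Sum>\<omega>\<in>words B (Suc n). f \<omega>) = (\<Sum>\<omega>\<in>words B n. \<Sum>\<beta>\<in>B. f (\<beta> # \<omega>))"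
proof -
  have "(\<Sum>\<omega>\<in>words B (Suc n). f \<omega>) = (\<Sum>(\<beta>, \<omega>)\<in>B \<times> words B n. f (\<beta> # \<omega>))"
    unfolding words_Suc by (subst sum.reindex) (auto simp: inj_on_def case_prod_beta)
  also have "\<dots> = (\<Sum>\<beta>\<in>B. \<Sum>\<omega>\<in>words B n. f (\<beta> # \<omega>))" by (rule sum.cartesian_product[symmetric])
  also have "\<dots> = (\<Sum>\<omega>\<in>words B n. \<Sum>\<beta>\<in>B. f (\<beta> # \<omega>))" by (rule sum.swap)
  finally show ?thesis .
qed

context cf_ifs
begin

lemma words_pos: "\<omega> \<in> words B n \<Longrightarrow> \<forall>\<beta>\<in>set \<omega>. 0 < \<beta>"
  using B_bounds \<gamma>1 by (force simp: words_def)

lemma word_map_S: "\<omega> \<in> words B n \<Longrightarrow> x \<in> S \<Longrightarrow> word_map \<omega> x \<in> S"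
proof (induction n arbitrary: \<omega>)
  case (Suc n)
  then show ?case using cf_map_S B_bounds by (fastforce simp: words_Suc)
qed (simp add: words_def)

text \<open>By the chain rule the weights multiply along an orbit. The resulting sum over words is
  the one that \<open>discrete_op\<close> discretizes, which is why the \<nu>-th power of the
  spectral radius appears in the theorem.\<close>

lemma transfer_op_power:
  assumes "x \<in> S"
  shows "(L ^^ n) f x = (\<Sum>\<omega>\<in>words B n. word_weight \<omega> x powr s * f (word_map \<omega> x))"
proof (induction n arbitrary: f)
  case 0
  have "words B 0 = {[]}" by (auto simp: words_def)
  moreover have "word_weight [] x = 1" by (simp add: word_weight_def)
  ultimately show ?case by simp
next
  case (Suc n)
  have "(L ^^ Suc n) f x = (L ^^ n) (L f) x" by (simp add: funpow_swap1)
  also have "\<dots> = (\<Sum>\<omega>\<in>words B n. word_weight \<omega> x powr s * L f (word_map \<omega> x))" by (rule Suc)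
  also have "\<dots> = (\<Sum>\<omega>\<in>words B n. \<Sum>\<beta>\<in>B. word_weight (\<beta> # \<omega>) x powr s * f (word_map (\<beta> # \<omega>) x))"
  proof (rule sum.cong)
    fix \<omega> assume \<omega>: "\<omega> \<in> words B n"
    have "word_weight (\<beta> # \<omega>) x powr s =
       word_weight \<omega> x powr s * \<bar>deriv (cf_map \<beta>) (word_map \<omega> x)\<bar> powr s" if "\<beta> \<in> B" for \<beta>
      using word_weight_Cons[OF words_pos[OF \<omega>], of \<beta> x] B_bounds[OF that] \<gamma>1 S_pos[OF assms]
      by (simp add: powr_mult word_weight_def mult.commute)
    then show "word_weight \<omega> x powr s * L f (word_map \<omega> x) =
        (\<Sum>\<beta>\<in>B. word_weight (\<beta> # \<omega>) x powr s * f (word_map (\<beta> # \<omega>) x))"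
      using word_map_S[OF \<omega> assms] by (simp add: transfer_op_def sum_distrib_left mult.assoc)
  qed simp
  finally show ?case by (simp add: sum_words_Suc)
qed

lemma B_tilde_ge_1: "1 \<le> B_tilde \<gamma> m \<and> 1 \<le> B_tilde \<gamma> (Suc m)"
  using \<gamma>1 by (induction m) (auto intro: order_trans[OF \<gamma>1] simp: add_increasing mult_ge1_I)

text \<open>Appending \<beta> replaces (c, d) by (d, c + \<beta> d). With the least letter this is
  the recursion of \<open>B_tilde\<close>, while the ratio d / c becomes \<beta> + 1 / (d / c),
  whose extremes follow \<open>frak_a\<close> and \<open>frak_b\<close>. Inversion exchanges the two
  ends, so the induction carries an upper bound for the ratio as well.\<close>

lemma word_denom_bounds:
  assumes "\<omega> \<in> words B (Suc m)"
  shows "B_tilde \<gamma> m \<le> fst (word_denom \<omega>)" "B_tilde \<gamma> (Suc m) \<le> snd (word_denom \<omega>)"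
    and "1 \<le> fst (word_denom \<omega>)"
    and "\<gamma> + frak_a \<gamma> \<Gamma> m \<le> snd (word_denom \<omega>) / fst (word_denom \<omega>)"
proof -
  note B1 = B_tilde_ge_1
  have "B_tilde \<gamma> m \<le> fst (word_denom \<omega>) \<and> B_tilde \<gamma> (Suc m) \<le> snd (word_denom \<omega>) \<and>
     \<gamma> + frak_a \<gamma> \<Gamma> m \<le> snd (word_denom \<omega>) / fst (word_denom \<omega>) \<and>
     snd (word_denom \<omega>) / fst (word_denom \<omega>) \<le> \<Gamma> + frak_b \<gamma> \<Gamma> m"
    using assms
  proof (induction m arbitrary: \<omega>)
    case 0
    then obtain \<beta> where "\<omega> = [\<beta>]" "\<beta> \<in> B" by (auto simp: words_def length_Suc_conv)
    moreover have "word_denom [\<beta>] = (1, \<beta>)" using word_denom_snoc[of "[]" \<beta>] by (simp add: word_denom_Nil)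
    ultimately show ?case using B_bounds[of \<beta>] \<gamma>1 by (auto intro: add_increasing2)
  next
    case (Suc m)
    obtain \<omega>' \<beta> where \<omega>: "\<omega> = \<omega>' @ [\<beta>]" using Suc.prems by (cases \<omega> rule: rev_cases) (auto simp: words_def)
    have \<omega>': "\<omega>' \<in> words B (Suc m)" "\<beta> \<in> B" using Suc.prems by (auto simp: \<omega> words_def)
    define C where "C = fst (word_denom \<omega>')"
    define D where "D = snd (word_denom \<omega>')"
    have IH: "B_tilde \<gamma> m \<le> C" "B_tilde \<gamma> (Suc m) \<le> D" "\<gamma> + frak_a \<gamma> \<Gamma> m \<le> D / C" "D / C \<le> \<Gamma> + frak_b \<gamma> \<Gamma> m"
      using Suc.IH[OF \<omega>'(1)] by (auto simp: C_def D_def)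
    have CD: "1 \<le> C" "1 \<le> D" using IH B1[of m] by linarith+
    have b: "\<gamma> \<le> \<beta>" "\<beta> \<le> \<Gamma>" using B_bounds \<omega>' by auto
    have "\<gamma> * B_tilde \<gamma> (Suc m) \<le> \<beta> * D" using b IH B1[of m] \<gamma>1 by (intro mult_mono) auto
    moreover have "C / D = 1 / (D / C)" by simp
    moreover have "1 / (\<Gamma> + frak_b \<gamma> \<Gamma> m) \<le> 1 / (D / C)"
      using IH CD frak_nonneg[of m] \<gamma>1 \<gamma>\<Gamma> by (intro divide_left_mono mult_pos_pos) auto
    moreover have "1 / (D / C) \<le> 1 / (\<gamma> + frak_a \<gamma> \<Gamma> m)"
      using IH CD frak_nonneg[of m] \<gamma>1 by (intro divide_left_mono mult_pos_pos) auto
    moreover have "(C + \<beta> * D) / D = \<beta> + C / D" using CD by (simp add: field_simps)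
    ultimately show ?case
      using IH b by (simp add: \<omega> word_denom_snoc C_def[symmetric] D_def[symmetric] cf_map_def add.commute add_mono)
  qed
  then show "B_tilde \<gamma> m \<le> fst (word_denom \<omega>)" "B_tilde \<gamma> (Suc m) \<le> snd (word_denom \<omega>)"
    "1 \<le> fst (word_denom \<omega>)" "\<gamma> + frak_a \<gamma> \<Gamma> m \<le> snd (word_denom \<omega>) / fst (word_denom \<omega>)"
    using B1[of m] by auto
qed

lemma word_weight_le_c_contr:
  assumes "\<omega> \<in> words B \<nu>" "1 \<le> \<nu>" "x \<in> S"
  shows "word_weight \<omega> x \<le> c_contr \<gamma> \<Gamma> \<nu>"
proof -
  obtain m where m: "\<nu> = Suc m" using assms by (cases \<nu>) auto
  note b = word_denom_bounds[of \<omega> m, OF assms(1)[unfolded m]]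
  have Bt: "0 < B_tilde \<gamma> k" for k using B_tilde_ge_1[of k] by linarith
  have "B_tilde \<gamma> m * A + B_tilde \<gamma> (Suc m) \<le> fst (word_denom \<omega>) * x + snd (word_denom \<omega>)"
    using b assms(3) A_pos by (intro add_mono mult_mono) (auto simp: S_iff)
  moreover have "0 < B_tilde \<gamma> m * A + B_tilde \<gamma> (Suc m)" using A_pos Bt by (simp add: add_pos_pos)
  ultimately show ?thesis
    unfolding word_weight_eq[OF words_pos[OF assms(1)] less_imp_le[OF S_pos[OF assms(3)]]] c_contr_def m
    by (intro divide_left_mono power_mono mult_pos_pos zero_less_power) (auto intro: less_le_trans)
qed

lemma word_map_contract:
  assumes "\<omega> \<in> words B \<nu>" "1 \<le> \<nu>" "x \<in> S" "y \<in> S"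
  shows "\<bar>word_map \<omega> x - word_map \<omega> y\<bar> \<le> c_contr \<gamma> \<Gamma> \<nu> * \<bar>x - y\<bar>"
proof -
  have "norm (word_map \<omega> x - word_map \<omega> y) \<le> c_contr \<gamma> \<Gamma> \<nu> * norm (x - y)"
  proof (rule field_differentiable_bound[where S = S and f' = "deriv (word_map \<omega>)"])
    show "convex S" by (simp add: S_int_def)
    fix z assume z: "z \<in> S"
    show "(word_map \<omega> has_field_derivative deriv (word_map \<omega>) z) (at z within S)"
      using word_map_deriv[OF words_pos[OF assms(1)] less_imp_le[OF S_pos[OF z]]] DERIV_imp_deriv
      by (metis has_field_derivative_at_within)
    show "norm (deriv (word_map \<omega>) z) \<le> c_contr \<gamma> \<Gamma> \<nu>"
      using word_weight_le_c_contr[OF assms(1,2) z] by (simp add: word_weight_def)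
  qed (use assms in auto)
  then show ?thesis by simp
qed

text \<open>The logarithmic derivative of the weight is -2 / (x + D / C), and x + D / C is at least
  e, the denominator in \<open>M_zero\<close>. The proof applies 1 + t <= exp t to the ratio of two
  denominators instead of differentiating.\<close>

lemma word_weight_log_lipschitz:
  assumes "\<omega> \<in> words B \<nu>" "1 \<le> \<nu>" "x \<in> S" "y \<in> S"
  shows "word_weight \<omega> x powr s \<le> exp (s * M_zero \<gamma> \<Gamma> \<nu> * \<bar>x - y\<bar>) * word_weight \<omega> y powr s"
proof -
  obtain m where m: "\<nu> = Suc m" using assms by (cases \<nu>) auto
  define C where "C = fst (word_denom \<omega>)"
  define D where "D = snd (word_denom \<omega>)"
  have C: "1 \<le> C" and DC: "\<gamma> + frak_a \<gamma> \<Gamma> m \<le> D / C"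
    using word_denom_bounds[of \<omega> m] assms(1) m by (auto simp: C_def D_def)
  define e where "e = A + frak_a \<gamma> \<Gamma> m + \<gamma>"
  have e0: "0 < e" using A_pos frak_nonneg[of m] \<gamma>1 by (simp add: e_def)
  have eC: "e * C \<le> C * z + D" if "z \<in> S" for z
  proof -
    have "e \<le> z + D / C" using DC that by (simp add: e_def S_iff)
    then have "e * C \<le> (z + D / C) * C" using C by (intro mult_right_mono) auto
    then show ?thesis using C by (simp add: algebra_simps)
  qed
  have pos: "0 < C * z + D" if "z \<in> S" for z
    using eC[OF that] e0 C by (smt (verit) mult_pos_pos)
  have "(C * y + D) / (C * x + D) \<le> 1 + \<bar>x - y\<bar> / e"
  proof -
    have "(C * y + D) / (C * x + D) = 1 + C * (y - x) / (C * x + D)"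
      using pos[OF assms(3)] by (simp add: field_simps)
    also have "C * (y - x) / (C * x + D) \<le> C * \<bar>x - y\<bar> / (e * C)"
      using C e0 eC[OF assms(3)] by (intro frac_le mult_left_mono) auto
    finally show ?thesis using C by simp
  qed
  also have "\<dots> \<le> exp (\<bar>x - y\<bar> / e)" by (rule exp_ge_add_one_self)
  finally have r: "(C * y + D) / (C * x + D) \<le> exp (\<bar>x - y\<bar> / e)" .
  have w: "word_weight \<omega> z = (C * z + D) powr (- 2)" if "z \<in> S" for z
    using word_weight_eq[OF words_pos[OF assms(1)] less_imp_le[OF S_pos[OF that]]] pos[OF that]
    by (simp add: C_def D_def powr_minus_divide)
  have ws: "word_weight \<omega> z powr s = (C * z + D) powr (- 2 * s)" if "z \<in> S" for z
    unfolding w[OF that] by (simp add: powr_powr)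
  have "word_weight \<omega> x powr s = ((C * y + D) / (C * x + D)) powr (2 * s) * word_weight \<omega> y powr s"
    unfolding ws[OF assms(3)] ws[OF assms(4)] using pos[OF assms(3)] pos[OF assms(4)]
    by (simp add: powr_divide powr_minus_divide field_simps)
  also have "\<dots> \<le> exp (\<bar>x - y\<bar> / e) powr (2 * s) * word_weight \<omega> y powr s"
    using r s_pos pos[OF assms(3)] pos[OF assms(4)] by (intro mult_right_mono powr_mono2) auto
  also have "exp (\<bar>x - y\<bar> / e) powr (2 * s) = exp (s * M_zero \<gamma> \<Gamma> \<nu> * \<bar>x - y\<bar>)"
    by (simp add: powr_def M_zero_def m e_def algebra_simps)
  finally show ?thesis .
qed

end

section \<open>Positive eigenfunction and spectral radius of the transfer operator\<close>

context cf_ifs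
begin

lemma transfer_op_eq:
  "x \<in> S \<Longrightarrow> L f x = (\<Sum>\<beta>\<in>B. (1 / (x + \<beta>)\<^sup>2) powr s * f (cf_map \<beta> x))"
proof -
  assume x: "x \<in> S"
  have "0 < x + \<beta>" if "\<beta> \<in> B" for \<beta> using B_bounds[OF that] \<gamma>1 S_pos[OF x] by linarith
  then show ?thesis using x by (simp add: transfer_op_def abs_deriv_cf_map)
qed

lemma transfer_op_outside: "x \<notin> S \<Longrightarrow> L f x = 0" by (simp add: transfer_op_def)

lemma transfer_op_linear: "L (\<lambda>x. f x + c * g x) = (\<lambda>x. L f x + c * L g x)"
  by (auto simp: transfer_op_def fun_eq_iff sum.distrib sum_distrib_left algebra_simps)

lemma transfer_op_maps:
  assumes f: "f \<in> continuous_functions S"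
  shows "L f \<in> continuous_functions S"
proof -
  have pos: "0 < x + \<beta>" if "\<beta> \<in> B" "x \<in> S" for \<beta> x
    using B_bounds[OF that(1)] \<gamma>1 S_pos[OF that(2)] by linarith
  then have nz: "x + \<beta> \<noteq> 0" if "\<beta> \<in> B" "x \<in> S" for \<beta> x using that by fastforce
  have cf: "continuous_on S (cf_map \<beta>)" if "\<beta> \<in> B" for \<beta>
    unfolding cf_map_def[abs_def] using pos[OF that] by (intro continuous_intros) (metis less_irrefl)
  have "continuous_on S (\<lambda>x. f (cf_map \<beta> x))" if b: "\<beta> \<in> B" for \<beta>
    by (rule continuous_on_compose2[OF _ cf[OF b], of S])
       (use f cf_map_S B_bounds[OF b] in \<open>auto simp: continuous_functions_def\<close>)
  then have "continuous_on S (\<lambda>x. \<Sum>\<beta>\<in>B. (1 / (x + \<beta>)\<^sup>2) powr s * f (cf_map \<beta> x))"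
    using nz by (intro continuous_intros) auto
  then have "continuous_on S (L f)"
    by (rule continuous_on_eq) (simp add: transfer_op_eq)
  then show ?thesis by (simp add: continuous_functions_def transfer_op_outside)
qed

lemma transfer_op_bound:
  assumes "\<And>y. y \<in> S \<Longrightarrow> \<bar>f y\<bar> \<le> C" "x \<in> S"
  shows "\<bar>L f x\<bar> \<le> real (card B) * C"
proof -
  have "\<bar>L f x\<bar> \<le> (\<Sum>\<beta>\<in>B. \<bar>(1 / (x + \<beta>)\<^sup>2) powr s * f (cf_map \<beta> x)\<bar>)"
    unfolding transfer_op_eq[OF assms(2)] by (rule sum_abs)
  also have "\<dots> \<le> (\<Sum>\<beta>\<in>B. C)"
  proof (rule sum_mono)
    fix \<beta> assume b: "\<beta> \<in> B"
    have 1: "1 \<le> x + \<beta>" using B_bounds[OF b] \<gamma>1 S_pos[OF assms(2)] by linarith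
    then have "1 / (x + \<beta>)\<^sup>2 \<le> 1" by (simp add: power_le_one_iff)
    then have w: "(1 / (x + \<beta>)\<^sup>2) powr s \<le> 1" using s_pos powr_mono2[of s "1 / (x + \<beta>)\<^sup>2" 1] by simp
    have fC: "\<bar>f (cf_map \<beta> x)\<bar> \<le> C" using assms cf_map_S B_bounds[OF b] by blast
    have "\<bar>(1 / (x + \<beta>)\<^sup>2) powr s * f (cf_map \<beta> x)\<bar> \<le> 1 * C"
      unfolding abs_mult using w fC by (intro mult_mono) auto
    then show "\<bar>(1 / (x + \<beta>)\<^sup>2) powr s * f (cf_map \<beta> x)\<bar> \<le> C" by simp
  qed
  finally show ?thesis by simp
qed

lemma c_contr_1: "c_contr \<gamma> \<Gamma> 1 < 1" "0 \<le> c_contr \<gamma> \<Gamma> 1"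
proof -
  have "1 < (A + \<gamma>)\<^sup>2" using A_pos \<gamma>1 by (intro one_less_power) auto
  then have "1 / (A + \<gamma>)\<^sup>2 < 1 / 1" by (intro divide_strict_left_mono) auto
  then show "c_contr \<gamma> \<Gamma> 1 < 1" "0 \<le> c_contr \<gamma> \<Gamma> 1" by (simp_all add: c_contr_def)
qed

text \<open>One branch adds the logarithmic Lipschitz constant of its weight to Q times its
  contraction. Only the behaviour of f on the image of the branch enters, so the lemma serves both
  the transfer operator and the piecewise interpolant.\<close>

lemma weighted_cone_step:
  assumes \<omega>: "\<omega> \<in> words B \<nu>" "1 \<le> \<nu>" and xy: "x \<in> S" "y \<in> S" and Q: "0 \<le> Q"
    and f: "\<And>u v. u \<in> word_map \<omega> ` S \<Longrightarrow> v \<in> word_map \<omega> ` S \<Longrightarrow> f u \<le> exp (Q * \<bar>u - v\<bar>) * f v"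
    and pos: "\<And>u. u \<in> word_map \<omega> ` S \<Longrightarrow> 0 \<le> f u"
    and M: "s * M_zero \<gamma> \<Gamma> \<nu> + Q * c_contr \<gamma> \<Gamma> \<nu> \<le> M"
  shows "word_weight \<omega> x powr s * f (word_map \<omega> x) \<le>
    exp (M * \<bar>x - y\<bar>) * (word_weight \<omega> y powr s * f (word_map \<omega> y))"
proof -
  have "f (word_map \<omega> x) \<le> exp (Q * \<bar>word_map \<omega> x - word_map \<omega> y\<bar>) * f (word_map \<omega> y)"
    using xy by (intro f) auto
  also have "\<dots> \<le> exp (Q * (c_contr \<gamma> \<Gamma> \<nu> * \<bar>x - y\<bar>)) * f (word_map \<omega> y)"
    using word_map_contract[OF \<omega> xy] Q pos xy by (intro mult_right_mono) (auto intro: mult_left_mono)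
  finally have fx: "f (word_map \<omega> x) \<le> exp (Q * (c_contr \<gamma> \<Gamma> \<nu> * \<bar>x - y\<bar>)) * f (word_map \<omega> y)" .
  have "word_weight \<omega> x powr s * f (word_map \<omega> x) \<le>
     (exp (s * M_zero \<gamma> \<Gamma> \<nu> * \<bar>x - y\<bar>) * word_weight \<omega> y powr s) *
     (exp (Q * (c_contr \<gamma> \<Gamma> \<nu> * \<bar>x - y\<bar>)) * f (word_map \<omega> y))"
    using word_weight_log_lipschitz[OF \<omega> xy] fx pos xy by (intro mult_mono) auto
  also have "\<dots> = exp ((s * M_zero \<gamma> \<Gamma> \<nu> + Q * c_contr \<gamma> \<Gamma> \<nu>) * \<bar>x - y\<bar>) *
      (word_weight \<omega> y powr s * f (word_map \<omega> y))"
    by (simp add: distrib_right exp_add algebra_simps)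
  also have "\<dots> \<le> exp (M * \<bar>x - y\<bar>) * (word_weight \<omega> y powr s * f (word_map \<omega> y))"
    using M pos xy by (intro mult_right_mono) (auto intro: mult_right_mono)
  finally show ?thesis .
qed

lemma transfer_op_eigenfunction:
  obtains lam v where "0 < lam" "v \<in> continuous_functions S" "\<And>x. x \<in> S \<Longrightarrow> 0 < v x" "L v = (\<lambda>x. lam * v x)"
proof -
  define c where "c = c_contr \<gamma> \<Gamma> 1"
  \<comment> \<open>\<kappa> lies halfway between the contraction c and 1, and M solves m0 + M c =
    \<kappa> M, so that every single branch sends the cone for M into the cone for \<kappa>
    M.\<close>
  define \<kappa> where "\<kappa> = (1 + c) / 2"
  have c: "0 \<le> c" "c < 1" using c_contr_1 by (simp_all add: c_def)
  have \<kappa>: "0 \<le> \<kappa>" "\<kappa> < 1" "0 < \<kappa> - c" using c by (simp_all add: \<kappa>_def field_simps)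
  define m0 where "m0 = s * M_zero \<gamma> \<Gamma> 1"
  have m0: "0 < m0" using s_pos A_pos \<gamma>1 by (simp add: m0_def M_zero_def)
  define M where "M = m0 / (\<kappa> - c)"
  have M: "0 < M" using m0 \<kappa> by (simp add: M_def)
  have M\<kappa>: "m0 + M * c = \<kappa> * M" using \<kappa> by (simp add: M_def field_simps)
  have pq: "A \<in> S" "A' \<in> S" "A \<noteq> A'" using A_less_A' by (auto simp: S_iff)
  have bnd: "bounded S" using S_compact compact_imp_bounded by blast
  have cone: "L F \<in> cone_K (\<kappa> * M) S" if F: "F \<in> cone_K M S" for F
  proof (rule cone_KI)
    fix x y assume xy: "x \<in> S" "y \<in> S"
    have e: "L F z = (\<Sum>\<omega>\<in>words B 1. word_weight \<omega> z powr s * F (word_map \<omega> z))" if "z \<in> S" for z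
      using transfer_op_power[OF that, of 1 F] by simp
    show "L F x \<le> exp (\<kappa> * M * \<bar>x - y\<bar>) * L F y"
      unfolding e[OF xy(1)] e[OF xy(2)] sum_distrib_left
    proof (rule sum_mono)
      fix \<omega> assume \<omega>: "\<omega> \<in> words B 1"
      have sub: "word_map \<omega> ` S \<subseteq> S" using word_map_S[OF \<omega>] by auto
      show "word_weight \<omega> x powr s * F (word_map \<omega> x) \<le>
         exp (\<kappa> * M * \<bar>x - y\<bar>) * (word_weight \<omega> y powr s * F (word_map \<omega> y))"
      proof (rule weighted_cone_step[OF \<omega> _ xy less_imp_le[OF M]])
        show "F u \<le> exp (M * \<bar>u - v\<bar>) * F v" if "u \<in> word_map \<omega> ` S" "v \<in> word_map \<omega> ` S" for u v
          using that sub by (intro cone_K_D[OF F]) auto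
        show "0 \<le> F u" if "u \<in> word_map \<omega> ` S" for u
          using that sub by (intro cone_K_nonneg[OF F M pq]) auto
        show "s * M_zero \<gamma> \<Gamma> 1 + M * c_contr \<gamma> \<Gamma> 1 \<le> \<kappa> * M"
          using M\<kappa> by (simp add: m0_def c_def)
      qed simp
    qed
  qed (simp add: transfer_op_outside)
  have Apos: "0 < L F A" if "F \<in> cone_K M S" "\<And>x. x \<in> S \<Longrightarrow> 0 < F x" for F
    unfolding transfer_op_eq[OF pq(1)]
  proof (rule sum_pos[OF B_fin B_ne])
    fix \<beta> assume b: "\<beta> \<in> B"
    have "0 < A + \<beta>" using A_pos B_bounds[OF b] \<gamma>1 by linarith
    then show "0 < (1 / (A + \<beta>)\<^sup>2) powr s * F (cf_map \<beta> A)"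
      using that(2) cf_map_S[OF _ _ pq(1)] B_bounds[OF b] by simp
  qed
  obtain lam v where lv: "0 < lam" "v \<in> cone_K (\<kappa> * M) S" "\<And>x. x \<in> S \<Longrightarrow> 0 < v x" "L v = (\<lambda>x. lam * v x)"
  proof (rule cone_K_eigenfunction[OF S_compact pq M \<kappa>(1,2), of L "real (card B)"])
    show "L (\<lambda>x. f x + c * g x) = (\<lambda>x. L f x + c * L g x)" for f g c by (rule transfer_op_linear)
    show "\<bar>L f x\<bar> \<le> real (card B) * C" if "\<And>y. y \<in> S \<Longrightarrow> \<bar>f y\<bar> \<le> C" "x \<in> S" for f C x
      using that by (rule transfer_op_bound)
    show "L F \<in> cone_K (\<kappa> * M) S" if "F \<in> cone_K M S" for F using that by (rule cone)
    show "0 < L F A" if "F \<in> cone_K M S" "\<And>x. x \<in> S \<Longrightarrow> 0 < F x" for F using that by (rule Apos)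
  qed (rule that)
  have "0 \<le> v x" if "x \<in> S" for x using lv(3)[OF that] by simp
  then have "v \<in> cone_K M S" using cone_K_mono[OF lv(2), of M] \<kappa> M by simp
  then have "v \<in> continuous_functions S" by (rule cone_K_continuous[OF _ bnd M pq])
  then show ?thesis using that lv by blast
qed

text \<open>L preserves the pointwise order, so a bound |f| <= b v passes to the powers with the
  factor lam^n; compactness of S compares v with constants.\<close>

lemma transfer_op_spectral_radius:
  assumes lam: "0 < lam" and v: "v \<in> continuous_functions S" "\<And>x. x \<in> S \<Longrightarrow> 0 < v x" "L v = (\<lambda>x. lam * v x)"
  shows "spectral_radius_on S (continuous_functions S) L = lam"
proof -
  have cv: "continuous_on S v" using v by (simp add: continuous_functions_def)
  have AS: "A \<in> S" using A_less_A' by (simp add: S_iff)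
  obtain x1 where x1: "x1 \<in> S" "\<And>x. x \<in> S \<Longrightarrow> v x1 \<le> v x"
    using continuous_attains_inf[OF S_compact _ cv] AS by blast
  obtain x2 where x2: "x2 \<in> S" "\<And>x. x \<in> S \<Longrightarrow> v x \<le> v x2"
    using continuous_attains_sup[OF S_compact _ cv] AS by blast
  have step: "\<bar>(L ^^ n) f x\<bar> \<le> b * lam ^ n * v x"
    if b: "\<And>x. x \<in> S \<Longrightarrow> \<bar>f x\<bar> \<le> b * v x" and x: "x \<in> S" for f b n x
    using x
  proof (induction n arbitrary: x)
    case (Suc n)
    have "\<bar>L ((L ^^ n) f) x\<bar> \<le> (\<Sum>\<beta>\<in>B. \<bar>(1 / (x + \<beta>)\<^sup>2) powr s * (L ^^ n) f (cf_map \<beta> x)\<bar>)"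
      unfolding transfer_op_eq[OF Suc.prems] by (rule sum_abs)
    also have "\<dots> \<le> (\<Sum>\<beta>\<in>B. b * lam ^ n * ((1 / (x + \<beta>)\<^sup>2) powr s * v (cf_map \<beta> x)))"
    proof (rule sum_mono)
      fix \<beta> assume "\<beta> \<in> B"
      then have "cf_map \<beta> x \<in> S" using cf_map_S Suc.prems B_bounds by blast
      from mult_left_mono[OF Suc.IH[OF this], of "(1 / (x + \<beta>)\<^sup>2) powr s"]
      show "\<bar>(1 / (x + \<beta>)\<^sup>2) powr s * (L ^^ n) f (cf_map \<beta> x)\<bar>
         \<le> b * lam ^ n * ((1 / (x + \<beta>)\<^sup>2) powr s * v (cf_map \<beta> x))"
        by (simp add: abs_mult algebra_simps)
    qed
    also have "\<dots> = b * lam ^ n * L v x" unfolding transfer_op_eq[OF Suc.prems] by (rule sum_distrib_left[symmetric])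
    finally show ?case by (simp add: v(3) algebra_simps)
  qed (use b in simp)
  have pow: "\<bar>(L ^^ n) f x\<bar> \<le> (v x2 / v x1) * lam ^ n * C"
    if "f \<in> continuous_functions S" and C: "\<And>y. y \<in> S \<Longrightarrow> \<bar>f y\<bar> \<le> C" and x: "x \<in> S" for f C x n
  proof -
    have C0: "0 \<le> C" using C[OF x] abs_ge_zero order_trans by blast
    have "\<bar>f y\<bar> \<le> C / v x1 * v y" if "y \<in> S" for y
    proof -
      have "C / v x1 * v x1 \<le> C / v x1 * v y"
        using x1 that C0 v(2) by (intro mult_left_mono) (auto intro: divide_nonneg_pos)
      then show ?thesis using C[OF that] v(2)[OF x1(1)] by simp
    qed
    from step[OF this x, of n] have "\<bar>(L ^^ n) f x\<bar> \<le> C / v x1 * lam ^ n * v x" .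
    also have "\<dots> \<le> C / v x1 * lam ^ n * v x2"
      using x2(2)[OF x] C0 v(2)[OF x1(1)] lam by (intro mult_left_mono mult_nonneg_nonneg) auto
    finally show ?thesis by (simp add: algebra_simps)
  qed
  show ?thesis
    by (rule spectral_radius_on_eqI[OF S_compact _ transfer_op_maps transfer_op_linear pow _ less_imp_le[OF lam] v(1) _ v(3), of A])
       (use AS v(2)[OF AS] v(2)[OF x1(1)] v(2)[OF x2(1)] in auto)
qed

end

section \<open>Approximation of the eigenfunction by positive combinations of powers\<close>

context cf_ifs
begin

lemma word_map_contract_power:
  assumes "x \<in> S" "y \<in> S" "\<omega> \<in> words B n"
  shows "\<bar>word_map \<omega> x - word_map \<omega> y\<bar> \<le> (c_contr \<gamma> \<Gamma> 1) ^ n * \<bar>x - y\<bar>"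
  using assms(3)
proof (induction n arbitrary: \<omega>)
  case (Suc n)
  obtain \<beta> \<omega>' where \<omega>: "\<omega> = \<beta> # \<omega>'" "\<beta> \<in> B" "\<omega>' \<in> words B n" using Suc.prems by (auto simp: words_Suc)
  have b: "[\<beta>] \<in> words B 1" using \<omega> by (simp add: words_def)
  have "\<bar>word_map \<omega> x - word_map \<omega> y\<bar> = \<bar>word_map [\<beta>] (word_map \<omega>' x) - word_map [\<beta>] (word_map \<omega>' y)\<bar>"
    by (simp add: \<omega>)
  also have "\<dots> \<le> c_contr \<gamma> \<Gamma> 1 * \<bar>word_map \<omega>' x - word_map \<omega>' y\<bar>"
    using word_map_S[OF \<omega>(3)] assms by (intro word_map_contract[OF b]) auto
  also have "\<dots> \<le> c_contr \<gamma> \<Gamma> 1 * ((c_contr \<gamma> \<Gamma> 1) ^ n * \<bar>x - y\<bar>)"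
    using Suc.IH[OF \<omega>(3)] c_contr_1 by (intro mult_left_mono) auto
  finally show ?case by simp
qed (simp add: words_def)

text \<open>q0 acts as an additional outermost branch. The ratio c / d of the coefficients starts at
  1 / q0 in S and is moved by branches, so it stays in S. After at least one letter \<beta> the
  inverse ratio is \<beta> plus an element of S, hence at least \<gamma> + A.\<close>

lemma word_denom_Cons_S:
  assumes q0: "0 < q0" "1 / q0 \<in> S" and \<omega>: "set \<omega> \<subseteq> B"
  shows "0 < fst (word_denom (q0 # \<omega>)) \<and> 0 < snd (word_denom (q0 # \<omega>)) \<and>
    fst (word_denom (q0 # \<omega>)) / snd (word_denom (q0 # \<omega>)) \<in> S \<and>
    (\<omega> \<noteq> [] \<longrightarrow> \<gamma> + A \<le> snd (word_denom (q0 # \<omega>)) / fst (word_denom (q0 # \<omega>)))"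
  using \<omega>
proof (induction \<omega> rule: rev_induct)
  case Nil
  have "word_denom [q0] = (1, q0)" using word_denom_snoc[of "[]" q0] by (simp add: word_denom_Nil)
  then show ?case using q0 by simp
next
  case (snoc \<beta> \<omega>)
  define C where "C = fst (word_denom (q0 # \<omega>))"
  define D where "D = snd (word_denom (q0 # \<omega>))"
  have IH: "0 < C" "0 < D" "C / D \<in> S" using snoc by (auto simp: C_def D_def)
  have b: "\<gamma> \<le> \<beta>" "\<beta> \<le> \<Gamma>" "0 < \<beta>" using snoc.prems B_bounds \<gamma>1 by fastforce+
  have e: "word_denom (q0 # \<omega> @ [\<beta>]) = (D, C + \<beta> * D)"
    using word_denom_snoc[of "q0 # \<omega>" \<beta>] by (simp add: C_def D_def)
  have "D / (C + \<beta> * D) = cf_map \<beta> (C / D)" using IH b by (simp add: cf_map_def field_simps)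
  moreover have "(C + \<beta> * D) / D = \<beta> + C / D" using IH by (simp add: field_simps)
  ultimately show ?case
    using IH b cf_map_S[OF b(1,2) IH(3)] unfolding e by (auto simp: S_iff add_pos_pos)
qed

text \<open>\<open>v\<close> is a limit of positive combinations of the functions \<open>x \<mapsto> (x + q) powr (- 2 s)\<close> with
  \<open>q \<ge> \<gamma> + A\<close>, since by contraction \<open>v (word_map \<omega> x)\<close> is for long \<open>\<omega>\<close> almost a constant multiple
  of \<open>(word_map \<omega> x + q0) powr (- 2 s)\<close>, where \<open>1 / q0 \<in> S\<close>.\<close>

lemma eigenfunction_positivity:
  assumes lam: "0 < lam" and v: "v \<in> continuous_functions S" "\<And>x. x \<in> S \<Longrightarrow> 0 < v x" "L v = (\<lambda>x. lam * v x)"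
    and I: "finite I" "\<And>i. i \<in> I \<Longrightarrow> x i \<in> S"
    and pos: "\<And>q. \<gamma> + A \<le> q \<Longrightarrow> 0 \<le> (\<Sum>i\<in>I. \<alpha> i * (x i + q) powr (- 2 * s))"
  shows "0 \<le> (\<Sum>i\<in>I. \<alpha> i * v (x i))"
proof -
  define q0 where "q0 = 1 / A"
  have q0: "0 < q0" "1 / q0 \<in> S" using A_pos A_less_A' by (auto simp: q0_def S_iff)
  \<comment> \<open>e is the weight of the additional branch, so the weight of \<omega> times e at
    the image point is the weight of \<open>q0 # \<omega>\<close>, a constant times a power of y +
    q.\<close>
  define e where "e = (\<lambda>y. \<bar>deriv (cf_map q0) y\<bar> powr s)"
  have e: "e y = (1 / (y + q0)\<^sup>2) powr s" if "y \<in> S" for y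
    unfolding e_def using S_pos[OF that] q0 by (subst abs_deriv_cf_map) auto
  have e_pos: "0 < e y" if "y \<in> S" for y using S_pos[OF that] q0 by (simp add: e[OF that])
  define \<phi> where "\<phi> = (\<lambda>y. v y / e y)"
  have cv: "continuous_on S v" using v by (simp add: continuous_functions_def)
  have ce: "continuous_on S (\<lambda>y. (1 / (y + q0)\<^sup>2) powr s)"
    using S_pos q0 by (intro continuous_intros) (auto simp: add_pos_pos less_imp_neq[symmetric])
  then have ce': "continuous_on S e" by (rule continuous_on_eq) (simp add: e)
  have c\<phi>: "continuous_on S \<phi>" unfolding \<phi>_def
    using cv ce' e_pos by (intro continuous_intros) (auto simp: less_imp_neq[symmetric])
  have AS: "A \<in> S" using A_less_A' by (simp add: S_iff)
  obtain x1 where x1: "x1 \<in> S" "\<And>x. x \<in> S \<Longrightarrow> \<phi> x1 \<le> \<phi> x"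
    using continuous_attains_inf[OF S_compact _ c\<phi>] AS by blast
  have \<phi>_pos: "0 < \<phi> y" if "y \<in> S" for y using v(2)[OF that] e_pos[OF that] by (simp add: \<phi>_def)
  have ev: "e y \<le> v y / \<phi> x1" if "y \<in> S" for y
  proof -
    have "\<phi> x1 * e y \<le> \<phi> y * e y" using x1(2)[OF that] e_pos[OF that] by (intro mult_right_mono) auto
    also have "\<dots> = v y" using e_pos[OF that] by (simp add: \<phi>_def)
    finally show ?thesis using \<phi>_pos[OF x1(1)] by (simp add: field_simps)
  qed
  \<comment> \<open>The iterated eigenvalue equation with \<phi> = v / e frozen at the image of A.
    Contraction makes \<phi> nearly constant on the image of a long word, and what remains depends
    on y only through branch weights.\<close>
  define w where "w m y = (\<Sum>\<omega>\<in>words B m. word_weight \<omega> y powr s * (\<phi> (word_map \<omega> A) * e (word_map \<omega> y))) / lam ^ m" for m y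
  have vpow: "lam ^ m * v y = (\<Sum>\<omega>\<in>words B m. word_weight \<omega> y powr s * v (word_map \<omega> y))" if "y \<in> S" for m y
  proof -
    have Ls: "L (\<lambda>x. c * v x) = (\<lambda>x. c * L v x)" for c
      using transfer_op_linear[of "\<lambda>x. 0" c v] by (simp add: transfer_op_def fun_eq_iff sum_distrib_left algebra_simps)
    have "(L ^^ m) v = (\<lambda>x. lam ^ m * v x)"
    proof (induction m)
      case (Suc m)
      then show ?case using Ls[of "lam ^ m"] by (simp add: v(3) mult.assoc mult.left_commute)
    qed simp
    then show ?thesis using transfer_op_power[OF that, of m v] by simp
  qed
  have wlim: "(\<lambda>m. w m y) \<longlonglongrightarrow> v y" if y: "y \<in> S" for y
  proof (rule LIMSEQ_I)
    fix r :: real assume r: "0 < r"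
    define r' where "r' = r * \<phi> x1 / (2 * v y)"
    have r': "0 < r'" using r \<phi>_pos[OF x1(1)] v(2)[OF y] by (simp add: r'_def)
    have "uniformly_continuous_on S \<phi>" using compact_uniformly_continuous[OF c\<phi> S_compact] .
    then obtain \<delta> where \<delta>: "0 < \<delta>" "\<And>a b. a \<in> S \<Longrightarrow> b \<in> S \<Longrightarrow> dist a b < \<delta> \<Longrightarrow> dist (\<phi> a) (\<phi> b) < r'"
      using r' unfolding uniformly_continuous_on_def by metis
    have "(\<lambda>m. (c_contr \<gamma> \<Gamma> 1) ^ m * \<bar>y - A\<bar>) \<longlonglongrightarrow> 0 * \<bar>y - A\<bar>"
      using c_contr_1 by (intro tendsto_mult LIMSEQ_power_zero tendsto_const) auto
    then have "\<forall>\<^sub>F m in sequentially. (c_contr \<gamma> \<Gamma> 1) ^ m * \<bar>y - A\<bar> < \<delta>"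
      using \<delta>(1) by (intro order_tendstoD(2)[where y = "0 * \<bar>y - A\<bar>"]) auto
    then obtain m0 where m0: "\<And>m. m0 \<le> m \<Longrightarrow> (c_contr \<gamma> \<Gamma> 1) ^ m * \<bar>y - A\<bar> < \<delta>"
      by (auto simp: eventually_sequentially)
    have "norm (w m y - v y) < r" if m: "m0 \<le> m" for m
    proof -
      have "v y = (\<Sum>\<omega>\<in>words B m. word_weight \<omega> y powr s * (\<phi> (word_map \<omega> y) * e (word_map \<omega> y))) / lam ^ m"
      proof -
        have "\<phi> (word_map \<omega> y) * e (word_map \<omega> y) = v (word_map \<omega> y)" if "\<omega> \<in> words B m" for \<omega>
          using e_pos[OF word_map_S[OF that y]] by (simp add: \<phi>_def)
        then show ?thesis using vpow[OF y, of m] lam by (simp add: field_simps)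
      qed
      then have "w m y - v y = (\<Sum>\<omega>\<in>words B m. word_weight \<omega> y powr s *
          ((\<phi> (word_map \<omega> A) - \<phi> (word_map \<omega> y)) * e (word_map \<omega> y))) / lam ^ m"
        unfolding w_def by (simp add: sum_subtractf[symmetric] diff_divide_distrib[symmetric] algebra_simps)
      then have "norm (w m y - v y) \<le> (\<Sum>\<omega>\<in>words B m. \<bar>word_weight \<omega> y powr s *
          ((\<phi> (word_map \<omega> A) - \<phi> (word_map \<omega> y)) * e (word_map \<omega> y))\<bar>) / lam ^ m"
        using lam by (simp add: abs_divide divide_right_mono)
      also have "\<dots> \<le> (\<Sum>\<omega>\<in>words B m. (r' / \<phi> x1) * (word_weight \<omega> y powr s * v (word_map \<omega> y))) / lam ^ m"
      proof (intro divide_right_mono sum_mono)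
        fix \<omega> assume \<omega>: "\<omega> \<in> words B m"
        have S: "word_map \<omega> y \<in> S" "word_map \<omega> A \<in> S" using word_map_S[OF \<omega>] y AS by auto
        have "dist (word_map \<omega> A) (word_map \<omega> y) < \<delta>"
          using word_map_contract_power[OF y AS \<omega>] m0[OF m] by (simp add: dist_real_def abs_minus_commute)
        then have "\<bar>\<phi> (word_map \<omega> A) - \<phi> (word_map \<omega> y)\<bar> \<le> r'"
          using \<delta>(2)[OF S(2,1)] by (simp add: dist_real_def)
        then have "word_weight \<omega> y powr s * (\<bar>\<phi> (word_map \<omega> A) - \<phi> (word_map \<omega> y)\<bar> * e (word_map \<omega> y))
            \<le> word_weight \<omega> y powr s * (r' * (v (word_map \<omega> y) / \<phi> x1))"
          using ev[OF S(1)] e_pos[OF S(1)] by (intro mult_left_mono mult_mono) auto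
        then show "\<bar>word_weight \<omega> y powr s * ((\<phi> (word_map \<omega> A) - \<phi> (word_map \<omega> y)) * e (word_map \<omega> y))\<bar>
            \<le> (r' / \<phi> x1) * (word_weight \<omega> y powr s * v (word_map \<omega> y))"
          using e_pos[OF S(1)] by (simp add: abs_mult mult_ac)
      qed (use lam in simp)
      also have "\<dots> = r' / \<phi> x1 * v y"
        unfolding sum_distrib_left[symmetric] vpow[OF y, symmetric] using lam by simp
      also have "\<dots> = r / 2" using \<phi>_pos[OF x1(1)] v(2)[OF y] by (simp add: r'_def)
      also have "\<dots> < r" using r by simp
      finally show ?thesis .
    qed
    then show "\<exists>m0. \<forall>m\<ge>m0. norm (w m y - v y) < r" by blast
  qed
  \<comment> \<open>Stated at Suc m because \<open>word_denom_Cons_S\<close> bounds q below by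
    \<gamma> + A only for nonempty words.\<close>
  have wrep: "0 \<le> (\<Sum>i\<in>I. \<alpha> i * w (Suc m) (x i))" for m
  proof -
    define k where "k \<omega> = \<phi> (word_map \<omega> A) * fst (word_denom (q0 # \<omega>)) powr (- 2 * s) / lam ^ Suc m" for \<omega>
    define q where "q \<omega> = snd (word_denom (q0 # \<omega>)) / fst (word_denom (q0 # \<omega>))" for \<omega>
    have wd: "0 < fst (word_denom (q0 # \<omega>))" "0 < snd (word_denom (q0 # \<omega>))" "\<gamma> + A \<le> q \<omega>"
      if "\<omega> \<in> words B (Suc m)" for \<omega>
      using word_denom_Cons_S[OF q0, of \<omega>] that by (auto simp: words_def q_def)
    have eq: "word_weight \<omega> y powr s * e (word_map \<omega> y) = fst (word_denom (q0 # \<omega>)) powr (- 2 * s) * (y + q \<omega>) powr (- 2 * s)"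
      if \<omega>: "\<omega> \<in> words B (Suc m)" and y: "y \<in> S" for \<omega> y
    proof -
      define C where "C = fst (word_denom (q0 # \<omega>))"
      define D where "D = snd (word_denom (q0 # \<omega>))"
      have CD: "0 < C" "0 < D" using wd[OF \<omega>] by (auto simp: C_def D_def)
      have p: "\<forall>\<beta>\<in>set (q0 # \<omega>). 0 < \<beta>" using words_pos[OF \<omega>] q0 by simp
      have "word_weight \<omega> y powr s * e (word_map \<omega> y) = word_weight (q0 # \<omega>) y powr s"
        using word_weight_Cons[OF words_pos[OF \<omega>] q0(1), of y] S_pos[OF y]
        by (simp add: e_def powr_mult word_weight_def mult.commute)
      also have "word_weight (q0 # \<omega>) y = 1 / (C * y + D)\<^sup>2"
        using word_weight_eq[OF p, of y] S_pos[OF y] by (simp add: C_def D_def)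
      also have "\<dots> = (C * y + D) powr (- 2)"
        using CD S_pos[OF y] by (simp add: powr_minus_divide add_pos_pos)
      also have "C * y + D = C * (y + D / C)" using CD by (simp add: algebra_simps)
      also have "((C * (y + D / C)) powr (- 2)) powr s = C powr (- 2 * s) * (y + D / C) powr (- 2 * s)"
        using CD S_pos[OF y] by (simp add: powr_powr powr_mult add_pos_pos)
      finally show ?thesis by (simp add: C_def D_def q_def)
    qed
    have "(\<Sum>i\<in>I. \<alpha> i * w (Suc m) (x i)) = (\<Sum>i\<in>I. \<Sum>\<omega>\<in>words B (Suc m). \<alpha> i * (k \<omega> * (x i + q \<omega>) powr (- 2 * s)))"
    proof (rule sum.cong)
      fix i assume i: "i \<in> I"
      have "w (Suc m) (x i) = (\<Sum>\<omega>\<in>words B (Suc m). k \<omega> * (x i + q \<omega>) powr (- 2 * s))"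
        unfolding w_def sum_divide_distrib
      proof (rule sum.cong)
        fix \<omega> assume "\<omega> \<in> words B (Suc m)"
        from eq[OF this I(2)[OF i]]
        have "\<phi> (word_map \<omega> A) * (word_weight \<omega> (x i) powr s * e (word_map \<omega> (x i))) / lam ^ Suc m
          = \<phi> (word_map \<omega> A) * (fst (word_denom (q0 # \<omega>)) powr (- 2 * s) * (x i + q \<omega>) powr (- 2 * s)) / lam ^ Suc m"
          by (simp only:)
        then show "word_weight \<omega> (x i) powr s * (\<phi> (word_map \<omega> A) * e (word_map \<omega> (x i))) / lam ^ Suc m =
           k \<omega> * (x i + q \<omega>) powr (- 2 * s)" by (simp add: k_def mult_ac)
      qed simp
      then show "\<alpha> i * w (Suc m) (x i) = (\<Sum>\<omega>\<in>words B (Suc m). \<alpha> i * (k \<omega> * (x i + q \<omega>) powr (- 2 * s)))"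
        by (simp add: sum_distrib_left)
    qed simp
    also have "\<dots> = (\<Sum>\<omega>\<in>words B (Suc m). k \<omega> * (\<Sum>i\<in>I. \<alpha> i * (x i + q \<omega>) powr (- 2 * s)))"
      by (subst sum.swap) (simp add: sum_distrib_left algebra_simps)
    also have "0 \<le> \<dots>"
    proof (rule sum_nonneg)
      fix \<omega> assume \<omega>: "\<omega> \<in> words B (Suc m)"
      have "0 \<le> k \<omega>" using \<phi>_pos[OF word_map_S[OF \<omega> AS]] lam by (simp add: k_def)
      then show "0 \<le> k \<omega> * (\<Sum>i\<in>I. \<alpha> i * (x i + q \<omega>) powr (- 2 * s))"
        by (rule mult_nonneg_nonneg[OF _ pos[OF wd(3)[OF \<omega>]]])
    qed
    finally show ?thesis .
  qed
  have "(\<lambda>m. \<Sum>i\<in>I. \<alpha> i * w (Suc m) (x i)) \<longlonglongrightarrow> (\<Sum>i\<in>I. \<alpha> i * v (x i))"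
    by (intro tendsto_sum tendsto_mult tendsto_const LIMSEQ_Suc wlim I(2))
  then show ?thesis using wrep by (intro LIMSEQ_le_const) auto
qed

end

section \<open>The discretized operator\<close>

text \<open>The quadratic Taylor polynomial of exp already suffices, with remainder 2 x^4 / ((1 - x)
  (1 + x)^2). The inequality lets an exponential factor absorb the passage from 1 - x to 1 +
  x.\<close>

lemma exp_ratio_bound:
  fixes x :: real
  assumes "0 \<le> x" "x < 1"
  shows "1 + x \<le> (1 - x) * exp (2 * x / (1 - x\<^sup>2))"
proof -
  define t where "t = 2 * x / (1 - x\<^sup>2)"
  have x2: "0 < 1 - x\<^sup>2" using assms by (simp add: power_less_one_iff abs_square_less_1)
  have t: "0 \<le> t" using assms x2 by (simp add: t_def)
  have f: "1 - x\<^sup>2 = (1 - x) * (1 + x)" by (simp add: power2_eq_square algebra_simps)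
  have nz: "1 - x \<noteq> 0" "1 + x \<noteq> 0" using assms by auto
  have "0 \<le> 2 * x\<^sup>2 * x\<^sup>2 / ((1 - x) * (1 + x)\<^sup>2)" using assms by simp
  also have "\<dots> = (1 - x) * (1 + t + t\<^sup>2 / 2) - (1 + x)"
    unfolding t_def f using nz by (simp add: divide_simps power2_eq_square) (simp add: algebra_simps)
  finally have "1 + x \<le> (1 - x) * (1 + t + t\<^sup>2 / 2)" by simp
  also have "\<dots> \<le> (1 - x) * exp t"
    using exp_lower_Taylor_quadratic[OF t] assms by (intro mult_left_mono) auto
  finally show ?thesis by (simp add: t_def)
qed

lemma functions_on_finite: "finite T \<Longrightarrow> functions_on T = continuous_functions T" for T :: "real set"
  by (auto simp: functions_on_def continuous_functions_def continuous_on_finite)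

text \<open>M stays abstract here, tied to the mesh by the smallness of u and by
  \<open>\<kappa>12\<close>. Its explicit value matters in the theorem, where it must be positive
  and exceed \<open>M_two\<close>.\<close>

locale discretization = cf_ifs B \<gamma> \<Gamma> s + mesh r I a b N
  for B :: "real set" and \<gamma> \<Gamma> s :: real and r I :: nat and a b :: "nat \<Rightarrow> real" and N :: "nat \<Rightarrow> nat" +
  fixes \<nu> :: nat and chi h \<mu> M \<kappa>1 \<kappa>2 u :: real
  assumes \<nu>1: "1 \<le> \<nu>" and sub_S: "i \<in> {1..I} \<Longrightarrow> {a i..b i} \<subseteq> S"
    and word_image: "\<omega> \<in> words B \<nu> \<Longrightarrow> \<exists>i\<in>{1..I}. word_map \<omega> ` S \<subseteq> {a i..b i}"
    and chi_def: "chi = 2 * A + \<gamma>" and h_def: "h = mesh_width I a b N" and \<mu>_def: "\<mu> = mesh_ratio I a b N"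
    and M_pos: "0 < M" and u_def: "u = M * eta r * h" and u_lt: "psi r * u * exp u < 1"
    and \<kappa>1_def: "\<kappa>1 = c_contr \<gamma> \<Gamma> \<nu> * (2 * eta r * (real r)\<^sup>2 * psi r)"
    and \<kappa>2: "0 \<le> \<kappa>2" "\<kappa>2 < 1"
    and \<kappa>12: "\<kappa>1 * exp u / (1 - psi r * u * exp u) \<le> \<kappa>2 - s * M_zero \<gamma> \<Gamma> \<nu> / M"
begin

abbreviation "Ld \<equiv> discrete_op B \<nu> s r I a b N"
abbreviation "pint \<equiv> piecewise_interpolant r I a b N"

lemma chi_pos: "0 < chi" using A_pos \<gamma>1 by (simp add: chi_def)

lemma w_le_h: "i \<in> {1..I} \<Longrightarrow> w i \<le> h" by (simp add: h_def mesh_width_def)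

lemma h_pos: "0 < h" using w_le_h[of 1] w_pos[of 1] I1 by simp

lemma mdom_S: "x \<in> mdom \<Longrightarrow> x \<in> S" using sub_S by blast

lemma T_S: "\<xi> \<in> T \<Longrightarrow> \<xi> \<in> S" using mdom_S T_subset by blast

lemma \<kappa>2M: "0 \<le> \<kappa>2 * M" "\<kappa>2 * M < M" "\<kappa>2 * M \<le> M"
  using \<kappa>2 M_pos mult_strict_right_mono[of \<kappa>2 1 M] by auto

lemma word_mdom: "\<omega> \<in> words B \<nu> \<Longrightarrow> x \<in> S \<Longrightarrow> word_map \<omega> x \<in> mdom"
  using word_image by blast

lemma Ld_eq: "\<xi> \<in> T \<Longrightarrow> Ld F \<xi> = (\<Sum>\<omega>\<in>words B \<nu>. word_weight \<omega> \<xi> powr s * pint F (word_map \<omega> \<xi>))"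
  by (simp add: discrete_op_def)

lemma Ld_outside: "\<xi> \<notin> T \<Longrightarrow> Ld F \<xi> = 0" by (simp add: discrete_op_def)

lemma Ld_linear: "Ld (\<lambda>x. F x + c * G x) = (\<lambda>x. Ld F x + c * Ld G x)"
proof
  fix \<xi>
  show "Ld (\<lambda>x. F x + c * G x) \<xi> = Ld F \<xi> + c * Ld G \<xi>"
  proof (cases "\<xi> \<in> T")
    case True
    have "pint (\<lambda>x. F x + c * G x) (word_map \<omega> \<xi>) = pint F (word_map \<omega> \<xi>) + c * pint G (word_map \<omega> \<xi>)"
      if "\<omega> \<in> words B \<nu>" for \<omega>
      by (rule interpolant_linear[OF word_mdom[OF that T_S[OF True]]])
    then show ?thesis unfolding Ld_eq[OF True] by (simp add: sum.distrib sum_distrib_left algebra_simps)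
  qed (simp add: Ld_outside)
qed

lemma weight_pos: "\<omega> \<in> words B n \<Longrightarrow> x \<in> S \<Longrightarrow> 0 < word_weight \<omega> x"
proof -
  assume \<omega>: "\<omega> \<in> words B n" and x: "x \<in> S"
  have "0 < fst (word_denom \<omega>) * x + snd (word_denom \<omega>)"
    using word_denom_nonneg[OF words_pos[OF \<omega>]] S_pos[OF x] by (simp add: add_nonneg_pos)
  then show ?thesis using word_weight_eq[OF words_pos[OF \<omega>], of x] S_pos[OF x] by simp
qed

lemma words_ne: "words B \<nu> \<noteq> {}"
proof -
  obtain \<beta> where "\<beta> \<in> B" using B_ne by blast
  then have "replicate \<nu> \<beta> \<in> words B \<nu>" by (auto simp: words_def)
  then show ?thesis by blast
qed

lemma Ld_bound:
  assumes F: "\<And>t. t \<in> T \<Longrightarrow> \<bar>F t\<bar> \<le> C" and \<xi>: "\<xi> \<in> T"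
  shows "\<bar>Ld F \<xi>\<bar> \<le> (real (card (words B \<nu>)) * (c_contr \<gamma> \<Gamma> \<nu> powr s * psi r)) * C"
proof -
  have C0: "0 \<le> C" using F[OF \<xi>] abs_ge_zero order_trans by blast
  have "\<bar>Ld F \<xi>\<bar> \<le> (\<Sum>\<omega>\<in>words B \<nu>. \<bar>word_weight \<omega> \<xi> powr s * pint F (word_map \<omega> \<xi>)\<bar>)"
    unfolding Ld_eq[OF \<xi>] by (rule sum_abs)
  also have "\<dots> \<le> (\<Sum>\<omega>\<in>words B \<nu>. c_contr \<gamma> \<Gamma> \<nu> powr s * (psi r * C))"
  proof (rule sum_mono)
    fix \<omega> assume \<omega>: "\<omega> \<in> words B \<nu>"
    have "word_weight \<omega> \<xi> powr s \<le> c_contr \<gamma> \<Gamma> \<nu> powr s"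
      using word_weight_le_c_contr[OF \<omega> \<nu>1 T_S[OF \<xi>]] weight_pos[OF \<omega> T_S[OF \<xi>]] s_pos
      by (intro powr_mono2) auto
    moreover have "\<bar>pint F (word_map \<omega> \<xi>)\<bar> \<le> psi r * C"
      by (rule interpolant_bound[OF F word_mdom[OF \<omega> T_S[OF \<xi>]]])
    ultimately show "\<bar>word_weight \<omega> \<xi> powr s * pint F (word_map \<omega> \<xi>)\<bar> \<le> c_contr \<gamma> \<Gamma> \<nu> powr s * (psi r * C)"
      unfolding abs_mult by (intro mult_mono) auto
  qed
  finally show ?thesis by simp
qed

lemma T_pq: obtains p q where "p \<in> T" "q \<in> T" "p \<noteq> q" using T_two_points by blast

lemma Ld_pos:
  assumes F: "F \<in> cone_K M T" "\<And>\<xi>. \<xi> \<in> T \<Longrightarrow> 0 < F \<xi>" and \<xi>: "\<xi> \<in> T"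
  shows "0 < Ld F \<xi>"
  unfolding Ld_eq[OF \<xi>]
proof (rule sum_pos[OF finite_words[OF B_fin] words_ne])
  fix \<omega> assume \<omega>: "\<omega> \<in> words B \<nu>"
  obtain i where i: "i \<in> {1..I}" "word_map \<omega> ` S \<subseteq> {a i..b i}" using word_image[OF \<omega>] by blast
  have x: "word_map \<omega> \<xi> \<in> {a i..b i}" using i(2) T_S[OF \<xi>] by blast
  have "0 < pint F (word_map \<omega> \<xi>)"
    by (rule interpolant_cone(1)[OF cone_K_D[OF F(1)] F(2) M_pos w_le_h u_def u_lt i(1) x x])
  then show "0 < word_weight \<omega> \<xi> powr s * pint F (word_map \<omega> \<xi>)"
    using weight_pos[OF \<omega> T_S[OF \<xi>]] by simp
qed

lemma cone_cases:
  assumes F: "F \<in> cone_K M T"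
  shows "(\<forall>\<xi>\<in>T. 0 < F \<xi>) \<or> (\<forall>\<xi>\<in>T. F \<xi> = 0)"
proof -
  obtain p q where pq: "p \<in> T" "q \<in> T" "p \<noteq> q" by (rule T_pq)
  have nn: "0 \<le> F \<xi>" if "\<xi> \<in> T" for \<xi> by (rule cone_K_nonneg[OF F M_pos pq that])
  show ?thesis using cone_K_pos[OF F] nn by (metis less_eq_real_def)
qed

lemma Ld_cone:
  assumes F: "F \<in> cone_K M T"
  shows "Ld F \<in> cone_K (\<kappa>2 * M) T"
proof (cases "\<forall>\<xi>\<in>T. 0 < F \<xi>")
  case True
  define Q where "Q = 2 * eta r * (real r)\<^sup>2 * psi r * M * exp u / (1 - psi r * u * exp u)"
  have Q0: "0 \<le> Q" using eta_bounds[OF r2] psi_pos[of r] M_pos u_lt by (simp add: Q_def)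
  \<comment> \<open>The contraction times Q equals M \<kappa>1 exp u / (1 - psi u exp u), so
    \<open>\<kappa>12\<close> is precisely the requirement of \<open>weighted_cone_step\<close> for
    the constant \<kappa>2 M.\<close>
  have QM: "s * M_zero \<gamma> \<Gamma> \<nu> + Q * c_contr \<gamma> \<Gamma> \<nu> \<le> \<kappa>2 * M"
  proof -
    have "Q * c_contr \<gamma> \<Gamma> \<nu> = M * (\<kappa>1 * exp u / (1 - psi r * u * exp u))" by (simp add: Q_def \<kappa>1_def)
    also have "\<dots> \<le> M * (\<kappa>2 - s * M_zero \<gamma> \<Gamma> \<nu> / M)" using \<kappa>12 M_pos by (intro mult_left_mono) auto
    also have "\<dots> = \<kappa>2 * M - s * M_zero \<gamma> \<Gamma> \<nu>" using M_pos by (simp add: algebra_simps)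
    finally show ?thesis by simp
  qed
  show ?thesis
  proof (rule cone_KI)
    fix \<xi> \<zeta> assume T: "\<xi> \<in> T" "\<zeta> \<in> T"
    show "Ld F \<xi> \<le> exp (\<kappa>2 * M * \<bar>\<xi> - \<zeta>\<bar>) * Ld F \<zeta>"
      unfolding Ld_eq[OF T(1)] Ld_eq[OF T(2)] sum_distrib_left
    proof (rule sum_mono)
      fix \<omega> assume \<omega>: "\<omega> \<in> words B \<nu>"
      obtain i where i: "i \<in> {1..I}" "word_map \<omega> ` S \<subseteq> {a i..b i}" using word_image[OF \<omega>] by blast
      have Fp: "0 < F t" if "t \<in> T" for t using True that by blast
      show "word_weight \<omega> \<xi> powr s * pint F (word_map \<omega> \<xi>) \<le>
          exp (\<kappa>2 * M * \<bar>\<xi> - \<zeta>\<bar>) * (word_weight \<omega> \<zeta> powr s * pint F (word_map \<omega> \<zeta>))"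
      proof (rule weighted_cone_step[OF \<omega> \<nu>1 T_S[OF T(1)] T_S[OF T(2)] Q0 _ _ QM])
        show "pint F x \<le> exp (Q * \<bar>x - y\<bar>) * pint F y" if "x \<in> word_map \<omega> ` S" "y \<in> word_map \<omega> ` S" for x y
          unfolding Q_def
          by (rule interpolant_cone(2)[OF cone_K_D[OF F] Fp M_pos w_le_h u_def u_lt i(1)]) (use that i(2) in auto)
        show "0 \<le> pint F x" if "x \<in> word_map \<omega> ` S" for x
          using interpolant_cone(1)[OF cone_K_D[OF F] Fp M_pos w_le_h u_def u_lt i(1), of x x] that i(2) by force
      qed
    qed
  qed (simp add: Ld_outside)
next
  case False
  then have "F t = 0" if "t \<in> T" for t using cone_cases[OF F] that by blast
  then have "Ld F \<xi> = 0" if "\<xi> \<in> T" for \<xi> using Ld_bound[of F 0 \<xi>] that by simp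
  then show ?thesis using Ld_outside by (intro cone_KI) auto
qed

lemma Ld_cone': "F \<in> cone_K M T \<Longrightarrow> Ld F \<in> cone_K M T"
proof -
  assume F: "F \<in> cone_K M T"
  have "0 \<le> Ld F \<xi>" if "\<xi> \<in> T" for \<xi>
  proof (cases "\<forall>\<xi>\<in>T. 0 < F \<xi>")
    case True
    then have Fp: "0 < F t" if "t \<in> T" for t using that by blast
    show ?thesis using Ld_pos[OF F Fp that] by simp
  next
    case False
    then have "F t = 0" if "t \<in> T" for t using cone_cases[OF F] that by blast
    then show ?thesis using Ld_bound[of F 0 \<xi>] that by simp
  qed
  then show ?thesis by (rule cone_K_mono[OF Ld_cone[OF F]]) (use \<kappa>2M in auto)
qed

lemma T_compact: "compact T" by (rule finite_imp_compact[OF finite_T])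

lemma T_bounded: "bounded T" by (rule compact_imp_bounded[OF T_compact])

lemma Ld_eigen:
  obtains \<rho> U where "0 < \<rho>" "U \<in> cone_K (\<kappa>2 * M) T" "\<And>x. x \<in> T \<Longrightarrow> 0 < U x" "Ld U = (\<lambda>x. \<rho> * U x)"
proof -
  obtain p q where pq: "p \<in> T" "q \<in> T" "p \<noteq> q" by (rule T_pq)
  show ?thesis
  proof (rule cone_K_eigenfunction[OF T_compact pq M_pos \<kappa>2, of Ld])
    show "Ld (\<lambda>x. F x + c * G x) = (\<lambda>x. Ld F x + c * Ld G x)" for F G c by (rule Ld_linear)
    show "\<bar>Ld F x\<bar> \<le> (real (card (words B \<nu>)) * (c_contr \<gamma> \<Gamma> \<nu> powr s * psi r)) * C"
      if "\<And>y. y \<in> T \<Longrightarrow> \<bar>F y\<bar> \<le> C" "x \<in> T" for F C x using that by (rule Ld_bound)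
    show "Ld F \<in> cone_K (\<kappa>2 * M) T" if "F \<in> cone_K M T" for F using that by (rule Ld_cone)
    show "0 < Ld F p" if "F \<in> cone_K M T" "\<And>x. x \<in> T \<Longrightarrow> 0 < F x" for F
      by (rule Ld_pos[OF that pq(1)])
  qed (rule that)
qed

text \<open>Pointwise order gives no control over the powers of \<open>Ld\<close>, since Lagrange
  basis polynomials change sign. The cone order replaces it: a large multiple of U dominates F and
  -F, \<open>Ld\<close> preserves this, and elements of the cone are nonnegative.\<close>

lemma Ld_spectral_radius:
  assumes \<rho>: "0 < \<rho>" and U: "U \<in> cone_K (\<kappa>2 * M) T" "\<And>x. x \<in> T \<Longrightarrow> 0 < U x" "Ld U = (\<lambda>x. \<rho> * U x)"
  shows "spectral_radius_on T (functions_on T) Ld = \<rho>"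
proof -
  obtain p q where pq: "p \<in> T" "q \<in> T" "p \<noteq> q" by (rule T_pq)
  obtain \<Delta> where \<Delta>: "\<And>x y. x \<in> T \<Longrightarrow> y \<in> T \<Longrightarrow> \<bar>x - y\<bar> \<le> \<Delta>"
    using T_bounded by (metis bounded_two_points dist_real_def)
  define \<delta> where "\<delta> = 2 * (sin (pi / (2 * real r + 2)))\<^sup>2 * Min (w ` {1..I})"
  have \<delta>: "0 < \<delta>" using sin_sq_node_bounds(1)[OF r2] Min_width_pos by (simp add: \<delta>_def)
  define m1 where "m1 = Min (U ` T)"
  define m2 where "m2 = Max (U ` T)"
  have ne: "T \<noteq> {}" using pq by auto
  have m1: "0 < m1" "\<And>x. x \<in> T \<Longrightarrow> m1 \<le> U x"
    unfolding m1_def using finite_T ne U(2) by (auto simp: Min_gr_iff)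
  have m2: "\<And>x. x \<in> T \<Longrightarrow> U x \<le> m2" unfolding m2_def using finite_T by simp
  define c where "c = (1 - \<kappa>2) * M * \<delta> * m1"
  have c: "0 < c" using \<kappa>2 M_pos \<delta> m1 by (simp add: c_def)
  define K0 where "K0 = (exp (M * \<Delta>) + 1) / c"
  have K0: "0 \<le> K0" using c by (simp add: K0_def)
  \<comment> \<open>On the finite node set U dominates every function and not only those of the
    cone: distinct nodes are at least \<delta> apart, so the slack exp (M d) - exp (\<kappa>2 M d)
    is at least (1 - \<kappa>2) M \<delta>.\<close>
  have unit: "(\<lambda>x. K0 * C * U x + e * F x) \<in> cone_K M T"
    if F: "F \<in> functions_on T" and C: "\<And>x. x \<in> T \<Longrightarrow> \<bar>F x\<bar> \<le> C" and e: "\<bar>e\<bar> = 1" for F C e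
  proof (rule cone_KI)
    fix x y assume xy: "x \<in> T" "y \<in> T"
    have C0: "0 \<le> C" using C[OF xy(1)] abs_ge_zero order_trans by blast
    show "K0 * C * U x + e * F x \<le> exp (M * \<bar>x - y\<bar>) * (K0 * C * U y + e * F y)"
    proof (cases "x = y")
      case False
      define d where "d = \<bar>x - y\<bar>"
      have d: "\<delta> \<le> d" "d \<le> \<Delta>" using T_separation[OF xy False] \<Delta>[OF xy] by (simp_all add: d_def \<delta>_def)
      have eF: "\<bar>e * F z\<bar> \<le> C" if "z \<in> T" for z using C[OF that] e by (simp add: abs_mult)
      have "e * F x - exp (M * d) * (e * F y) \<le> C + exp (M * \<Delta>) * C"
      proof -
        have "- (e * F y) \<le> C" using eF[OF xy(2)] by (simp add: abs_le_iff)
        then have "exp (M * d) * (- (e * F y)) \<le> exp (M * d) * C" by (intro mult_left_mono) auto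
        also have "\<dots> \<le> exp (M * \<Delta>) * C" using d M_pos C0 by (intro mult_right_mono) auto
        finally show ?thesis using eF[OF xy(1)] by (simp add: abs_le_iff)
      qed
      also have "\<dots> = K0 * C * c"
      proof -
        have "K0 * c = exp (M * \<Delta>) + 1" using c by (simp add: K0_def)
        then have "K0 * c * C = (exp (M * \<Delta>) + 1) * C" by simp
        then show ?thesis by (simp add: algebra_simps)
      qed
      also have "\<dots> \<le> K0 * C * (exp (M * d) * U y - U x)"
      proof (intro mult_left_mono mult_nonneg_nonneg K0 C0)
        have "c = (1 - \<kappa>2) * M * \<delta> * m1" by (simp add: c_def)
        also have "\<dots> \<le> (exp (M * d) - exp (\<kappa>2 * M * d)) * U y"
        proof (rule mult_mono)
          define z where "z = (1 - \<kappa>2) * M * d"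
          have z: "0 \<le> z" using \<kappa>2 M_pos d \<delta> by (simp add: z_def)
          have "(1 - \<kappa>2) * M * \<delta> \<le> z" unfolding z_def using \<kappa>2 M_pos d by (intro mult_left_mono) auto
          also have "z \<le> 1 * (exp z - 1)" using exp_ge_add_one_self[of z]
            by (simp only: mult_1 le_diff_eq add.commute)
          also have "\<dots> \<le> exp (\<kappa>2 * M * d) * (exp z - 1)"
            using \<kappa>2 M_pos d \<delta> z by (intro mult_right_mono) auto
          also have "\<dots> = exp (M * d) - exp (\<kappa>2 * M * d)"
            by (simp add: z_def algebra_simps exp_add[symmetric])
          finally show le: "(1 - \<kappa>2) * M * \<delta> \<le> exp (M * d) - exp (\<kappa>2 * M * d)" .
          have "0 \<le> (1 - \<kappa>2) * M * \<delta>" using \<kappa>2 M_pos \<delta> by simp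
          with le show "0 \<le> exp (M * d) - exp (\<kappa>2 * M * d)" by linarith
        qed (use m1 xy in auto)
        also have "\<dots> \<le> exp (M * d) * U y - U x"
          using cone_K_D[OF U(1) xy] by (simp add: d_def algebra_simps)
        finally show "c \<le> exp (M * d) * U y - U x" .
      qed
      finally show ?thesis by (simp add: d_def algebra_simps)
    qed simp
  qed (use cone_K_outside[OF U(1)] F in \<open>simp add: functions_on_def\<close>)
  have powU: "(Ld ^^ n) (\<lambda>x. k * U x + e * F x) = (\<lambda>x. k * \<rho> ^ n * U x + e * (Ld ^^ n) F x)" for n k e F
  proof (induction n)
    case (Suc n)
    have z: "Ld (\<lambda>x. 0) = (\<lambda>x. 0)" using Ld_linear[of "\<lambda>x. 0" 1 "\<lambda>x. 0"] by (auto simp: fun_eq_iff)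
    have "Ld (\<lambda>x. 0 + (k * \<rho> ^ n) * U x) = (\<lambda>x. Ld (\<lambda>x. 0) x + (k * \<rho> ^ n) * Ld U x)" by (rule Ld_linear)
    then have LU: "Ld (\<lambda>x. k * \<rho> ^ n * U x) = (\<lambda>x. k * \<rho> ^ n * (\<rho> * U x))" by (simp add: z U(3))
    have "Ld (\<lambda>x. k * \<rho> ^ n * U x + e * (Ld ^^ n) F x) = (\<lambda>x. k * \<rho> ^ n * (\<rho> * U x) + e * Ld ((Ld ^^ n) F) x)"
      unfolding Ld_linear LU ..
    then show ?case using Suc by (simp add: algebra_simps)
  qed simp
  have coneN: "(Ld ^^ n) F \<in> cone_K M T" if "F \<in> cone_K M T" for F n
    by (induction n) (use that Ld_cone' in auto)
  have pow: "\<bar>(Ld ^^ n) F x\<bar> \<le> (K0 * m2) * \<rho> ^ n * C"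
    if F: "F \<in> functions_on T" and C: "\<And>y. y \<in> T \<Longrightarrow> \<bar>F y\<bar> \<le> C" and x: "x \<in> T" for F C x n
  proof -
    have "0 \<le> K0 * C * \<rho> ^ n * U x + e * (Ld ^^ n) F x" if "\<bar>e\<bar> = 1" for e
      using cone_K_nonneg[OF coneN[OF unit[OF F C that], of n] M_pos pq x] unfolding powU by simp
    from this[of 1] this[of "- 1"] have "\<bar>(Ld ^^ n) F x\<bar> \<le> K0 * C * \<rho> ^ n * U x" by (simp add: abs_le_iff)
    also have "\<dots> \<le> K0 * C * \<rho> ^ n * m2"
    proof -
      have "0 \<le> C" using C[OF x] abs_ge_zero order_trans by blast
      then show ?thesis using K0 \<rho> m2[OF x] by (intro mult_left_mono) auto
    qed
    finally show ?thesis by (simp add: algebra_simps)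
  qed
  have m20: "0 \<le> m2" using m2[OF pq(1)] U(2)[OF pq(1)] by simp
  show ?thesis
    unfolding functions_on_finite[OF finite_T]
  proof (rule spectral_radius_on_eqI[OF T_compact ne])
    show "Ld f \<in> continuous_functions T" if "f \<in> continuous_functions T" for f
      unfolding functions_on_finite[OF finite_T, symmetric] by (simp add: functions_on_def Ld_outside)
    show "Ld (\<lambda>x. f x + c * g x) = (\<lambda>x. Ld f x + c * Ld g x)" for f g c by (rule Ld_linear)
    show "\<bar>(Ld ^^ n) f x\<bar> \<le> (K0 * m2) * \<rho> ^ n * C"
      if "f \<in> continuous_functions T" "\<And>y. y \<in> T \<Longrightarrow> \<bar>f y\<bar> \<le> C" "x \<in> T" for f C x n
      using that unfolding functions_on_finite[OF finite_T, symmetric] by (rule pow)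
    show "U \<in> continuous_functions T"
      unfolding functions_on_finite[OF finite_T, symmetric] using cone_K_outside[OF U(1)]
      by (simp add: functions_on_def)
    show "U p \<noteq> 0" using U(2)[OF pq(1)] by simp
  qed (use K0 m20 \<rho> U(3) in auto)
qed

text \<open>If c exceeded \<rho>, applying \<open>Ld\<close> to U - t V and dividing by \<rho> would
  keep the difference in the cone with t multiplied by c / \<rho> each time, until it is negative at
  a node.\<close>

lemma compare_lower:
  assumes \<rho>: "0 < \<rho>" and U: "U \<in> cone_K (\<kappa>2 * M) T" "\<And>x. x \<in> T \<Longrightarrow> 0 < U x" "Ld U = (\<lambda>x. \<rho> * U x)"
    and V: "V \<in> cone_K M T" "\<And>x. x \<in> T \<Longrightarrow> 0 < V x"
    and c: "(\<lambda>x. Ld V x - c * V x) \<in> cone_K M T"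
  shows "c \<le> \<rho>"
proof (rule ccontr)
  assume "\<not> c \<le> \<rho>"
  then have c\<rho>: "1 < c / \<rho>" "0 < c" using \<rho> by (simp_all add: field_simps)
  obtain p q where pq: "p \<in> T" "q \<in> T" "p \<noteq> q" by (rule T_pq)
  obtain \<epsilon> where \<epsilon>: "0 < \<epsilon>" "(\<lambda>x. U x - \<epsilon> * V x) \<in> cone_K M T"
    using cone_K_dominates[OF U(1,2) V(1) \<kappa>2M(1,2) T_bounded pq] by blast
  have it: "(\<lambda>x. U x - (c / \<rho>) ^ n * \<epsilon> * V x) \<in> cone_K M T" for n
  proof (induction n)
    case (Suc n)
    define t where "t = (c / \<rho>) ^ n * \<epsilon>"
    have t: "0 \<le> t" using c\<rho> \<epsilon> by (simp add: t_def)
    have "Ld (\<lambda>x. U x + (- t) * V x) \<in> cone_K M T" by (rule Ld_cone') (use Suc in \<open>simp add: t_def\<close>)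
    then have "(\<lambda>x. \<rho> * U x - t * Ld V x) \<in> cone_K M T" unfolding Ld_linear U(3) by simp
    from cone_K_scale[OF cone_K_add[OF this c t], of "1 / \<rho>"]
    have "(\<lambda>x. 1 / \<rho> * (\<rho> * U x - t * Ld V x + t * (Ld V x - c * V x))) \<in> cone_K M T" using \<rho> by simp
    moreover have "(\<lambda>x. 1 / \<rho> * (\<rho> * U x - t * Ld V x + t * (Ld V x - c * V x))) = (\<lambda>x. U x - (c / \<rho>) ^ Suc n * \<epsilon> * V x)"
      using \<rho> by (simp add: t_def field_simps fun_eq_iff)
    ultimately show ?case by simp
  qed (use \<epsilon> in simp)
  obtain n where "U p / (\<epsilon> * V p) < (c / \<rho>) ^ n" using real_arch_pow[OF c\<rho>(1)] by blast
  then have "U p < (c / \<rho>) ^ n * \<epsilon> * V p" using \<epsilon> V(2)[OF pq(1)] by (simp add: field_simps)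
  with cone_K_nonneg[OF it[of n] M_pos pq pq(1)] show False by simp
qed

text \<open>The mirror image of \<open>compare_lower\<close>, with a growing multiple of U below V.
  To start, V must be an order unit for U, hence the narrower cone for V.\<close>

lemma compare_upper:
  assumes \<rho>: "0 < \<rho>" and U: "U \<in> cone_K (\<kappa>2 * M) T" "\<And>x. x \<in> T \<Longrightarrow> 0 < U x" "Ld U = (\<lambda>x. \<rho> * U x)"
    and V: "V \<in> cone_K M' T" "0 \<le> M'" "M' < M" "\<And>x. x \<in> T \<Longrightarrow> 0 < V x"
    and c: "(\<lambda>x. c * V x - Ld V x) \<in> cone_K M T" "0 < c"
  shows "\<rho> \<le> c"
proof (rule ccontr)
  assume "\<not> \<rho> \<le> c"
  then have c\<rho>: "1 < \<rho> / c" using c by (simp add: field_simps)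
  obtain p q where pq: "p \<in> T" "q \<in> T" "p \<noteq> q" by (rule T_pq)
  have UM: "U \<in> cone_K M T" by (rule cone_K_mono[OF U(1)]) (use U(2) \<kappa>2M in \<open>auto intro: less_imp_le\<close>)
  obtain \<epsilon> where \<epsilon>: "0 < \<epsilon>" "(\<lambda>x. V x - \<epsilon> * U x) \<in> cone_K M T"
    using cone_K_dominates[OF V(1,4) UM V(2,3) T_bounded pq] by blast
  have it: "(\<lambda>x. V x - (\<rho> / c) ^ n * \<epsilon> * U x) \<in> cone_K M T" for n
  proof (induction n)
    case (Suc n)
    define t where "t = (\<rho> / c) ^ n * \<epsilon>"
    have "Ld (\<lambda>x. V x + (- t) * U x) \<in> cone_K M T" by (rule Ld_cone') (use Suc in \<open>simp add: t_def\<close>)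
    then have "(\<lambda>x. Ld V x - t * (\<rho> * U x)) \<in> cone_K M T" unfolding Ld_linear U(3) by simp
    from cone_K_scale[OF cone_K_add[OF this c(1), of 1], of "1 / c"]
    have "(\<lambda>x. 1 / c * (Ld V x - t * (\<rho> * U x) + 1 * (c * V x - Ld V x))) \<in> cone_K M T" using c by simp
    moreover have "(\<lambda>x. 1 / c * (Ld V x - t * (\<rho> * U x) + 1 * (c * V x - Ld V x))) = (\<lambda>x. V x - (\<rho> / c) ^ Suc n * \<epsilon> * U x)"
      using c by (simp add: t_def field_simps fun_eq_iff)
    ultimately show ?case by simp
  qed (use \<epsilon> in simp)
  obtain n where "V p / (\<epsilon> * U p) < (\<rho> / c) ^ n" using real_arch_pow[OF c\<rho>] by blast
  then have "V p < (\<rho> / c) ^ n * \<epsilon> * U p" using \<epsilon> U(2)[OF pq(1)] by (simp add: field_simps)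
  with cone_K_nonneg[OF it[of n] M_pos pq pq(1)] show False by simp
qed

text \<open>\<open>eigenfunction_positivity\<close> with two points, with coefficients -1 and the
  exponential, transfers the inequality from the powers of x + q, where it follows from x + q >=
  chi.\<close>

lemma eigenfunction_log_lipschitz:
  assumes lam: "0 < lam" and v: "v \<in> continuous_functions S" "\<And>x. x \<in> S \<Longrightarrow> 0 < v x" "L v = (\<lambda>x. lam * v x)"
    and xy: "x \<in> S" "y \<in> S"
  shows "v x \<le> exp (2 * s / chi * \<bar>x - y\<bar>) * v y"
proof -
  define \<alpha> where "\<alpha> = (\<lambda>i :: nat. if i = 0 then - 1 else exp (2 * s / chi * \<bar>x - y\<bar>) :: real)"
  define X where "X = (\<lambda>i :: nat. if i = 0 then x else y)"
  have "0 \<le> (\<Sum>i\<in>{0, 1}. \<alpha> i * v (X i))"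
  proof (rule eigenfunction_positivity[OF lam v])
    fix q assume q: "\<gamma> + A \<le> q"
    have p: "chi \<le> x + q" "chi \<le> y + q" using q xy by (auto simp: S_iff chi_def)
    have "(y + q) / (x + q) \<le> 1 + \<bar>x - y\<bar> / chi"
    proof -
      have "(y + q) / (x + q) = 1 + (y - x) / (x + q)" using p chi_pos by (simp add: field_simps)
      also have "(y - x) / (x + q) \<le> \<bar>x - y\<bar> / chi" using p chi_pos by (intro frac_le) auto
      finally show ?thesis by simp
    qed
    also have "\<dots> \<le> exp (\<bar>x - y\<bar> / chi)" by (rule exp_ge_add_one_self)
    finally have "((y + q) / (x + q)) powr (2 * s) \<le> exp (\<bar>x - y\<bar> / chi) powr (2 * s)"
      using p chi_pos s_pos by (intro powr_mono2) auto
    moreover have "exp (\<bar>x - y\<bar> / chi) powr (2 * s) = exp (2 * s / chi * \<bar>x - y\<bar>)" by (simp add: powr_def)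
    moreover have "(x + q) powr (- 2 * s) = ((y + q) / (x + q)) powr (2 * s) * (y + q) powr (- 2 * s)"
      using p chi_pos by (simp add: powr_divide powr_minus_divide)
    ultimately have "(x + q) powr (- 2 * s) \<le> exp (2 * s / chi * \<bar>x - y\<bar>) * (y + q) powr (- 2 * s)"
      by (metis mult_right_mono powr_ge_zero)
    then show "0 \<le> (\<Sum>i\<in>{0, 1}. \<alpha> i * (X i + q) powr (- 2 * s))" by (simp add: \<alpha>_def X_def)
  qed (use xy in \<open>auto simp: X_def\<close>)
  then show ?thesis by (simp add: \<alpha>_def X_def)
qed

text \<open>For fixed x the interpolation error is a linear functional of the values at x and at the
  r + 1 nodes of its piece. Both signs of the claim are therefore of the form covered by
  \<open>eigenfunction_positivity\<close>, and for powers they are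
  \<open>powr_interpolation_error\<close>.\<close>

lemma eigenfunction_interpolation:
  assumes lam: "0 < lam" and v: "v \<in> continuous_functions S" "\<And>x. x \<in> S \<Longrightarrow> 0 < v x" "L v = (\<lambda>x. lam * v x)"
    and x: "x \<in> mdom" and V: "\<And>t. t \<in> T \<Longrightarrow> V t = v t"
  shows "\<bar>v x - pint V x\<bar> \<le> G_const r s chi h * h ^ (r + 1) * v x"
proof -
  define g where "g = G_const r s chi h * h ^ (r + 1)"
  obtain i j where ij: "i \<in> {1..I}" "j \<in> {1..N i}" "x \<in> {mp i (j - 1)..mp i j}"
    using x piece_exists by blast
  have mpj: "mp i j = mp i (j - 1) + w i" using mp_Suc[of i "j - 1"] ij by simp
  have nT: "nd i j k \<in> T" if "k < r + 1" for k using node_in_T[OF ij(1,2)] that by simp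
  define l where "l k = poly (lagrange_basis (nd i j) (r + 1) k) x" for k
  have pV: "pint V x = (\<Sum>k<r + 1. v (nd i j k) * l k)"
    unfolding piecewise_interpolant_eq[OF ij] lag_def poly_lagrange_poly l_def
    using V nT by (intro sum.cong) auto
  have xS: "x \<in> S" by (rule mdom_S[OF x])
  have err: "\<bar>(x + q) powr (- 2 * s) - (\<Sum>k<r + 1. (nd i j k + q) powr (- 2 * s) * l k)\<bar> \<le> g * (x + q) powr (- 2 * s)"
    if q: "\<gamma> + A \<le> q" for q
  proof -
    have "A \<le> mp i (j - 1)"
      using piece_subset[OF ij(1,2), of "mp i (j - 1)"] mpj w_pos[OF ij(1)] sub_S[OF ij(1)] by (auto simp: S_iff)
    then have "chi \<le> mp i (j - 1) + q" using q by (simp add: chi_def)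
    from powr_interpolation_error[OF r1 w_pos[OF ij(1)] w_le_h[OF ij(1)] _ s_pos chi_pos this, of x "nd i j"]
    show ?thesis unfolding poly_lagrange_poly l_def g_def
      using ij nd_mem[OF ij(1), of j] mpj by (auto simp: nd_eq)
  qed
  have pos: "0 \<le> (g + e) * v x - e * (\<Sum>k<r + 1. v (nd i j k) * l k)" if e: "\<bar>e\<bar> = 1" for e
  proof -
    define X where "X k = (if k < r + 1 then nd i j k else x)" for k
    \<comment> \<open>e = 1 and e = -1 give the two one-sided bounds; index r + 1 stands for the
      point x itself.\<close>
    define \<alpha> where "\<alpha> k = (if k < r + 1 then - e * l k else g + e)" for k
    have expand: "(\<Sum>k<Suc (r + 1). \<alpha> k * f (X k)) = (g + e) * f x - e * (\<Sum>k<r + 1. f (nd i j k) * l k)"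
      for f :: "real \<Rightarrow> real"
    proof -
      have "(\<Sum>k<r + 1. \<alpha> k * f (X k)) = (\<Sum>k<r + 1. - (e * (f (nd i j k) * l k)))"
        by (intro sum.cong) (auto simp: \<alpha>_def X_def)
      also have "\<dots> = - (e * (\<Sum>k<r + 1. f (nd i j k) * l k))" by (simp only: sum_negf sum_distrib_left)
      finally have "(\<Sum>k<r + 1. \<alpha> k * f (X k)) = - (e * (\<Sum>k<r + 1. f (nd i j k) * l k))" .
      moreover have "\<alpha> (r + 1) * f (X (r + 1)) = (g + e) * f x" by (simp add: \<alpha>_def X_def)
      ultimately show ?thesis unfolding sum.lessThan_Suc by linarith
    qed
    have "0 \<le> (\<Sum>k<Suc (r + 1). \<alpha> k * v (X k))"
    proof (rule eigenfunction_positivity[OF lam v])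
      fix q assume q: "\<gamma> + A \<le> q"
      define y where "y = (x + q) powr (- 2 * s)"
      define z where "z = (\<Sum>k<r + 1. (nd i j k + q) powr (- 2 * s) * l k)"
      have "\<bar>y - z\<bar> \<le> g * y" using err[OF q] by (simp only: y_def z_def)
      moreover have "e = 1 \<or> e = - 1" using e by (auto simp: abs_if split: if_splits)
      ultimately have "0 \<le> (g + e) * y - e * z" by (auto simp: abs_le_iff algebra_simps)
      then show "0 \<le> (\<Sum>k<Suc (r + 1). \<alpha> k * (X k + q) powr (- 2 * s))"
        unfolding expand[of "\<lambda>t. (t + q) powr (- 2 * s)"] y_def z_def .
    next
      show "X k \<in> S" if "k \<in> {..<Suc (r + 1)}" for k using xS T_S nT by (simp add: X_def)
    qed auto
    then show ?thesis unfolding expand .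
  qed
  define z where "z = (\<Sum>k<r + 1. v (nd i j k) * l k)"
  have "\<bar>v x - z\<bar> \<le> g * v x"
    using pos[of 1] pos[of "- 1"] unfolding z_def[symmetric] by (simp add: abs_le_iff algebra_simps)
  then show ?thesis unfolding pV g_def z_def .
qed

end

section \<open>Numerical bounds for \<open>G_const\<close>, \<open>H_const\<close> and
  \<open>M_two\<close>\<close>

lemma prod_ratio_le:
  assumes "2 \<le> r"
  shows "(\<Prod>k=0..r. 3 + real k) / (\<Prod>k=1..r+1. 2 * real k) * (578 / 1000) ^ (r + 1) \<le> 242 / 1000"
  using assms
proof (induction r rule: dec_induct)
  \<comment> \<open>3 is the largest value of 2 s, and 0.578 exceeds 1 / sqrt 3. At r = 2 the
    product is 1.25 * 0.578^3, about 0.2414; each further step multiplies it by at most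
    0.578.\<close>
  case base
  show ?case by (simp add: eval_nat_numeral)
next
  case (step r)
  define p1 where "p1 = (\<Prod>k=0..r. 3 + real k)"
  define p2 where "p2 = (\<Prod>k=1..r+1. 2 * real k)"
  define p3 where "p3 = (578 / 1000 :: real) ^ (r + 1)"
  have p: "0 \<le> p1" "0 \<le> p2" "0 \<le> p3" unfolding p1_def p2_def p3_def
    by (rule prod_nonneg, simp)+ simp
  have "(\<Prod>k=0..Suc r. 3 + real k) = p1 * (4 + real r)" by (simp add: p1_def)
  moreover have "(\<Prod>k=1..Suc r+1. 2 * real k) = p2 * (2 * (real r + 2))" by (simp add: p2_def)
  moreover have "(578 / 1000 :: real) ^ (Suc r + 1) = p3 * (578 / 1000)" by (simp add: p3_def)
  ultimately have "(\<Prod>k=0..Suc r. 3 + real k) / (\<Prod>k=1..Suc r+1. 2 * real k) * (578 / 1000 :: real) ^ (Suc r + 1)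
      = p1 * (4 + real r) / (p2 * (2 * (real r + 2))) * (p3 * (578 / 1000))"
    by (simp only:)
  also have "\<dots> = (p1 / p2 * p3) * ((4 + real r) / (2 * (real r + 2)) * (578 / 1000))"
  proof -
    have "x1 * x2 / (y1 * y2) * (z1 * z2) = (x1 / y1 * z1) * (x2 / y2 * z2)" for x1 x2 y1 y2 z1 z2 :: real
      by simp
    then show ?thesis .
  qed
  also have "\<dots> \<le> (p1 / p2 * p3) * 1"
  proof (rule mult_left_mono)
    have "(4 + real r) / (2 * (real r + 2)) \<le> 1" by simp
    then have "(4 + real r) / (2 * (real r + 2)) * (578 / 1000) \<le> 1 * 1" by (intro mult_mono) auto
    then show "(4 + real r) / (2 * (real r + 2)) * (578 / 1000) \<le> 1" by simp
  qed (use p in simp)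
  also have "\<dots> \<le> 242 / 1000" using step by (simp only: p1_def p2_def p3_def mult_1_right)
  finally show ?case .
qed

text \<open>Each factor is replaced by its worst case: the exponential by 1.96 > exp (3 / 5), 2 s by
  3, and 1 / (2 c) by 0.578, since c >= cos (\<pi> / 6). A value below 1 controls the denominator
  with \<open>G_const\<close> in \<open>M_two\<close>.\<close>

lemma G_const_bounds:
  assumes r: "2 \<le> r" and s: "0 < s" "s \<le> 3 / 2" and chi: "1 \<le> chi" and h: "0 < h" "h \<le> 1 / 5"
  shows "0 < G_const r s chi h" "G_const r s chi h \<le> 95 / 100"
proof -
  define c where "c = cos (pi / (2 * real r + 2))"
  have c0: "0 < c" using cos_pi_half_div_pos[of r] r by (simp add: c_def)
  have c1: "sqrt 3 / 2 \<le> c"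
  proof -
    have "pi / (2 * real r + 2) \<le> pi / 6" using r by (intro divide_left_mono) auto
    then have "cos (pi / 6) \<le> c" unfolding c_def by (intro cos_monotone_0_pi_le) auto
    then show ?thesis by (simp add: cos_30)
  qed
  have p1: "0 < (\<Prod>k=0..r. 2 * s + real k)" using s by (intro prod_pos) (auto intro: add_pos_nonneg)
  have p2: "0 < (\<Prod>k=1..r+1. 2 * real k)" by (intro prod_pos) auto
  show "0 < G_const r s chi h" unfolding G_const_def c_def[symmetric]
    by (intro mult_pos_pos divide_pos_pos zero_less_power p1 p2) (use c0 chi in auto)
  have e: "exp (2 * s * h / chi) \<le> 196 / 100"
  proof -
    have "2 * s * h / chi \<le> 3 * (1 / 5) / 1" using s h chi by (intro frac_le mult_mono) auto
    then have "exp (2 * s * h / chi) \<le> exp (3 / 5)" by simp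
    also have "\<dots> \<le> 1 + 3 / 5 + (3 / 5)\<^sup>2" by (rule exp_bound) auto
    finally show ?thesis by (simp add: power2_eq_square)
  qed
  have pr: "(\<Prod>k=0..r. 2 * s + real k) \<le> (\<Prod>k=0..r. 3 + real k)" using s by (intro prod_mono) auto
  have q: "1 / (2 * c) \<le> 578 / 1000"
  proof -
    have "1.7302 \<le> sqrt 3" by (rule real_le_rsqrt) (simp add: power2_eq_square)
    then have "1.7302 \<le> 2 * c" using c1 by simp
    then have "1 / (2 * c) \<le> 1 / 1.7302" by (intro divide_left_mono) auto
    then show ?thesis by simp
  qed
  have chi1: "1 / chi ^ (r + 1) \<le> 1" using one_le_power[OF chi, of "r + 1"] by (simp del: power_Suc)
  have "G_const r s chi h = 2 * exp (2 * s * h / chi)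
       * (((\<Prod>k=0..r. 2 * s + real k) / (\<Prod>k=1..r+1. 2 * real k)) * (1 / (2 * c)) ^ (r + 1)) * (1 / chi ^ (r + 1))"
    by (simp add: G_const_def c_def)
  also have "\<dots> \<le> 2 * (196 / 100) * (((\<Prod>k=0..r. 3 + real k) / (\<Prod>k=1..r+1. 2 * real k)) * (578 / 1000) ^ (r + 1)) * 1"
    using e pr p2 q chi1 c0 s chi
    by (intro mult_mono mult_left_mono divide_right_mono power_mono mult_nonneg_nonneg divide_nonneg_nonneg prod_nonneg) auto
  also have "\<dots> \<le> 2 * (196 / 100) * (242 / 1000) * 1"
    using prod_ratio_le[OF r] by (intro mult_right_mono mult_left_mono) auto
  finally show "G_const r s chi h \<le> 95 / 100" by simp
qed

text \<open>The first bound replaces the two reciprocals in \<open>M_two\<close> by 1 + h^(2 r + 2)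
  and 1 + h^2, which gives the expression in the hypothesis on \<open>h1\<close>. The second keeps
  the summands that \<open>perturbed_eigenfunction_cone\<close> asks for.\<close>

lemma M_two_bounds:
  assumes r: "2 \<le> r" and s: "0 < s" "s \<le> 3 / 2" and chi: "1 \<le> chi" and h: "0 < h" "h \<le> 1 / 5" and \<mu>: "1 \<le> \<mu>"
  defines "y \<equiv> 2 * s / (\<mu> * chi) * (sin (pi / (2 * real r + 2)))\<^sup>2"
  shows "M_two r s chi \<mu> h < 2 * s / chi * (2 + H_const r s chi \<mu> h * h ^ r * (1 + h ^ (2 * r + 2)) + h\<^sup>2)"
    and "2 * s / chi * (1 + 1 / (1 - h\<^sup>2 * y)) \<le> M_two r s chi \<mu> h"
    and "0 < y" "y \<le> 3 / 4" "0 < H_const r s chi \<mu> h"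
proof -
  define G where "G = G_const r s chi h"
  define H where "H = H_const r s chi \<mu> h"
  define z where "z = h ^ (2 * r + 2)"
  have G: "0 < G" "G \<le> 95 / 100" using G_const_bounds[OF r s chi h] by (simp_all add: G_def)
  have sn: "0 < sin (pi / (2 * real r + 2))" "(sin (pi / (2 * real r + 2)))\<^sup>2 \<le> 1 / 4"
    using sin_sq_node_bounds[OF r] by auto
  show H0: "0 < H_const r s chi \<mu> h" unfolding H_const_def using G s chi \<mu> sn by (simp add: G_def)
  show y0: "0 < y" using s \<mu> chi sn by (simp add: y_def)
  show y1: "y \<le> 3 / 4"
  proof -
    have "2 * s / (\<mu> * chi) \<le> 3 / 1"
      using s mult_mono[OF \<mu> chi] \<mu> by (intro frac_le) auto
    then have "y \<le> 3 * (1 / 4)" unfolding y_def using sn s \<mu> chi by (intro mult_mono) auto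
    then show ?thesis by simp
  qed
  have h2: "h\<^sup>2 \<le> 1 / 25" using h power_mono[of h "1 / 5" 2] by (simp add: power2_eq_square)
  have h20: "0 < h\<^sup>2" using h by simp
  have z0: "0 < z" using h by (simp add: z_def)
  have z1: "z \<le> 1 / 25"
  proof -
    have "h ^ (2 * r + 2) \<le> h ^ 2" using h by (intro power_decreasing) auto
    then show ?thesis using h2 by (simp add: z_def)
  qed
  have G2: "G\<^sup>2 \<le> 9025 / 10000" using power_mono[OF G(2), of 2] G by (simp add: power2_eq_square)
  have G2z: "G\<^sup>2 * (1 + z) \<le> 9025 / 10000 * (1 + 1 / 25)" using G2 z0 z1 by (intro mult_mono) auto
  have d1: "0 < 1 - G\<^sup>2 * z"
  proof -
    have "G\<^sup>2 * z \<le> 9025 / 10000 * (1 / 25)" using G2 z0 z1 by (intro mult_mono) auto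
    then show ?thesis by simp
  qed
  have t1: "1 / (1 - G\<^sup>2 * z) \<le> 1 + z"
  proof -
    have "0 \<le> z * (1 - G\<^sup>2 * (1 + z))" using z0 G2z by (intro mult_nonneg_nonneg) auto
    also have "\<dots> = (1 + z) * (1 - G\<^sup>2 * z) - 1" by (simp add: algebra_simps)
    finally show ?thesis using d1 by (simp add: pos_divide_le_eq)
  qed
  have hy: "h\<^sup>2 * y \<le> 1 / 25 * (3 / 4)" using h2 y1 y0 by (intro mult_mono) auto
  have d2: "0 < 1 - h\<^sup>2 * y" using hy by simp
  have t2: "1 / (1 - h\<^sup>2 * y) < 1 + h\<^sup>2"
  proof -
    have "0 < h\<^sup>2 * (1 - y - h\<^sup>2 * y)" using h20 hy y1 by (intro mult_pos_pos) auto
    also have "\<dots> = (1 + h\<^sup>2) * (1 - h\<^sup>2 * y) - 1" by (simp add: algebra_simps)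
    finally show ?thesis using d2 by (simp add: pos_divide_less_eq)
  qed
  have M2: "M_two r s chi \<mu> h = 2 * s / chi * (1 + H * h ^ r / (1 - G\<^sup>2 * z) + 1 / (1 - h\<^sup>2 * y))"
    by (simp add: M_two_def G_def H_def z_def y_def mult.assoc)
  have Hh: "0 \<le> H * h ^ r" using H0 h by (simp add: H_def)
  have "H * h ^ r / (1 - G\<^sup>2 * z) = H * h ^ r * (1 / (1 - G\<^sup>2 * z))" by simp
  also have "\<dots> \<le> H * h ^ r * (1 + z)" using t1 Hh by (intro mult_left_mono) auto
  finally have "1 + H * h ^ r / (1 - G\<^sup>2 * z) + 1 / (1 - h\<^sup>2 * y) < 2 + H * h ^ r * (1 + z) + h\<^sup>2"
    using t2 by linarith
  then have "M_two r s chi \<mu> h < 2 * s / chi * (2 + H * h ^ r * (1 + z) + h\<^sup>2)"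
    unfolding M2 using s chi by (intro mult_strict_left_mono) auto
  then show "M_two r s chi \<mu> h < 2 * s / chi * (2 + H_const r s chi \<mu> h * h ^ r * (1 + h ^ (2 * r + 2)) + h\<^sup>2)"
    by (simp only: H_def z_def)
  have "0 \<le> H * h ^ r / (1 - G\<^sup>2 * z)" using Hh d1 by simp
  then show "2 * s / chi * (1 + 1 / (1 - h\<^sup>2 * y)) \<le> M_two r s chi \<mu> h"
    unfolding M2 using s chi by (intro mult_left_mono) auto
qed

context discretization
begin

lemma \<mu>_ge_1: "1 \<le> \<mu>"
proof -
  have "Min (w ` {1..I}) \<le> h" by (rule order_trans[OF Min_width w_le_h, of 1]) (use I1 in auto)
  then show ?thesis using Min_width_pos by (simp add: \<mu>_def mesh_ratio_def h_def[symmetric])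
qed

text \<open>Nodes are at distance at least \<open>\<delta>\<close>, which absorbs a relative perturbation of size \<open>x\<close>
  proportional to \<open>\<delta>\<close> into the exponential weight of the cone.\<close>

lemma perturbed_eigenfunction_cone:
  assumes v: "\<And>x y. x \<in> S \<Longrightarrow> y \<in> S \<Longrightarrow> v x \<le> exp (2 * s / chi * \<bar>x - y\<bar>) * v y" "\<And>x. x \<in> S \<Longrightarrow> 0 < v x"
    and D: "\<And>\<xi>. \<xi> \<notin> T \<Longrightarrow> D \<xi> = 0" "\<And>\<xi>. \<xi> \<in> T \<Longrightarrow> k * (1 - x) * v \<xi> \<le> D \<xi> \<and> D \<xi> \<le> k * (1 + x) * v \<xi>"
    and k: "0 \<le> k" and x: "x = s / chi * (2 * (sin (pi / (2 * real r + 2)))\<^sup>2 * Min (w ` {1..I}))" "x < 1"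
    and M: "2 * s / chi * (1 + 1 / (1 - x\<^sup>2)) \<le> M"
  shows "D \<in> cone_K M T"
proof (rule cone_KI)
  fix \<xi> \<zeta> assume T: "\<xi> \<in> T" "\<zeta> \<in> T"
  show "D \<xi> \<le> exp (M * \<bar>\<xi> - \<zeta>\<bar>) * D \<zeta>"
  proof (cases "\<xi> = \<zeta>")
    case False
    define d where "d = \<bar>\<xi> - \<zeta>\<bar>"
    have x0: "0 \<le> x" unfolding x(1) using s_pos chi_pos Min_width_pos by simp
    have x2: "0 < 1 - x\<^sup>2" using x0 x(2) by (simp add: abs_square_less_1)
    have "x \<le> s / chi * d"
      unfolding x(1) d_def using T_separation[OF T False] s_pos chi_pos by (intro mult_left_mono) auto
    then have "2 * x / (1 - x\<^sup>2) \<le> 2 * (s / chi * d) / (1 - x\<^sup>2)" using x2 by (intro divide_right_mono) auto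
    then have e: "exp (2 * x / (1 - x\<^sup>2)) \<le> exp (2 * s / chi * (1 / (1 - x\<^sup>2)) * d)" by (simp add: algebra_simps)
    have "D \<xi> \<le> k * (1 + x) * v \<xi>" using D(2)[OF T(1)] by simp
    also have "\<dots> \<le> k * (1 + x) * (exp (2 * s / chi * d) * v \<zeta>)"
      unfolding d_def using k x0 by (intro mult_left_mono v(1) T_S T mult_nonneg_nonneg) auto
    also have "\<dots> = (1 + x) * (k * exp (2 * s / chi * d) * v \<zeta>)" by simp
    also have "\<dots> \<le> ((1 - x) * exp (2 * s / chi * (1 / (1 - x\<^sup>2)) * d)) * (k * exp (2 * s / chi * d) * v \<zeta>)"
    proof (rule mult_right_mono)
      have "1 + x \<le> (1 - x) * exp (2 * x / (1 - x\<^sup>2))" by (rule exp_ratio_bound[OF x0 x(2)])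
      also have "\<dots> \<le> (1 - x) * exp (2 * s / chi * (1 / (1 - x\<^sup>2)) * d)" using e x by (intro mult_left_mono) auto
      finally show "1 + x \<le> (1 - x) * exp (2 * s / chi * (1 / (1 - x\<^sup>2)) * d)" .
      show "0 \<le> k * exp (2 * s / chi * d) * v \<zeta>" using k v(2)[OF T_S[OF T(2)]] by simp
    qed
    also have "\<dots> = exp (2 * s / chi * (1 + 1 / (1 - x\<^sup>2)) * d) * (k * (1 - x) * v \<zeta>)"
      by (simp add: distrib_left distrib_right exp_add)
    also have "\<dots> \<le> exp (M * d) * (k * (1 - x) * v \<zeta>)"
    proof (rule mult_right_mono)
      show "exp (2 * s / chi * (1 + 1 / (1 - x\<^sup>2)) * d) \<le> exp (M * d)"
        using M mult_right_mono[OF M, of d] by (simp add: d_def)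
      show "0 \<le> k * (1 - x) * v \<zeta>" using k x v(2)[OF T_S[OF T(2)]] by simp
    qed
    also have "\<dots> \<le> exp (M * d) * D \<zeta>" using D(2)[OF T(2)] by (intro mult_left_mono) auto
    finally show ?thesis by (simp add: d_def)
  qed simp
qed (rule D(1))

lemma spectral_radius_bounds:
  assumes chi1: "1 \<le> chi" and s32: "s \<le> 3 / 2" and h5: "h \<le> 1 / 5" and M2: "M_two r s chi \<mu> h < M"
  defines "lam \<equiv> spectral_radius_on S (continuous_functions S) L"
    and "\<rho> \<equiv> spectral_radius_on T (functions_on T) Ld" and "k \<equiv> H_const r s chi \<mu> h * h ^ r"
  shows "lam ^ \<nu> * (1 - k) \<le> \<rho> \<and> \<rho> \<le> lam ^ \<nu> * (1 + k)"
proof -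
  obtain l v where l: "0 < l" and v: "v \<in> continuous_functions S" "\<And>x. x \<in> S \<Longrightarrow> 0 < v x" "L v = (\<lambda>x. l * v x)"
    by (rule transfer_op_eigenfunction) blast
  have lam: "lam = l" unfolding lam_def by (rule transfer_op_spectral_radius[OF l v])
  obtain \<rho>' U where \<rho>': "0 < \<rho>'" and U: "U \<in> cone_K (\<kappa>2 * M) T" "\<And>x. x \<in> T \<Longrightarrow> 0 < U x" "Ld U = (\<lambda>x. \<rho>' * U x)"
    by (rule Ld_eigen) blast
  have \<rho>: "\<rho> = \<rho>'" unfolding \<rho>_def by (rule Ld_spectral_radius[OF \<rho>' U])
  define sn where "sn = (sin (pi / (2 * real r + 2)))\<^sup>2"
  have sn: "0 < sn" using sin_sq_node_bounds(1)[OF r2] by (simp add: sn_def)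
  \<comment> \<open>x = h y is s / chi times the guaranteed node distance 2 sin^2 (\<pi> / (2 r +
    2)) h / \<mu>, and h^2 y is the term in the last denominator of \<open>M_two\<close>. As y <= 3
    / 4, x^2 is at most h^2 y, so the exponent needed for the perturbation stays below
    \<open>M_two\<close>.\<close>
  define y where "y = 2 * s / (\<mu> * chi) * sn"
  define x where "x = h * y"
  note Mb = M_two_bounds[OF r2 s_pos s32 chi1 h_pos h5 \<mu>_ge_1, folded sn_def, folded y_def]
  have y: "0 < y" "y \<le> 3 / 4" by (rule Mb(3), rule Mb(4))
  have k0: "0 < k" using Mb(5) h_pos by (simp add: k_def)
  have Minw: "Min (w ` {1..I}) = h / \<mu>"
    using Min_width_pos h_pos by (simp add: \<mu>_def mesh_ratio_def h_def[symmetric])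
  have x_eq: "x = s / chi * (2 * (sin (pi / (2 * real r + 2)))\<^sup>2 * Min (w ` {1..I}))"
    unfolding Minw by (simp add: x_def y_def sn_def mult_ac)
  have x1: "x < 1"
  proof -
    have "x \<le> 1 / 5 * (3 / 4)" unfolding x_def using h5 y by (intro mult_mono) auto
    then show ?thesis by simp
  qed
  have x0: "0 \<le> x" using h_pos y by (simp add: x_def)
  have MM: "2 * s / chi * (1 + 1 / (1 - x\<^sup>2)) \<le> M"
  proof -
    have "x\<^sup>2 \<le> h\<^sup>2 * y"
    proof -
      have "y * y \<le> 1 * y" using y by (intro mult_right_mono) auto
      then have "h\<^sup>2 * (y * y) \<le> h\<^sup>2 * y" by (intro mult_left_mono) auto
      then show ?thesis by (simp add: x_def power2_eq_square mult_ac)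
    qed
    moreover have "h\<^sup>2 * y < 1"
    proof -
      have "h * h \<le> 1 / 5 * (1 / 5)" using h5 h_pos by (intro mult_mono) auto
      then have "h\<^sup>2 * y \<le> 1 / 25 * (3 / 4)" using y by (intro mult_mono) (auto simp: power2_eq_square)
      then show ?thesis by simp
    qed
    ultimately have "1 / (1 - x\<^sup>2) \<le> 1 / (1 - h\<^sup>2 * y)" by (intro divide_left_mono mult_pos_pos) auto
    then have "2 * s / chi * (1 + 1 / (1 - x\<^sup>2)) \<le> 2 * s / chi * (1 + 1 / (1 - h\<^sup>2 * y))"
      using s_pos chi_pos by (intro mult_left_mono) auto
    then show ?thesis using Mb(2) M2 by linarith
  qed
  \<comment> \<open>This identity explains the form of \<open>H_const\<close>: the relative
    interpolation error splits into k, the final relative error, and x, which the node distance can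
    absorb.\<close>
  have kx: "G_const r s chi h * h ^ (r + 1) = k * x"
    using s_pos chi_pos \<mu>_ge_1 sn
    by (simp add: k_def x_def y_def H_const_def sn_def power_divide field_simps)
  have vl: "v a \<le> exp (2 * s / chi * \<bar>a - b\<bar>) * v b" if "a \<in> S" "b \<in> S" for a b
    by (rule eigenfunction_log_lipschitz[OF l v that])
  define V where "V t = (if t \<in> T then v t else 0)" for t
  have VT: "V t = v t" if "t \<in> T" for t using that by (simp add: V_def)
  have Vpos: "0 < V t" if "t \<in> T" for t using v(2)[OF T_S[OF that]] that by (simp add: V_def)
  have Vcone: "V \<in> cone_K (2 * s / chi) T"
    by (rule cone_KI) (use vl T_S in \<open>auto simp: V_def\<close>)
  have M': "0 \<le> 2 * s / chi" "2 * s / chi < M"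
  proof -
    show p: "0 \<le> 2 * s / chi" using s_pos chi_pos by simp
    have x2: "0 < 1 - x\<^sup>2" using x0 x1 by (simp add: abs_square_less_1)
    have "0 < 2 * s / chi * (1 / (1 - x\<^sup>2))" using s_pos chi_pos x2 by simp
    then show "2 * s / chi < M" using MM by (simp add: distrib_left)
  qed
  have VM: "V \<in> cone_K M T" by (rule cone_K_mono[OF Vcone]) (use Vpos M' in \<open>auto intro: less_imp_le\<close>)
  have lpow: "l ^ \<nu> * v \<xi> = (\<Sum>\<omega>\<in>words B \<nu>. word_weight \<omega> \<xi> powr s * v (word_map \<omega> \<xi>))" if "\<xi> \<in> S" for \<xi>
  proof -
    have z: "L (\<lambda>x. 0) = (\<lambda>x. 0)" using transfer_op_linear[of "\<lambda>x. 0" 1 "\<lambda>x. 0"] by (auto simp: fun_eq_iff)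
    have sc: "L (\<lambda>x. c * v x) = (\<lambda>x. c * L v x)" for c using transfer_op_linear[of "\<lambda>x. 0" c v] z by simp
    have "(L ^^ n) v = (\<lambda>x. l ^ n * v x)" for n
    proof (induction n)
      case (Suc n)
      then show ?case using sc[of "l ^ n"] by (simp add: v(3) mult.assoc mult.left_commute)
    qed simp
    then show ?thesis using transfer_op_power[OF that, of \<nu> v] by simp
  qed
  have E: "\<bar>l ^ \<nu> * v \<xi> - Ld V \<xi>\<bar> \<le> k * x * (l ^ \<nu> * v \<xi>)" if \<xi>: "\<xi> \<in> T" for \<xi>
  proof -
    have "l ^ \<nu> * v \<xi> - Ld V \<xi> = (\<Sum>\<omega>\<in>words B \<nu>. word_weight \<omega> \<xi> powr s * (v (word_map \<omega> \<xi>) - pint V (word_map \<omega> \<xi>)))"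
      unfolding lpow[OF T_S[OF \<xi>]] Ld_eq[OF \<xi>] by (simp add: sum_subtractf right_diff_distrib)
    then have "\<bar>l ^ \<nu> * v \<xi> - Ld V \<xi>\<bar> \<le> (\<Sum>\<omega>\<in>words B \<nu>. \<bar>word_weight \<omega> \<xi> powr s * (v (word_map \<omega> \<xi>) - pint V (word_map \<omega> \<xi>))\<bar>)"
      by simp
    also have "\<dots> \<le> (\<Sum>\<omega>\<in>words B \<nu>. k * x * (word_weight \<omega> \<xi> powr s * v (word_map \<omega> \<xi>)))"
    proof (rule sum_mono)
      fix \<omega> assume \<omega>: "\<omega> \<in> words B \<nu>"
      have "\<bar>v (word_map \<omega> \<xi>) - pint V (word_map \<omega> \<xi>)\<bar> \<le> k * x * v (word_map \<omega> \<xi>)"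
        using eigenfunction_interpolation[OF l v word_mdom[OF \<omega> T_S[OF \<xi>]] VT] by (simp only: kx)
      then have "word_weight \<omega> \<xi> powr s * \<bar>v (word_map \<omega> \<xi>) - pint V (word_map \<omega> \<xi>)\<bar>
         \<le> word_weight \<omega> \<xi> powr s * (k * x * v (word_map \<omega> \<xi>))" by (rule mult_left_mono) simp
      then show "\<bar>word_weight \<omega> \<xi> powr s * (v (word_map \<omega> \<xi>) - pint V (word_map \<omega> \<xi>))\<bar> \<le>
          k * x * (word_weight \<omega> \<xi> powr s * v (word_map \<omega> \<xi>))" by (simp add: abs_mult mult_ac)
    qed
    also have "\<dots> = k * x * (l ^ \<nu> * v \<xi>)" unfolding lpow[OF T_S[OF \<xi>]] by (rule sum_distrib_left[symmetric])
    finally show ?thesis .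
  qed
  have bnds: "k * l ^ \<nu> * (1 - x) * v \<xi> \<le> k * l ^ \<nu> * v \<xi> + e * (Ld V \<xi> - l ^ \<nu> * v \<xi>) \<and>
      k * l ^ \<nu> * v \<xi> + e * (Ld V \<xi> - l ^ \<nu> * v \<xi>) \<le> k * l ^ \<nu> * (1 + x) * v \<xi>"
    if "\<xi> \<in> T" "\<bar>e\<bar> = 1" for \<xi> e
  proof -
    have "\<bar>e * (Ld V \<xi> - l ^ \<nu> * v \<xi>)\<bar> \<le> k * x * (l ^ \<nu> * v \<xi>)"
      using E[OF that(1)] that(2) by (simp add: abs_mult abs_minus_commute)
    then show ?thesis by (simp add: abs_le_iff algebra_simps)
  qed
  have out: "Ld V \<xi> = 0" "V \<xi> = 0" if "\<xi> \<notin> T" for \<xi> using that by (simp_all add: Ld_outside V_def)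
  have kl: "0 \<le> k * l ^ \<nu>" using k0 l by simp
  \<comment> \<open>The residual is k l^\<nu> v plus the discretization error. The error alone has
    no definite sign, but it is at most k x l^\<nu> v, so the residual stays between the factors 1 -
    x and 1 + x.\<close>
  have low: "(\<lambda>\<xi>. Ld V \<xi> - (1 - k) * l ^ \<nu> * V \<xi>) \<in> cone_K M T"
  proof (rule perturbed_eigenfunction_cone[OF vl v(2) _ _ kl x_eq x1 MM])
    show "k * l ^ \<nu> * (1 - x) * v \<xi> \<le> Ld V \<xi> - (1 - k) * l ^ \<nu> * V \<xi> \<and>
        Ld V \<xi> - (1 - k) * l ^ \<nu> * V \<xi> \<le> k * l ^ \<nu> * (1 + x) * v \<xi>" if "\<xi> \<in> T" for \<xi>
      using bnds[OF that, of 1] VT[OF that] by (simp add: algebra_simps)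
  qed (use out in auto)
  have upp: "(\<lambda>\<xi>. (1 + k) * l ^ \<nu> * V \<xi> - Ld V \<xi>) \<in> cone_K M T"
  proof (rule perturbed_eigenfunction_cone[OF vl v(2) _ _ kl x_eq x1 MM])
    show "k * l ^ \<nu> * (1 - x) * v \<xi> \<le> (1 + k) * l ^ \<nu> * V \<xi> - Ld V \<xi> \<and>
        (1 + k) * l ^ \<nu> * V \<xi> - Ld V \<xi> \<le> k * l ^ \<nu> * (1 + x) * v \<xi>" if "\<xi> \<in> T" for \<xi>
      using bnds[OF that, of "- 1"] VT[OF that] by (simp add: algebra_simps)
  qed (use out in auto)
  have "(1 - k) * l ^ \<nu> \<le> \<rho>'" by (rule compare_lower[OF \<rho>' U VM Vpos low])
  moreover have "\<rho>' \<le> (1 + k) * l ^ \<nu>"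
    by (rule compare_upper[OF \<rho>' U Vcone M' Vpos upp]) (use k0 l in simp_all)
  ultimately show ?thesis by (simp add: lam \<rho> mult.commute)
qed

end

section \<open>Verification of the abstract hypotheses and of the size of M\<close>

theorem theorem8p8:
  fixes B :: "real set"
    and \<gamma> \<Gamma> chi s \<kappa>1 \<kappa>2 M h \<mu> h0 h1 u H :: real
    and r \<nu> I :: nat
    and a b :: "nat \<Rightarrow> real"
    and N :: "nat \<Rightarrow> nat"
    and S T :: "real set"
  assumes "finite B" and "B \<noteq> {}"
    and "\<gamma> = Min B" and "1 \<le> \<gamma>" and "\<Gamma> = Max B" and "\<gamma> < \<Gamma>"
    and "S = S_int \<gamma> \<Gamma>"
    and "chi = 2 * a_inf \<gamma> \<Gamma> + \<gamma>" and "1 \<le> chi"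
    and "0 < s" and "s \<le> 3 / 2"
    and "2 \<le> r" and "1 \<le> \<nu>"
    and "\<kappa>1 = c_contr \<gamma> \<Gamma> \<nu> * (2 * eta r * (real r)\<^sup>2 * psi r)"
    and "\<kappa>1 < 1" and "\<kappa>1 < \<kappa>2" and "\<kappa>2 < 1"
    and "M = 4 * s / (a_inf \<gamma> \<Gamma> + frak_a \<gamma> \<Gamma> (\<nu> - 1) + \<gamma>) * (1 / (\<kappa>2 - \<kappa>1))"
    and "admissible_mesh B S \<nu> r I a b N"
    and "h = mesh_width I a b N" and "\<mu> = mesh_ratio I a b N"
    and "T = node_set r I a b N"
    and "0 < h0"
    and "\<forall>x. 0 < x \<and> x \<le> h0 \<longrightarrow>
           (let v = M * eta r * x in
              psi r * v * exp v < 1 \<and>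
              \<kappa>1 * exp v / (1 - psi r * v * exp v) < \<kappa>2 - s * M_zero \<gamma> \<Gamma> \<nu> / M)"
    and "0 < h1"
    and "\<forall>x. 0 < x \<and> x \<le> h1 \<longrightarrow>
           2 + H_const r s chi \<mu> x * x ^ r * (1 + x ^ (2 * r + 2)) + x\<^sup>2 \<le> 2 / (\<kappa>2 - \<kappa>1)"
    and "h \<le> min h0 (min h1 0.2)"
    and "u = M * eta r * h"
    and "H = H_const r s chi \<mu> h"
  shows "psi r * u * exp u < 1
       \<and> \<kappa>1 * exp u / (1 - psi r * u * exp u) < \<kappa>2 - s * M_zero \<gamma> \<Gamma> \<nu> / M
       \<and> M_two r s chi \<mu> h < M
       \<and> \<kappa>2 * M < M
       \<and> discrete_op B \<nu> s r I a b N ` cone_K M T \<subseteq> cone_K (\<kappa>2 * M) T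
       \<and> spectral_radius_on S (continuous_functions S) (transfer_op B S s) ^ \<nu> * (1 - H * h ^ r)
           \<le> spectral_radius_on T (functions_on T) (discrete_op B \<nu> s r I a b N)
       \<and> spectral_radius_on T (functions_on T) (discrete_op B \<nu> s r I a b N)
           \<le> spectral_radius_on S (continuous_functions S) (transfer_op B S s) ^ \<nu> * (1 + H * h ^ r)"
proof -
  note fin = assms(1) and ne = assms(2) and gam = assms(3,4) and Gam = assms(5,6) and S = assms(7)
    and chi = assms(8,9) and s = assms(10,11) and r = assms(12) and nu = assms(13)
    and k1 = assms(14) and k12 = assms(16) and k2 = assms(17) and M_eq = assms(18) and adm = assms(19)
    and h = assms(20) and mu = assms(21) and T = assms(22) and h0 = assms(24) and h1 = assms(26)
    and hle = assms(27) and u = assms(28) and H = assms(29)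
  interpret cf_ifs B \<gamma> \<Gamma> s
    by unfold_locales (use fin ne gam Gam s in auto)
  note adm' = adm[unfolded admissible_mesh_def S]
  obtain \<beta> where "\<beta> \<in> B" using ne by blast
  \<comment> \<open>Some word exists and its image lies in some mesh interval, which forces I >=
    1.\<close>
  then have "replicate \<nu> \<beta> \<in> words B \<nu>" by (auto simp: words_def)
  then have I1: "1 \<le> I" using adm' by fastforce
  interpret mesh r I a b N
    by unfold_locales (use r I1 adm' in auto)
  have w_le: "sub_width a b N i \<le> h" if "i \<in> {1..I}" for i
    using that by (simp add: h mesh_width_def)
  have h_pos: "0 < h" using w_le[of 1] w_pos[of 1] I1 by simp
  have hb: "h \<le> h0" "h \<le> h1" "h \<le> 1 / 5" using hle by auto
  \<comment> \<open>The denominator in M. It is at most chi because \<open>frak_a\<close> never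
    exceeds its limit A, so passing from chi to e only enlarges the bound obtained for
    \<open>M_two\<close>.\<close>
  define e where "e = a_inf \<gamma> \<Gamma> + frak_a \<gamma> \<Gamma> (\<nu> - 1) + \<gamma>"
  have e: "0 < e" "e \<le> chi"
    using A_pos frak_nonneg[of "\<nu> - 1"] frak_bounds[of "\<nu> - 1"] gam chi by (auto simp: e_def)
  have M: "0 < M" using e s k12 by (simp add: M_eq e_def)
  have u1: "psi r * u * exp u < 1" and
    u2: "\<kappa>1 * exp u / (1 - psi r * u * exp u) < \<kappa>2 - s * M_zero \<gamma> \<Gamma> \<nu> / M"
    using h0[rule_format, of h] h_pos hb(1) by (simp_all add: Let_def u)
  have k1_nonneg: "0 \<le> \<kappa>1"
    using eta_bounds[OF r] psi_pos[of r] by (simp add: k1 c_contr_def)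
  interpret discretization B \<gamma> \<Gamma> s r I a b N \<nu> chi h \<mu> M \<kappa>1 \<kappa>2 u
  proof unfold_locales
    show "{a i..b i} \<subseteq> S_int \<gamma> \<Gamma>" if "i \<in> {1..I}" for i using adm' that by blast
    show "\<exists>i\<in>{1..I}. word_map \<omega> ` S_int \<gamma> \<Gamma> \<subseteq> {a i..b i}" if "\<omega> \<in> words B \<nu>" for \<omega>
      using adm' that by blast
    show "0 \<le> \<kappa>2" using k1_nonneg k12 by linarith
  qed (rule nu chi(1) h mu M u u1 k1 k2 less_imp_le[OF u2])+
  have M2: "M_two r s chi \<mu> h < M"
  proof -
    have "M_two r s chi \<mu> h < 2 * s / chi * (2 + H_const r s chi \<mu> h * h ^ r * (1 + h ^ (2 * r + 2)) + h\<^sup>2)"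
      by (rule M_two_bounds(1)[OF r s chi(2) h_pos hb(3) \<mu>_ge_1])
    also have "\<dots> \<le> 2 * s / chi * (2 / (\<kappa>2 - \<kappa>1))"
      using h1[rule_format, of h] h_pos hb(2) s chi_pos by (intro mult_left_mono) auto
    also have "\<dots> = 4 * s / chi * (1 / (\<kappa>2 - \<kappa>1))" by simp
    also have "\<dots> \<le> 4 * s / e * (1 / (\<kappa>2 - \<kappa>1))"
      using e s k12 by (intro mult_right_mono divide_left_mono) auto
    also have "\<dots> = M" by (simp add: M_eq e_def)
    finally show ?thesis .
  qed
  have "Ld ` cone_K M (node_set r I a b N) \<subseteq> cone_K (\<kappa>2 * M) (node_set r I a b N)"
    using Ld_cone by blast
  moreover note spectral_radius_bounds[OF chi(2) s(2) hb(3) M2]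
  ultimately show ?thesis using u1 u2 M2 \<kappa>2M(2) unfolding S T H by blast
qed

end
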